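(* Suppose that $P$ is a symmetric subcritical operator in a manifold $M$ with ends $E_1,\ldots,E_N$, $N\ge2$. Assume that for each $1\le i\le N$ there exists a function $u_i$ which is a positive solution of the equation $Pu=0$ in $M$ of minimal growth near each end $x_j$, $j\ne i$, and satisfying $$\lim_{x\to x_i}\frac{u_j(x)}{u_i(x)}=0\qquad\forall j\ne i.$$ Consider $$v:=\prod_{j=1}^N u_j^{\alpha_j},$$ where $0<\alpha_j\le1/2$ for all $1\le j\le N$, and $\sum_{j=1}^N\alpha_j=1$. Then, for the corresponding Hardy-weight $W:=Pv/v$, the operator $P-W$ is critical in $M$.
   Context: Ends. $M$ is a noncompact (smooth, $n$-dimensional, $n\ge2$) manifold. $M$ has $N$ ends $E_1,\ldots,E_N$ if each $E_i$ is a smooth noncompact connected manifold with boundary such that $M=\bigcup_{i=0}^N E_i$, the sets $E_1,\dots,E_N$ are pairwise disjoint, and $E_0$ is a relatively compact open subset of $M$. The ideal infinity point of $E_i$ is denoted $x_i$; $x\to x_i$ means that $x\in E_i$ leaves every compact subset of $M$, and a neighborhood of $x_i$ is a neighborhood of infinity in $E_i$. Operator. $\nu$ is a measure $\mathrm{d}\nu=f\,\mathrm{d}\mathrm{vol}$ on $M$ with $f>0$. $P$ is a symmetric second-order elliptic operator with real coefficients $Pu=-\mathrm{div}(A\nabla u+ub)+b\cdot\nabla u+cu$, where $-\mathrm{div}$ is the formal adjoint of the gradient with respect to $\nu$ and $A(x)$ is symmetric and positive definite; $P$ is locally uniformly elliptic with coefficients locally sufficiently regular for standard elliptic theory (for example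 $A,f$ locally Hölder continuous, $b\in L^p_{\mathrm{loc}}$, $c\in L^{p/2}_{\mathrm{loc}}$, $p>n$). Definitions. $P\ge0$ in $M$ means that $Pu=0$ has a positive solution in $M$; $\lambda_0(P,V,M):=\sup\{\lambda:P-\lambda V\ge0\text{ in }M\}$. If $P\ge0$ in $M$, $P$ is subcritical in $M$ if $\lambda_0(P,V,M)>0$ for some nonzero nonnegative continuous $V$, and critical otherwise. A positive solution $u$ of $Pu=0$ in a neighborhood of $x_j$ has minimal growth near (at) $x_j$ if for every positive supersolution $z$ of $Pz=0$ in a neighborhood of $x_j$ there is a constant $C$ such that $u\le Cz$ in some neighborhood of $x_j$. *)

theory Defs
  imports "HOL-Analysis.Analysis"
begin

section \<open>Calculus on open subsets of Euclidean space\<close>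

primrec Ck_on :: "nat \<Rightarrow> 'a::euclidean_space set \<Rightarrow> ('a \<Rightarrow> 'b::real_normed_vector) \<Rightarrow> bool" where
  "Ck_on 0 S f \<longleftrightarrow> continuous_on S f"
| "Ck_on (Suc k) S f \<longleftrightarrow>
     (\<forall>x\<in>S. f differentiable (at x)) \<and> (\<forall>v. Ck_on k S (\<lambda>x. frechet_derivative f (at x) v))"

definition smooth_on :: "'a::euclidean_space set \<Rightarrow> ('a \<Rightarrow> 'b::real_normed_vector) \<Rightarrow> bool" where
  "smooth_on S f \<longleftrightarrow> (\<forall>k. Ck_on k S f)"

definition test_function :: "'a::euclidean_space set \<Rightarrow> ('a \<Rightarrow> real) \<Rightarrow> bool" where
  "test_function S \<psi> \<longleftrightarrow>
     smooth_on UNIV \<psi> \<and> compact (closure {y. \<psi> y \<noteq> 0}) \<and> closure {y. \<psi> y \<noteq> 0} \<subseteq> S"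

definition partials :: "(real^'n \<Rightarrow> real) \<Rightarrow> real^'n \<Rightarrow> real^'n" where
  "partials \<psi> y = (\<chi> k. frechet_derivative \<psi> (at y) (axis k 1))"

definition locally_holder_on :: "'a::metric_space set \<Rightarrow> ('a \<Rightarrow> 'b::metric_space) \<Rightarrow> bool" where
  "locally_holder_on S h \<longleftrightarrow>
     (\<forall>K. compact K \<and> K \<subseteq> S \<longrightarrow>
        (\<exists>C \<gamma>. 0 < \<gamma> \<and> \<gamma> \<le> 1 \<and> (\<forall>x\<in>K. \<forall>y\<in>K. dist (h x) (h y) \<le> C * dist x y powr \<gamma>)))"

definition L_loc :: "real \<Rightarrow> 'a::euclidean_space set \<Rightarrow> ('a \<Rightarrow> 'b::euclidean_space) \<Rightarrow> bool" where
  "L_loc p S h \<longleftrightarrow>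
     (\<forall>K. compact K \<and> K \<subseteq> S \<longrightarrow>
        set_borel_measurable lebesgue K h \<and> set_integrable lebesgue K (\<lambda>y. norm (h y) powr p))"

definition weak_gradient_on :: "(real^'n) set \<Rightarrow> (real^'n \<Rightarrow> real) \<Rightarrow> (real^'n \<Rightarrow> real^'n) \<Rightarrow> bool" where
  "weak_gradient_on S h w \<longleftrightarrow>
     (\<forall>\<psi> k. test_function S \<psi> \<longrightarrow>
        integral\<^sup>L lebesgue (\<lambda>y. h y * partials \<psi> y $ k) = - integral\<^sup>L lebesgue (\<lambda>y. w y $ k * \<psi> y))"


section \<open>Weighted Riemannian manifolds\<close>

text \<open>
  The underlying set of the manifold is a whole type. A chart is a pair of a domain and a coordinate
  map (whose values off the domain are irrelevant). Tensor fields are given classically, by their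
  components in every chart of the atlas together with the transformation law under changes of
  coordinates.
\<close>

type_synonym ('a, 'n) chart = "'a set \<times> ('a \<Rightarrow> real^'n)"

definition point :: "('a, 'n::finite) chart \<Rightarrow> real^'n \<Rightarrow> 'a" where
  "point c = inv_into (fst c) (snd c)"

definition coords :: "('a, 'n::finite) chart \<Rightarrow> 'a set \<Rightarrow> (real^'n) set" where
  "coords c U = snd c ` (fst c \<inter> U)"

definition is_chart :: "('a::topological_space, 'n::finite) chart \<Rightarrow> bool" where
  "is_chart c \<longleftrightarrow>
     open (fst c) \<and> open (coords c UNIV) \<and> homeomorphism (fst c) (coords c UNIV) (snd c) (point c)"

definition transition :: "('a, 'n::finite) chart \<Rightarrow> ('a, 'n::finite) chart \<Rightarrow> real^'n \<Rightarrow> real^'n" where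
  "transition c d = snd d \<circ> point c"

definition smoothly_compatible :: "('a, 'n::finite) chart \<Rightarrow> ('a, 'n::finite) chart \<Rightarrow> bool" where
  "smoothly_compatible c d \<longleftrightarrow>
     smooth_on (coords c (fst d)) (transition c d) \<and> smooth_on (coords d (fst c)) (transition d c)"

definition transition_jacobian :: "('a, 'n::finite) chart \<Rightarrow> ('a, 'n::finite) chart \<Rightarrow> 'a \<Rightarrow> real^'n^'n" where
  "transition_jacobian c d x = jacobian (transition c d) (at (snd c x))"

record ('a, 'n::finite) weighted_manifold =
  atlas :: "('a, 'n::finite) chart set"
  metric :: "('a, 'n::finite) chart \<Rightarrow> 'a \<Rightarrow> real^'n^'n"
  weight :: "'a \<Rightarrow> real"

definition smooth_atlas :: "('a::topological_space, 'n::finite) chart set \<Rightarrow> bool" where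
  "smooth_atlas \<A> \<longleftrightarrow>
     (\<forall>c\<in>\<A>. is_chart c) \<and> (\<Union>c\<in>\<A>. fst c) = UNIV \<and> (\<forall>c\<in>\<A>. \<forall>d\<in>\<A>. smoothly_compatible c d)"

definition riemannian_metric ::
    "('a, 'n::finite) chart set \<Rightarrow> (('a, 'n::finite) chart \<Rightarrow> 'a \<Rightarrow> real^'n^'n) \<Rightarrow> bool" where
  "riemannian_metric \<A> g \<longleftrightarrow>
     (\<forall>c\<in>\<A>. smooth_on (coords c UNIV) (g c \<circ> point c)
        \<and> (\<forall>x\<in>fst c. transpose (g c x) = g c x \<and> (\<forall>\<xi>. \<xi> \<noteq> 0 \<longrightarrow> \<xi> \<bullet> (g c x *v \<xi>) > 0)))
   \<and> (\<forall>c\<in>\<A>. \<forall>d\<in>\<A>. \<forall>x\<in>fst c \<inter> fst d. let J = transition_jacobian c d x in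
        g c x = transpose J ** g d x ** J)"

definition is_weighted_manifold :: "('a::topological_space, 'n::finite) weighted_manifold \<Rightarrow> bool" where
  "is_weighted_manifold M \<longleftrightarrow>
     smooth_atlas (atlas M) \<and> riemannian_metric (atlas M) (metric M)
   \<and> (\<forall>x. weight M x > 0)
   \<and> (\<forall>c\<in>atlas M. locally_holder_on (coords c UNIV) (weight M \<circ> point c))"

definition metric_inner ::
    "('a, 'n::finite) weighted_manifold \<Rightarrow> ('a, 'n::finite) chart \<Rightarrow> 'a \<Rightarrow> real^'n \<Rightarrow> real^'n \<Rightarrow> real" where
  "metric_inner M c x \<xi> \<eta> = \<xi> \<bullet> (metric M c x *v \<eta>)"

text \<open>The Riemannian gradient raises the index of the differential.\<close>

definition raise ::
    "('a, 'n::finite) weighted_manifold \<Rightarrow> ('a, 'n::finite) chart \<Rightarrow> 'a \<Rightarrow> real^'n \<Rightarrow> real^'n" where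
  "raise M c x w = matrix_inv (metric M c x) *v w"

text \<open>
  Lebesgue density, in the coordinates of the chart \<open>c\<close>, of the measure \<open>d\<nu> = f dvol\<close>, where
  \<open>f\<close> is the weight and \<open>dvol = sqrt (det g) dy\<close>.
\<close>

definition nu_density :: "('a, 'n::finite) weighted_manifold \<Rightarrow> ('a, 'n::finite) chart \<Rightarrow> 'a \<Rightarrow> real" where
  "nu_density M c x = weight M x * sqrt (det (metric M c x))"

definition ae_on :: "('a, 'n::finite) weighted_manifold \<Rightarrow> 'a set \<Rightarrow> ('a \<Rightarrow> bool) \<Rightarrow> bool" where
  "ae_on M U Q \<longleftrightarrow> (\<forall>c\<in>atlas M. AE y in lebesgue. y \<in> coords c U \<longrightarrow> Q (point c y))"


section \<open>The operator\<close>

text \<open>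
  \<open>P u = - div (A \<nabla>u + u b) + b \<cdot> \<nabla>u + c u\<close>, with \<open>A\<close> a field of endomorphisms
  of the tangent spaces, \<open>b\<close> a vector field and \<open>c\<close> a function.
\<close>

record ('a, 'n::finite) operator =
  leading :: "('a, 'n::finite) chart \<Rightarrow> 'a \<Rightarrow> real^'n^'n"
  drift :: "('a, 'n::finite) chart \<Rightarrow> 'a \<Rightarrow> real^'n"
  potential :: "'a \<Rightarrow> real"

definition elliptic_operator ::
    "('a, 'n::finite) weighted_manifold \<Rightarrow> ('a, 'n::finite) operator \<Rightarrow> bool" where
  "elliptic_operator M P \<longleftrightarrow>
     (\<forall>c\<in>atlas M. \<forall>d\<in>atlas M. \<forall>x\<in>fst c \<inter> fst d. let J = transition_jacobian c d x in
        J ** leading P c x = leading P d x ** J \<and> drift P d x = J *v drift P c x)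
   \<and> (\<forall>c\<in>atlas M. \<forall>x\<in>fst c.
        (\<forall>\<xi> \<eta>. metric_inner M c x (leading P c x *v \<xi>) \<eta> = metric_inner M c x \<xi> (leading P c x *v \<eta>))
      \<and> (\<forall>\<xi>. \<xi> \<noteq> 0 \<longrightarrow> metric_inner M c x (leading P c x *v \<xi>) \<xi> > 0))
   \<and> (\<forall>c\<in>atlas M. \<forall>K. compact K \<and> K \<subseteq> coords c UNIV \<longrightarrow>
        (\<exists>\<Lambda>>0. \<forall>y\<in>K. \<forall>\<xi>.
           metric_inner M c (point c y) \<xi> \<xi> / \<Lambda>
             \<le> metric_inner M c (point c y) (leading P c (point c y) *v \<xi>) \<xi>
         \<and> metric_inner M c (point c y) (leading P c (point c y) *v \<xi>) \<xi>
             \<le> \<Lambda> * metric_inner M c (point c y) \<xi> \<xi>))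
   \<and> (\<forall>c\<in>atlas M. locally_holder_on (coords c UNIV) (leading P c \<circ> point c))
   \<and> (\<exists>p. p > real CARD('n) \<and> (\<forall>c\<in>atlas M.
        L_loc p (coords c UNIV) (drift P c \<circ> point c)
      \<and> L_loc (p / 2) (coords c UNIV) (potential P \<circ> point c)))"

definition minus_potential :: "('a, 'n::finite) operator \<Rightarrow> ('a \<Rightarrow> real) \<Rightarrow> ('a, 'n::finite) operator" where
  "minus_potential P V = P\<lparr>potential := (\<lambda>x. potential P x - V x)\<rparr>"

text \<open>
  \<open>u\<close> belongs to the local Sobolev space \<open>H\<^sup>1\<close> on \<open>U\<close> and \<open>w\<close> is its weak differential
  (given by its components in each chart).
\<close>

definition weak_differential ::
    "('a, 'n::finite) weighted_manifold \<Rightarrow> 'a set \<Rightarrow> ('a \<Rightarrow> real) \<Rightarrow> (('a, 'n::finite) chart \<Rightarrow> 'a \<Rightarrow> real^'n) \<Rightarrow> bool" where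
  "weak_differential M U u w \<longleftrightarrow>
     (\<forall>c\<in>atlas M.
        L_loc 2 (coords c U) (u \<circ> point c) \<and> L_loc 2 (coords c U) (w c \<circ> point c)
      \<and> weak_gradient_on (coords c U) (u \<circ> point c) (w c \<circ> point c))"

text \<open>
  The integrand of the weak form of \<open>P u\<close> tested against \<open>\<psi>\<close>, in the coordinates of \<open>c\<close>:
  since \<open>- div\<close> is the formal adjoint of the gradient with respect to \<open>\<nu>\<close>, it is
  \<open>\<langle>A \<nabla>u + u b, \<nabla>\<psi>\<rangle> + \<langle>b, \<nabla>u\<rangle> \<psi> + c u \<psi>\<close>
  times the density of \<open>\<nu>\<close>. Here \<open>w\<close> is the weak differential of \<open>u\<close>.
  The solution concepts below test only against functions supported in a single chart; by a
  smooth partition of unity this is the same as testing against compactly supported smooth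
  functions on the manifold.
\<close>

definition weak_integrand ::
    "('a, 'n::finite) weighted_manifold \<Rightarrow> ('a, 'n::finite) operator \<Rightarrow> ('a, 'n::finite) chart \<Rightarrow>
     ('a \<Rightarrow> real) \<Rightarrow> (('a, 'n::finite) chart \<Rightarrow> 'a \<Rightarrow> real^'n) \<Rightarrow> (real^'n \<Rightarrow> real) \<Rightarrow> real^'n \<Rightarrow> real" where
  "weak_integrand M P c u w \<psi> y =
     (let x = point c y; grad_u = raise M c x (w c x); grad_\<psi> = raise M c x (partials \<psi> y) in
       (metric_inner M c x (leading P c x *v grad_u + u x *\<^sub>R drift P c x) grad_\<psi>
        + metric_inner M c x (drift P c x) grad_u * \<psi> y
        + potential P x * u x * \<psi> y) * nu_density M c x)"

text \<open>\<open>P u = h\<close> weakly in the open set \<open>U\<close>.\<close>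

definition weak_eq ::
    "('a, 'n::finite) weighted_manifold \<Rightarrow> ('a, 'n::finite) operator \<Rightarrow> 'a set \<Rightarrow> ('a \<Rightarrow> real) \<Rightarrow> ('a \<Rightarrow> real) \<Rightarrow> bool" where
  "weak_eq M P U u h \<longleftrightarrow>
     (\<exists>w. weak_differential M U u w \<and>
        (\<forall>c\<in>atlas M. \<forall>\<psi>. test_function (coords c U) \<psi> \<longrightarrow>
           integrable lebesgue (weak_integrand M P c u w \<psi>)
         \<and> integrable lebesgue (\<lambda>y. h (point c y) * \<psi> y * nu_density M c (point c y))
         \<and> integral\<^sup>L lebesgue (weak_integrand M P c u w \<psi>)
             = integral\<^sup>L lebesgue (\<lambda>y. h (point c y) * \<psi> y * nu_density M c (point c y))))"

text \<open>
  By elliptic regularity weak solutions have continuous representatives; solutions are always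
  taken to be these. Supersolutions are only defined almost everywhere.
\<close>

definition positive_solution ::
    "('a::topological_space, 'n::finite) weighted_manifold \<Rightarrow> ('a, 'n::finite) operator \<Rightarrow> 'a set \<Rightarrow> ('a \<Rightarrow> real) \<Rightarrow> bool" where
  "positive_solution M P U u \<longleftrightarrow>
     continuous_on U u \<and> (\<forall>x\<in>U. u x > 0) \<and> weak_eq M P U u (\<lambda>x. 0)"

definition positive_supersolution ::
    "('a, 'n::finite) weighted_manifold \<Rightarrow> ('a, 'n::finite) operator \<Rightarrow> 'a set \<Rightarrow> ('a \<Rightarrow> real) \<Rightarrow> bool" where
  "positive_supersolution M P U z \<longleftrightarrow>
     ae_on M U (\<lambda>x. z x > 0) \<and>
     (\<exists>w. weak_differential M U z w \<and>
        (\<forall>c\<in>atlas M. \<forall>\<psi>. test_function (coords c U) \<psi> \<and> (\<forall>y. \<psi> y \<ge> 0) \<longrightarrow>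
           integrable lebesgue (weak_integrand M P c z w \<psi>)
         \<and> integral\<^sup>L lebesgue (weak_integrand M P c z w \<psi>) \<ge> 0))"


section \<open>Criticality\<close>

definition nonneg_operator ::
    "('a::topological_space, 'n::finite) weighted_manifold \<Rightarrow> ('a, 'n::finite) operator \<Rightarrow> bool" where
  "nonneg_operator M P \<longleftrightarrow> (\<exists>u. positive_solution M P UNIV u)"

definition lambda0 ::
    "('a::topological_space, 'n::finite) weighted_manifold \<Rightarrow> ('a, 'n::finite) operator \<Rightarrow> ('a \<Rightarrow> real) \<Rightarrow> ereal" where
  "lambda0 M P V = Sup (ereal ` {t. nonneg_operator M (minus_potential P (\<lambda>x. t * V x))})"

definition subcritical ::
    "('a::topological_space, 'n::finite) weighted_manifold \<Rightarrow> ('a, 'n::finite) operator \<Rightarrow> bool" where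
  "subcritical M P \<longleftrightarrow>
     nonneg_operator M P \<and>
     (\<exists>V. continuous_on UNIV V \<and> (\<forall>x. V x \<ge> 0) \<and> (\<exists>x. V x \<noteq> 0) \<and> lambda0 M P V > 0)"

definition critical ::
    "('a::topological_space, 'n::finite) weighted_manifold \<Rightarrow> ('a, 'n::finite) operator \<Rightarrow> bool" where
  "critical M P \<longleftrightarrow> nonneg_operator M P \<and> \<not> subcritical M P"


section \<open>Ends\<close>

text \<open>
  Subsets that are smooth (codimension zero) submanifolds with boundary: near each of its points the
  set is, in suitable coordinates of the ambient manifold, a half-space. Interior points are
  those with \<open>snd c p $ k > 0\<close>.
\<close>

definition submanifold_with_boundary ::
    "('a::topological_space, 'n::finite) weighted_manifold \<Rightarrow> 'a set \<Rightarrow> bool" where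
  "submanifold_with_boundary M E \<longleftrightarrow>
     (\<forall>p\<in>E. \<exists>c k. is_chart c \<and> (\<forall>d\<in>atlas M. smoothly_compatible c d) \<and> p \<in> fst c \<and>
        E \<inter> fst c = {x \<in> fst c. snd c x $ k \<ge> 0})"

definition has_ends ::
    "('a::topological_space, 'n::finite) weighted_manifold \<Rightarrow> nat \<Rightarrow> (nat \<Rightarrow> 'a set) \<Rightarrow> bool" where
  "has_ends M N E \<longleftrightarrow>
     (\<forall>i\<in>{1..N}. submanifold_with_boundary M (E i) \<and> \<not> compact (E i) \<and> connected (E i))
   \<and> UNIV = (\<Union>i\<in>{0..N}. E i)
   \<and> disjoint_family_on E {1..N}
   \<and> open (E 0) \<and> compact (closure (E 0))"

text \<open>\<open>x \<rightarrow> x\<^sub>i\<close>: the point \<open>x\<close> of the end \<open>F\<close> leaves every compact subset.\<close>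

definition at_end :: "'a::topological_space set \<Rightarrow> 'a filter" where
  "at_end F = (INF K\<in>{K. compact K}. principal (F - K))"

definition end_neighborhood :: "'a::topological_space set \<Rightarrow> 'a set \<Rightarrow> bool" where
  "end_neighborhood F U \<longleftrightarrow> open U \<and> U \<subseteq> F \<and> (\<exists>K. compact K \<and> F - K \<subseteq> U)"

definition minimal_growth_at ::
    "('a::topological_space, 'n::finite) weighted_manifold \<Rightarrow> ('a, 'n::finite) operator \<Rightarrow> 'a set \<Rightarrow> ('a \<Rightarrow> real) \<Rightarrow> bool" where
  "minimal_growth_at M P F u \<longleftrightarrow>
     (\<exists>U. end_neighborhood F U \<and> positive_solution M P U u) \<and>
     (\<forall>U z. end_neighborhood F U \<and> positive_supersolution M P U z \<longrightarrow>
        (\<exists>C U'. end_neighborhood F U' \<and> U' \<subseteq> U \<and> ae_on M U' (\<lambda>x. u x \<le> C * z x)))"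

end

theory Submission
  imports Defs
begin

text \<open>
  If \<open>P - W\<close> were subcritical, there would be \<open>V \<ge> 0\<close>, not identically zero, and a positive
  solution \<open>f\<close> of \<open>(P - W - V) f = 0\<close>. Testing the equations of \<open>v\<close> and \<open>f\<close> with multiples of
  \<open>w\<^sup>2\<close> and completing a square gives \<open>\<integral> V v\<^sup>2 w\<^sup>2 \<le> \<integral> v\<^sup>2 \<langle>A \<nabla>w, \<nabla>w\<rangle>\<close>
  for every compactly supported \<open>w\<close>; so it suffices to find such \<open>w\<close>, equal to one on a given
  compact set, that make the right-hand side arbitrarily small.

  In the end \<open>E\<^sub>i\<close> fix \<open>k \<noteq> i\<close>. Minimal growth gives \<open>u\<^sub>m \<le> C u\<^sub>k\<close> for all \<open>m \<noteq> i\<close>, and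
  \<open>u\<^sub>k \<le> u\<^sub>i\<close> near \<open>x\<^sub>i\<close>, whence \<open>v\<^sup>2 \<le> C\<^sup>2 u\<^sub>i u\<^sub>k\<close> because \<open>\<alpha>\<^sub>i \<le> 1/2\<close>. The function
  \<open>l = ln (u\<^sub>k / u\<^sub>i)\<close> tends to \<open>-\<infinity>\<close> at \<open>x\<^sub>i\<close>, and since \<open>P\<close> is symmetric,
  \<open>u\<^sub>i u\<^sub>k A \<nabla>l\<close> is divergence free. Hence the energy with weight \<open>u\<^sub>i u\<^sub>k\<close> of a cutoff that
  depends only on \<open>l / T\<close> is a constant flux divided by \<open>T\<close>, which tends to zero as \<open>T\<close> grows.
\<close>

section \<open>Mollification\<close>

text \<open>The test functions named in the overview, such as \<open>w^2 v / f\<close> or cutoffs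
  built from \<open>l\<close>, are continuous with a weak gradient in L^2_loc, but they are neither
  smooth nor confined to one chart, whereas a solution is tested only with smooth functions
  supported in a single chart. Closing this gap shapes the development: mollification extends tested
  identities to the class \<open>H1C\<close>, weak differentials are corrected so as to obey the
  transformation law at every point, and an integral for compactly supported densities is built on
  the manifold. Continuity of the solutions keeps the class closed under products, logarithms and
  powers. The cutoff depends on \<open>l\<close> and not on a distance, so no geometry of the end at
  infinity has to be controlled; its transition layer is \<open>-2T < l < -T\<close>. The potential
  is a parameter throughout: \<open>P\<close>, \<open>P - W\<close> and \<open>P - W - tV\<close>
  share their principal and drift parts and are compared within one locale. Existence of
  \<open>W\<close> is part of the conclusion, and criticality is shown for every \<open>W\<close>
  that satisfies the weak equation.\<close>

lemma Ck_on_SucD: "Ck_on (Suc k) S f \<Longrightarrow> Ck_on k S f"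
proof (induction k arbitrary: f)
  case 0
  then show ?case
    by (simp add: continuous_at_imp_continuous_on differentiable_imp_continuous_within)
next
  case (Suc k)
  then show ?case by (metis Ck_on.simps(2))
qed

lemma Ck_on_const: "Ck_on k UNIV (\<lambda>x. c)"
  by (induction k arbitrary: c) (simp_all add: frechet_derivative_const)

lemma Ck_on_add: "Ck_on k UNIV f \<Longrightarrow> Ck_on k UNIV g \<Longrightarrow> Ck_on k UNIV (\<lambda>x. f x + g x)"
proof (induction k arbitrary: f g)
  case 0
  then show ?case by (simp add: continuous_on_add)
next
  case (Suc k)
  have "frechet_derivative (\<lambda>x. f x + g x) (at x) v =
      frechet_derivative f (at x) v + frechet_derivative g (at x) v" for x v
  proof -
    have "((\<lambda>x. f x + g x) has_derivative (\<lambda>v. frechet_derivative f (at x) v + frechet_derivative g (at x) v)) (at x)"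
      using Suc.prems by (intro has_derivative_add) (auto simp: frechet_derivative_works[THEN iffD1])
    from frechet_derivative_at[OF this] show ?thesis by metis
  qed
  then show ?case using Suc by (simp add: differentiable_add)
qed

lemma Ck_on_mult:
  fixes f g :: "'a::euclidean_space \<Rightarrow> real"
  shows "Ck_on k UNIV f \<Longrightarrow> Ck_on k UNIV g \<Longrightarrow> Ck_on k UNIV (\<lambda>x. f x * g x)"
proof (induction k arbitrary: f g)
  case 0
  then show ?case by (simp add: continuous_on_mult)
next
  case (Suc k)
  have *: "frechet_derivative (\<lambda>x. f x * g x) (at x) v =
      f x * frechet_derivative g (at x) v + frechet_derivative f (at x) v * g x" for x v
  proof -
    have "((\<lambda>x. f x * g x) has_derivative (\<lambda>v. f x * frechet_derivative g (at x) v + frechet_derivative f (at x) v * g x)) (at x)"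
      using Suc.prems by (intro has_derivative_mult) (auto simp: frechet_derivative_works[THEN iffD1])
    from frechet_derivative_at[OF this] show ?thesis by metis
  qed
  show ?case
    using Suc Ck_on_SucD[OF Suc.prems(1)] Ck_on_SucD[OF Suc.prems(2)]
    by (auto simp: * intro!: Ck_on_add differentiable_mult)
qed

lemma Ck_on_linear:
  assumes "bounded_linear f"
  shows "Ck_on k UNIV f"
proof (cases k)
  case 0
  then show ?thesis using assms linear_continuous_on by auto
next
  case (Suc m)
  have d: "(f has_derivative f) (at x)" for x using assms by (rule bounded_linear_imp_has_derivative)
  then have "frechet_derivative f (at x) = f" for x using frechet_derivative_at by metis
  then show ?thesis using d Suc by (auto simp: Ck_on_const differentiable_def)
qed

section \<open>A smooth bump function and the normalised mollifier\<close>

definition flat_exp :: "nat \<Rightarrow> real \<Rightarrow> real" where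
  "flat_exp m t = (if t > 0 then (1/t)^m * exp (- (1/t)) else 0)"

lemma flat_exp_tendsto_0: "(flat_exp m \<longlongrightarrow> 0) (at 0)"
proof -
  have "((\<lambda>x::real. x ^ m / exp x) \<longlongrightarrow> 0) at_top" by (rule tendsto_power_div_exp_0)
  then have "((\<lambda>t::real. (inverse t) ^ m / exp (inverse t)) \<longlongrightarrow> 0) (at_right 0)"
    using filterlim_compose filterlim_inverse_at_top_right by blast
  then have r: "(flat_exp m \<longlongrightarrow> 0) (at_right 0)"
    by (rule Lim_transform_eventually)
       (auto simp: eventually_at_filter flat_exp_def exp_minus field_simps)
  have l: "(flat_exp m \<longlongrightarrow> 0) (at_left 0)"
    by (rule Lim_transform_eventually[OF tendsto_const])
       (auto simp: eventually_at_filter flat_exp_def)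
  from l r show ?thesis by (simp add: filterlim_at_split)
qed

text \<open>The powers of \<open>1/t\<close> make the family closed under differentiation, so this
  one formula serves the derivatives of every order.\<close>

lemma flat_exp_DERIV:
  "(flat_exp m has_real_derivative (- real m * flat_exp (m+1) t + flat_exp (m+2) t)) (at t)"
proof -
  consider "t > 0" | "t < 0" | "t = 0" by linarith
  then show ?thesis
  proof cases
    case 1
    have "((\<lambda>t. (1/t)^m * exp (- (1/t))) has_real_derivative
       (- real m * flat_exp (m+1) t + flat_exp (m+2) t)) (at t)"
      using 1
      apply (auto intro!: derivative_eq_intros simp: flat_exp_def)
      apply (cases m)
       apply (auto simp: field_simps power2_eq_square)
      done
    then show ?thesis
      by (rule DERIV_cong_ev[THEN iffD1, rotated -1])
         (use 1 in \<open>auto simp: flat_exp_def eventually_nhds intro!: exI[of _ "{0<..}"]\<close>)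
  next
    case 2
    have "((\<lambda>t. 0) has_real_derivative (- real m * flat_exp (m+1) t + flat_exp (m+2) t)) (at t)"
      using 2 by (auto simp: flat_exp_def)
    then show ?thesis
      by (rule DERIV_cong_ev[THEN iffD1, rotated -1])
         (use 2 in \<open>auto simp: flat_exp_def eventually_nhds intro!: exI[of _ "{..<0}"]\<close>)
  next
    case 3
    \<comment> \<open>The difference quotient at 0 is \<open>flat_exp (Suc m)\<close>, which has
      just been shown to tend to 0.\<close>
    have "((\<lambda>h. (flat_exp m (0 + h) - flat_exp m 0) / h) \<longlongrightarrow> 0) (at 0)"
      by (rule Lim_transform_eventually[OF flat_exp_tendsto_0[of "Suc m"]])
         (auto simp: eventually_at_filter flat_exp_def)
    then show ?thesis using 3 by (simp add: DERIV_def flat_exp_def)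
  qed
qed

definition bump :: "nat \<Rightarrow> real \<Rightarrow> 'a::euclidean_space \<Rightarrow> real" where
  "bump m e x = flat_exp m (e^2 - x \<bullet> x)"

lemma bump_has_derivative:
  "(bump m e has_derivative
     (\<lambda>v. (- real m * bump (m+1) e x + bump (m+2) e x) * (- 2 * (x \<bullet> v)))) (at x)"
proof -
  have "((\<lambda>x. e^2 - x \<bullet> x) has_derivative (\<lambda>v. - 2 * (x \<bullet> v))) (at x)"
    by (auto intro!: derivative_eq_intros simp: inner_commute)
  from DERIV_compose_FDERIV[OF flat_exp_DERIV this, of m]
  show ?thesis unfolding bump_def by (simp add: mult.commute)
qed

text \<open>\<open>m\<close> is generalised in the induction because a derivative of
  \<open>bump m e\<close> is a linear function times a combination of \<open>bump (m+1) e\<close>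
  and \<open>bump (m+2) e\<close>.\<close>

lemma Ck_on_bump: "Ck_on k UNIV (bump m e :: 'a::euclidean_space \<Rightarrow> real)"
proof (induction k arbitrary: m)
  case 0
  then show ?case using bump_has_derivative
    by (auto intro!: continuous_at_imp_continuous_on has_derivative_continuous)
next
  case (Suc k)
  have "frechet_derivative (bump m e) (at x) v =
     (- real m * bump (m+1) e x + bump (m+2) e x) * (- 2 * (x \<bullet> v))" for x v :: 'a
    using frechet_derivative_at[OF bump_has_derivative] by metis
  moreover have "Ck_on k UNIV (\<lambda>x. (- real m * bump (m+1) e x + bump (m+2) e x) * (- 2 * (x \<bullet> v)))" for v :: 'a
    by (intro Ck_on_mult Ck_on_add Ck_on_const)
       ((rule Suc.IH | (rule Ck_on_linear, rule bounded_linear_inner_left))+)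
  moreover have "bump m e differentiable (at x)" for x :: 'a
    unfolding differentiable_def using bump_has_derivative by blast
  ultimately show ?case by simp
qed

lemma bump_pos_iff: "bump 0 e x > 0 \<longleftrightarrow> x \<bullet> x < e^2"
  by (simp add: bump_def flat_exp_def)

lemma bump_nonneg: "bump 0 e x \<ge> 0"
  by (simp add: bump_def flat_exp_def)

lemma bump_eq_0: "e > 0 \<Longrightarrow> norm x \<ge> e \<Longrightarrow> bump 0 e x = 0"
proof -
  assume "e > 0" "norm x \<ge> e"
  then have "e^2 \<le> (norm x)^2" by (intro power_mono) auto
  then show ?thesis by (simp add: bump_def flat_exp_def power2_norm_eq_inner)
qed

lemma bump_uminus: "bump m e (- x) = bump m e x"
  by (simp add: bump_def)

lemma continuous_on_bump: "continuous_on S (bump m e)"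
  by (meson Ck_on.simps(1) Ck_on_bump continuous_on_subset subset_UNIV)

lemma borel_measurable_bump [measurable]: "bump m e \<in> borel_measurable borel"
  by (simp add: borel_measurable_continuous_onI continuous_on_bump)

definition moll :: "real \<Rightarrow> 'a::euclidean_space \<Rightarrow> real" where
  "moll e x = bump 0 e x / (\<integral>x. bump 0 e (x::'a) \<partial>lborel)"

lemma integrable_bump: "e > 0 \<Longrightarrow> integrable lborel (bump 0 e :: 'a::euclidean_space \<Rightarrow> real)"
proof -
  assume e: "e > 0"
  have "integrable lborel (\<lambda>x::'a. indicator (cball 0 e) x *\<^sub>R bump 0 e x)"
    by (rule borel_integrable_compact) (auto intro: continuous_on_bump)
  moreover have "(\<lambda>x::'a. indicator (cball 0 e) x *\<^sub>R bump 0 e x) = bump 0 e"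
    using bump_eq_0[OF e] by (force simp: indicator_def fun_eq_iff)
  ultimately show ?thesis by metis
qed

lemma integral_bump_pos:
  assumes "e > 0"
  shows "(\<integral>x. bump 0 e (x::'a::euclidean_space) \<partial>lborel) > 0"
proof (rule ccontr)
  assume "\<not> ?thesis"
  then have "(\<integral>x. bump 0 e (x::'a) \<partial>lborel) = 0"
    by (meson Bochner_Integration.integral_nonneg bump_nonneg linorder_not_less order_antisym_conv)
  then have "AE x in lborel. bump 0 e (x::'a) = 0"
    using integral_nonneg_eq_0_iff_AE[OF integrable_bump[OF assms]] bump_nonneg by auto
  then have "emeasure lborel {x::'a. bump 0 e x \<noteq> 0} = 0"
    by (subst (asm) AE_iff_measurable[OF _ refl]) auto
  moreover have "ball (0::'a) e \<subseteq> {x. bump 0 e x \<noteq> 0}"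
  proof
    fix x :: 'a assume "x \<in> ball 0 e"
    then have "norm x ^2 < e^2" by (intro power_strict_mono) auto
    then show "x \<in> {x. bump 0 e x \<noteq> 0}" using bump_pos_iff[of e x] by (simp add: power2_norm_eq_inner)
  qed
  ultimately have "emeasure lborel (ball (0::'a) e) = 0"
    using emeasure_mono[of "ball (0::'a) e" "{x. bump 0 e x \<noteq> 0}" lborel] by simp
  then have "negligible (ball (0::'a) e)"
    by (simp add: negligible_iff_emeasure0)
  then show False using assms open_not_negligible[of "ball (0::'a) e"] by simp
qed

lemma moll_nonneg: "e > 0 \<Longrightarrow> moll e (x::'a::euclidean_space) \<ge> 0"
  using integral_bump_pos[of e, where 'a='a] by (simp add: moll_def bump_nonneg)

lemma moll_eq_0: "e > 0 \<Longrightarrow> norm x \<ge> e \<Longrightarrow> moll e x = 0"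
  by (simp add: moll_def bump_eq_0)

lemma moll_uminus: "moll e (- x) = moll e x"
  by (simp add: moll_def bump_uminus)

lemma moll_minus_commute: "moll e (x - y) = moll e (y - x)"
  using moll_uminus[of e "x - y"] by simp

lemma borel_measurable_moll [measurable]: "moll e \<in> borel_measurable borel"
  unfolding moll_def by measurable

lemma smooth_on_moll: "smooth_on UNIV (moll e)"
proof -
  have "Ck_on k UNIV (\<lambda>x. bump 0 e x * inverse (\<integral>x. bump 0 e (x::'a) \<partial>lborel))" for k
    by (intro Ck_on_mult Ck_on_bump Ck_on_const)
  then show ?thesis unfolding smooth_on_def moll_def[abs_def] divide_inverse by blast
qed

lemma continuous_on_moll: "continuous_on S (moll e)"
  using smooth_on_moll unfolding smooth_on_def
  by (meson Ck_on.simps(1) continuous_on_subset subset_UNIV)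

lemma integrable_moll: "e > 0 \<Longrightarrow> integrable lborel (moll e :: 'a::euclidean_space \<Rightarrow> real)"
  unfolding moll_def by (intro integrable_divide_zero integrable_bump) auto

lemma integral_moll: "e > 0 \<Longrightarrow> (\<integral>x. moll e (x::'a::euclidean_space) \<partial>lborel) = 1"
  using integral_bump_pos[of e, where 'a='a] by (simp add: moll_def)

section \<open>Test functions, their derivatives and uniform bounds\<close>

lemma test_functionD:
  assumes "test_function S \<psi>"
  shows "smooth_on UNIV \<psi>" "compact (closure {y. \<psi> y \<noteq> 0})" "closure {y. \<psi> y \<noteq> 0} \<subseteq> S"
  using assms by (auto simp: test_function_def)

lemma test_function_mono: "test_function S \<psi> \<Longrightarrow> S \<subseteq> T \<Longrightarrow> test_function T \<psi>"
  by (auto simp: test_function_def)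

lemma smooth_on_differentiable: "smooth_on UNIV f \<Longrightarrow> f differentiable (at x)"
  unfolding smooth_on_def by (metis Ck_on.simps(2) UNIV_I)

lemma smooth_on_deriv: "smooth_on UNIV f \<Longrightarrow> smooth_on UNIV (\<lambda>x. frechet_derivative f (at x) v)"
  unfolding smooth_on_def by (metis Ck_on.simps(2))

lemma smooth_on_continuous: "smooth_on UNIV f \<Longrightarrow> continuous_on A f"
  unfolding smooth_on_def by (metis Ck_on.simps(1) continuous_on_subset subset_UNIV)

lemma frechet_derivative_eq_0_locally:
  assumes "open U" "x \<in> U" "\<And>y. y \<in> U \<Longrightarrow> f y = 0"
  shows "(f has_derivative (\<lambda>_. 0)) (at x)" "frechet_derivative f (at x) v = 0"
proof -
  have "((\<lambda>_. 0) has_derivative (\<lambda>_. 0)) (at x)" by simp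
  then show "(f has_derivative (\<lambda>_. 0)) (at x)"
    using assms by (rule_tac has_derivative_transform_within_open[of "\<lambda>_. 0" _ x UNIV U f]) auto
  from frechet_derivative_at[OF this] show "frechet_derivative f (at x) v = 0" by metis
qed

lemma deriv_eq_0_outside_support:
  assumes "x \<notin> closure {y. f y \<noteq> 0}"
  shows "frechet_derivative f (at x) v = 0"
proof (rule frechet_derivative_eq_0_locally(2))
  show "open (- closure {y. f y \<noteq> 0})" "x \<in> - closure {y. f y \<noteq> 0}" using assms by auto
  show "f y = 0" if "y \<in> - closure {y. f y \<noteq> 0}" for y
    using that closure_subset[of "{y. f y \<noteq> 0}"] by blast
qed

lemma test_function_deriv:
  assumes "test_function S \<psi>"
  shows "test_function S (\<lambda>x. frechet_derivative \<psi> (at x) v)"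
proof -
  have "{x. frechet_derivative \<psi> (at x) v \<noteq> 0} \<subseteq> closure {y. \<psi> y \<noteq> 0}"
    using deriv_eq_0_outside_support[of _ \<psi> v] by auto
  then have "closure {x. frechet_derivative \<psi> (at x) v \<noteq> 0} \<subseteq> closure {y. \<psi> y \<noteq> 0}"
    by (simp add: closure_minimal)
  moreover from this have "compact (closure {x. frechet_derivative \<psi> (at x) v \<noteq> 0})"
    using test_functionD(2)[OF assms] by (meson bounded_subset closed_closure compact_eq_bounded_closed)
  ultimately show ?thesis using test_functionD[OF assms] smooth_on_deriv[of \<psi> v]
    unfolding test_function_def by blast
qed

lemma test_function_bounded:
  assumes "test_function S \<psi>"
  obtains B where "B > 0" "\<And>x. \<bar>\<psi> x\<bar> \<le> B"
proof -
  let ?K = "closure {y. \<psi> y \<noteq> 0}"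
  have "compact (\<psi> ` ?K)"
    using test_functionD[OF assms] by (intro compact_continuous_image smooth_on_continuous)
  then obtain B where B: "\<And>x. x \<in> ?K \<Longrightarrow> \<bar>\<psi> x\<bar> \<le> B"
    by (metis bounded_iff compact_imp_bounded imageI real_norm_def)
  have "\<bar>\<psi> x\<bar> \<le> max B 1" for x
    using B[of x] closure_subset[of "{y. \<psi> y \<noteq> 0}"] by (cases "\<psi> x = 0") (auto simp: le_max_iff_disj)
  then show ?thesis using that[of "max B 1"] by auto
qed

text \<open>The mean value inequality with bounds for the directional derivatives along the basis.
  Applied later to the derivatives of a test function, it yields a Taylor remainder of second order
  that is uniform in the base point.\<close>

lemma test_function_lipschitz:
  assumes "test_function S (\<psi> :: 'a::euclidean_space \<Rightarrow> real)"
  obtains L where "L > 0" "\<And>x y. \<bar>\<psi> x - \<psi> y\<bar> \<le> L * norm (x - y)"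
proof -
  have "\<exists>B. B > 0 \<and> (\<forall>x. \<bar>frechet_derivative \<psi> (at x) b\<bar> \<le> B)" for b
    using test_function_bounded[OF test_function_deriv[OF assms]] by metis
  then obtain B where B: "\<And>b. B b > 0" "\<And>b x. \<bar>frechet_derivative \<psi> (at x) b\<bar> \<le> B b" by metis
  let ?L = "\<Sum>b\<in>(Basis::'a set). B b"
  have d: "(\<psi> has_derivative frechet_derivative \<psi> (at x)) (at x)" for x
    using smooth_on_differentiable[OF test_functionD(1)[OF assms]] frechet_derivative_works by blast
  have on: "onorm (frechet_derivative \<psi> (at x)) \<le> ?L" for x
  proof (rule onorm_le)
    fix v :: 'a
    interpret bounded_linear "frechet_derivative \<psi> (at x)" using d has_derivative_bounded_linear by blast
    have "frechet_derivative \<psi> (at x) v = frechet_derivative \<psi> (at x) (\<Sum>b\<in>Basis. (v \<bullet> b) *\<^sub>R b)"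
      by (simp add: euclidean_representation)
    also have "\<dots> = (\<Sum>b\<in>Basis. (v \<bullet> b) * frechet_derivative \<psi> (at x) b)" by (simp add: sum scale)
    also have "norm \<dots> \<le> (\<Sum>b\<in>Basis. norm v * B b)"
      by (rule sum_norm_le) (auto simp: abs_mult intro!: mult_mono B Basis_le_norm)
    also have "(\<Sum>b\<in>Basis. norm v * B b) = ?L * norm v"
      by (subst sum_distrib_right) (simp add: mult.commute)
    finally show "norm (frechet_derivative \<psi> (at x) v) \<le> ?L * norm v" .
  qed
  have "\<bar>\<psi> x - \<psi> y\<bar> \<le> ?L * norm (x - y)" for x y
    using differentiable_bound[of UNIV \<psi> "\<lambda>x. frechet_derivative \<psi> (at x)" ?L x y] d on by auto
  moreover have "?L > 0" using B by (intro sum_pos) auto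
  ultimately show ?thesis using that by blast
qed

section \<open>Convolution with a test function\<close>

definition conv :: "('a::euclidean_space \<Rightarrow> real) \<Rightarrow> ('a \<Rightarrow> real) \<Rightarrow> 'a \<Rightarrow> real" where
  "conv f \<psi> y = (\<integral>z. f z * \<psi> (y - z) \<partial>lebesgue)"

lemma test_function_measurable_diff:
  assumes "test_function S \<psi>"
  shows "(\<lambda>z. \<psi> (y - z)) \<in> borel_measurable lebesgue"
proof -
  have "continuous_on UNIV (\<lambda>z. \<psi> (y - z))"
    by (rule continuous_on_compose2[OF smooth_on_continuous[OF test_functionD(1)[OF assms], of UNIV]])
       (auto intro!: continuous_intros)
  then show ?thesis
    by (simp add: borel_measurable_continuous_onI measurable_completion)
qed

lemma conv_integrable:
  assumes f: "integrable lebesgue f" and \<psi>: "test_function S \<psi>"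
  shows "integrable lebesgue (\<lambda>z. f z * \<psi> (y - z))"
proof -
  obtain B where "B > 0" and B: "\<And>x. \<bar>\<psi> x\<bar> \<le> B" using test_function_bounded[OF \<psi>] by blast
  show ?thesis
    by (rule Bochner_Integration.integrable_bound[OF integrable_mult_right[OF f, of B]])
       (use B f \<open>B > 0\<close> test_function_measurable_diff[OF \<psi>] in
         \<open>auto simp: abs_mult mult.commute[of B] intro!: mult_left_mono\<close>)
qed

text \<open>Differentiation passes under the integral because the derivative of
  \<open>\<psi>\<close> is Lipschitz: the first order Taylor remainder is at most a constant times
  \<open>norm h * norm h\<close> at every point, and integrating it against the integrable
  \<open>\<bar>f\<bar>\<close> preserves this order.\<close>

lemma conv_has_derivative:
  assumes f: "integrable lebesgue f" and \<psi>: "test_function S (\<psi> :: 'a::euclidean_space \<Rightarrow> real)"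
  shows "(conv f \<psi> has_derivative (\<lambda>v. conv f (\<lambda>x. frechet_derivative \<psi> (at x) v) y)) (at y)"
proof -
  let ?D = "\<lambda>x. frechet_derivative \<psi> (at x)"
  have d: "(\<psi> has_derivative ?D x) (at x)" for x
    using smooth_on_differentiable[OF test_functionD(1)[OF \<psi>]] frechet_derivative_works by blast
  have lin: "bounded_linear (?D x)" for x using d has_derivative_bounded_linear by blast
  have "\<exists>L. L > 0 \<and> (\<forall>x y. \<bar>?D x b - ?D y b\<bar> \<le> L * norm (x - y))" for b
    using test_function_lipschitz[OF test_function_deriv[OF \<psi>]] by metis
  then obtain B where B: "\<And>b. B b > 0" "\<And>b x y. \<bar>?D x b - ?D y b\<bar> \<le> B b * norm (x - y)" by metis
  let ?L = "\<Sum>b\<in>(Basis::'a set). B b"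
  have on: "norm (?D x v - ?D y v) \<le> ?L * norm (x - y) * norm v" for x y v
  proof -
    interpret X: bounded_linear "?D x" by (rule lin)
    interpret Y: bounded_linear "?D y" by (rule lin)
    have "?D x v - ?D y v = ?D x (\<Sum>b\<in>Basis. (v \<bullet> b) *\<^sub>R b) - ?D y (\<Sum>b\<in>Basis. (v \<bullet> b) *\<^sub>R b)"
      by (simp add: euclidean_representation)
    also have "\<dots> = (\<Sum>b\<in>Basis. (v \<bullet> b) * (?D x b - ?D y b))"
      by (simp add: X.sum X.scale Y.sum Y.scale sum_subtractf right_diff_distrib)
    also have "norm \<dots> \<le> (\<Sum>b\<in>Basis. norm v * (B b * norm (x - y)))"
      by (rule sum_norm_le) (auto simp: abs_mult intro!: mult_mono B Basis_le_norm)
    also have "(\<Sum>b\<in>Basis. norm v * (B b * norm (x - y))) = ?L * norm (x - y) * norm v"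
      by (simp only: sum_distrib_right) (simp add: mult_ac)
    finally show ?thesis .
  qed
  have L0: "?L > 0" using B by (intro sum_pos) auto
  have taylor: "\<bar>\<psi> (x + h) - \<psi> x - ?D x h\<bar> \<le> ?L * norm h * norm h" for x h
  proof -
    have "norm (\<psi> (x + h) - \<psi> x - ?D x ((x + h) - x)) \<le> norm ((x + h) - x) * (?L * norm h)"
    proof (rule differentiable_bound_linearization[where S = "(\<lambda>t. x + t *\<^sub>R ((x + h) - x)) ` {0..1}" and f' = ?D])
      fix z assume "z \<in> (\<lambda>t. x + t *\<^sub>R ((x + h) - x)) ` {0..1}"
      then obtain t :: real where t: "0 \<le> t" "t \<le> 1" and z: "z = x + t *\<^sub>R h" by auto
      show "onorm (?D z - ?D x) \<le> ?L * norm h"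
      proof (rule onorm_le)
        fix v
        have "norm (?D z v - ?D x v) \<le> ?L * norm (t *\<^sub>R h) * norm v"
          using on[of z v x] by (simp add: z)
        also have "\<dots> \<le> ?L * norm h * norm v"
          using t L0 by (intro mult_right_mono mult_left_mono) (auto simp: mult_left_le_one_le)
        finally show "norm ((?D z - ?D x) v) \<le> ?L * norm h * norm v" by simp
      qed
        next
      show "x \<in> (\<lambda>t. x + t *\<^sub>R ((x + h) - x)) ` {0..1}"
        by (rule image_eqI[of _ _ 0]) auto
      show "x + t *\<^sub>R ((x + h) - x) \<in> (\<lambda>t. x + t *\<^sub>R ((x + h) - x)) ` {0..1}" if "t \<in> {0..1}" for t
        using that by (rule imageI)
    qed (rule has_derivative_at_withinI[OF d])
    then show ?thesis by (simp add: mult_ac)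
  qed
  note int = conv_integrable[OF f \<psi>] conv_integrable[OF f test_function_deriv[OF \<psi>]]
  let ?A = "\<integral>z. \<bar>f z\<bar> \<partial>lebesgue"
  have est: "\<bar>conv f \<psi> (y + h) - conv f \<psi> y - conv f (\<lambda>x. ?D x h) y\<bar> \<le> ?A * ?L * norm h * norm h" for h
  proof -
    have eq: "f z * (\<psi> ((y - z) + h) - \<psi> (y - z) - ?D (y - z) h) =
       f z * \<psi> ((y + h) - z) - f z * \<psi> (y - z) - f z * ?D (y - z) h" for z
    proof -
      have "(y - z) + h = (y + h) - z" by simp
      then show ?thesis by (simp only: right_diff_distrib)
    qed
    have int': "integrable lebesgue (\<lambda>z. f z * (\<psi> ((y - z) + h) - \<psi> (y - z) - ?D (y - z) h))"
      by (simp only: eq) (intro Bochner_Integration.integrable_diff int)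
    have E: "conv f \<psi> (y + h) - conv f \<psi> y - conv f (\<lambda>x. ?D x h) y =
       (\<integral>z. f z * (\<psi> ((y - z) + h) - \<psi> (y - z) - ?D (y - z) h) \<partial>lebesgue)"
      unfolding conv_def
      by (simp only: eq Bochner_Integration.integral_diff Bochner_Integration.integrable_diff int)
    have "\<bar>conv f \<psi> (y + h) - conv f \<psi> y - conv f (\<lambda>x. ?D x h) y\<bar> \<le> (\<integral>z. \<bar>f z * (\<psi> ((y - z) + h) - \<psi> (y - z) - ?D (y - z) h)\<bar> \<partial>lebesgue)"
      unfolding E by (rule integral_abs_bound)
    also have "\<dots> \<le> (\<integral>z. \<bar>f z\<bar> * (?L * norm h * norm h) \<partial>lebesgue)"
    proof (rule Bochner_Integration.integral_mono[OF integrable_abs[OF int']])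
      show "integrable lebesgue (\<lambda>z. \<bar>f z\<bar> * (?L * norm h * norm h))"
        using f by (intro integrable_mult_left integrable_abs)
      show "\<bar>f z * (\<psi> ((y - z) + h) - \<psi> (y - z) - ?D (y - z) h)\<bar> \<le> \<bar>f z\<bar> * (?L * norm h * norm h)" for z
        unfolding abs_mult by (intro mult_left_mono taylor) auto
    qed
    finally show ?thesis by (simp only: mult.assoc[symmetric] Bochner_Integration.integral_mult_left_zero)
  qed
  have A0: "?A \<ge> 0" by simp
  have lin': "bounded_linear (\<lambda>v. conv f (\<lambda>x. ?D x v) y)"
  proof -
    have "linear (\<lambda>v. conv f (\<lambda>x. ?D x v) y)"
    proof (rule linearI)
      fix v w :: 'a
      have "conv f (\<lambda>x. ?D x (v + w)) y = (\<integral>z. f z * ?D (y - z) v + f z * ?D (y - z) w \<partial>lebesgue)"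
        unfolding conv_def by (simp add: linear_simps(1)[OF lin] distrib_left)
      also have "\<dots> = conv f (\<lambda>x. ?D x v) y + conv f (\<lambda>x. ?D x w) y"
        unfolding conv_def by (rule Bochner_Integration.integral_add[OF int(2) int(2)])
      finally show "conv f (\<lambda>x. ?D x (v + w)) y = conv f (\<lambda>x. ?D x v) y + conv f (\<lambda>x. ?D x w) y" .
    next
      fix r :: real and v :: 'a
      show "conv f (\<lambda>x. ?D x (r *\<^sub>R v)) y = r *\<^sub>R conv f (\<lambda>x. ?D x v) y"
        unfolding conv_def by (simp add: linear_simps(5)[OF lin] mult.left_commute[of _ r])
    qed
    then show ?thesis by (simp add: linear_conv_bounded_linear)
  qed
  show ?thesis
    unfolding has_derivative_at_alt
  proof (intro conjI allI impI lin')
    fix e :: real assume "e > 0"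
    \<comment> \<open>The \<open>+ 1\<close> keeps the quotient defined when \<open>f\<close>
      vanishes almost everywhere.\<close>
    define d where "d = e / (?A * ?L + 1)"
    have pos: "?A * ?L + 1 > 0" using A0 L0 by (simp add: add_nonneg_pos)
    then have "d > 0" using \<open>e > 0\<close> by (simp add: d_def)
    moreover have "norm (conv f \<psi> y' - conv f \<psi> y - conv f (\<lambda>x. ?D x (y' - y)) y) \<le> e * norm (y' - y)"
      if "norm (y' - y) < d" for y'
    proof -
      have "?A * ?L * norm (y' - y) \<le> (?A * ?L + 1) * d"
        using A0 L0 that pos by (intro mult_mono) auto
      also have "\<dots> = e" using pos by (simp add: d_def)
      finally have "?A * ?L * norm (y' - y) \<le> e" .
      then have "?A * ?L * norm (y' - y) * norm (y' - y) \<le> e * norm (y' - y)"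
        by (intro mult_right_mono) auto
      then show ?thesis using est[of "y' - y"] by simp
    qed
    ultimately show "\<exists>d>0. \<forall>y'. norm (y' - y) < d \<longrightarrow>
       norm (conv f \<psi> y' - conv f \<psi> y - conv f (\<lambda>x. ?D x (y' - y)) y) \<le> e * norm (y' - y)" by blast
  qed
qed

lemma frechet_derivative_conv:
  assumes "integrable lebesgue f" "test_function S \<psi>"
  shows "frechet_derivative (conv f \<psi>) (at y) v = conv f (\<lambda>x. frechet_derivative \<psi> (at x) v) y"
  using frechet_derivative_at[OF conv_has_derivative[OF assms]] by metis

lemma smooth_on_conv:
  assumes f: "integrable lebesgue f" and "test_function S \<psi>"
  shows "smooth_on UNIV (conv f \<psi>)"
proof -
  have "Ck_on k UNIV (conv f \<psi>)" for k
    using assms(2)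
  proof (induction k arbitrary: \<psi>)
    case 0
    then show ?case using conv_has_derivative[OF f]
      by (auto intro!: continuous_at_imp_continuous_on has_derivative_continuous)
  next
    case (Suc k)
    have "conv f \<psi> differentiable (at x)" for x
      using conv_has_derivative[OF f Suc.prems] unfolding differentiable_def by blast
    moreover have "Ck_on k UNIV (conv f (\<lambda>x. frechet_derivative \<psi> (at x) v))" for v
      by (rule Suc.IH[OF test_function_deriv[OF Suc.prems]])
    ultimately show ?case by (simp add: frechet_derivative_conv[OF f Suc.prems])
  qed
  then show ?thesis by (simp add: smooth_on_def)
qed

lemma test_function_moll: "e > 0 \<Longrightarrow> test_function UNIV (moll e :: 'a::euclidean_space \<Rightarrow> real)"
proof -
  assume e: "e > 0"
  have "norm y \<le> e" if "moll e y \<noteq> 0" for y :: 'a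
    using moll_eq_0[OF e, of y] that by linarith
  then have "closure {y. moll e y \<noteq> 0} \<subseteq> cball (0::'a) e"
    by (intro closure_minimal) auto
  then show ?thesis unfolding test_function_def
    using smooth_on_moll by (metis bounded_cball bounded_subset closed_closure compact_eq_bounded_closed subset_UNIV)
qed

section \<open>Convergence of mollifications in L^2\<close>

lemma L2_compact_support_integrable:
  fixes f :: "'a::euclidean_space \<Rightarrow> real"
  assumes m: "f \<in> borel_measurable lebesgue" and i: "integrable lebesgue (\<lambda>x. (f x)\<^sup>2)"
    and z: "\<And>x. x \<notin> cball 0 R \<Longrightarrow> f x = 0"
  shows "integrable lebesgue f"
proof (rule Bochner_Integration.integrable_bound)
  have "cball (0::'a) R \<in> lmeasurable" by simp
  then have "integrable lebesgue (indicat_real (cball (0::'a) R))"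
    by (simp add: fmeasurable_def integrable_indicator_iff)
  then show "integrable lebesgue (\<lambda>x. indicat_real (cball 0 R) x + (f x)\<^sup>2)"
    using i by (rule Bochner_Integration.integrable_add)
  have "\<bar>f x\<bar> \<le> 1 + (f x)\<^sup>2" for x
    using zero_le_power2[of "\<bar>f x\<bar> - 1"] zero_le_power2[of "f x"] by (simp add: power2_diff)
  then show "AE x in lebesgue. norm (f x) \<le> norm (indicat_real (cball 0 R) x + (f x)\<^sup>2)"
    using z by (intro AE_I2) (auto simp: indicator_def)
qed (rule m)

lemma lebesgue_translate:
  fixes f :: "'a::euclidean_space \<Rightarrow> real"
  assumes "integrable lborel f"
  shows "integrable lborel (\<lambda>x. f (x - y))" "(\<integral>x. f (x - y) \<partial>lborel) = (\<integral>x. f x \<partial>lborel)"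
proof -
  have d: "distr lborel borel ((+) (- y)) = (lborel :: 'a measure)" by (rule lborel_distr_plus)
  have f: "f \<in> borel_measurable borel" using assms by auto
  have "integrable (distr lborel borel ((+) (- y))) f" using assms by (simp add: d)
  then show "integrable lborel (\<lambda>x. f (x - y))"
    by (subst (asm) integrable_distr_eq) (use f in auto)
  have "(\<integral>x. f x \<partial>distr lborel borel ((+) (- y))) = (\<integral>x. f (- y + x) \<partial>lborel)"
    by (rule integral_distr) (use f in auto)
  then show "(\<integral>x. f (x - y) \<partial>lborel) = (\<integral>x. f x \<partial>lborel)" by (simp add: d)
qed

lemma integral_moll_diff:
  assumes "e > 0"
  shows "integrable lebesgue (\<lambda>z. moll e (y - z :: 'a::euclidean_space))" "(\<integral>z. moll e (y - z :: 'a) \<partial>lebesgue) = 1"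
proof -
  have m: "(\<lambda>z. moll e (z - y)) \<in> borel_measurable lborel" by measurable
  note t = lebesgue_translate[OF integrable_moll[OF assms], of y]
  have eq: "(\<lambda>z. moll e (y - z)) = (\<lambda>z. moll e (z - y))" by (auto simp: moll_minus_commute)
  show "integrable lebesgue (\<lambda>z. moll e (y - z))"
    unfolding eq using t(1) m by (simp add: integrable_completion)
  show "(\<integral>z. moll e (y - z) \<partial>lebesgue) = 1"
    unfolding eq using t(2) m by (simp add: integral_completion integral_moll[OF assms])
qed

text \<open>The mollification is an average of \<open>f\<close> over the ball of radius
  \<open>e\<close>. With small \<open>r\<close> this gives uniform convergence for continuous
  functions; with \<open>r = 0\<close> it shows that a mollification vanishes as soon as
  \<open>f\<close> vanishes on the ball.\<close>

lemma conv_moll_near: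
  assumes f: "integrable lebesgue f" and e: "e > 0"
    and near: "\<And>z. norm (z - y) < e \<Longrightarrow> \<bar>f z - c\<bar> \<le> r"
  shows "\<bar>conv f (moll e) y - c\<bar> \<le> r"
proof -
  note m = integral_moll_diff[OF e, of y]
  have i: "integrable lebesgue (\<lambda>z. f z * moll e (y - z))"
    by (rule conv_integrable[OF f test_function_moll[OF e]])
  have i': "integrable lebesgue (\<lambda>z. (f z - c) * moll e (y - z))"
    unfolding left_diff_distrib by (intro Bochner_Integration.integrable_diff i integrable_mult_right m)
  have "conv f (moll e) y - c = (\<integral>z. f z * moll e (y - z) \<partial>lebesgue) - (\<integral>z. c * moll e (y - z) \<partial>lebesgue)"
    using m by (simp add: conv_def)
  also have "\<dots> = (\<integral>z. (f z - c) * moll e (y - z) \<partial>lebesgue)"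
    unfolding left_diff_distrib
    by (rule Bochner_Integration.integral_diff[symmetric]) (intro i integrable_mult_right m)+
  finally have E: "conv f (moll e) y - c = (\<integral>z. (f z - c) * moll e (y - z) \<partial>lebesgue)" .
  have "\<bar>conv f (moll e) y - c\<bar> \<le> (\<integral>z. \<bar>(f z - c) * moll e (y - z)\<bar> \<partial>lebesgue)"
    unfolding E by (rule integral_abs_bound)
  also have "\<dots> \<le> (\<integral>z. r * moll e (y - z) \<partial>lebesgue)"
  proof (rule Bochner_Integration.integral_mono[OF integrable_abs[OF i']])
    show "integrable lebesgue (\<lambda>z. r * moll e (y - z))" by (intro integrable_mult_right m)
    show "\<bar>(f z - c) * moll e (y - z)\<bar> \<le> r * moll e (y - z)" for z
    proof (cases "norm (z - y) < e")
      case True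
      then show ?thesis using near moll_nonneg[OF e, of "y - z"] by (auto simp: abs_mult intro!: mult_right_mono)
    next
      case False
      then have "moll e (y - z) = 0" using moll_eq_0[OF e, of "y - z"] by (simp add: norm_minus_commute)
      then show ?thesis by simp
    qed
  qed
  also have "\<dots> = r" using m by simp
  finally show ?thesis .
qed

lemma borel_measurable_conv:
  assumes "integrable lebesgue f" "test_function S \<psi>"
  shows "conv f \<psi> \<in> borel_measurable borel"
  by (rule borel_measurable_continuous_onI[OF smooth_on_continuous[OF smooth_on_conv[OF assms]]])

text \<open>Tonelli: after exchanging the integrals, the inner one is the total mass of the
  mollifier, which is 1.\<close>

lemma conv_nonneg_integral:
  fixes h :: "'a::euclidean_space \<Rightarrow> real"
  assumes h: "integrable lborel h" "\<And>x. h x \<ge> 0" and e: "e > 0"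
  shows "integrable lborel (conv h (moll e))" "(\<integral>y. conv h (moll e) y \<partial>lborel) = (\<integral>x. h x \<partial>lborel)"
proof -
  have hm[measurable]: "h \<in> borel_measurable borel" using h by auto
  have hl: "integrable lebesgue h" using h by (simp add: integrable_completion)
  have mm: "(\<lambda>z. h z * moll e (y - z)) \<in> borel_measurable lborel" for y by measurable
  have i: "integrable lborel (\<lambda>z. h z * moll e (y - z))" for y
    using conv_integrable[OF hl test_function_moll[OF e], of y] mm by (simp add: integrable_completion)
  have nn: "ennreal (conv h (moll e) y) = (\<integral>\<^sup>+z. ennreal (h z * moll e (y - z)) \<partial>lborel)" for y
  proof -
    have "conv h (moll e) y = (\<integral>z. h z * moll e (y - z) \<partial>lborel)"
      unfolding conv_def using mm by (simp add: integral_completion)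
    moreover have "AE z in lborel. 0 \<le> h z * moll e (y - z)"
      using h moll_nonneg[OF e] by (intro AE_I2 mult_nonneg_nonneg) auto
    ultimately show ?thesis using nn_integral_eq_integral[OF i, of y] by simp
  qed
  have inner: "(\<integral>\<^sup>+y. ennreal (moll e (y - z)) \<partial>lborel) = 1" for z :: 'a
  proof -
    have "AE y in lborel. 0 \<le> moll e (y - z)" by (rule AE_I2) (rule moll_nonneg[OF e])
    from nn_integral_eq_integral[OF lebesgue_translate(1)[OF integrable_moll[OF e], of z] this]
    show ?thesis
      using lebesgue_translate(2)[OF integrable_moll[OF e], of z] integral_moll[OF e, where 'a='a] by simp
  qed
  have "(\<integral>\<^sup>+y. ennreal (conv h (moll e) y) \<partial>lborel)
     = (\<integral>\<^sup>+y. (\<integral>\<^sup>+z. ennreal (h z * moll e (y - z)) \<partial>lborel) \<partial>lborel)" by (simp add: nn)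
  also have "\<dots> = (\<integral>\<^sup>+z. (\<integral>\<^sup>+y. ennreal (h z * moll e (y - z)) \<partial>lborel) \<partial>lborel)"
    by (rule lborel_pair.Fubini') measurable
  also have "\<dots> = (\<integral>\<^sup>+z. ennreal (h z) \<partial>lborel)"
    by (simp only: ennreal_mult[OF h(2) moll_nonneg[OF e]]) (simp add: nn_integral_cmult inner)
  also have "\<dots> = ennreal (\<integral>z. h z \<partial>lborel)" using h by (simp add: nn_integral_eq_integral)
  finally have N: "(\<integral>\<^sup>+y. ennreal (conv h (moll e) y) \<partial>lborel) = ennreal (\<integral>z. h z \<partial>lborel)" .
  have pos: "conv h (moll e) y \<ge> 0" for y
    unfolding conv_def by (rule Bochner_Integration.integral_nonneg, rule mult_nonneg_nonneg) (use h moll_nonneg[OF e] in auto)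
  have meas: "conv h (moll e) \<in> borel_measurable lborel"
    using borel_measurable_conv[OF hl test_function_moll[OF e]] by simp
  show int: "integrable lborel (conv h (moll e))"
    by (rule integrableI_nonneg[OF meas]) (use pos N in auto)
  show "(\<integral>y. conv h (moll e) y \<partial>lborel) = (\<integral>x. h x \<partial>lborel)"
    using N nn_integral_eq_integral[OF int] pos h by (simp add: ennreal_inj)
qed

text \<open>Jensen's inequality for the probability density
  \<open>\<lambda>z. moll e (y - z)\<close>, obtained by expanding the nonnegative variance of
  \<open>f\<close> about its mean \<open>?m\<close>.\<close>

lemma conv_square_le:
  assumes f: "integrable lebesgue f" and f2: "integrable lebesgue (\<lambda>x. (f x)\<^sup>2)" and e: "e > 0"
  shows "(conv f (moll e) y)\<^sup>2 \<le> conv (\<lambda>x. (f x)\<^sup>2) (moll e) y"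
proof -
  let ?m = "conv f (moll e) y"
  note m = integral_moll_diff[OF e, of y]
  note i1 = conv_integrable[OF f test_function_moll[OF e], of y]
  note i2 = conv_integrable[OF f2 test_function_moll[OF e], of y]
  have eq: "(f z - ?m)\<^sup>2 * moll e (y - z) =
     (f z)\<^sup>2 * moll e (y - z) - (2 * ?m) * (f z * moll e (y - z)) + ?m\<^sup>2 * moll e (y - z)" for z
    by (simp add: power2_diff algebra_simps)
  have "0 \<le> (\<integral>z. (f z - ?m)\<^sup>2 * moll e (y - z) \<partial>lebesgue)"
    using moll_nonneg[OF e] by (intro Bochner_Integration.integral_nonneg mult_nonneg_nonneg) auto
  also have "\<dots> = (\<integral>z. (f z)\<^sup>2 * moll e (y - z) - (2 * ?m) * (f z * moll e (y - z)) + ?m\<^sup>2 * moll e (y - z) \<partial>lebesgue)"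
    by (simp only: eq)
  also have "\<dots> = conv (\<lambda>x. (f x)\<^sup>2) (moll e) y - (2 * ?m) * ?m + ?m\<^sup>2 * 1"
    unfolding m(2)[symmetric] using i1 i2 m(1)
    by (simp add: conv_def)
  finally show ?thesis by (simp add: power2_eq_square)
qed

text \<open>Jensen pointwise, then conservation of mass for the function \<open>f^2\<close>. The
  mollification is thus a contraction of L^2 for every radius, which lets an approximation error be
  mollified without growing.\<close>

lemma conv_moll_L2_contract:
  fixes f :: "'a::euclidean_space \<Rightarrow> real"
  assumes m: "f \<in> borel_measurable borel" and f: "integrable lebesgue f" and f2: "integrable lebesgue (\<lambda>x. (f x)\<^sup>2)" and e: "e > 0"
  shows "integrable lebesgue (\<lambda>y. (conv f (moll e) y)\<^sup>2)"
    "(\<integral>y. (conv f (moll e) y)\<^sup>2 \<partial>lebesgue) \<le> (\<integral>y. (f y)\<^sup>2 \<partial>lebesgue)"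
proof -
  have f2': "integrable lborel (\<lambda>x. (f x)\<^sup>2)" using f2 m by (simp add: integrable_completion)
  note c = conv_nonneg_integral[OF f2' _ e]
  have cm: "conv f (moll e) \<in> borel_measurable borel" by (rule borel_measurable_conv[OF f test_function_moll[OF e]])
  then have m2: "(\<lambda>y. (conv f (moll e) y)\<^sup>2) \<in> borel_measurable lborel" by simp
  have I: "integrable lborel (\<lambda>y. (conv f (moll e) y)\<^sup>2)"
    by (rule Bochner_Integration.integrable_bound[OF c(1) m2])
       (auto intro!: AE_I2 order_trans[OF conv_square_le[OF f f2 e] abs_ge_self])
  then show "integrable lebesgue (\<lambda>y. (conv f (moll e) y)\<^sup>2)" using m2 by (simp add: integrable_completion)
  have "(\<integral>y. (conv f (moll e) y)\<^sup>2 \<partial>lborel) \<le> (\<integral>y. conv (\<lambda>x. (f x)\<^sup>2) (moll e) y \<partial>lborel)"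
    by (rule Bochner_Integration.integral_mono[OF I c(1)]) (use conv_square_le[OF f f2 e] in auto)
  then show "(\<integral>y. (conv f (moll e) y)\<^sup>2 \<partial>lebesgue) \<le> (\<integral>y. (f y)\<^sup>2 \<partial>lebesgue)"
    using c(2) m m2 by (simp add: integral_completion)
qed

text \<open>First truncate \<open>f\<close> at a height \<open>B\<close>. The continuous functions
  \<open>h\<close> that converge to the truncation off a negligible set can then be clamped to the
  same height and multiplied by the cutoff \<open>\<tau>\<close> without changing their limit, so
  that dominated convergence applies in both steps.\<close>

lemma continuous_dense_L2:
  fixes f :: "'a::euclidean_space \<Rightarrow> real"
  assumes m: "f \<in> borel_measurable lebesgue" and f2: "integrable lebesgue (\<lambda>x. (f x)\<^sup>2)"
    and z: "\<And>x. x \<notin> cball 0 R \<Longrightarrow> f x = 0" and d: "d > 0"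
  obtains g where "continuous_on UNIV g" "\<And>x. x \<notin> cball 0 (R + 1) \<Longrightarrow> g x = 0"
    "integrable lebesgue (\<lambda>x. (g x)\<^sup>2)" "integrable lebesgue (\<lambda>x. (f x - g x)\<^sup>2)" "(\<integral>x. (f x - g x)\<^sup>2 \<partial>lebesgue) < d"
proof -
  define cl where "cl B t = max (- B) (min B t)" for B t :: real
  have clB: "\<bar>cl B t\<bar> \<le> B" if "B \<ge> 0" for B t using that by (auto simp: cl_def)
  have cl0: "cl B 0 = 0" if "B \<ge> 0" for B using that by (auto simp: cl_def)
  have "(\<lambda>n. \<integral>x. (f x - cl (real n) (f x))\<^sup>2 \<partial>lebesgue) \<longlonglongrightarrow> (\<integral>x. 0 \<partial>(lebesgue :: 'a measure))"
  proof (rule integral_dominated_convergence[OF _ _ f2])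
    show "(\<lambda>x. (f x - cl (real n) (f x))\<^sup>2) \<in> borel_measurable lebesgue" for n
      unfolding cl_def using m by measurable
    show "AE x in lebesgue. (\<lambda>n. (f x - cl (real n) (f x))\<^sup>2) \<longlonglongrightarrow> 0"
    proof (rule AE_I2)
      fix x
      obtain n0 :: nat where n0: "\<bar>f x\<bar> \<le> real n0" using real_arch_simple by blast
      have "\<forall>\<^sub>F n in sequentially. (f x - cl (real n) (f x))\<^sup>2 = 0"
        using eventually_ge_at_top[of n0] by eventually_elim (use n0 in \<open>auto simp: cl_def\<close>)
      then show "(\<lambda>n. (f x - cl (real n) (f x))\<^sup>2) \<longlonglongrightarrow> 0" by (rule tendsto_eventually)
    qed
    show "AE x in lebesgue. norm ((f x - cl (real n) (f x))\<^sup>2) \<le> (f x)\<^sup>2" for n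
      by (rule AE_I2) (auto simp: cl_def abs_le_square_iff[symmetric])
  qed simp
  then have "\<forall>\<^sub>F n in sequentially. (\<integral>x. (f x - cl (real n) (f x))\<^sup>2 \<partial>lebesgue) < d/4"
    using d by (intro order_tendstoD) auto
  \<comment> \<open>A quarter of \<open>d\<close> for each of the two errors, since
    \<open>sq\<close> doubles both squares.\<close>
  then obtain n where n: "(\<integral>x. (f x - cl (real n) (f x))\<^sup>2 \<partial>lebesgue) < d/4"
    using eventually_happens' sequentially_bot by blast
  define B where "B = real n"
  have B: "B \<ge> 0" by (simp add: B_def)
  define F where "F x = cl B (f x)" for x
  have Fm: "F \<in> borel_measurable lebesgue" unfolding F_def cl_def using m by measurable
  have Fz: "x \<notin> cball 0 R \<Longrightarrow> F x = 0" for x using z cl0[OF B] by (simp add: F_def)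
  have fF: "integrable lebesgue (\<lambda>x. (f x - F x)\<^sup>2)"
    by (rule Bochner_Integration.integrable_bound[OF f2])
       (use Fm m B in \<open>auto simp: F_def cl_def abs_le_square_iff[symmetric] intro!: AE_I2\<close>)
  have "F measurable_on UNIV" using Fm by (simp add: measurable_on_iff_borel_measurable)
  then obtain N h where N: "negligible N" and h: "\<And>n. continuous_on UNIV (h n)"
    "\<And>x. x \<notin> N \<Longrightarrow> (\<lambda>n. h n x) \<longlonglongrightarrow> F x"
    unfolding measurable_on_def by auto
  \<comment> \<open>Equal to 1 where \<open>F\<close> may be nonzero and to 0 off the ball of radius
    \<open>R + 1\<close>; it gives the approximants compact support.\<close>
  define \<tau> where "\<tau> x = max 0 (min 1 (R + 1 - norm x))" for x :: 'a
  have \<tau>: "0 \<le> \<tau> x" "\<tau> x \<le> 1" "x \<in> cball 0 R \<Longrightarrow> \<tau> x = 1" "x \<notin> cball 0 (R+1) \<Longrightarrow> \<tau> x = 0" for x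
    by (auto simp: \<tau>_def)
  define G where "G k x = cl B (h k x) * \<tau> x" for k x
  have Gc: "continuous_on UNIV (G k)" for k
    unfolding G_def cl_def \<tau>_def by (intro continuous_intros h)
  then have Gm: "G k \<in> borel_measurable lebesgue" for k
    by (simp add: borel_measurable_continuous_onI measurable_completion)
  have GB: "\<bar>G k x\<bar> \<le> B * indicat_real (cball 0 (R+1)) x" for k x
    using clB[OF B, of "h k x"] \<tau>[of x] B by (cases "x \<in> cball 0 (R+1)") (auto simp: G_def abs_mult intro: mult_mono[of _ B _ 1, simplified])
  have FB: "\<bar>F x\<bar> \<le> B * indicat_real (cball 0 (R+1)) x" for x
    using clB[OF B] Fz[of x] B by (cases "x \<in> cball 0 R") (auto simp: F_def indicator_def)
  have dom: "integrable lebesgue (\<lambda>x. (2*B)^2 * indicat_real (cball (0::'a) (R+1)) x)"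
    using lmeasurable_cball[of "0::'a" "R+1"] by (intro integrable_mult_right) (simp add: fmeasurable_def integrable_indicator_iff)
  have FGb: "norm ((F x - G k x)\<^sup>2) \<le> (2*B)^2 * indicat_real (cball 0 (R+1)) x" for x k
  proof -
    have "\<bar>F x - G k x\<bar> \<le> 2 * B * indicat_real (cball 0 (R+1)) x"
      using abs_triangle_ineq4[of "F x" "G k x"] GB[of k x] FB[of x] by linarith
    then have "(F x - G k x)\<^sup>2 \<le> (2 * B * indicat_real (cball 0 (R+1)) x)^2"
      using B by (subst abs_le_square_iff[symmetric]) auto
    then show ?thesis by (cases "x \<in> cball 0 (R+1)") auto
  qed
  have "(\<lambda>k. \<integral>x. (F x - G k x)\<^sup>2 \<partial>lebesgue) \<longlonglongrightarrow> (\<integral>x. 0 \<partial>(lebesgue :: 'a measure))"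
  proof (rule integral_dominated_convergence[OF _ _ dom])
    show "(\<lambda>x. (F x - G k x)\<^sup>2) \<in> borel_measurable lebesgue" for k using Fm Gm by measurable
    have "AE x in lebesgue. x \<notin> N" using N by (simp add: negligible_iff_null_sets AE_not_in)
    then show "AE x in lebesgue. (\<lambda>k. (F x - G k x)\<^sup>2) \<longlonglongrightarrow> 0"
    proof eventually_elim
      case (elim x)
      have "(\<lambda>k. G k x) \<longlonglongrightarrow> cl B (F x) * \<tau> x"
        unfolding G_def cl_def by (intro tendsto_intros h elim)
      moreover have "cl B (F x) * \<tau> x = F x"
        using B Fz[of x] \<tau>(3)[of x] by (cases "x \<in> cball 0 R") (auto simp: F_def cl_def)
      ultimately have "(\<lambda>k. (F x - G k x)\<^sup>2) \<longlonglongrightarrow> (F x - F x)\<^sup>2" by (intro tendsto_intros) simp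
      then show ?case by simp
    qed
    show "AE x in lebesgue. norm ((F x - G k x)\<^sup>2) \<le> (2*B)^2 * indicat_real (cball 0 (R+1)) x" for k
      using FGb by blast
  qed simp
  then have "\<forall>\<^sub>F k in sequentially. (\<integral>x. (F x - G k x)\<^sup>2 \<partial>lebesgue) < d/4"
    using d by (intro order_tendstoD) auto
  then obtain k where k: "(\<integral>x. (F x - G k x)\<^sup>2 \<partial>lebesgue) < d/4"
    using eventually_happens' sequentially_bot by blast
  have FG: "integrable lebesgue (\<lambda>x. (F x - G k x)\<^sup>2)"
    by (rule Bochner_Integration.integrable_bound[OF dom]) (use Fm Gm FGb in \<open>auto intro: AE_I2 order_trans[OF _ abs_ge_self]\<close>)
  have sq: "(f x - G k x)\<^sup>2 \<le> 2 * (f x - F x)\<^sup>2 + 2 * (F x - G k x)\<^sup>2" for x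
    using zero_le_power2[of "(f x - F x) - (F x - G k x)"] by (simp add: power2_eq_square algebra_simps)
  have bi: "integrable lebesgue (\<lambda>x. 2 * (f x - F x)\<^sup>2 + 2 * (F x - G k x)\<^sup>2)" using fF FG by auto
  have I: "integrable lebesgue (\<lambda>x. (f x - G k x)\<^sup>2)"
    by (rule Bochner_Integration.integrable_bound[OF bi]) (use m Gm sq in \<open>auto intro: AE_I2 order_trans[OF _ abs_ge_self]\<close>)
  have "(\<integral>x. (f x - G k x)\<^sup>2 \<partial>lebesgue) \<le> (\<integral>x. 2 * (f x - F x)\<^sup>2 + 2 * (F x - G k x)\<^sup>2 \<partial>lebesgue)"
    by (rule Bochner_Integration.integral_mono[OF I bi sq])
  also have "\<dots> < d" using n k fF FG d by (simp add: F_def B_def)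
  finally have lt: "(\<integral>x. (f x - G k x)\<^sup>2 \<partial>lebesgue) < d" .
  have G2: "integrable lebesgue (\<lambda>x. (G k x)\<^sup>2)"
  proof (rule Bochner_Integration.integrable_bound[OF dom])
    have "(G k x)\<^sup>2 \<le> (2*B)^2 * indicat_real (cball 0 (R+1)) x" for x
    proof (cases "x \<in> cball 0 (R+1)")
      case True
      then have "\<bar>G k x\<bar> \<le> \<bar>2 * B\<bar>" using GB[of k x] B by simp
      then have "(G k x)\<^sup>2 \<le> (2 * B)\<^sup>2" by (simp only: abs_le_square_iff)
      then show ?thesis using True by simp
    qed (use GB[of k x] in auto)
    then show "AE x in lebesgue. norm ((G k x)\<^sup>2) \<le> norm ((2*B)^2 * indicat_real (cball 0 (R+1)) x)"
      by (intro AE_I2) (simp add: order_trans[OF _ abs_ge_self])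
  qed (use Gm in auto)
  show ?thesis
    by (rule that[of "G k"]) (use Gc G2 I lt \<tau>(4) in \<open>auto simp: G_def\<close>)
qed

lemma conv_AE_cong:
  assumes "AE x in lebesgue. f x = g x" "f \<in> borel_measurable lebesgue" "g \<in> borel_measurable lebesgue" "test_function S \<psi>"
  shows "conv f \<psi> y = conv g \<psi> y"
  unfolding conv_def using assms test_function_measurable_diff[OF assms(4), of y]
  by (intro integral_cong_AE) auto

lemma conv_diff:
  assumes "integrable lebesgue f" "integrable lebesgue g" "test_function S \<psi>"
  shows "conv (\<lambda>x. f x - g x) \<psi> y = conv f \<psi> y - conv g \<psi> y"
  unfolding conv_def left_diff_distrib
  by (rule Bochner_Integration.integral_diff) (rule conv_integrable assms)+

text \<open>Compare with a continuous \<open>g\<close> close to \<open>f\<close>. The mollified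
  difference is controlled by the contraction property, and the mollification of \<open>g\<close>
  converges uniformly by uniform continuity on a compact ball. The outcome is a threshold
  \<open>e0\<close> for the radius and not a sequence, so that several components can share one
  sequence of radii.\<close>

lemma conv_moll_L2:
  fixes f :: "'a::euclidean_space \<Rightarrow> real"
  assumes m: "f \<in> borel_measurable lebesgue" and f2: "integrable lebesgue (\<lambda>x. (f x)\<^sup>2)"
    and z: "\<And>x. x \<notin> cball 0 R \<Longrightarrow> f x = 0" and d: "d > 0"
  obtains e0 where "e0 > 0" "\<And>e. 0 < e \<Longrightarrow> e < e0 \<Longrightarrow>
    integrable lebesgue (\<lambda>y. (conv f (moll e) y - f y)\<^sup>2) \<and> (\<integral>y. (conv f (moll e) y - f y)\<^sup>2 \<partial>lebesgue) < d"
proof -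
  note fi = L2_compact_support_integrable[OF m f2 z]
  \<comment> \<open>Three errors are below \<open>d/12\<close> each and enter \<open>three\<close>
    with the factor 3, so they add up to less than \<open>3 * d / 4\<close>.\<close>
  have d6: "d/12 > 0" using d by simp
  obtain g where gc: "continuous_on UNIV g" and gz: "\<And>x. x \<notin> cball 0 (R + 1) \<Longrightarrow> g x = 0"
    and g2: "integrable lebesgue (\<lambda>x. (g x)\<^sup>2)"
    and fg: "integrable lebesgue (\<lambda>x. (f x - g x)\<^sup>2)" "(\<integral>x. (f x - g x)\<^sup>2 \<partial>lebesgue) < d/12"
    by (rule continuous_dense_L2[OF m f2 z d6], assumption) (rule that)
  have gb: "g \<in> borel_measurable borel" using gc by (rule borel_measurable_continuous_onI)
  have gm: "g \<in> borel_measurable lebesgue" using gb by (simp add: measurable_completion)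
  note gi = L2_compact_support_integrable[OF gm g2 gz]
  \<comment> \<open>The contraction property rests on Tonelli for Borel functions, so the difference
    \<open>f - g\<close> is replaced by the Borel function \<open>k\<close> that agrees with it
    almost everywhere.\<close>
  obtain f0 where f0: "f0 \<in> borel_measurable lborel" "AE x in lborel. f x = f0 x"
    using completion_ex_borel_measurable_real[OF m] by blast
  have ff0: "AE x in lebesgue. f x = f0 x" using f0(2) by (rule AE_completion)
  define k where "k x = f0 x - g x" for x
  have kb: "k \<in> borel_measurable borel" unfolding k_def using f0 gb by measurable
  have km: "k \<in> borel_measurable lebesgue" using kb by (simp add: measurable_completion)
  have kae: "AE x in lebesgue. f x - g x = k x" using ff0 by eventually_elim (simp add: k_def)
  have ki: "integrable lebesgue k"
    using Bochner_Integration.integrable_diff[OF fi gi] kae km m gm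
    by (subst integrable_cong_AE[of _ _ "\<lambda>x. f x - g x"]) auto
  have k2: "integrable lebesgue (\<lambda>x. (k x)\<^sup>2)"
    using fg(1) kae km m gm by (subst integrable_cong_AE[of _ _ "\<lambda>x. (f x - g x)\<^sup>2"]) auto
  have k2i: "(\<integral>x. (k x)\<^sup>2 \<partial>lebesgue) < d/12"
    using fg(2) kae km m gm by (subst integral_cong_AE[of _ _ "\<lambda>x. (f x - g x)\<^sup>2"]) auto
  have C: "conv f (moll e) y - conv g (moll e) y = conv k (moll e) y" if "e > 0" for e y
    using conv_diff[OF fi gi test_function_moll[OF that], where y = y]
      conv_AE_cong[where f = "\<lambda>x. f x - g x" and g = k, OF kae _ km test_function_moll[OF that], where y = y] m gm by simp
  let ?V = "measure lebesgue (cball (0::'a) (R+2))"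
  \<comment> \<open>A uniform error \<open>r\<close> on the ball of radius \<open>R + 2\<close>
    contributes \<open>r^2\<close> times its volume, which this choice keeps below
    \<open>d/12\<close>; the \<open>+ 1\<close> avoids a zero denominator. The radius is
    \<open>R + 2\<close> because \<open>g\<close> lives in radius \<open>R + 1\<close> and the
    mollifier reaches at most 1 further.\<close>
  define r where "r = sqrt (d / (12 * (?V + 1)))"
  have V: "?V \<ge> 0" by simp
  have r: "r > 0" using d V by (simp add: r_def add_nonneg_pos)
  have rV: "r\<^sup>2 * ?V < d/12"
  proof -
    have "r\<^sup>2 = d / (12 * (?V + 1))" using d V by (simp add: r_def)
    then have "r\<^sup>2 * ?V = (d/12) * (?V / (?V + 1))" by simp
    also have "\<dots> < (d/12) * 1"
    proof (rule mult_strict_left_mono)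
      have "c / (c + 1) < 1" if "c \<ge> 0" for c :: real using that by (simp add: divide_simps)
      from this[OF V] show "?V / (?V + 1) < 1" .
    qed (use d in auto)
    finally show ?thesis by simp
  qed
  have "uniformly_continuous_on (cball 0 (R+2)) g"
    using gc by (intro compact_uniformly_continuous) (auto intro: continuous_on_subset)
  then obtain s where s: "s > 0" "\<And>x x'. x \<in> cball 0 (R+2) \<Longrightarrow> x' \<in> cball 0 (R+2) \<Longrightarrow> dist x' x < s \<Longrightarrow> dist (g x') (g x) < r"
    unfolding uniformly_continuous_on_def using r by metis
  show ?thesis
  proof (rule that[of "min s 1"])
    fix e :: real assume e: "0 < e" "e < min s 1"
    have near: "\<bar>conv g (moll e) y - g y\<bar> \<le> r * indicat_real (cball 0 (R+2)) y" for y
    proof (cases "y \<in> cball 0 (R + 2)")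
      case True
      have "\<bar>g z - g y\<bar> \<le> r" if "norm (z - y) < e" for z
      proof (cases "z \<in> cball 0 (R+2)")
        case True
        then show ?thesis using s(2)[OF \<open>y \<in> cball 0 (R+2)\<close> True] that e by (simp add: dist_norm)
      next
        case False
        have "norm y > R + 1" using False that e norm_triangle_ineq2[of z y] by auto
        then show ?thesis using False gz[of y] gz[of z] r by auto
      qed
      then have "\<bar>conv g (moll e) y - g y\<bar> \<le> r" using conv_moll_near[OF gi e(1)] by blast
      then show ?thesis using True by simp
    next
      case False
      have "\<bar>g z - g y\<bar> \<le> 0" if "norm (z - y) < e" for z
      proof -
        have "norm z > R + 1" using False that e norm_triangle_ineq2[of y z] by (auto simp: norm_minus_commute)
        then show ?thesis using False gz[of y] gz[of z] by auto
      qed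
      then have "\<bar>conv g (moll e) y - g y\<bar> \<le> 0" using conv_moll_near[OF gi e(1)] by blast
      then show ?thesis using False by simp
    qed
    note cg = borel_measurable_conv[OF gi test_function_moll[OF e(1)]]
    have cf: "conv f (moll e) \<in> borel_measurable lebesgue"
      using borel_measurable_conv[OF fi test_function_moll[OF e(1)]] by (simp add: measurable_completion)
    have ind: "integrable lebesgue (\<lambda>x. r\<^sup>2 * indicat_real (cball (0::'a) (R+2)) x)"
      using lmeasurable_cball[of "0::'a" "R+2"] by (intro integrable_mult_right) (simp add: fmeasurable_def integrable_indicator_iff)
    let ?S = "\<lambda>y. 3 * (conv k (moll e) y)\<^sup>2 + 3 * (r\<^sup>2 * indicat_real (cball 0 (R+2)) y) + 3 * (f y - g y)\<^sup>2"
    note kk = conv_moll_L2_contract[OF kb ki k2 e(1)]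
    have Si: "integrable lebesgue ?S"
      by (intro Bochner_Integration.integrable_add integrable_mult_right kk fg ind)
    have sq: "(conv f (moll e) y - f y)\<^sup>2 \<le> ?S y" for y
    proof -
      have three: "(a + b + c)\<^sup>2 \<le> 3 * a\<^sup>2 + 3 * b\<^sup>2 + 3 * c\<^sup>2" for a b c :: real
        using zero_le_power2[of "a - b"] zero_le_power2[of "b - c"] zero_le_power2[of "a - c"]
        by (simp add: power2_eq_square algebra_simps)
      have "(conv g (moll e) y - g y)\<^sup>2 \<le> (r * indicat_real (cball 0 (R+2)) y)\<^sup>2"
        using near[of y] r by (subst abs_le_square_iff[symmetric]) auto
      also have "\<dots> = r\<^sup>2 * indicat_real (cball 0 (R+2)) y" by (auto simp: indicator_def)
      finally have 1: "(conv g (moll e) y - g y)\<^sup>2 \<le> r\<^sup>2 * indicat_real (cball 0 (R+2)) y" .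
      have "conv f (moll e) y - f y = conv k (moll e) y + (conv g (moll e) y - g y) + (g y - f y)"
        using C[OF e(1), of y] by simp
      then have "(conv f (moll e) y - f y)\<^sup>2 \<le> 3 * (conv k (moll e) y)\<^sup>2 + 3 * (conv g (moll e) y - g y)\<^sup>2 + 3 * (g y - f y)\<^sup>2"
        by (simp only: three)
      then show ?thesis using 1 by (simp add: power2_commute[of "g y"])
    qed
    have I: "integrable lebesgue (\<lambda>y. (conv f (moll e) y - f y)\<^sup>2)"
      by (rule Bochner_Integration.integrable_bound[OF Si])
         (use cf m sq in \<open>auto intro!: AE_I2 order_trans[OF sq abs_ge_self]\<close>)
    have "(\<integral>y. (conv f (moll e) y - f y)\<^sup>2 \<partial>lebesgue) \<le> (\<integral>y. ?S y \<partial>lebesgue)"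
      by (rule Bochner_Integration.integral_mono[OF I Si sq])
    also have "\<dots> = 3 * (\<integral>y. (conv k (moll e) y)\<^sup>2 \<partial>lebesgue) + 3 * (r\<^sup>2 * ?V) + 3 * (\<integral>y. (f y - g y)\<^sup>2 \<partial>lebesgue)"
      using kk(1) fg(1) ind by simp
    also have "\<dots> < d" using kk(2) k2i rV fg(2) d by linarith
    finally show "integrable lebesgue (\<lambda>y. (conv f (moll e) y - f y)\<^sup>2) \<and> (\<integral>y. (conv f (moll e) y - f y)\<^sup>2 \<partial>lebesgue) < d"
      using I by blast
  qed (use s in auto)
qed

section \<open>Functions with weak gradients\<close>

definition l2_on :: "'a::euclidean_space set \<Rightarrow> ('a \<Rightarrow> real) \<Rightarrow> bool" where
  "l2_on K f \<longleftrightarrow> set_borel_measurable lebesgue K f \<and> set_integrable lebesgue K (\<lambda>y. (f y)\<^sup>2)"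

lemma set_integrable_bound_real:
  fixes f g :: "'a::euclidean_space \<Rightarrow> real"
  assumes "set_integrable lebesgue K g" "set_borel_measurable lebesgue K f" "\<And>x. x \<in> K \<Longrightarrow> \<bar>f x\<bar> \<le> g x"
  shows "set_integrable lebesgue K f"
  unfolding set_integrable_def
  by (rule Bochner_Integration.integrable_bound[OF assms(1)[unfolded set_integrable_def]])
     (use assms(2,3) in \<open>auto simp: set_borel_measurable_def indicator_def intro!: AE_I2 order_trans[OF _ abs_ge_self]\<close>)

lemma set_borel_measurable_mult:
  fixes f g :: "'a::euclidean_space \<Rightarrow> real"
  assumes "set_borel_measurable lebesgue K f" "set_borel_measurable lebesgue K g"
  shows "set_borel_measurable lebesgue K (\<lambda>x. f x * g x)"
proof -
  have "(\<lambda>x. (indicator K x *\<^sub>R f x) * (indicator K x *\<^sub>R g x)) \<in> borel_measurable lebesgue"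
    using assms unfolding set_borel_measurable_def by measurable
  moreover have "(\<lambda>x. (indicator K x *\<^sub>R f x) * (indicator K x *\<^sub>R g x)) = (\<lambda>x. indicator K x *\<^sub>R (f x * g x))"
    by (auto simp: indicator_def)
  ultimately show ?thesis unfolding set_borel_measurable_def by simp
qed

lemma set_borel_measurable_add:
  fixes f g :: "'a::euclidean_space \<Rightarrow> real"
  assumes "set_borel_measurable lebesgue K f" "set_borel_measurable lebesgue K g"
  shows "set_borel_measurable lebesgue K (\<lambda>x. f x + g x)"
  using borel_measurable_add[OF assms[unfolded set_borel_measurable_def]]
  unfolding set_borel_measurable_def by (simp add: algebra_simps)

lemma set_borel_measurable_continuous_compact:
  fixes f :: "'a::euclidean_space \<Rightarrow> 'b::euclidean_space"
  assumes "compact K" "continuous_on K f"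
  shows "set_borel_measurable lebesgue K f"
  using borel_integrable_compact[OF assms] unfolding set_borel_measurable_def
  by (intro measurable_completion) auto

lemma set_integrable_continuous_compact:
  fixes f :: "'a::euclidean_space \<Rightarrow> real"
  assumes "compact K" "continuous_on K f"
  shows "set_integrable lebesgue K f"
  using borel_integrable_compact[OF assms] unfolding set_integrable_def
  by (subst integrable_completion) auto

lemma continuous_compact_bounded:
  fixes f :: "'a::topological_space \<Rightarrow> real"
  assumes "compact K" "continuous_on K f"
  obtains B where "B > 0" "\<And>x. x \<in> K \<Longrightarrow> \<bar>f x\<bar> \<le> B"
proof -
  have "compact (f ` K)" using assms by (rule compact_continuous_image[rotated])
  then obtain B where "\<And>x. x \<in> K \<Longrightarrow> \<bar>f x\<bar> \<le> B"
    by (metis bounded_iff compact_imp_bounded imageI real_norm_def)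
  then show ?thesis using that[of "max B 1"] by (fastforce simp: le_max_iff_disj)
qed

lemma l2_on_continuous:
  fixes f :: "'a::euclidean_space \<Rightarrow> real"
  assumes "compact K" "continuous_on K f"
  shows "l2_on K f"
  unfolding l2_on_def using assms
  by (auto intro!: set_borel_measurable_continuous_compact set_integrable_continuous_compact continuous_intros)

lemma l2_on_mult_integrable:
  assumes "l2_on K f" "l2_on K g"
  shows "set_integrable lebesgue K (\<lambda>x. f x * g x)"
proof (rule set_integrable_bound_real)
  show "set_integrable lebesgue K (\<lambda>x. (f x)\<^sup>2 + (g x)\<^sup>2)"
    using assms by (simp add: l2_on_def set_integral_add)
  show "set_borel_measurable lebesgue K (\<lambda>x. f x * g x)"
    using assms by (simp add: l2_on_def set_borel_measurable_mult)
  show "\<bar>f x * g x\<bar> \<le> (f x)\<^sup>2 + (g x)\<^sup>2" for x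
    using zero_le_power2[of "\<bar>f x\<bar> - \<bar>g x\<bar>"] zero_le_power2[of "f x"] zero_le_power2[of "g x"]
    unfolding power2_diff power2_abs abs_mult by linarith
qed

lemma l2_on_bounded_mult:
  assumes "l2_on K f" "set_borel_measurable lebesgue K a" "\<And>x. x \<in> K \<Longrightarrow> \<bar>a x\<bar> \<le> C"
  shows "l2_on K (\<lambda>x. a x * f x)"
  unfolding l2_on_def
proof (rule conjI)
  show m: "set_borel_measurable lebesgue K (\<lambda>x. a x * f x)"
    using assms by (simp add: l2_on_def set_borel_measurable_mult)
  show "set_integrable lebesgue K (\<lambda>x. (a x * f x)\<^sup>2)"
  proof (rule set_integrable_bound_real)
  show "set_integrable lebesgue K (\<lambda>x. C\<^sup>2 * (f x)\<^sup>2)"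
    using assms(1) by (simp add: l2_on_def)
  show "set_borel_measurable lebesgue K (\<lambda>x. (a x * f x)\<^sup>2)"
    unfolding power2_eq_square by (rule set_borel_measurable_mult[OF m m])
  show "\<bar>(a x * f x)\<^sup>2\<bar> \<le> C\<^sup>2 * (f x)\<^sup>2" if "x \<in> K" for x
  proof -
    have "(a x)\<^sup>2 \<le> C\<^sup>2" using assms(3)[OF that] by (intro abs_le_square_iff[THEN iffD1]) linarith
    then show ?thesis by (simp add: power_mult_distrib mult_right_mono)
  qed
  qed
qed

lemma l2_on_continuous_mult:
  fixes f a :: "'a::euclidean_space \<Rightarrow> real"
  assumes "compact K" "l2_on K f" "continuous_on K a"
  shows "l2_on K (\<lambda>x. a x * f x)"
proof -
  obtain C where "\<And>x. x \<in> K \<Longrightarrow> \<bar>a x\<bar> \<le> C" using continuous_compact_bounded[OF assms(1,3)] by blast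
  then show ?thesis using assms by (intro l2_on_bounded_mult set_borel_measurable_continuous_compact)
qed

lemma l2_on_add:
  assumes "l2_on K f" "l2_on K g"
  shows "l2_on K (\<lambda>x. f x + g x)"
  unfolding l2_on_def
proof (intro conjI)
  show "set_borel_measurable lebesgue K (\<lambda>x. f x + g x)"
    using assms by (simp add: l2_on_def set_borel_measurable_add)
  have "set_integrable lebesgue K (\<lambda>x. (f x)\<^sup>2 + (g x)\<^sup>2 + 2 * (f x * g x))"
    using assms l2_on_mult_integrable[OF assms] by (intro set_integral_add) (auto simp: l2_on_def)
  then show "set_integrable lebesgue K (\<lambda>x. (f x + g x)\<^sup>2)"
    by (simp add: power2_sum mult.assoc)
qed

lemma l2_on_cmult: "l2_on K f \<Longrightarrow> l2_on K (\<lambda>x. c * f x)"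
  unfolding l2_on_def power_mult_distrib set_borel_measurable_def
  by (auto simp: mult.left_commute[of _ c])

lemma l2_on_diff:
  assumes "l2_on K f" "l2_on K g"
  shows "l2_on K (\<lambda>x. f x - g x)"
  using l2_on_add[OF assms(1) l2_on_cmult[OF assms(2), of "-1"]] by simp

lemma l2_on_sum: "finite I \<Longrightarrow> compact K \<Longrightarrow> (\<And>i. i \<in> I \<Longrightarrow> l2_on K (f i)) \<Longrightarrow> l2_on K (\<lambda>x. \<Sum>i\<in>I. f i x)"
  by (induction I rule: finite_induct) (auto intro: l2_on_add l2_on_continuous)

lemma l2_on_set_integrable:
  assumes "compact K" "l2_on K f"
  shows "set_integrable lebesgue K f"
  using l2_on_mult_integrable[OF l2_on_continuous[OF assms(1), of "\<lambda>_. 1"] assms(2)] by simp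

lemma L_loc_2_component:
  fixes w :: "'a::euclidean_space \<Rightarrow> real^'n"
  assumes "L_loc 2 S w" "compact K" "K \<subseteq> S"
  shows "l2_on K (\<lambda>y. w y $ k)"
  unfolding l2_on_def
proof (rule conjI)
  have w: "set_borel_measurable lebesgue K w" "set_integrable lebesgue K (\<lambda>y. norm (w y) powr 2)"
    using assms unfolding L_loc_def by auto
  have "(\<lambda>x. (indicator K x *\<^sub>R w x) $ k) \<in> borel_measurable lebesgue"
    by (rule borel_measurable_continuous_on[of "\<lambda>v. v $ k"])
       (use w in \<open>auto simp: set_borel_measurable_def intro!: continuous_intros\<close>)
  then show m: "set_borel_measurable lebesgue K (\<lambda>y. w y $ k)"
    by (simp add: set_borel_measurable_def)
  show "set_integrable lebesgue K (\<lambda>y. (w y $ k)\<^sup>2)"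
  proof (rule set_integrable_bound_real)
  show "set_borel_measurable lebesgue K (\<lambda>y. (w y $ k)\<^sup>2)"
    unfolding power2_eq_square by (rule set_borel_measurable_mult[OF m m])
  show "set_integrable lebesgue K (\<lambda>y. (norm (w y))\<^sup>2)" using w(2) by simp
  show "\<bar>(w y $ k)\<^sup>2\<bar> \<le> (norm (w y))\<^sup>2" for y
    using component_le_norm_cart[of "w y" k] by (simp add: abs_le_square_iff[symmetric])
  qed
qed

lemma L_loc_2_I:
  fixes w :: "'a::euclidean_space \<Rightarrow> real^'n"
  assumes "\<And>K k. compact K \<Longrightarrow> K \<subseteq> S \<Longrightarrow> l2_on K (\<lambda>y. w y $ k)"
  shows "L_loc 2 S w"
  unfolding L_loc_def
proof (intro allI impI conjI)
  fix K assume K: "compact K \<and> K \<subseteq> S"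
  then have l: "l2_on K (\<lambda>y. w y $ k)" for k using assms by blast
  show "set_borel_measurable lebesgue K w"
    unfolding set_borel_measurable_def
  proof (subst borel_measurable_euclidean_space, rule ballI)
    fix b :: "real^'n" assume "b \<in> Basis"
    then obtain k where b: "b = axis k 1" by (auto simp: Basis_vec_def)
    show "(\<lambda>x. (indicator K x *\<^sub>R w x) \<bullet> b) \<in> borel_measurable lebesgue"
      using l[of k] by (simp add: b inner_axis l2_on_def set_borel_measurable_def)
  qed
  have "set_integrable lebesgue K (\<lambda>y. \<Sum>k\<in>UNIV. (w y $ k)\<^sup>2)"
    using l unfolding l2_on_def set_integrable_def scaleR_sum_right
    by (intro Bochner_Integration.integrable_sum) auto
  then show "set_integrable lebesgue K (\<lambda>y. norm (w y) powr 2)"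
    by (simp add: norm_vec_def L2_set_def sum_nonneg)
qed

lemma L_loc_2_real:
  fixes h :: "'a::euclidean_space \<Rightarrow> real"
  shows "L_loc 2 S h \<longleftrightarrow> (\<forall>K. compact K \<and> K \<subseteq> S \<longrightarrow> l2_on K h)"
  unfolding L_loc_def l2_on_def by simp

text \<open>The margin \<open>r\<close> around \<open>K\<close> inside \<open>S\<close> is the room
  needed to mollify near \<open>K\<close> without leaving \<open>S\<close>.\<close>

lemma compact_neighborhood:
  fixes K :: "'a::euclidean_space set"
  assumes "compact K" "open S" "K \<subseteq> S"
  obtains r K' where "r > 0" "compact K'" "K' \<subseteq> S" "K \<subseteq> K'" "\<And>x y. x \<in> K \<Longrightarrow> dist x y \<le> r \<Longrightarrow> y \<in> K'"
proof -
  obtain r where r: "r > 0" "(\<Union>x\<in>K. cball x r) \<subseteq> S"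
    using compact_subset_open_imp_cball_epsilon_subset[OF assms] by blast
  have "compact {x + y |x y. x \<in> K \<and> y \<in> cball 0 r}"
    by (rule compact_sums) (use assms in auto)
  also have "{x + y |x y. x \<in> K \<and> y \<in> cball 0 r} = (\<Union>x\<in>K. cball x r)"
  proof (intro equalityI subsetI)
    fix z assume "z \<in> (\<Union>x\<in>K. cball x r)"
    then obtain x where "x \<in> K" "dist x z \<le> r" by auto
    then have "z = x + (z - x)" "z - x \<in> cball 0 r" by (auto simp: dist_norm norm_minus_commute)
    then show "z \<in> {x + y |x y. x \<in> K \<and> y \<in> cball 0 r}" using \<open>x \<in> K\<close> by blast
  next
    fix z assume "z \<in> {x + y |x y. x \<in> K \<and> y \<in> cball 0 r}"
    then obtain x y where "z = x + y" "x \<in> K" "norm y \<le> r" by auto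
    then show "z \<in> (\<Union>x\<in>K. cball x r)" by (intro UN_I[of x]) (auto simp: dist_norm)
  qed
  finally show ?thesis using r that[of r "\<Union>x\<in>K. cball x r"] by force
qed

section \<open>Integration by parts and mollified weak gradients\<close>

lemma has_derivative_partials:
  fixes f :: "real^'n \<Rightarrow> real"
  assumes "f differentiable (at x)"
  shows "frechet_derivative f (at x) v = partials f x \<bullet> v"
proof -
  interpret bounded_linear "frechet_derivative f (at x)"
    using assms frechet_derivative_works has_derivative_bounded_linear by blast
  have "frechet_derivative f (at x) v = frechet_derivative f (at x) (\<Sum>k\<in>UNIV. v $ k *\<^sub>R axis k 1)"
    using basis_expansion[of v] by (simp add: scalar_mult_eq_scaleR)
  also have "\<dots> = (\<Sum>k\<in>UNIV. v $ k * partials f x $ k)" by (simp add: sum scale partials_def)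
  finally show ?thesis by (simp add: inner_vec_def mult.commute)
qed

lemma partials_eqI:
  fixes f :: "real^'n \<Rightarrow> real"
  assumes "(f has_derivative f') (at x)"
  shows "partials f x $ k = f' (axis k 1)"
  using frechet_derivative_at[OF assms] by (simp add: partials_def)

lemma continuous_on_zero_extension:
  fixes f :: "'a::topological_space \<Rightarrow> 'b::real_normed_vector"
  assumes "open S" "closed K" "K \<subseteq> S" "continuous_on S f" "\<And>x. x \<notin> K \<Longrightarrow> f x = 0"
  shows "continuous_on UNIV f"
proof -
  have "continuous_on (S \<union> - K) f"
  proof (rule continuous_on_open_Un)
    show "continuous_on (- K) f"
      by (rule continuous_on_eq[of _ "\<lambda>_. 0"]) (use assms in auto)
  qed (use assms in auto)
  moreover have "S \<union> - K = UNIV" using assms by blast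
  ultimately show ?thesis by simp
qed

lemma integrable_continuous_compact_support:
  fixes f :: "'a::euclidean_space \<Rightarrow> real"
  assumes "compact K" "continuous_on K f" "\<And>x. x \<notin> K \<Longrightarrow> f x = 0"
  shows "integrable lborel f" "integrable lebesgue f"
proof -
  have eq: "(\<lambda>x. indicator K x *\<^sub>R f x) = f" using assms(3) by (force simp: indicator_def fun_eq_iff)
  show 1: "integrable lborel f" using borel_integrable_compact[OF assms(1,2)] unfolding eq .
  then show "integrable lebesgue f" by (subst integrable_completion) auto
qed

text \<open>Translation invariance makes the integral of every difference quotient of
  \<open>h\<close> in direction \<open>v\<close> vanish. A global Lipschitz bound dominates the
  quotients, so the integral of their limit, the derivative, vanishes too.\<close>

lemma integral_deriv_compact_support:
  fixes h :: "'a::euclidean_space \<Rightarrow> real"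
  assumes h: "\<And>x. (h has_derivative h' x) (at x)" and c: "continuous_on UNIV (\<lambda>x. h' x v)"
    and K: "compact K" "\<And>x. x \<notin> K \<Longrightarrow> h x = 0" "\<And>x. x \<notin> K \<Longrightarrow> h' x v = 0"
  shows "(\<integral>x. h' x v \<partial>lebesgue) = 0"
proof -
  have hc: "continuous_on UNIV h" using h by (auto intro!: continuous_at_imp_continuous_on has_derivative_continuous)
  have hm: "h \<in> borel_measurable borel" using hc by (rule borel_measurable_continuous_onI)
  have h'm: "(\<lambda>x. h' x v) \<in> borel_measurable borel" using c by (rule borel_measurable_continuous_onI)
  have hi: "integrable lborel h"
    by (rule integrable_continuous_compact_support(1)[OF K(1) _ K(2)]) (use hc continuous_on_subset in auto)
  obtain C where C: "C > 0" "\<And>x. x \<in> K \<Longrightarrow> \<bar>h' x v\<bar> \<le> C"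
    using continuous_compact_bounded[OF K(1) continuous_on_subset[OF c]] by blast
  have Cb: "\<bar>h' x v\<bar> \<le> C" for x using C K(3)[of x] by (cases "x \<in> K") auto
  have lip: "\<bar>h (x + t *\<^sub>R v) - h x\<bar> \<le> C * \<bar>t\<bar>" for x and t :: real
  proof -
    have d: "((\<lambda>s. h (x + s *\<^sub>R v)) has_derivative (\<lambda>s. h' (x + a *\<^sub>R v) (s *\<^sub>R v))) (at a)" for a
      by (rule has_derivative_compose[of "\<lambda>s. x + s *\<^sub>R v"]) (auto intro!: derivative_eq_intros h)
    have "norm (h (x + t *\<^sub>R v) - h (x + 0 *\<^sub>R v)) \<le> C * norm (t - 0)"
    proof (rule differentiable_bound[of UNIV "\<lambda>s. h (x + s *\<^sub>R v)" "\<lambda>a s. h' (x + a *\<^sub>R v) (s *\<^sub>R v)" C t 0])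
      show "onorm (\<lambda>s. h' (x + a *\<^sub>R v) (s *\<^sub>R v)) \<le> C" for a
      proof (rule onorm_le)
        fix s
        have "h' (x + a *\<^sub>R v) (s *\<^sub>R v) = s * h' (x + a *\<^sub>R v) v"
          using linear_simps(5)[OF has_derivative_bounded_linear[OF h]] by simp
        then show "norm (h' (x + a *\<^sub>R v) (s *\<^sub>R v)) \<le> C * norm s"
          using mult_left_mono[OF Cb[of "x + a *\<^sub>R v"], of "\<bar>s\<bar>"] by (simp add: abs_mult mult.commute[of C])
      qed
    qed (use d in auto)
    then show ?thesis by simp
  qed
  define t where "t n = 1 / real (Suc n)" for n
  have t: "t n > 0" "t n \<le> 1" for n by (auto simp: t_def)
  have t0: "t \<longlonglongrightarrow> 0" unfolding t_def using LIMSEQ_inverse_real_of_nat by (simp add: inverse_eq_divide)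
  obtain R where R: "K \<subseteq> cball 0 R" using bounded_subset_ballD[OF compact_imp_bounded[OF K(1)], of 0] ball_subset_cball by blast
  \<comment> \<open>The steps \<open>t n\<close> are at most 1, so this ball contains the support of
    every difference quotient.\<close>
  let ?B = "cball (0::'a) (R + norm v)"
  have dom: "integrable lborel (\<lambda>x. C * indicat_real ?B x)"
    using emeasure_lborel_cball_finite[of "0::'a" "R + norm v"]
    by (intro integrable_mult_right) (simp add: integrable_indicator_iff)
  have "(\<lambda>n. \<integral>x. (h (x + t n *\<^sub>R v) - h x) / t n \<partial>lborel) \<longlonglongrightarrow> (\<integral>x. h' x v \<partial>lborel)"
  proof (rule integral_dominated_convergence[OF _ _ dom])
    show "(\<lambda>x. (h (x + t n *\<^sub>R v) - h x) / t n) \<in> borel_measurable lborel" for n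
      using hm by measurable
    show "(\<lambda>x. h' x v) \<in> borel_measurable lborel" using h'm by simp
    show "AE x in lborel. (\<lambda>n. (h (x + t n *\<^sub>R v) - h x) / t n) \<longlonglongrightarrow> h' x v"
    proof (rule AE_I2)
      fix x
      have "((\<lambda>s. h (x + s *\<^sub>R v)) has_derivative (\<lambda>s. h' (x + 0 *\<^sub>R v) (s *\<^sub>R v))) (at 0)"
        by (rule has_derivative_compose[of "\<lambda>s. x + s *\<^sub>R v"]) (auto intro!: derivative_eq_intros h)
      moreover have "h' x (s *\<^sub>R v) = s * h' x v" for s
        using linear_simps(5)[OF has_derivative_bounded_linear[OF h]] by simp
      ultimately have "((\<lambda>s. h (x + s *\<^sub>R v)) has_real_derivative h' x v) (at 0)"
        by (simp add: has_field_derivative_def mult.commute[of _ "h' x v"])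
      then have "((\<lambda>s. (h (x + s *\<^sub>R v) - h x) / s) \<longlongrightarrow> h' x v) (at 0)" by (simp add: DERIV_def)
      moreover have "filterlim t (at 0) sequentially"
        unfolding filterlim_at using t0 t(1) by (auto simp: less_imp_neq[symmetric] intro!: always_eventually)
      ultimately show "(\<lambda>n. (h (x + t n *\<^sub>R v) - h x) / t n) \<longlonglongrightarrow> h' x v"
        by (rule filterlim_compose)
    qed
    show "AE x in lborel. norm ((h (x + t n *\<^sub>R v) - h x) / t n) \<le> C * indicat_real ?B x" for n
    proof (rule AE_I2)
      fix x
      show "norm ((h (x + t n *\<^sub>R v) - h x) / t n) \<le> C * indicat_real ?B x"
      proof (cases "x \<in> ?B")
        case True
        then show ?thesis using lip[of x "t n"] t[of n] by (simp add: divide_simps mult.commute)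
      next
        case False
        have "norm (t n *\<^sub>R v) \<le> norm v" using t[of n] by (simp add: mult_left_le_one_le)
        moreover have "norm x > R + norm v" using False by simp
        ultimately have "norm (x + t n *\<^sub>R v) > R" "norm x > R"
          using norm_diff_ineq[of x "t n *\<^sub>R v"] norm_ge_zero[of v] by linarith+
        then have "h (x + t n *\<^sub>R v) = 0" "h x = 0" using R K(2) by (force simp: subset_iff)+
        then show ?thesis using C(1) by simp
      qed
    qed
  qed
  moreover have "(\<integral>x. (h (x + t n *\<^sub>R v) - h x) / t n \<partial>lborel) = 0" for n
  proof -
    have "integrable lborel (\<lambda>x. h (x + t n *\<^sub>R v))" "(\<integral>x. h (x + t n *\<^sub>R v) \<partial>lborel) = (\<integral>x. h x \<partial>lborel)"
      using lebesgue_translate[OF hi, of "- (t n *\<^sub>R v)"] by auto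
    then show ?thesis using hi by simp
  qed
  ultimately have "(\<lambda>n. 0) \<longlonglongrightarrow> (\<integral>x. h' x v \<partial>lborel)" by (simp only:)
  then have "(\<integral>x. h' x v \<partial>lborel) = 0" by (simp add: LIMSEQ_const_iff)
  then show ?thesis using h'm by (simp add: integral_completion)
qed

lemma C1_integration_by_parts:
  fixes g :: "'a::euclidean_space \<Rightarrow> real"
  assumes S: "open S" and g: "\<And>x. x \<in> S \<Longrightarrow> (g has_derivative g' x) (at x)"
    and c: "continuous_on S (\<lambda>x. g' x v)" and \<psi>: "test_function S \<psi>"
  shows "(\<integral>x. g x * frechet_derivative \<psi> (at x) v \<partial>lebesgue) = - (\<integral>x. g' x v * \<psi> x \<partial>lebesgue)"
proof -
  let ?K = "closure {y. \<psi> y \<noteq> 0}"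
  have K: "compact ?K" "?K \<subseteq> S" using test_functionD[OF \<psi>] by auto
  have \<psi>0: "\<psi> x = 0" if "x \<notin> ?K" for x using that closure_subset[of "{y. \<psi> y \<noteq> 0}"] by blast
  have D0: "frechet_derivative \<psi> (at x) w = 0" if "x \<notin> ?K" for x w using deriv_eq_0_outside_support[OF that] .
  have d\<psi>: "(\<psi> has_derivative frechet_derivative \<psi> (at x)) (at x)" for x
    using smooth_on_differentiable[OF test_functionD(1)[OF \<psi>]] frechet_derivative_works by blast
  \<comment> \<open>Nothing is known about \<open>g\<close> and \<open>g'\<close> outside
    \<open>S\<close>; since \<open>\<psi>\<close> vanishes near every point off \<open>?K\<close>,
    the product extends by zero to a function that is differentiable everywhere.\<close>
  define h' where "h' x w = (if x \<in> ?K then g x * frechet_derivative \<psi> (at x) w + g' x w * \<psi> x else 0)" for x w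
  have der: "((\<lambda>x. g x * \<psi> x) has_derivative h' x) (at x)" for x
  proof (cases "x \<in> ?K")
    case True
    then show ?thesis unfolding h'_def using has_derivative_mult[OF g d\<psi>, of x] K by auto
  next
    case False
    have "((\<lambda>x. g x * \<psi> x) has_derivative (\<lambda>_. 0)) (at x)"
    proof (rule frechet_derivative_eq_0_locally(1))
      show "open (- ?K)" "x \<in> - ?K" using False by auto
      show "g y * \<psi> y = 0" if "y \<in> - ?K" for y using \<psi>0[of y] that by simp
    qed
    moreover have "h' x = (\<lambda>_. 0)" using False by (simp add: h'_def fun_eq_iff)
    ultimately show ?thesis by simp
  qed
  have h'v: "h' x v = g x * frechet_derivative \<psi> (at x) v + g' x v * \<psi> x" for x
    using D0[of x v] \<psi>0[of x] by (auto simp: h'_def)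
  have gc: "continuous_on S g"
    using g by (auto intro!: continuous_at_imp_continuous_on has_derivative_continuous)
  have c1: "continuous_on S (\<lambda>x. g x * frechet_derivative \<psi> (at x) v)"
    by (intro continuous_intros gc smooth_on_continuous[OF smooth_on_deriv[OF test_functionD(1)[OF \<psi>]]])
  have c2: "continuous_on S (\<lambda>x. g' x v * \<psi> x)"
    by (intro continuous_intros c smooth_on_continuous[OF test_functionD(1)[OF \<psi>]])
  have i1: "integrable lebesgue (\<lambda>x. g x * frechet_derivative \<psi> (at x) v)"
    by (rule integrable_continuous_compact_support(2)[OF K(1)])
       (rule continuous_on_subset[OF c1 K(2)], drule D0[where w = v], simp)
  have i2: "integrable lebesgue (\<lambda>x. g' x v * \<psi> x)"
    by (rule integrable_continuous_compact_support(2)[OF K(1)])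
       (rule continuous_on_subset[OF c2 K(2)], drule \<psi>0, simp)
  have "continuous_on UNIV (\<lambda>x. h' x v)"
    unfolding h'v
  proof (rule continuous_on_zero_extension[OF S closed_closure K(2)])
    show "continuous_on S (\<lambda>x. g x * frechet_derivative \<psi> (at x) v + g' x v * \<psi> x)"
      by (rule continuous_on_add[OF c1 c2])
    show "g x * frechet_derivative \<psi> (at x) v + g' x v * \<psi> x = 0" if "x \<notin> ?K" for x
      using D0[OF that] \<psi>0[OF that] by simp
  qed
  then have "(\<integral>x. h' x v \<partial>lebesgue) = 0"
    by (rule integral_deriv_compact_support[OF der _ K(1)]) (drule \<psi>0, simp, simp add: h'_def)
  then show ?thesis unfolding h'v using i1 i2 by simp
qed

lemma moll_shift_has_derivative:
  "((\<lambda>z. moll e (y - z)) has_derivative (\<lambda>v. - frechet_derivative (moll e) (at (y - z)) v)) (at z)"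
proof -
  interpret bounded_linear "frechet_derivative (moll e) (at (y - z))"
    using smooth_on_differentiable[OF smooth_on_moll] frechet_derivative_works has_derivative_bounded_linear by blast
  have fd: "(moll e has_derivative frechet_derivative (moll e) (at (y - z))) (at (y - z))"
    using smooth_on_differentiable[OF smooth_on_moll] frechet_derivative_works by blast
  have "((\<lambda>z. y - z) has_derivative (\<lambda>v. - v)) (at z)" by (auto intro!: derivative_eq_intros)
  from has_derivative_compose[OF this fd] show ?thesis by (simp add: linear_simps(4)[OF bounded_linear_axioms])
qed

lemma Ck_on_reflect:
  fixes f :: "'a::euclidean_space \<Rightarrow> real"
  shows "Ck_on k UNIV f \<Longrightarrow> Ck_on k UNIV (\<lambda>z. f (y - z))"
proof (induction k arbitrary: f)
  case 0
  have "continuous_on UNIV (\<lambda>z. y - z)" by (intro continuous_intros)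
  with 0 show ?case using continuous_on_compose2[of UNIV f UNIV "\<lambda>z. y - z"] by simp
next
  case (Suc k)
  have d: "((\<lambda>z. f (y - z)) has_derivative (\<lambda>v. - 1 * frechet_derivative f (at (y - z)) v)) (at z)" for z
  proof -
    have fd: "(f has_derivative frechet_derivative f (at (y - z))) (at (y - z))"
      using Suc.prems frechet_derivative_works by auto
    then interpret bounded_linear "frechet_derivative f (at (y - z))" by (rule has_derivative_bounded_linear)
    have "((\<lambda>z. y - z) has_derivative (\<lambda>v. - v)) (at z)" by (auto intro!: derivative_eq_intros)
    from has_derivative_compose[OF this fd] show ?thesis by (simp add: linear_simps(4)[OF bounded_linear_axioms])
  qed
  have "frechet_derivative (\<lambda>z. f (y - z)) (at z) v = - 1 * frechet_derivative f (at (y - z)) v" for z v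
    using frechet_derivative_at[OF d] by metis
  moreover have "Ck_on k UNIV (\<lambda>z. - 1 * frechet_derivative f (at (y - z)) v)" for v
    using Suc by (intro Ck_on_mult Ck_on_const Suc.IH[of "\<lambda>x. frechet_derivative f (at x) v"]) auto
  moreover have "(\<lambda>z. f (y - z)) differentiable (at z)" for z unfolding differentiable_def using d by blast
  ultimately show ?case by simp
qed

lemma test_function_moll_shift:
  assumes e: "e > 0" and S: "cball y e \<subseteq> S"
  shows "test_function S (\<lambda>z. moll e (y - z :: 'a::euclidean_space))"
proof -
  have "norm (y - z) \<le> e" if "moll e (y - z) \<noteq> 0" for z :: 'a
    using moll_eq_0[OF e, of "y - z"] that by linarith
  then have *: "closure {z. moll e (y - z) \<noteq> 0} \<subseteq> cball y e"
    by (intro closure_minimal) (auto simp: dist_norm)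
  then have "compact (closure {z. moll e (y - z) \<noteq> 0})"
    by (meson bounded_cball bounded_subset closed_closure compact_eq_bounded_closed)
  moreover have "smooth_on UNIV (\<lambda>z. moll e (y - z))"
    using smooth_on_moll unfolding smooth_on_def by (blast intro: Ck_on_reflect)
  ultimately show ?thesis using * S unfolding test_function_def by blast
qed

text \<open>The derivative falls on the mollifier, and \<open>\<lambda>z. moll e (y - z)\<close> is
  itself an admissible test function as long as the closed ball of radius \<open>e\<close> about
  \<open>y\<close> stays in \<open>S\<close>. The indicators are harmless because the mollifier
  vanishes off this ball, which lies in \<open>K'\<close>.\<close>

lemma conv_moll_partials:
  fixes h :: "real^'n \<Rightarrow> real"
  assumes w: "weak_gradient_on S h w" and e: "e > 0" and c: "cball y e \<subseteq> K'" "K' \<subseteq> S"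
    and i: "integrable lebesgue (\<lambda>z. indicat_real K' z * h z)"
  shows "partials (conv (\<lambda>z. indicat_real K' z * h z) (moll e)) y $ k
    = conv (\<lambda>z. indicat_real K' z * w z $ k) (moll e) y"
proof -
  let ?D = "\<lambda>x. frechet_derivative (moll e) (at x)"
  have out: "moll e (y - z) = 0" "?D (y - z) v = 0" if "z \<notin> cball y e" for z v
  proof -
    have n: "norm (y - z) > e" using that by (simp add: dist_norm)
    then show "moll e (y - z) = 0" using moll_eq_0[OF e, of "y - z"] by simp
    show "?D (y - z) v = 0"
    proof (rule frechet_derivative_eq_0_locally(2))
      show "open (- cball (0::real^'n) e)" "y - z \<in> - cball 0 e" using n by auto
      show "moll e x = 0" if "x \<in> - cball (0::real^'n) e" for x
        using moll_eq_0[OF e, of x] that by (auto simp: not_le)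
    qed
  qed
  have p: "partials (\<lambda>z. moll e (y - z)) z $ k = - ?D (y - z) (axis k 1)" for z
    by (rule partials_eqI[OF moll_shift_has_derivative])
  have t: "test_function S (\<lambda>z. moll e (y - z))"
    using c by (intro test_function_moll_shift[OF e]) auto
  have "partials (conv (\<lambda>z. indicat_real K' z * h z) (moll e)) y $ k
     = (\<integral>z. (indicat_real K' z * h z) * ?D (y - z) (axis k 1) \<partial>lebesgue)"
    unfolding partials_def by (simp add: frechet_derivative_conv[OF i test_function_moll[OF e]] conv_def)
  also have "\<dots> = (\<integral>z. - (h z * partials (\<lambda>z. moll e (y - z)) z $ k) \<partial>lebesgue)"
  proof (rule Bochner_Integration.integral_cong[OF refl])
    fix z
    show "(indicat_real K' z * h z) * ?D (y - z) (axis k 1) = - (h z * partials (\<lambda>z. moll e (y - z)) z $ k)"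
      unfolding p using out(2)[of z "axis k 1"] c by (cases "z \<in> cball y e") (auto simp: indicator_def)
  qed
  also have "\<dots> = - (\<integral>z. h z * partials (\<lambda>z. moll e (y - z)) z $ k \<partial>lebesgue)" by simp
  also have "\<dots> = (\<integral>z. w z $ k * moll e (y - z) \<partial>lebesgue)"
    using w t unfolding weak_gradient_on_def by simp
  also have "\<dots> = conv (\<lambda>z. indicat_real K' z * w z $ k) (moll e) y"
    unfolding conv_def
  proof (rule Bochner_Integration.integral_cong[OF refl])
    fix z
    show "w z $ k * moll e (y - z) = (indicat_real K' z * w z $ k) * moll e (y - z)"
      using out(1)[of z] c by (cases "z \<in> cball y e") (auto simp: indicator_def)
  qed
  finally show ?thesis .
qed

lemma l2_on_indicator:
  fixes f :: "'a::euclidean_space \<Rightarrow> real"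
  assumes "l2_on K f"
  shows "(\<lambda>z. indicat_real K z * f z) \<in> borel_measurable lebesgue"
    "integrable lebesgue (\<lambda>z. (indicat_real K z * f z)\<^sup>2)"
proof -
  show "(\<lambda>z. indicat_real K z * f z) \<in> borel_measurable lebesgue"
    using assms by (simp add: l2_on_def set_borel_measurable_def)
  have "(\<lambda>z. (indicat_real K z * f z)\<^sup>2) = (\<lambda>z. indicat_real K z *\<^sub>R (f z)\<^sup>2)"
    by (auto simp: indicator_def fun_eq_iff)
  then show "integrable lebesgue (\<lambda>z. (indicat_real K z * f z)\<^sup>2)"
    using assms by (simp add: l2_on_def set_integrable_def)
qed

lemma filterlim_at_right_0_div_Suc:
  assumes "r > (0::real)"
  shows "filterlim (\<lambda>n. r / real (n + 2)) (at_right 0) sequentially"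
proof -
  have "(\<lambda>n. r * inverse (real (Suc (Suc n)))) \<longlonglongrightarrow> r * 0"
    by (intro tendsto_intros LIMSEQ_Suc[OF LIMSEQ_inverse_real_of_nat])
  then have "(\<lambda>n. r / real (n + 2)) \<longlonglongrightarrow> 0" by (simp add: divide_inverse)
  then show ?thesis unfolding filterlim_at using assms by (auto intro!: always_eventually)
qed

text \<open>Mollification with radius tending to zero; all later calculus rules for weak gradients
  are obtained by passing to the limit along such a sequence.\<close>

lemma weak_gradient_approx:
  fixes h :: "real^'n \<Rightarrow> real"
  assumes S: "open S" and h: "continuous_on S h" and w: "weak_gradient_on S h w" and wl: "L_loc 2 S w"
    and K: "compact K" "K \<subseteq> S"
  obtains F where "\<And>n. smooth_on UNIV (F n)" "uniform_limit K F h sequentially"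
    "\<And>k. (\<lambda>n. LINT y:K|lebesgue. (partials (F n) y $ k - w y $ k)\<^sup>2) \<longlonglongrightarrow> 0"
    "\<And>k n. set_integrable lebesgue K (\<lambda>y. (partials (F n) y $ k - w y $ k)\<^sup>2)"
    "\<And>L. (\<And>y. y \<in> S \<Longrightarrow> y \<notin> L \<Longrightarrow> h y = 0) \<Longrightarrow> compact L \<Longrightarrow> L \<subseteq> interior K \<Longrightarrow>
       eventually (\<lambda>n. test_function S (F n) \<and> (\<forall>y. y \<notin> K \<longrightarrow> F n y = 0)) sequentially"
proof -
  obtain r K' where r: "r > 0" and K': "compact K'" "K' \<subseteq> S" "K \<subseteq> K'"
    and near: "\<And>x y. x \<in> K \<Longrightarrow> dist x y \<le> r \<Longrightarrow> y \<in> K'"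
    using compact_neighborhood[OF K(1) S K(2)] by blast
  define H where "H z = indicat_real K' z * h z" for z
  define W where "W k z = indicat_real K' z * w z $ k" for k z
  obtain R where R: "K' \<subseteq> cball 0 R"
    using bounded_subset_ballD[OF compact_imp_bounded[OF K'(1)], of 0] ball_subset_cball by blast
  have hK': "continuous_on K' h" using h K'(2) continuous_on_subset by blast
  have Hi: "integrable lebesgue H"
    using set_integrable_continuous_compact[OF K'(1) hK'] by (simp add: H_def[abs_def] set_integrable_def)
  have Wm: "W k \<in> borel_measurable lebesgue" "integrable lebesgue (\<lambda>z. (W k z)\<^sup>2)" for k
    using l2_on_indicator[OF L_loc_2_component[OF wl K'(1,2)]] by (auto simp: W_def[abs_def])
  have Wz: "z \<notin> cball 0 R \<Longrightarrow> W k z = 0" for k z using R by (auto simp: W_def indicator_def)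
  \<comment> \<open>The \<open>+ 2\<close> keeps every radius strictly below \<open>r\<close>, so
    that mollifying at points of \<open>K\<close> only sees \<open>K'\<close>.\<close>
  define e where "e n = r / real (n + 2)" for n :: nat
  have e: "e n > 0" "e n < r" for n using r by (auto simp: e_def divide_simps)
  have e0: "filterlim e (at_right 0) sequentially" unfolding e_def by (rule filterlim_at_right_0_div_Suc[OF r])
  define F where "F n = conv H (moll (e n))" for n
  have sm: "smooth_on UNIV (F n)" for n
    unfolding F_def by (rule smooth_on_conv[OF Hi test_function_moll[OF e(1)]])
  have part: "partials (F n) y $ k = conv (W k) (moll (e n)) y" if "y \<in> K" for n y k
    unfolding F_def H_def[abs_def] W_def[abs_def]
    by (rule conv_moll_partials[OF w e(1) _ K'(2)])
       (use near[OF that] e(2)[of n] Hi in \<open>auto simp: H_def[abs_def] intro: less_imp_le order_trans\<close>)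
  have l2W: "\<exists>e0>0. \<forall>s. 0 < s \<and> s < e0 \<longrightarrow> integrable lebesgue (\<lambda>y. (conv (W k) (moll s) y - W k y)\<^sup>2) \<and>
       (\<integral>y. (conv (W k) (moll s) y - W k y)\<^sup>2 \<partial>lebesgue) < d" if "d > 0" for k d
    by (rule conv_moll_L2[OF Wm Wz that]) (assumption, blast)
  have Wi: "integrable lebesgue (W k)" for k by (rule L2_compact_support_integrable[OF Wm Wz])
  have l2K: "l2_on K (\<lambda>y. partials (F n) y $ k - w y $ k)" for n k
  proof (rule l2_on_diff)
    show "l2_on K (\<lambda>y. w y $ k)" by (rule L_loc_2_component[OF wl K])
    have "continuous_on K (\<lambda>y. frechet_derivative (F n) (at y) (axis k 1))"
      by (rule smooth_on_continuous[OF smooth_on_deriv[OF sm]])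
    then show "l2_on K (\<lambda>y. partials (F n) y $ k)" by (intro l2_on_continuous K) (simp add: partials_def)
  qed
  have lim: "(\<lambda>n. LINT y:K|lebesgue. (partials (F n) y $ k - w y $ k)\<^sup>2) \<longlonglongrightarrow> 0" for k
  proof (rule tendstoI)
    fix d :: real assume d: "d > 0"
    obtain e0' where e0': "e0' > 0" "\<And>s. 0 < s \<Longrightarrow> s < e0' \<Longrightarrow> integrable lebesgue (\<lambda>y. (conv (W k) (moll s) y - W k y)\<^sup>2) \<and>
       (\<integral>y. (conv (W k) (moll s) y - W k y)\<^sup>2 \<partial>lebesgue) < d" using l2W[OF d, of k] by blast
    have "eventually (\<lambda>n. e n < e0') sequentially"
      using e0 e0'(1) by (auto simp: filterlim_at dest: order_tendstoD(2))
    then show "eventually (\<lambda>n. dist (LINT y:K|lebesgue. (partials (F n) y $ k - w y $ k)\<^sup>2) 0 < d) sequentially"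
    proof eventually_elim
      case (elim n)
      note ii = e0'(2)[OF e(1) elim]
      have eq: "(\<lambda>y. indicator K y *\<^sub>R (partials (F n) y $ k - w y $ k)\<^sup>2)
         = (\<lambda>y. indicat_real K y * (conv (W k) (moll (e n)) y - W k y)\<^sup>2)"
        using K'(3) by (auto simp: fun_eq_iff indicator_def part W_def)
      have "(LINT y:K|lebesgue. (partials (F n) y $ k - w y $ k)\<^sup>2) \<le> (\<integral>y. (conv (W k) (moll (e n)) y - W k y)\<^sup>2 \<partial>lebesgue)"
        unfolding set_lebesgue_integral_def
      proof (rule Bochner_Integration.integral_mono)
        show "integrable lebesgue (\<lambda>y. indicator K y *\<^sub>R (partials (F n) y $ k - w y $ k)\<^sup>2)"
          using l2K[of n k] by (simp add: l2_on_def set_integrable_def)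
        show "indicator K y *\<^sub>R (partials (F n) y $ k - w y $ k)\<^sup>2 \<le> (conv (W k) (moll (e n)) y - W k y)\<^sup>2" for y
          using fun_cong[OF eq, of y] by (simp add: indicator_def)
      qed (use ii in auto)
      moreover have "(LINT y:K|lebesgue. (partials (F n) y $ k - w y $ k)\<^sup>2) \<ge> 0"
        unfolding set_lebesgue_integral_def by (rule Bochner_Integration.integral_nonneg) auto
      ultimately show ?case using ii by (simp add: dist_norm)
    qed
  qed
  have uni: "uniform_limit K F h sequentially"
  proof (rule uniform_limitI)
    fix d :: real assume d: "d > 0"
    have "uniformly_continuous_on K' h" using hK' K'(1) by (rule compact_uniformly_continuous)
    then obtain s where s: "s > 0" "\<And>x x'. x \<in> K' \<Longrightarrow> x' \<in> K' \<Longrightarrow> dist x' x < s \<Longrightarrow> dist (h x') (h x) < d/2"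
      unfolding uniformly_continuous_on_def using d by (metis half_gt_zero)
    have "eventually (\<lambda>n. e n < s) sequentially"
      using e0 s(1) by (auto simp: filterlim_at dest: order_tendstoD(2))
    then show "\<forall>\<^sub>F n in sequentially. \<forall>x\<in>K. dist (F n x) (h x) < d"
    proof eventually_elim
      case (elim n)
      show ?case
      proof
        fix x assume x: "x \<in> K"
        have "\<bar>H z - h x\<bar> \<le> d/2" if "norm (z - x) < e n" for z
        proof -
          have "z \<in> K'" using near[OF x, of z] that e(2)[of n] by (simp add: dist_norm norm_minus_commute)
          moreover have "x \<in> K'" using x K' by blast
          moreover have "dist z x < s" using that elim by (simp add: dist_norm)
          ultimately show ?thesis using s(2)[of x z] by (simp add: H_def dist_norm)
        qed
        then have "\<bar>conv H (moll (e n)) x - h x\<bar> \<le> d/2" using conv_moll_near[OF Hi e(1)] by blast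
        then show "dist (F n x) (h x) < d" using d by (simp add: F_def dist_norm)
      qed
    qed
  qed
  \<comment> \<open>Once the radius is below the margin of \<open>L\<close> inside
    \<open>interior K\<close>, the mollification vanishes off the compact set \<open>L'\<close>,
    which lies in \<open>K\<close>.\<close>
  have supp: "eventually (\<lambda>n. test_function S (F n) \<and> (\<forall>y. y \<notin> K \<longrightarrow> F n y = 0)) sequentially"
    if L: "\<And>y. y \<in> S \<Longrightarrow> y \<notin> L \<Longrightarrow> h y = 0" "compact L" "L \<subseteq> interior K" for L
  proof -
    obtain r' L' where r': "r' > 0" "compact L'" "L' \<subseteq> interior K" "L \<subseteq> L'"
      and near': "\<And>x y. x \<in> L \<Longrightarrow> dist x y \<le> r' \<Longrightarrow> y \<in> L'"
      using compact_neighborhood[OF L(2) open_interior L(3)] by blast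
    have "eventually (\<lambda>n. e n < r') sequentially"
      using e0 r'(1) by (auto simp: filterlim_at dest: order_tendstoD(2))
    then show ?thesis
    proof eventually_elim
      case (elim n)
      have z: "F n y = 0" if "y \<notin> L'" for y
      proof -
        have "\<bar>H z - 0\<bar> \<le> 0" if "norm (z - y) < e n" for z
        proof -
          have "z \<notin> L" using near'[of z y] that elim \<open>y \<notin> L'\<close> by (auto simp: dist_norm)
          then show ?thesis using L(1)[of z] K'(2) by (auto simp: H_def indicator_def)
        qed
        then have "\<bar>conv H (moll (e n)) y - 0\<bar> \<le> 0" using conv_moll_near[OF Hi e(1)] by blast
        then show ?thesis by (simp add: F_def)
      qed
      then have "{y. F n y \<noteq> 0} \<subseteq> L'" by blast
      then have "closure {y. F n y \<noteq> 0} \<subseteq> L'" using r'(2) by (simp add: closure_minimal compact_imp_closed)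
      moreover from this have "compact (closure {y. F n y \<noteq> 0})"
        using r'(2) by (meson bounded_subset closed_closure compact_eq_bounded_closed)
      moreover have "L' \<subseteq> K" using r'(3) interior_subset by blast
      ultimately show ?case using sm[of n] z K(2) unfolding test_function_def by blast
    qed
  qed
  show ?thesis
  proof (rule that[of F])
    show "set_integrable lebesgue K (\<lambda>y. (partials (F n) y $ k - w y $ k)\<^sup>2)" for k n
      using l2K[of n k] by (simp add: l2_on_def)
  qed (rule sm uni lim | erule (2) supp)+
qed

text \<open>Replace first \<open>b n\<close> by \<open>B\<close>, then \<open>a n\<close> by
  \<open>A\<close>. In the first step \<open>\<bar>c\<bar> \<le> s + c^2 / s\<close> plays the role
  of the Cauchy-Schwarz inequality; the second is dominated convergence with majorant
  \<open>C' * \<bar>B\<bar>\<close>.\<close>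

lemma tendsto_set_integral_bounded_mult:
  fixes a :: "nat \<Rightarrow> 'a::euclidean_space \<Rightarrow> real"
  assumes K: "compact K"
    and am: "\<And>n. set_borel_measurable lebesgue K (a n)" and aC: "eventually (\<lambda>n. \<forall>x\<in>K. \<bar>a n x\<bar> \<le> C) sequentially"
    and al: "\<And>x. x \<in> K \<Longrightarrow> (\<lambda>n. a n x) \<longlonglongrightarrow> A x"
    and bn: "\<And>n. l2_on K (b n)" and b: "l2_on K B"
    and lim: "(\<lambda>n. LINT y:K|lebesgue. (b n y - B y)\<^sup>2) \<longlonglongrightarrow> 0"
  shows "(\<lambda>n. LINT y:K|lebesgue. a n y * b n y) \<longlonglongrightarrow> (LINT y:K|lebesgue. A y * B y)"
proof -
  obtain n0 where n0: "\<And>n x. n \<ge> n0 \<Longrightarrow> x \<in> K \<Longrightarrow> \<bar>a n x\<bar> \<le> C"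
    using aC unfolding eventually_sequentially by blast
  define C' where "C' = \<bar>C\<bar> + 1"
  have C': "C' > 0" "\<And>n x. n \<ge> n0 \<Longrightarrow> x \<in> K \<Longrightarrow> \<bar>a n x\<bar> \<le> C'" using n0 by (force simp: C'_def)+
  let ?V = "measure lebesgue K"
  have Kone: "set_integrable lebesgue K (\<lambda>_. c)" for c :: real
    by (rule set_integrable_continuous_compact[OF K]) auto
  have Vc: "(LINT y:K|lebesgue. c) = c * ?V" for c :: real
    using K by (simp add: set_lebesgue_integral_def)
  have d: "set_integrable lebesgue K (\<lambda>y. (b n y - B y)\<^sup>2)" for n
    using l2_on_diff[OF bn b, of n] by (simp add: l2_on_def)
  have abn: "l2_on K (\<lambda>y. a n y * b n y)" if "n \<ge> n0" for n
    by (rule l2_on_bounded_mult[OF bn am C'(2)[OF that]])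
  have aB: "l2_on K (\<lambda>y. a n y * B y)" if "n \<ge> n0" for n
    by (rule l2_on_bounded_mult[OF b am C'(2)[OF that]])
  note abi = l2_on_set_integrable[OF K abn] and aBi = l2_on_set_integrable[OF K aB]
  have one: "(\<lambda>n. (LINT y:K|lebesgue. a n y * b n y) - (LINT y:K|lebesgue. a n y * B y)) \<longlonglongrightarrow> 0"
  proof (rule tendstoI)
    fix r :: real assume r: "r > 0"
    \<comment> \<open>Chosen so that the constant part of the bound is below \<open>r / 2\<close>;
      with \<open>s\<close> fixed, \<open>n\<close> is taken so large that the quadratic part is
      below \<open>r / 2\<close> as well.\<close>
    define s where "s = r / (2 * C' * (?V + 1))"
    have V0: "?V \<ge> 0" by simp
    then have V1: "?V + 1 > 0" by linarith
    have s: "s > 0" using r C'(1) V1 by (simp add: s_def)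
    have sV: "C' * (s * ?V) < r / 2"
    proof -
      have "C' * (s * ?V) < C' * (s * (?V + 1))" using C'(1) s by simp
      also have "\<dots> = r / 2" using C'(1) V1 by (simp add: s_def)
      finally show ?thesis .
    qed
    have "eventually (\<lambda>n. (LINT y:K|lebesgue. (b n y - B y)\<^sup>2) < s * r / (2 * C')) sequentially"
      using lim s r C'(1) by (intro order_tendstoD(2)[of _ 0]) auto
    then show "eventually (\<lambda>n. dist ((LINT y:K|lebesgue. a n y * b n y) - (LINT y:K|lebesgue. a n y * B y)) 0 < r) sequentially"
      using eventually_ge_at_top[of n0]
    proof eventually_elim
      case (elim n)
      have i: "set_integrable lebesgue K (\<lambda>y. a n y * b n y - a n y * B y)"
        using abi[OF elim(2)] aBi[OF elim(2)] by (rule set_integral_diff)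
      have E: "(LINT y:K|lebesgue. a n y * b n y) - (LINT y:K|lebesgue. a n y * B y) = (LINT y:K|lebesgue. a n y * b n y - a n y * B y)"
        using abi[OF elim(2)] aBi[OF elim(2)] by (simp add: set_integral_diff)
      have "\<bar>LINT y:K|lebesgue. a n y * b n y - a n y * B y\<bar> \<le> (LINT y:K|lebesgue. \<bar>a n y * b n y - a n y * B y\<bar>)"
        using set_integral_norm_bound[OF i] by simp
      also have "\<dots> \<le> (LINT y:K|lebesgue. C' * (s + (b n y - B y)\<^sup>2 / s))"
      proof (rule set_integral_mono)
        show "set_integrable lebesgue K (\<lambda>y. \<bar>a n y * b n y - a n y * B y\<bar>)" using i by (rule set_integrable_abs)
        show "set_integrable lebesgue K (\<lambda>y. C' * (s + (b n y - B y)\<^sup>2 / s))"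
          using d[of n] Kone[of s] by (intro set_integrable_mult_right set_integral_add) auto
        fix y assume y: "y \<in> K"
        have "\<bar>c\<bar> \<le> s + c\<^sup>2 / s" for c
        proof -
          have "0 \<le> (\<bar>c\<bar> - s)\<^sup>2" by simp
          then have "2 * s * \<bar>c\<bar> \<le> c\<^sup>2 + s\<^sup>2" by (simp add: power2_diff mult_ac)
          moreover have "0 \<le> c\<^sup>2 + s\<^sup>2" by simp
          ultimately have "s * \<bar>c\<bar> \<le> c\<^sup>2 + s\<^sup>2" by linarith
          then show ?thesis using s by (simp add: field_simps power2_eq_square)
        qed
        then have "\<bar>b n y - B y\<bar> \<le> s + (b n y - B y)\<^sup>2 / s" by blast
        then have "\<bar>a n y\<bar> * \<bar>b n y - B y\<bar> \<le> C' * (s + (b n y - B y)\<^sup>2 / s)"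
          using C'(2)[OF elim(2) y] C'(1) s by (intro mult_mono) auto
        then show "\<bar>a n y * b n y - a n y * B y\<bar> \<le> C' * (s + (b n y - B y)\<^sup>2 / s)"
          by (simp add: right_diff_distrib[symmetric] abs_mult)
      qed
      also have "\<dots> = C' * (s * ?V + (LINT y:K|lebesgue. (b n y - B y)\<^sup>2) / s)"
        using d[of n] Kone[of s] by (simp add: set_integral_add Vc)
      also have "\<dots> = C' * (s * ?V) + C' / s * (LINT y:K|lebesgue. (b n y - B y)\<^sup>2)" by (simp add: distrib_left)
      also have "\<dots> < r / 2 + C' / s * (s * r / (2 * C'))"
        using sV elim(1) C'(1) s by (intro add_strict_mono mult_strict_left_mono) auto
      also have "\<dots> = r" using C'(1) s by simp
      finally show ?case unfolding E by (simp add: dist_norm)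
    qed
  qed
  have two: "(\<lambda>n. LINT y:K|lebesgue. a n y * B y) \<longlonglongrightarrow> (LINT y:K|lebesgue. A y * B y)"
  proof -
    have Bi: "set_integrable lebesgue K (\<lambda>y. C' * \<bar>B y\<bar>)"
      using l2_on_set_integrable[OF K b] by (intro set_integrable_mult_right set_integrable_abs)
    have meas: "set_borel_measurable lebesgue K A"
      unfolding set_borel_measurable_def
      by (rule borel_measurable_LIMSEQ_real[of _ "\<lambda>n x. indicator K x *\<^sub>R a n x"])
         (use am al in \<open>auto simp: set_borel_measurable_def indicator_def\<close>)
    have "(\<lambda>n. \<integral>y. indicator K y *\<^sub>R (a (n + n0) y * B y) \<partial>lebesgue) \<longlonglongrightarrow> (\<integral>y. indicator K y *\<^sub>R (A y * B y) \<partial>lebesgue)"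
    proof (rule integral_dominated_convergence[OF _ _ Bi[unfolded set_integrable_def]])
      show "(\<lambda>y. indicator K y *\<^sub>R (A y * B y)) \<in> borel_measurable lebesgue"
        using set_borel_measurable_mult[OF meas] b by (simp add: l2_on_def set_borel_measurable_def)
      show "(\<lambda>y. indicator K y *\<^sub>R (a (n + n0) y * B y)) \<in> borel_measurable lebesgue" for n
        using set_borel_measurable_mult[OF am] b by (simp add: l2_on_def set_borel_measurable_def)
      show "AE y in lebesgue. (\<lambda>n. indicator K y *\<^sub>R (a (n + n0) y * B y)) \<longlonglongrightarrow> indicator K y *\<^sub>R (A y * B y)"
        using al by (intro AE_I2) (auto simp: indicator_def intro!: tendsto_intros LIMSEQ_ignore_initial_segment)
      show "AE y in lebesgue. norm (indicator K y *\<^sub>R (a (n + n0) y * B y)) \<le> indicator K y *\<^sub>R (C' * \<bar>B y\<bar>)" for n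
        using C'(2)[of "n + n0"] by (intro AE_I2) (auto simp: indicator_def abs_mult intro!: mult_right_mono)
    qed
    then show ?thesis unfolding set_lebesgue_integral_def by (rule LIMSEQ_offset)
  qed
  from tendsto_add[OF one two] show ?thesis by simp
qed

text \<open>Continuity is built into this local Sobolev class: continuous functions are bounded on
  compact sets, so they may multiply L^2_loc gradients, and the class becomes closed under products
  and under composition with \<open>C^1\<close> functions.\<close>

definition H1C :: "(real^'n) set \<Rightarrow> (real^'n \<Rightarrow> real) \<Rightarrow> (real^'n \<Rightarrow> real^'n) \<Rightarrow> bool" where
  "H1C S h w \<longleftrightarrow> continuous_on S h \<and> weak_gradient_on S h w \<and> L_loc 2 S w"

lemma H1C_D:
  assumes "H1C S h w"
  shows "continuous_on S h" "weak_gradient_on S h w" "L_loc 2 S w"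
  using assms by (auto simp: H1C_def)

lemma integral_eq_set_integral:
  fixes f :: "'a::euclidean_space \<Rightarrow> real"
  assumes "\<And>x. x \<notin> K \<Longrightarrow> f x = 0"
  shows "(\<integral>x. f x \<partial>lebesgue) = (LINT x:K|lebesgue. f x)"
    "integrable lebesgue f \<longleftrightarrow> set_integrable lebesgue K f"
proof -
  have eq: "(\<lambda>x. indicator K x *\<^sub>R f x) = f"
  proof
    fix x show "indicator K x *\<^sub>R f x = f x" using assms[of x] by (cases "x \<in> K") auto
  qed
  show "(\<integral>x. f x \<partial>lebesgue) = (LINT x:K|lebesgue. f x)" "integrable lebesgue f \<longleftrightarrow> set_integrable lebesgue K f"
    unfolding set_lebesgue_integral_def set_integrable_def eq by auto
qed

lemma test_function_support:
  fixes \<psi> :: "real^'n \<Rightarrow> real"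
  assumes "test_function S \<psi>"
  obtains K where "compact K" "K \<subseteq> S" "\<And>x. x \<notin> K \<Longrightarrow> \<psi> x = 0" "\<And>x k. x \<notin> K \<Longrightarrow> partials \<psi> x $ k = 0"
    "continuous_on UNIV \<psi>" "\<And>k. continuous_on UNIV (\<lambda>x. partials \<psi> x $ k)" "test_function K \<psi>"
proof (rule that[of "closure {y. \<psi> y \<noteq> 0}"])
  show "\<psi> x = 0" if "x \<notin> closure {y. \<psi> y \<noteq> 0}" for x using that closure_subset[of "{y. \<psi> y \<noteq> 0}"] by blast
  show "partials \<psi> x $ k = 0" if "x \<notin> closure {y. \<psi> y \<noteq> 0}" for x k
    using deriv_eq_0_outside_support[OF that, of "axis k 1"] by (simp add: partials_def)
  show "continuous_on UNIV (\<lambda>x. partials \<psi> x $ k)" for k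
    using smooth_on_continuous[OF smooth_on_deriv[OF test_functionD(1)[OF assms]]] by (simp add: partials_def)
  show "test_function (closure {y. \<psi> y \<noteq> 0}) \<psi>" using assms by (simp add: test_function_def)
qed (use test_functionD[OF assms] smooth_on_continuous in blast)+

lemma test_integrable:
  fixes h :: "real^'n \<Rightarrow> real"
  assumes "test_function S \<psi>"
  shows "continuous_on S h \<Longrightarrow> integrable lebesgue (\<lambda>y. h y * partials \<psi> y $ k)"
    "L_loc 2 S w \<Longrightarrow> integrable lebesgue (\<lambda>y. (w y :: real^'n) $ k * \<psi> y)"
proof -
  obtain K where K: "compact K" "K \<subseteq> S" "\<And>x. x \<notin> K \<Longrightarrow> \<psi> x = 0" "\<And>x k. x \<notin> K \<Longrightarrow> partials \<psi> x $ k = 0"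
    "continuous_on UNIV \<psi>" "\<And>k. continuous_on UNIV (\<lambda>x. partials \<psi> x $ k)"
    using test_function_support[OF assms] by metis
  have c: "continuous_on K \<psi>" "continuous_on K (\<lambda>x. partials \<psi> x $ k)" using K(5,6) continuous_on_subset by blast+
  show "integrable lebesgue (\<lambda>y. h y * partials \<psi> y $ k)" if "continuous_on S h"
    by (subst integral_eq_set_integral(2)[of K])
       (use K(1,2,4) c(2) continuous_on_subset[OF that K(2)] in \<open>auto intro!: set_integrable_continuous_compact continuous_on_mult\<close>)
  show "integrable lebesgue (\<lambda>y. w y $ k * \<psi> y)" if "L_loc 2 S w"
  proof (subst integral_eq_set_integral(2)[of K])
    show "set_integrable lebesgue K (\<lambda>y. w y $ k * \<psi> y)"
      by (rule l2_on_mult_integrable[OF L_loc_2_component[OF that K(1,2)] l2_on_continuous[OF K(1) c(1)]])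
  qed (use K(3) in auto)
qed

lemma L_loc_2_continuous_scaleR:
  fixes w :: "real^'n \<Rightarrow> real^'n"
  assumes "continuous_on S a" "L_loc 2 S w"
  shows "L_loc 2 S (\<lambda>y. a y *\<^sub>R w y)"
proof (rule L_loc_2_I)
  fix K :: "(real^'n) set" and k assume K: "compact K" "K \<subseteq> S"
  have "l2_on K (\<lambda>y. a y * w y $ k)"
    by (rule l2_on_continuous_mult[OF K(1) L_loc_2_component[OF assms(2) K] continuous_on_subset[OF assms(1) K(2)]])
  then show "l2_on K (\<lambda>y. (a y *\<^sub>R w y) $ k)" by simp
qed

lemma L_loc_2_add:
  fixes w :: "real^'n \<Rightarrow> real^'n"
  assumes "L_loc 2 S v" "L_loc 2 S w"
  shows "L_loc 2 S (\<lambda>y. v y + w y)"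
proof (rule L_loc_2_I)
  fix K :: "(real^'n) set" and k assume K: "compact K" "K \<subseteq> S"
  show "l2_on K (\<lambda>y. (v y + w y) $ k)"
    using l2_on_add[OF L_loc_2_component[OF assms(1) K] L_loc_2_component[OF assms(2) K], of k k] by simp
qed

section \<open>Sums, products, chain rule and uniqueness for weak gradients\<close>

lemma H1C_add:
  assumes "H1C S f v" "H1C S g w"
  shows "H1C S (\<lambda>y. f y + g y) (\<lambda>y. v y + w y)"
  unfolding H1C_def
proof (intro conjI)
  note f = H1C_D[OF assms(1)] and g = H1C_D[OF assms(2)]
  show "continuous_on S (\<lambda>y. f y + g y)" using f g by (intro continuous_on_add)
  show "L_loc 2 S (\<lambda>y. v y + w y)" using f g by (intro L_loc_2_add)
  show "weak_gradient_on S (\<lambda>y. f y + g y) (\<lambda>y. v y + w y)"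
    unfolding weak_gradient_on_def
  proof (intro allI impI)
    fix \<psi> k assume t: "test_function S \<psi>"
    have "(\<integral>y. f y * partials \<psi> y $ k \<partial>lebesgue) = - (\<integral>y. v y $ k * \<psi> y \<partial>lebesgue)"
      "(\<integral>y. g y * partials \<psi> y $ k \<partial>lebesgue) = - (\<integral>y. w y $ k * \<psi> y \<partial>lebesgue)"
      using f(2) g(2) t unfolding weak_gradient_on_def by auto
    then show "(\<integral>y. (f y + g y) * partials \<psi> y $ k \<partial>lebesgue) = - (\<integral>y. (v y + w y) $ k * \<psi> y \<partial>lebesgue)"
      using test_integrable(1)[OF t f(1)] test_integrable(2)[OF t f(3)] test_integrable(1)[OF t g(1)] test_integrable(2)[OF t g(3)]
      by (simp add: distrib_right)
  qed
qed

lemma H1C_cmult: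
  assumes "H1C S f v"
  shows "H1C S (\<lambda>y. c * f y) (\<lambda>y. c *\<^sub>R v y)"
  unfolding H1C_def
proof (intro conjI)
  note f = H1C_D[OF assms(1)]
  show "continuous_on S (\<lambda>y. c * f y)" using f by (intro continuous_intros)
  show "L_loc 2 S (\<lambda>y. c *\<^sub>R v y)" using f by (intro L_loc_2_continuous_scaleR) auto
  show "weak_gradient_on S (\<lambda>y. c * f y) (\<lambda>y. c *\<^sub>R v y)"
    using f(2) unfolding weak_gradient_on_def by (simp add: mult.assoc)
qed

lemma H1C_cong:
  assumes "H1C S f v" "\<And>y. y \<in> S \<Longrightarrow> f y = g y" "\<And>y. y \<in> S \<Longrightarrow> v y = w y"
  shows "H1C S g w"
  unfolding H1C_def
proof (intro conjI)
  note f = H1C_D[OF assms(1)]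
  show "continuous_on S g" using f assms(2) continuous_on_cong by metis
  show "L_loc 2 S w"
  proof (rule L_loc_2_I)
    fix K :: "(real^'a) set" and k assume K: "compact K" "K \<subseteq> S"
    have "(\<lambda>x. indicat_real K x * v x $ k) = (\<lambda>x. indicat_real K x * w x $ k)"
         "(\<lambda>x. indicat_real K x * (v x $ k)\<^sup>2) = (\<lambda>x. indicat_real K x * (w x $ k)\<^sup>2)"
      using K assms(3) by (auto simp: indicator_def fun_eq_iff)
    then show "l2_on K (\<lambda>y. w y $ k)" using L_loc_2_component[OF f(3) K, of k]
      by (simp add: l2_on_def set_borel_measurable_def set_integrable_def)
  qed
  show "weak_gradient_on S g w"
    unfolding weak_gradient_on_def
  proof (intro allI impI)
    fix \<psi> k assume t: "test_function S \<psi>"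
    obtain K where K: "K \<subseteq> S" "\<And>x. x \<notin> K \<Longrightarrow> \<psi> x = 0" "\<And>x k. x \<notin> K \<Longrightarrow> partials \<psi> x $ k = 0"
      using test_function_support[OF t] by metis
    have e1: "g y * partials \<psi> y $ k = f y * partials \<psi> y $ k" for y
      using assms(2)[of y] K(1) K(3)[of y k] by (cases "y \<in> K") auto
    have e2: "w y $ k * \<psi> y = v y $ k * \<psi> y" for y
      using assms(3)[of y] K(1) K(2)[of y] by (cases "y \<in> K") auto
    show "(\<integral>y. g y * partials \<psi> y $ k \<partial>lebesgue) = - (\<integral>y. w y $ k * \<psi> y \<partial>lebesgue)"
      unfolding e1 e2 using f(2) t unfolding weak_gradient_on_def by blast
  qed
qed

lemma H1C_C1:
  fixes g :: "real^'n \<Rightarrow> real"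
  assumes S: "open S" and g: "\<And>x. x \<in> S \<Longrightarrow> (g has_derivative (\<lambda>v. w x \<bullet> v)) (at x)" and c: "continuous_on S w"
  shows "H1C S g w"
  unfolding H1C_def
proof (intro conjI)
  show "continuous_on S g"
    using g by (auto intro!: continuous_at_imp_continuous_on has_derivative_continuous)
  show "L_loc 2 S w"
    by (rule L_loc_2_I, rule l2_on_continuous) (auto intro!: continuous_intros continuous_on_subset[OF c])
  show "weak_gradient_on S g w"
    unfolding weak_gradient_on_def
  proof (intro allI impI)
    fix \<psi> k assume t: "test_function S \<psi>"
    have "continuous_on S (\<lambda>x. w x \<bullet> axis k 1)" by (intro continuous_intros c)
    from C1_integration_by_parts[OF S g this t]
    show "(\<integral>y. g y * partials \<psi> y $ k \<partial>lebesgue) = - (\<integral>y. w y $ k * \<psi> y \<partial>lebesgue)"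
      by (simp add: partials_def inner_axis)
  qed
qed

text \<open>True classically for the mollifications \<open>F n\<close>. They converge uniformly on
  the support of \<open>\<psi>\<close> while their gradients converge in L^2, so both sides of the
  integration by parts pass to the limit.\<close>

lemma H1C_chain:
  fixes h :: "real^'n \<Rightarrow> real"
  assumes S: "open S" and H: "H1C S h w" and I: "open I" "\<And>y. y \<in> S \<Longrightarrow> h y \<in> I"
    and G: "\<And>t. t \<in> I \<Longrightarrow> (G has_real_derivative G' t) (at t)" and G'c: "continuous_on I G'"
  shows "H1C S (\<lambda>y. G (h y)) (\<lambda>y. G' (h y) *\<^sub>R w y)"
  unfolding H1C_def
proof (intro conjI)
  note h = H1C_D[OF H]
  have Gc: "continuous_on I G" using G by (auto intro!: continuous_at_imp_continuous_on DERIV_isCont)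
  show "continuous_on S (\<lambda>y. G (h y))" by (rule continuous_on_compose2[OF Gc h(1)]) (use I in auto)
  have "continuous_on S (\<lambda>y. G' (h y))" by (rule continuous_on_compose2[OF G'c h(1)]) (use I in auto)
  then show "L_loc 2 S (\<lambda>y. G' (h y) *\<^sub>R w y)" by (rule L_loc_2_continuous_scaleR[OF _ h(3)])
  show "weak_gradient_on S (\<lambda>y. G (h y)) (\<lambda>y. G' (h y) *\<^sub>R w y)"
    unfolding weak_gradient_on_def
  proof (intro allI impI)
    fix \<psi> k assume t: "test_function S \<psi>"
    obtain K where K: "compact K" "K \<subseteq> S" "\<And>x. x \<notin> K \<Longrightarrow> \<psi> x = 0" "\<And>x k. x \<notin> K \<Longrightarrow> partials \<psi> x $ k = 0"
      "continuous_on UNIV \<psi>" "\<And>k. continuous_on UNIV (\<lambda>x. partials \<psi> x $ k)" "test_function K \<psi>"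
      using test_function_support[OF t] by metis
    have hK: "continuous_on K h" using h(1) K(2) continuous_on_subset by blast
    have \<psi>K: "continuous_on K \<psi>" "continuous_on K (\<lambda>x. partials \<psi> x $ k)" using K(5,6) continuous_on_subset by blast+
    have hKI: "compact (h ` K)" "h ` K \<subseteq> I" using compact_continuous_image[OF hK K(1)] K(2) I by auto
    obtain r J where r: "r > 0" and J: "compact J" "J \<subseteq> I" "h ` K \<subseteq> J"
      and near: "\<And>x y. x \<in> h ` K \<Longrightarrow> dist x y \<le> r \<Longrightarrow> y \<in> J"
      by (rule compact_neighborhood[OF hKI(1) I(1) hKI(2)]) (rule that)
    obtain F0 where F0: "\<And>n. smooth_on UNIV (F0 n)" "uniform_limit K F0 h sequentially"
      "\<And>k. (\<lambda>n. LINT y:K|lebesgue. (partials (F0 n) y $ k - w y $ k)\<^sup>2) \<longlonglongrightarrow> 0"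
      by (rule weak_gradient_approx[OF S h K(1,2)]) (rule that)
    obtain n0 where n0: "\<And>n x. n \<ge> n0 \<Longrightarrow> x \<in> K \<Longrightarrow> dist (F0 n x) (h x) < r"
      using uniform_limitD[OF F0(2) r] unfolding eventually_sequentially by blast
    \<comment> \<open>Dropping the first \<open>n0\<close> terms keeps all values on
      \<open>K\<close> in the compact set \<open>J\<close>, where \<open>G\<close> and
      \<open>G'\<close> are bounded.\<close>
    define F where "F n = F0 (n + n0)" for n
    have F: "smooth_on UNIV (F n)" for n using F0(1) by (simp add: F_def)
    have FJ: "F n x \<in> J" if "x \<in> K" for n x
      using near[of "h x" "F n x"] n0[of "n + n0" x] that by (simp add: F_def dist_commute)
    have Fl: "(\<lambda>n. F n x) \<longlonglongrightarrow> h x" if "x \<in> K" for x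
      unfolding F_def using tendsto_uniform_limitI[OF F0(2) that] by (rule LIMSEQ_ignore_initial_segment)
    have Fg: "(\<lambda>n. LINT y:K|lebesgue. (partials (F n) y $ k - w y $ k)\<^sup>2) \<longlonglongrightarrow> 0"
      unfolding F_def using F0(3) by (rule LIMSEQ_ignore_initial_segment)
    have Fc: "continuous_on A (F n)" for A n by (rule smooth_on_continuous[OF F])
    have Fpc: "continuous_on A (\<lambda>y. partials (F n) y $ k)" for A n
      using smooth_on_continuous[OF smooth_on_deriv[OF F]] by (simp add: partials_def)
    have GF: "continuous_on K (\<lambda>x. G (F n x))" for n
      by (rule continuous_on_compose2[OF Gc Fc]) (use FJ J in auto)
    have G'F: "continuous_on K (\<lambda>x. G' (F n x))" for n
      by (rule continuous_on_compose2[OF G'c Fc]) (use FJ J in auto)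
    have parts: "(LINT y:K|lebesgue. G (F n y) * partials \<psi> y $ k)
       = - (LINT y:K|lebesgue. (G' (F n y) * \<psi> y) * partials (F n) y $ k)" for n
    proof -
      \<comment> \<open>\<open>G\<close> is differentiable only on \<open>I\<close>. Parts are
        therefore integrated over the open set where \<open>F n\<close> takes values in
        \<open>I\<close>, which contains the support of \<open>\<psi>\<close>.\<close>
      let ?O = "{x. F n x \<in> I}"
      have O: "open ?O" using open_vimage[OF I(1) Fc, of n] by (simp add: vimage_def)
      have "test_function ?O \<psi>" using K(7) by (rule test_function_mono) (use FJ J in auto)
      moreover have "((\<lambda>x. G (F n x)) has_derivative (\<lambda>v. G' (F n x) * frechet_derivative (F n) (at x) v)) (at x)"
        if "x \<in> ?O" for x
      proof -
        have "(F n has_derivative frechet_derivative (F n) (at x)) (at x)"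
          using smooth_on_differentiable[OF F] frechet_derivative_works by blast
        from DERIV_compose_FDERIV[OF G this] that show ?thesis by (simp add: mult.commute)
      qed
      moreover have "continuous_on ?O (\<lambda>x. G' (F n x) * frechet_derivative (F n) (at x) (axis k 1))"
      proof (rule continuous_on_mult)
        show "continuous_on ?O (\<lambda>x. G' (F n x))" by (rule continuous_on_compose2[OF G'c Fc]) auto
        show "continuous_on ?O (\<lambda>x. frechet_derivative (F n) (at x) (axis k 1))"
          by (rule smooth_on_continuous[OF smooth_on_deriv[OF F]])
      qed
      ultimately have "(\<integral>x. G (F n x) * frechet_derivative \<psi> (at x) (axis k 1) \<partial>lebesgue)
         = - (\<integral>x. (G' (F n x) * frechet_derivative (F n) (at x) (axis k 1)) * \<psi> x \<partial>lebesgue)"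
        by (intro C1_integration_by_parts[OF O]) auto
      then have "(\<integral>x. G (F n x) * partials \<psi> x $ k \<partial>lebesgue)
         = - (\<integral>x. (G' (F n x) * \<psi> x) * partials (F n) x $ k \<partial>lebesgue)"
        by (simp add: partials_def mult_ac)
      then show ?thesis using K(3,4)
        by (subst (asm) (1 2) integral_eq_set_integral(1)[of K]) auto
    qed
    obtain B where B: "\<And>t. t \<in> J \<Longrightarrow> \<bar>G t\<bar> \<le> B"
      using continuous_compact_bounded[OF J(1) continuous_on_subset[OF Gc J(2)]] by blast
    obtain B' where B': "B' > 0" "\<And>t. t \<in> J \<Longrightarrow> \<bar>G' t\<bar> \<le> B'"
      using continuous_compact_bounded[OF J(1) continuous_on_subset[OF G'c J(2)]] by blast
    obtain B'' where B'': "\<And>x. x \<in> K \<Longrightarrow> \<bar>\<psi> x\<bar> \<le> B''"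
      using continuous_compact_bounded[OF K(1) \<psi>K(1)] by blast
    have 1: "(\<lambda>n. LINT y:K|lebesgue. G (F n y) * partials \<psi> y $ k) \<longlonglongrightarrow> (LINT y:K|lebesgue. G (h y) * partials \<psi> y $ k)"
    proof (rule tendsto_set_integral_bounded_mult[OF K(1), where C = B])
      show "(\<lambda>n. G (F n x)) \<longlonglongrightarrow> G (h x)" if "x \<in> K" for x
        by (rule isCont_tendsto_compose[OF _ Fl[OF that]]) (use G I K that DERIV_isCont in blast)
    qed (use B FJ in \<open>auto intro!: set_borel_measurable_continuous_compact[OF K(1) GF] l2_on_continuous[OF K(1) \<psi>K(2)] always_eventually\<close>)
    have 2: "(\<lambda>n. LINT y:K|lebesgue. (G' (F n y) * \<psi> y) * partials (F n) y $ k)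
       \<longlonglongrightarrow> (LINT y:K|lebesgue. (G' (h y) * \<psi> y) * w y $ k)"
    proof (rule tendsto_set_integral_bounded_mult[OF K(1), where C = "B' * B''"])
      show "set_borel_measurable lebesgue K (\<lambda>y. G' (F n y) * \<psi> y)" for n
        by (intro set_borel_measurable_continuous_compact K continuous_on_mult G'F \<psi>K)
      have "\<bar>G' (F n x) * \<psi> x\<bar> \<le> B' * B''" if "x \<in> K" for n x
        unfolding abs_mult using B'(1) B'(2)[OF FJ[OF that]] B''[OF that] by (intro mult_mono) auto
      then show "\<forall>\<^sub>F n in sequentially. \<forall>x\<in>K. \<bar>G' (F n x) * \<psi> x\<bar> \<le> B' * B''" by simp
      show "(\<lambda>n. G' (F n x) * \<psi> x) \<longlonglongrightarrow> G' (h x) * \<psi> x" if "x \<in> K" for x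
      proof (rule tendsto_mult)
        have "isCont G' (h x)" using G'c I K(2) that continuous_on_eq_continuous_at by blast
        then show "(\<lambda>n. G' (F n x)) \<longlonglongrightarrow> G' (h x)" by (rule isCont_tendsto_compose[OF _ Fl[OF that]])
      qed auto
      show "l2_on K (\<lambda>y. partials (F n) y $ k)" for n by (rule l2_on_continuous[OF K(1) Fpc])
      show "l2_on K (\<lambda>y. w y $ k)" by (rule L_loc_2_component[OF h(3) K(1,2)])
    qed (rule Fg)
    have "(LINT y:K|lebesgue. G (h y) * partials \<psi> y $ k) = - (LINT y:K|lebesgue. (G' (h y) * \<psi> y) * w y $ k)"
      using LIMSEQ_unique[OF 1[unfolded parts] tendsto_minus[OF 2]] .
    then show "(\<integral>y. G (h y) * partials \<psi> y $ k \<partial>lebesgue) = - (\<integral>y. (G' (h y) *\<^sub>R w y) $ k * \<psi> y \<partial>lebesgue)"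
      using K(3,4) by (subst (1 2) integral_eq_set_integral(1)[of K]) (auto simp: mult_ac)
  qed
qed

text \<open>Polarisation, \<open>4 f g = (f + g)^2 - (f - g)^2\<close>, reduces the product rule to
  linearity and the chain rule for the square.\<close>

lemma H1C_mult:
  assumes S: "open S" and f: "H1C S f v" and g: "H1C S g w"
  shows "H1C S (\<lambda>y. f y * g y) (\<lambda>y. f y *\<^sub>R w y + g y *\<^sub>R v y)"
proof -
  have sq: "H1C S (\<lambda>y. (u y)\<^sup>2) (\<lambda>y. (2 * u y) *\<^sub>R z y)" if "H1C S u z" for u z
    by (rule H1C_chain[OF S that, of UNIV "\<lambda>t. t\<^sup>2" "\<lambda>t. 2 * t"]) (auto intro!: derivative_eq_intros continuous_intros)
  have d: "H1C S (\<lambda>y. f y + - 1 * g y) (\<lambda>y. v y + - 1 *\<^sub>R w y)"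
    by (intro H1C_add H1C_cmult f g)
  have "H1C S (\<lambda>y. (1/4) * (f y + g y)\<^sup>2 + (- 1/4) * (f y + - 1 * g y)\<^sup>2)
     (\<lambda>y. (1/4) *\<^sub>R ((2 * (f y + g y)) *\<^sub>R (v y + w y)) + (- 1/4) *\<^sub>R ((2 * (f y + - 1 * g y)) *\<^sub>R (v y + - 1 *\<^sub>R w y)))"
    by (intro H1C_add[OF H1C_cmult H1C_cmult] sq d H1C_add[OF f g])
  then show ?thesis
  proof (rule H1C_cong)
    fix y
    show "(1/4) * (f y + g y)\<^sup>2 + (- 1/4) * (f y + - 1 * g y)\<^sup>2 = f y * g y"
      by (simp add: power2_eq_square algebra_simps)
    show "(1/4) *\<^sub>R ((2 * (f y + g y)) *\<^sub>R (v y + w y)) + (- 1/4) *\<^sub>R ((2 * (f y + - 1 * g y)) *\<^sub>R (v y + - 1 *\<^sub>R w y))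
       = f y *\<^sub>R w y + g y *\<^sub>R v y"
      by (simp add: vec_eq_iff algebra_simps)
  qed
qed

text \<open>Testing with shifted mollifiers shows that every mollification of \<open>w - w'\<close>
  with small radius vanishes on \<open>K\<close>; these mollifications converge in L^2 to
  \<open>w - w'\<close>, which is therefore zero almost everywhere.\<close>

lemma H1C_unique:
  fixes h :: "real^'n \<Rightarrow> real"
  assumes S: "open S" and w: "H1C S h w" and w': "H1C S h w'"
  shows "AE y in lebesgue. y \<in> S \<longrightarrow> w y = w' y"
proof -
  have null: "AE y in lebesgue. y \<in> K \<longrightarrow> w y $ k = w' y $ k" if K: "compact K" "K \<subseteq> S" for K k
  proof -
    obtain r K' where r: "r > 0" and K': "compact K'" "K' \<subseteq> S" "K \<subseteq> K'"
      and near: "\<And>x y. x \<in> K \<Longrightarrow> dist x y \<le> r \<Longrightarrow> y \<in> K'"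
      using compact_neighborhood[OF K(1) S K(2)] by blast
    obtain R where R: "K' \<subseteq> cball 0 R"
      using bounded_subset_ballD[OF compact_imp_bounded[OF K'(1)], of 0] ball_subset_cball by blast
    have dl: "l2_on K' (\<lambda>y. w y $ k - w' y $ k)"
      using w w' K' by (intro l2_on_diff L_loc_2_component) (auto simp: H1C_def)
    define D where "D z = indicat_real K' z * (w z $ k - w' z $ k)" for z
    note Dm = l2_on_indicator[OF dl, folded D_def]
    have Dz: "z \<notin> cball 0 R \<Longrightarrow> D z = 0" for z using R by (auto simp: D_def indicator_def)
    have Di: "integrable lebesgue D" by (rule L2_compact_support_integrable[OF Dm Dz])
    have c0: "conv D (moll e) y = 0" if e: "e > 0" "e < r" and y: "y \<in> K" for e y
    proof -
      have cb: "cball y e \<subseteq> K'" using near[OF y] e by auto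
      have t: "test_function S (\<lambda>z. moll e (y - z))"
        using cb K'(2) by (intro test_function_moll_shift[OF e(1)]) auto
      have "conv D (moll e) y = (\<integral>z. (w z $ k * moll e (y - z)) - (w' z $ k * moll e (y - z)) \<partial>lebesgue)"
        unfolding conv_def
      proof (rule Bochner_Integration.integral_cong[OF refl])
        fix z
        show "D z * moll e (y - z) = (w z $ k * moll e (y - z)) - (w' z $ k * moll e (y - z))"
        proof (cases "z \<in> cball y e")
          case True
          then show ?thesis using cb by (auto simp: D_def left_diff_distrib)
        next
          case False
          then have "moll e (y - z) = 0" using moll_eq_0[OF e(1), of "y - z"] by (simp add: dist_norm)
          then show ?thesis by simp
        qed
      qed
      also have "\<dots> = (\<integral>z. w z $ k * moll e (y - z) \<partial>lebesgue) - (\<integral>z. w' z $ k * moll e (y - z) \<partial>lebesgue)"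
        using test_integrable(2)[OF t] w w' by (intro Bochner_Integration.integral_diff) (auto simp: H1C_def)
      also have "\<dots> = 0"
      proof -
        have "(\<integral>y'. h y' * partials (\<lambda>z. moll e (y - z)) y' $ k \<partial>lebesgue) = - (\<integral>z. w z $ k * moll e (y - z) \<partial>lebesgue)"
          "(\<integral>y'. h y' * partials (\<lambda>z. moll e (y - z)) y' $ k \<partial>lebesgue) = - (\<integral>z. w' z $ k * moll e (y - z) \<partial>lebesgue)"
          using H1C_D(2)[OF w] H1C_D(2)[OF w'] t unfolding weak_gradient_on_def by blast+
        then show ?thesis by simp
      qed
      finally show ?thesis .
    qed
    let ?f = "\<lambda>y. indicat_real K y * (w y $ k - w' y $ k)\<^sup>2"
    have Kl: "l2_on K (\<lambda>y. w y $ k - w' y $ k)"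
      using w w' K by (intro l2_on_diff L_loc_2_component) (auto simp: H1C_def)
    then have fi: "integrable lebesgue ?f" by (simp add: l2_on_def set_integrable_def)
    have small: "integral\<^sup>L lebesgue ?f < d" if d: "d > 0" for d
    proof -
      have "\<exists>e0>0. \<forall>e. 0 < e \<and> e < e0 \<longrightarrow> integrable lebesgue (\<lambda>y. (conv D (moll e) y - D y)\<^sup>2) \<and>
         (\<integral>y. (conv D (moll e) y - D y)\<^sup>2 \<partial>lebesgue) < d"
        by (rule conv_moll_L2[OF Dm Dz d]) (assumption, blast)
      then
      obtain e0 where e0: "e0 > 0" "\<And>e. 0 < e \<Longrightarrow> e < e0 \<Longrightarrow>
        integrable lebesgue (\<lambda>y. (conv D (moll e) y - D y)\<^sup>2) \<and> (\<integral>y. (conv D (moll e) y - D y)\<^sup>2 \<partial>lebesgue) < d"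
        by blast
      define e where "e = min e0 r / 2"
      have e: "e > 0" "e < e0" "e < r" using e0(1) r by (auto simp: e_def min_def)
      note ii = e0(2)[OF e(1,2)]
      have "integral\<^sup>L lebesgue ?f \<le> (\<integral>y. (conv D (moll e) y - D y)\<^sup>2 \<partial>lebesgue)"
      proof (rule Bochner_Integration.integral_mono[OF fi])
        show "?f y \<le> (conv D (moll e) y - D y)\<^sup>2" for y
          using c0[OF e(1,3), of y] K'(3) by (cases "y \<in> K") (auto simp: D_def)
      qed (use ii in auto)
      then show ?thesis using ii by linarith
    qed
    have "integral\<^sup>L lebesgue ?f \<ge> 0" by (rule Bochner_Integration.integral_nonneg) auto
    moreover have "\<not> integral\<^sup>L lebesgue ?f > 0" using small[of "integral\<^sup>L lebesgue ?f"] by blast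
    ultimately have "integral\<^sup>L lebesgue ?f = 0" by linarith
    then have "AE y in lebesgue. ?f y = 0"
      using integral_nonneg_eq_0_iff_AE[OF fi] by auto
    then show ?thesis by eventually_elim (auto simp: indicator_def)
  qed
  \<comment> \<open>A countable exhaustion, so that the exceptional null sets of the pieces and
    components still have a null union.\<close>
  obtain C where C: "\<And>n::nat. compact (C n)" "\<And>n. C n \<subseteq> S" "\<Union>(range C) = S"
    using open_Union_compact_subsets[OF S] by metis
  have "AE y in lebesgue. \<forall>n. y \<in> C n \<longrightarrow> (\<forall>k. w y $ k = w' y $ k)"
  proof (subst AE_all_countable, rule allI)
    fix n
    have "AE y in lebesgue. \<forall>k. y \<in> C n \<longrightarrow> w y $ k = w' y $ k"
      unfolding AE_all_countable using null[OF C(1,2)] by simp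
    then show "AE y in lebesgue. y \<in> C n \<longrightarrow> (\<forall>k. w y $ k = w' y $ k)" by eventually_elim blast
  qed
  then show ?thesis
  proof eventually_elim
    case (elim y)
    then show ?case using C(3) by (auto simp: vec_eq_iff)
  qed
qed

lemma set_integrable_sum:
  fixes f :: "'i \<Rightarrow> 'a \<Rightarrow> real"
  assumes "\<And>i. i \<in> I \<Longrightarrow> set_integrable M A (f i)"
  shows "set_integrable M A (\<lambda>x. \<Sum>i\<in>I. f i x)"
  using assms unfolding set_integrable_def scaleR_sum_right by (intro Bochner_Integration.integrable_sum)

lemma set_integral_sum:
  fixes f :: "'i \<Rightarrow> 'a \<Rightarrow> real"
  assumes "\<And>i. i \<in> I \<Longrightarrow> set_integrable M A (f i)"
  shows "(LINT x:A|M. \<Sum>i\<in>I. f i x) = (\<Sum>i\<in>I. LINT x:A|M. f i x)"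
  using assms unfolding set_integrable_def set_lebesgue_integral_def scaleR_sum_right
  by (intro Bochner_Integration.integral_sum)

text \<open>Here the fixed factor \<open>X\<close> may be unbounded; the weighted inequality
  \<open>\<bar>p * q\<bar> \<le> s * p^2 + q^2 / s\<close> uses its L^2 norm in place of a pointwise
  bound.\<close>

lemma tendsto_set_integral_l2_mult:
  fixes X :: "'a::euclidean_space \<Rightarrow> real"
  assumes X: "l2_on K X" and bn: "\<And>n. l2_on K (b n)" and b: "l2_on K B"
    and lim: "(\<lambda>n. LINT y:K|lebesgue. (b n y - B y)\<^sup>2) \<longlonglongrightarrow> 0"
  shows "(\<lambda>n. LINT y:K|lebesgue. X y * b n y) \<longlonglongrightarrow> (LINT y:K|lebesgue. X y * B y)"
proof -
  let ?A = "LINT y:K|lebesgue. (X y)\<^sup>2"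
  have A0: "?A \<ge> 0" unfolding set_lebesgue_integral_def by (rule Bochner_Integration.integral_nonneg) auto
  have Xi: "set_integrable lebesgue K (\<lambda>y. (X y)\<^sup>2)" using X by (simp add: l2_on_def)
  have d: "set_integrable lebesgue K (\<lambda>y. (b n y - B y)\<^sup>2)" for n
    using l2_on_diff[OF bn b, of n] by (simp add: l2_on_def)
  have i1: "set_integrable lebesgue K (\<lambda>y. X y * b n y)" for n by (rule l2_on_mult_integrable[OF X bn])
  have i2: "set_integrable lebesgue K (\<lambda>y. X y * B y)" by (rule l2_on_mult_integrable[OF X b])
  have "(\<lambda>n. (LINT y:K|lebesgue. X y * b n y) - (LINT y:K|lebesgue. X y * B y)) \<longlonglongrightarrow> 0"
  proof (rule tendstoI)
    fix r :: real assume r: "r > 0"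
    define s where "s = r / (2 * (?A + 1))"
    have s: "s > 0" using r A0 by (simp add: s_def add_nonneg_pos)
    have sA: "s * ?A < r / 2"
    proof -
      have "s * ?A < s * (?A + 1)" using s by simp
      also have "\<dots> = r / 2"
      proof -
        have "r / (2 * c) * c = r / 2" if "c \<noteq> 0" for c :: real using that by simp
        moreover have "?A + 1 \<noteq> 0" using A0 by linarith
        ultimately show ?thesis unfolding s_def by blast
      qed
      finally show ?thesis .
    qed
    have "eventually (\<lambda>n. (LINT y:K|lebesgue. (b n y - B y)\<^sup>2) < s * r / 2) sequentially"
      using lim s r by (intro order_tendstoD(2)[of _ 0]) auto
    then show "eventually (\<lambda>n. dist ((LINT y:K|lebesgue. X y * b n y) - (LINT y:K|lebesgue. X y * B y)) 0 < r) sequentially"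
    proof eventually_elim
      case (elim n)
      have i: "set_integrable lebesgue K (\<lambda>y. X y * b n y - X y * B y)" using i1 i2 by (rule set_integral_diff)
      have E: "(LINT y:K|lebesgue. X y * b n y) - (LINT y:K|lebesgue. X y * B y) = (LINT y:K|lebesgue. X y * b n y - X y * B y)"
        using i1 i2 by (simp add: set_integral_diff)
      have "\<bar>LINT y:K|lebesgue. X y * b n y - X y * B y\<bar> \<le> (LINT y:K|lebesgue. \<bar>X y * b n y - X y * B y\<bar>)"
        using set_integral_norm_bound[OF i] by simp
      also have "\<dots> \<le> (LINT y:K|lebesgue. s * (X y)\<^sup>2 + (b n y - B y)\<^sup>2 / s)"
      proof (rule set_integral_mono)
        show "set_integrable lebesgue K (\<lambda>y. \<bar>X y * b n y - X y * B y\<bar>)" using i by (rule set_integrable_abs)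
        show "set_integrable lebesgue K (\<lambda>y. s * (X y)\<^sup>2 + (b n y - B y)\<^sup>2 / s)"
          using d[of n] Xi by (intro set_integral_add) auto
        fix y
        have "\<bar>p * q\<bar> \<le> s * p\<^sup>2 + q\<^sup>2 / s" for p q
        proof -
          have "0 \<le> (s * \<bar>p\<bar> - \<bar>q\<bar>)\<^sup>2" by simp
          then have "2 * (s * (\<bar>p\<bar> * \<bar>q\<bar>)) \<le> (s * p)\<^sup>2 + q\<^sup>2"
            using s by (simp add: power2_diff power_mult_distrib mult_ac)
          moreover have "0 \<le> (s * p)\<^sup>2 + q\<^sup>2" by simp
          ultimately have "s * \<bar>p * q\<bar> \<le> (s * p)\<^sup>2 + q\<^sup>2" unfolding abs_mult by linarith
          also have "\<dots> = s * (s * p\<^sup>2 + q\<^sup>2 / s)" using s by (simp add: field_simps power2_eq_square)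
          finally show ?thesis using s by simp
        qed
        from this[of "X y" "b n y - B y"]
        show "\<bar>X y * b n y - X y * B y\<bar> \<le> s * (X y)\<^sup>2 + (b n y - B y)\<^sup>2 / s"
          by (simp add: right_diff_distrib)
      qed
      also have "\<dots> = s * ?A + (LINT y:K|lebesgue. (b n y - B y)\<^sup>2) / s"
        using d[of n] Xi by (simp add: set_integral_add)
      also have "\<dots> < r / 2 + (s * r / 2) / s"
        using sA elim s by (intro add_strict_mono divide_strict_right_mono) auto
      also have "\<dots> = r" using s by simp
      finally show ?case unfolding E by (simp add: dist_norm)
    qed
  qed
  then show ?thesis by (simp add: LIM_zero_iff)
qed

text \<open>A weak identity that holds for smooth test functions also holds for compactly supported
  test functions that are merely continuous with an \<open>L\<^sup>2\<close> gradient.\<close>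

lemma weak_identity_extend:
  fixes X :: "real^'n \<Rightarrow> real^'n"
  assumes S: "open S" and X: "L_loc 2 S X" and Y: "\<And>K. compact K \<Longrightarrow> K \<subseteq> S \<Longrightarrow> set_integrable lebesgue K Y"
    and id: "\<And>\<psi>. test_function S \<psi> \<Longrightarrow> (\<integral>y. X y \<bullet> partials \<psi> y + Y y * \<psi> y \<partial>lebesgue) = 0"
    and \<xi>: "H1C S \<xi> w" and K: "compact K" "K \<subseteq> S" and L: "compact L" "L \<subseteq> interior K"
    and z: "\<And>y. y \<in> S \<Longrightarrow> y \<notin> L \<Longrightarrow> \<xi> y = 0"
  shows "(LINT y:K|lebesgue. X y \<bullet> w y + Y y * \<xi> y) = 0"
proof -
  note h = H1C_D[OF \<xi>]
  obtain F0 where F0: "\<And>n. smooth_on UNIV (F0 n)" "uniform_limit K F0 \<xi> sequentially"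
    "\<And>k. (\<lambda>n. LINT y:K|lebesgue. (partials (F0 n) y $ k - w y $ k)\<^sup>2) \<longlonglongrightarrow> 0"
    and F0t: "eventually (\<lambda>n. test_function S (F0 n) \<and> (\<forall>y. y \<notin> K \<longrightarrow> F0 n y = 0)) sequentially"
  proof (rule weak_gradient_approx[OF S h K], goal_cases)
    case (1 F)
    show ?case by (rule that[OF 1(2) 1(3) 1(4) 1(6)[OF z L]])
  qed
  have "eventually (\<lambda>n. (test_function S (F0 n) \<and> (\<forall>y. y \<notin> K \<longrightarrow> F0 n y = 0)) \<and> (\<forall>x\<in>K. dist (F0 n x) (\<xi> x) < 1)) sequentially"
    by (intro eventually_conj F0t uniform_limitD[OF F0(2)]) auto
  then obtain n0 where n0: "\<And>n. n \<ge> n0 \<Longrightarrow> test_function S (F0 n)" "\<And>n y. n \<ge> n0 \<Longrightarrow> y \<notin> K \<Longrightarrow> F0 n y = 0"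
     "\<And>n x. n \<ge> n0 \<Longrightarrow> x \<in> K \<Longrightarrow> dist (F0 n x) (\<xi> x) < 1"
    unfolding eventually_sequentially by blast
  define F where "F n = F0 (n + n0)" for n
  have t: "test_function S (F n)" and Fz: "y \<notin> K \<Longrightarrow> F n y = 0" for n y using n0 by (auto simp: F_def)
  have sm: "smooth_on UNIV (F n)" for n using F0(1) by (simp add: F_def)
  have pz: "partials (F n) y $ k = 0" if "y \<notin> K" for n y k
    unfolding partials_def vec_lambda_beta
  proof (rule frechet_derivative_eq_0_locally(2))
    show "open (- K)" "y \<in> - K" using compact_imp_closed[OF K(1)] that by auto
    show "F n x = 0" if "x \<in> - K" for x using Fz that by simp
  qed
  have Fl: "(\<lambda>n. F n x) \<longlonglongrightarrow> \<xi> x" if "x \<in> K" for x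
    unfolding F_def using tendsto_uniform_limitI[OF F0(2) that] by (rule LIMSEQ_ignore_initial_segment)
  have Fg: "(\<lambda>n. LINT y:K|lebesgue. (partials (F n) y $ k - w y $ k)\<^sup>2) \<longlonglongrightarrow> 0" for k
    unfolding F_def using F0(3) by (rule LIMSEQ_ignore_initial_segment)
  have Fc: "continuous_on A (F n)" for A n by (rule smooth_on_continuous[OF sm])
  have Fpc: "continuous_on A (\<lambda>y. partials (F n) y $ k)" for A n k
    using smooth_on_continuous[OF smooth_on_deriv[OF sm]] by (simp add: partials_def)
  have wl: "l2_on K (\<lambda>y. w y $ k)" and Xl: "l2_on K (\<lambda>y. X y $ k)" for k
    by (rule L_loc_2_component[OF h(3) K], rule L_loc_2_component[OF X K])
  have pl: "l2_on K (\<lambda>y. partials (F n) y $ k)" for n k by (rule l2_on_continuous[OF K(1) Fpc])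
  have \<xi>K: "continuous_on K \<xi>" using h(1) K(2) continuous_on_subset by blast
  obtain C where C: "\<And>x. x \<in> K \<Longrightarrow> \<bar>\<xi> x\<bar> \<le> C" using continuous_compact_bounded[OF K(1) \<xi>K] by blast
  have Fb: "\<bar>F n x\<bar> \<le> C + 1" if "x \<in> K" for n x
    using n0(3)[of "n + n0" x] C[OF that] that by (simp add: F_def dist_norm)
  note Yi = Y[OF K]
  have Ym: "set_borel_measurable lebesgue K Y"
    using Yi by (simp add: set_integrable_def set_borel_measurable_def borel_measurable_integrable)
  have YF: "set_integrable lebesgue K (\<lambda>y. Y y * a y)" if ac: "continuous_on K a" for a
  proof -
    obtain B where B: "\<And>x. x \<in> K \<Longrightarrow> \<bar>a x\<bar> \<le> B" using continuous_compact_bounded[OF K(1) ac] by blast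
    show ?thesis
    proof (rule set_integrable_bound_real)
      show "set_integrable lebesgue K (\<lambda>x. \<bar>Y x\<bar> * B)" using Yi by (intro set_integrable_mult_left set_integrable_abs)
      show "set_borel_measurable lebesgue K (\<lambda>y. Y y * a y)"
        by (intro set_borel_measurable_mult Ym set_borel_measurable_continuous_compact K ac)
      show "\<bar>Y x * a x\<bar> \<le> \<bar>Y x\<bar> * B" if "x \<in> K" for x
        using B[OF that] by (simp add: abs_mult mult_left_mono)
    qed
  qed
  have zero: "(\<Sum>k\<in>UNIV. LINT y:K|lebesgue. X y $ k * partials (F n) y $ k) + (LINT y:K|lebesgue. Y y * F n y) = 0" for n
  proof -
    have "(\<integral>y. X y \<bullet> partials (F n) y + Y y * F n y \<partial>lebesgue) = (LINT y:K|lebesgue. X y \<bullet> partials (F n) y + Y y * F n y)"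
      by (rule integral_eq_set_integral(1)) (simp add: inner_vec_def pz Fz)
    also have "\<dots> = (LINT y:K|lebesgue. X y \<bullet> partials (F n) y) + (LINT y:K|lebesgue. Y y * F n y)"
    proof (rule set_integral_add(2))
      show "set_integrable lebesgue K (\<lambda>y. X y \<bullet> partials (F n) y)"
        unfolding inner_vec_def inner_real_def
        by (rule set_integrable_sum) (auto intro: l2_on_mult_integrable Xl pl)
      show "set_integrable lebesgue K (\<lambda>y. Y y * F n y)" by (rule YF[OF Fc])
    qed
    also have "(LINT y:K|lebesgue. X y \<bullet> partials (F n) y) = (\<Sum>k\<in>UNIV. LINT y:K|lebesgue. X y $ k * partials (F n) y $ k)"
      unfolding inner_vec_def inner_real_def
      by (rule set_integral_sum) (auto intro: l2_on_mult_integrable Xl pl)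
    finally show ?thesis using id[OF t, of n] by simp
  qed
  have 1: "(\<lambda>n. \<Sum>k\<in>UNIV. LINT y:K|lebesgue. X y $ k * partials (F n) y $ k) \<longlonglongrightarrow> (\<Sum>k\<in>UNIV. LINT y:K|lebesgue. X y $ k * w y $ k)"
    by (intro tendsto_sum tendsto_set_integral_l2_mult Xl pl wl Fg)
  \<comment> \<open>\<open>Y\<close> is merely integrable, so L^2 convergence does not help in this
    term; what makes the limit possible is that the \<open>F n\<close> are uniformly bounded on
    \<open>K\<close> and converge pointwise.\<close>
  have 2: "(\<lambda>n. LINT y:K|lebesgue. Y y * F n y) \<longlonglongrightarrow> (LINT y:K|lebesgue. Y y * \<xi> y)"
    unfolding set_lebesgue_integral_def
  proof (rule integral_dominated_convergence)
    show "integrable lebesgue (\<lambda>y. indicator K y *\<^sub>R (\<bar>Y y\<bar> * (C + 1)))"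
      using set_integrable_mult_left[OF set_integrable_abs[OF Yi], of "C + 1"] by (simp add: set_integrable_def)
    show "(\<lambda>y. indicator K y *\<^sub>R (Y y * \<xi> y)) \<in> borel_measurable lebesgue"
      using YF[OF \<xi>K] by (simp add: set_integrable_def borel_measurable_integrable)
    show "(\<lambda>y. indicator K y *\<^sub>R (Y y * F n y)) \<in> borel_measurable lebesgue" for n
      using YF[OF Fc] by (simp add: set_integrable_def borel_measurable_integrable)
    show "AE y in lebesgue. (\<lambda>n. indicator K y *\<^sub>R (Y y * F n y)) \<longlonglongrightarrow> indicator K y *\<^sub>R (Y y * \<xi> y)"
      using Fl by (intro AE_I2) (auto simp: indicator_def intro!: tendsto_intros)
    show "AE y in lebesgue. norm (indicator K y *\<^sub>R (Y y * F n y)) \<le> indicator K y *\<^sub>R (\<bar>Y y\<bar> * (C + 1))" for n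
      using Fb by (intro AE_I2) (auto simp: indicator_def abs_mult intro!: mult_left_mono)
  qed
  have "(\<lambda>n. 0) \<longlonglongrightarrow> (\<Sum>k\<in>UNIV. LINT y:K|lebesgue. X y $ k * w y $ k) + (LINT y:K|lebesgue. Y y * \<xi> y)"
    using tendsto_add[OF 1 2] by (simp only: zero)
  then have "0 = (\<Sum>k\<in>UNIV. LINT y:K|lebesgue. X y $ k * w y $ k) + (LINT y:K|lebesgue. Y y * \<xi> y)"
    by (simp only: LIMSEQ_const_iff)
  also have "(\<Sum>k\<in>UNIV. LINT y:K|lebesgue. X y $ k * w y $ k) = (LINT y:K|lebesgue. X y \<bullet> w y)"
    unfolding inner_vec_def inner_real_def
    by (rule set_integral_sum[symmetric]) (auto intro: l2_on_mult_integrable Xl wl)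
  also have "(LINT y:K|lebesgue. X y \<bullet> w y) + (LINT y:K|lebesgue. Y y * \<xi> y) = (LINT y:K|lebesgue. X y \<bullet> w y + Y y * \<xi> y)"
  proof (rule set_integral_add(2)[symmetric])
    show "set_integrable lebesgue K (\<lambda>y. X y \<bullet> w y)"
      unfolding inner_vec_def inner_real_def
      by (rule set_integrable_sum) (auto intro: l2_on_mult_integrable Xl wl)
    show "set_integrable lebesgue K (\<lambda>y. Y y * \<xi> y)" by (rule YF[OF \<xi>K])
  qed
  finally show ?thesis by simp
qed

section \<open>Changes of coordinates\<close>

text \<open>The library's change of variables theorem needs a well-ordered index type; this copy of
  an arbitrary finite index type carries the order of an initial segment of \<open>nat\<close>.\<close>

typedef ('n::finite) ordered_index = "{..<CARD('n)}"
  by (rule exI[of _ 0]) simp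

instantiation ordered_index :: (finite) wellorder
begin

definition less_eq_ordered_index :: "'a ordered_index \<Rightarrow> 'a ordered_index \<Rightarrow> bool" where
  "less_eq_ordered_index x y \<longleftrightarrow> Rep_ordered_index x \<le> Rep_ordered_index y"
definition less_ordered_index :: "'a ordered_index \<Rightarrow> 'a ordered_index \<Rightarrow> bool" where
  "less_ordered_index x y \<longleftrightarrow> Rep_ordered_index x < Rep_ordered_index y"

instance
proof
  fix P :: "'a ordered_index \<Rightarrow> bool" and a
  assume step: "\<And>x. (\<And>y. y < x \<Longrightarrow> P y) \<Longrightarrow> P x"
  have "\<forall>a. Rep_ordered_index a = n \<longrightarrow> P a" for n
  proof (induction n rule: less_induct)
    case (less n)
    show ?case
    proof (intro allI impI)
      fix a :: "'a ordered_index" assume a: "Rep_ordered_index a = n"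
      show "P a"
      proof (rule step)
        fix y assume "y < a"
        then have "Rep_ordered_index y < n" using a by (simp add: less_ordered_index_def)
        then show "P y" using less.IH by blast
      qed
    qed
  qed
  then show "P a" by blast
qed (auto simp: less_eq_ordered_index_def less_ordered_index_def Rep_ordered_index_inject)

end

instance ordered_index :: (finite) finite
proof
  have "(UNIV :: 'a ordered_index set) = Abs_ordered_index ` {..<CARD('a)}"
    by (metis type_definition.Abs_image type_definition_ordered_index)
  then show "finite (UNIV :: 'a ordered_index set)" by (metis finite_imageI finite_lessThan)
qed

lemma card_ordered_index: "CARD('n::finite ordered_index) = CARD('n)"
  using type_definition.card[OF type_definition_ordered_index] by simp

section \<open>Permutation of coordinates\<close>

definition reindex :: "('m::finite \<Rightarrow> 'n::finite) \<Rightarrow> real^'n \<Rightarrow> real^'m" where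
  "reindex b x = (\<chi> i. x $ b i)"

lemma linear_reindex: "linear (reindex b)"
  by (rule linearI) (simp_all add: reindex_def vec_eq_iff)

lemma bounded_linear_reindex: "bounded_linear (reindex b)"
  using linear_reindex by (simp add: linear_conv_bounded_linear)

lemma reindex_inverse: "(\<And>i. c (b i) = i) \<Longrightarrow> reindex b (reindex c x) = x"
  by (simp add: reindex_def vec_eq_iff)

lemma borel_measurable_reindex [measurable]: "reindex b \<in> borel_measurable borel"
  by (intro borel_measurable_continuous_onI linear_continuous_on bounded_linear_reindex)

lemma prod_Basis_vec:
  fixes f :: "real^'n \<Rightarrow> real"
  shows "(\<Prod>e\<in>Basis. f e) = (\<Prod>i\<in>UNIV. f (axis i 1))"
proof -
  have B: "(Basis :: (real^'n) set) = (\<lambda>i. axis i 1) ` UNIV" by (auto simp: Basis_vec_def)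
  have "inj (\<lambda>i::'n. axis i (1::real))" by (simp add: inj_on_def axis_eq_axis)
  then show ?thesis unfolding B by (subst prod.reindex) auto
qed

text \<open>Permuting coordinates takes boxes to boxes with the same product of side lengths, and
  Lebesgue measure is determined by its values on boxes.\<close>

lemma distr_reindex:
  fixes b :: "'m::finite \<Rightarrow> 'n::finite"
  assumes b: "bij b"
  shows "distr lborel borel (reindex b) = lborel"
proof (rule lborel_eqI[symmetric])
  fix l u :: "real^'m"
  assume le: "\<And>e. e \<in> Basis \<Longrightarrow> l \<bullet> e \<le> u \<bullet> e"
  define c where "c = inv b"
  have bc: "b (c i) = i" "c (b j) = j" for i j
    unfolding c_def using b by (auto simp: bij_is_surj surj_f_inv_f bij_is_inj)
  have "reindex b -` box l u = box (reindex c l) (reindex c u)"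
  proof (intro set_eqI iffI)
    fix x
    assume "x \<in> reindex b -` box l u"
    then have *: "l $ i < x $ b i" "x $ b i < u $ i" for i by (auto simp: mem_box_cart reindex_def)
    then show "x \<in> box (reindex c l) (reindex c u)"
      using *[of "c _"] by (auto simp: mem_box_cart reindex_def bc)
  next
    fix x
    assume "x \<in> box (reindex c l) (reindex c u)"
    then have *: "l $ c j < x $ j" "x $ j < u $ c j" for j by (auto simp: mem_box_cart reindex_def)
    then show "x \<in> reindex b -` box l u"
      using *[of "b _"] by (auto simp: mem_box_cart reindex_def bc)
  qed
  then have "emeasure (distr lborel borel (reindex b)) (box l u) = emeasure lborel (box (reindex c l) (reindex c u))"
    by (subst emeasure_distr) auto
  also have "\<dots> = (\<Prod>e\<in>Basis. (reindex c u - reindex c l) \<bullet> e)"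
  proof (rule emeasure_lborel_box)
    fix e :: "real^'n" assume "e \<in> Basis"
    then obtain i where e: "e = axis i 1" by (auto simp: Basis_vec_def)
    have "axis (c i) 1 \<in> (Basis :: (real^'m) set)" by (auto simp: Basis_vec_def)
    from le[OF this] show "reindex c l \<bullet> e \<le> reindex c u \<bullet> e"
      using e by (simp add: inner_axis reindex_def)
  qed
  also have "(\<Prod>e\<in>Basis. (reindex c u - reindex c l) \<bullet> e) = (\<Prod>j\<in>UNIV. (u - l) $ c j)"
    by (simp add: prod_Basis_vec inner_axis reindex_def)
  also have "\<dots> = (\<Prod>i\<in>UNIV. (u - l) $ i)"
    by (rule prod.reindex_bij_betw) (use b in \<open>simp add: c_def bij_imp_bij_inv\<close>)
  also have "\<dots> = (\<Prod>e\<in>Basis. (u - l) \<bullet> e)"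
    by (simp add: prod_Basis_vec inner_axis)
  finally show "emeasure (distr lborel borel (reindex b)) (box l u) = ennreal (\<Prod>e\<in>Basis. (u - l) \<bullet> e)" .
qed simp

text \<open>Measurability between completed measures requires that preimages of null sets be null,
  which is where invariance of the measure enters.\<close>

lemma measurable_lebesgue_reindex:
  fixes b :: "'m::finite \<Rightarrow> 'n::finite"
  assumes b: "bij b"
  shows "reindex b \<in> measurable lebesgue lebesgue"
proof (rule completion.measurable_completion2)
  have m: "reindex b \<in> measurable lborel lborel" by simp
  then show mc: "reindex b \<in> measurable lebesgue lborel" by (rule measurable_completion)
  show "null_sets lborel \<subseteq> null_sets (distr lebesgue lborel (reindex b))"
  proof
    fix N :: "(real^'m) set" assume N: "N \<in> null_sets lborel"
    have Nb: "N \<in> sets borel" using N by auto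
    have "emeasure (distr lebesgue lborel (reindex b)) N = emeasure lebesgue (reindex b -` N)"
      using Nb mc by (subst emeasure_distr) auto
    also have "\<dots> = emeasure lborel (reindex b -` N)"
      using measurable_sets[OF borel_measurable_reindex[of b] Nb] by (simp add: emeasure_completion)
    also have "\<dots> = emeasure (distr lborel borel (reindex b)) N"
      using Nb by (subst emeasure_distr) auto
    also have "\<dots> = 0" using N distr_reindex[OF b] by auto
    finally show "N \<in> null_sets (distr lebesgue lborel (reindex b))" using Nb by auto
  qed
qed

lemma lebesgue_integral_reindex:
  fixes b :: "'m::finite \<Rightarrow> 'n::finite" and f :: "real^'m \<Rightarrow> real"
  assumes b: "bij b" and f: "integrable lebesgue f"
  shows "integrable lebesgue (\<lambda>x. f (reindex b x))" "(\<integral>x. f (reindex b x) \<partial>lebesgue) = (\<integral>x. f x \<partial>lebesgue)"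
proof -
  obtain g where g[measurable]: "g \<in> borel_measurable lborel" and ae: "AE x in lborel. f x = g x"
    using completion_ex_borel_measurable_real[of f lborel] f by blast
  have aeL: "AE x in lebesgue. f x = g x" using ae by (rule AE_completion)
  have gl: "g \<in> borel_measurable lebesgue" using g by (rule measurable_completion)
  have gi: "integrable lebesgue g" using f gl aeL by (subst integrable_cong_AE[of _ _ f]) auto
  then have gi': "integrable lborel g" using g by (simp add: integrable_completion)
  have rm: "reindex b \<in> measurable lborel borel" by simp
  have "AE x in distr lborel borel (reindex b). f x = g x" by (subst distr_reindex[OF b]) (rule ae)
  then have "AE x in lborel. f (reindex b x) = g (reindex b x)"
    using AE_distrD[OF rm] by blast
  then have ae': "AE x in lebesgue. f (reindex b x) = g (reindex b x)" by (rule AE_completion)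
  have gb: "g \<in> borel_measurable borel" using g by simp
  have gr: "(\<lambda>x. g (reindex b x)) \<in> borel_measurable lborel" using gb by measurable
  have "integrable (distr lborel borel (reindex b)) g" using gi' distr_reindex[OF b] by simp
  then have i1: "integrable lborel (\<lambda>x. g (reindex b x))" by (subst (asm) integrable_distr_eq) (use gb in auto)
  have "(\<integral>x. g x \<partial>distr lborel borel (reindex b)) = (\<integral>x. g (reindex b x) \<partial>lborel)"
    by (rule integral_distr) (use gb in auto)
  then have i2: "(\<integral>x. g x \<partial>lborel) = (\<integral>x. g (reindex b x) \<partial>lborel)" using distr_reindex[OF b] by simp
  have grl: "(\<lambda>x. g (reindex b x)) \<in> borel_measurable lebesgue" using gr by (rule measurable_completion)
  have frl: "(\<lambda>x. f (reindex b x)) \<in> borel_measurable lebesgue"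
    by (rule measurable_compose[OF measurable_lebesgue_reindex[OF b]]) (use f in auto)
  show "integrable lebesgue (\<lambda>x. f (reindex b x))"
    using i1 gr grl frl ae' by (subst integrable_cong_AE[of _ _ "\<lambda>x. g (reindex b x)"]) (auto simp: integrable_completion)
  have "(\<integral>x. f (reindex b x) \<partial>lebesgue) = (\<integral>x. g (reindex b x) \<partial>lebesgue)"
    using ae' grl frl by (intro integral_cong_AE) auto
  also have "\<dots> = (\<integral>x. g (reindex b x) \<partial>lborel)" using gr by (simp add: integral_completion)
  also have "\<dots> = (\<integral>x. g x \<partial>lborel)" using i2 by simp
  also have "\<dots> = (\<integral>x. g x \<partial>lebesgue)" using g by (simp add: integral_completion)
  also have "\<dots> = (\<integral>x. f x \<partial>lebesgue)" using aeL gl f by (intro integral_cong_AE) auto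
  finally show "(\<integral>x. f (reindex b x) \<partial>lebesgue) = (\<integral>x. f x \<partial>lebesgue)" .
qed

text \<open>In the Leibniz formula a permutation of the old index type is transported to the new one
  by conjugation with \<open>b\<close>, which preserves its sign.\<close>

lemma det_reindex:
  fixes A :: "real^'n^'n" and b :: "'m::finite \<Rightarrow> 'n::finite"
  assumes b: "bij b"
  shows "det (\<chi> i j. A $ b i $ b j) = det A"
proof -
  let ?mp = "map_permutation (UNIV::'m set) b"
  define c where "c = inv b"
  have bc: "b (c i) = i" "c (b j) = j" for i j
    unfolding c_def using b by (auto simp: bij_is_surj surj_f_inv_f bij_is_inj)
  have inj: "inj_on b UNIV" using b by (simp add: bij_def)
  have mp: "?mp p (b i) = b (p i)" for p i using inj by (simp add: map_permutation_apply)
  have mp_eq: "?mp p = b \<circ> p \<circ> c" for p using mp[of p "c _"] by (simp add: fun_eq_iff bc)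
  have perm: "p permutes UNIV \<longleftrightarrow> bij p" for p :: "'k \<Rightarrow> 'k" by (simp add: permutes_def bij_iff)
  have cb: "bij c" using b by (simp add: c_def bij_imp_bij_inv)
  have bb: "bij_betw ?mp {p. p permutes (UNIV::'m set)} {p. p permutes (UNIV::'n set)}"
    by (rule bij_betw_byWitness[where f' = "\<lambda>q. c \<circ> q \<circ> b"])
       (use b cb in \<open>auto simp: mp_eq perm bc fun_eq_iff intro!: bij_comp\<close>)
  have "det (\<chi> i j. A $ b i $ b j) = (\<Sum>p | p permutes (UNIV::'m set). of_int (sign p) * (\<Prod>i\<in>UNIV. A $ b i $ b (p i)))"
    by (simp add: det_def)
  also have "\<dots> = (\<Sum>p | p permutes (UNIV::'m set). of_int (sign (?mp p)) * (\<Prod>i\<in>UNIV. A $ i $ ?mp p i))"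
  proof (rule sum.cong[OF refl])
    fix p assume "p \<in> {p. p permutes (UNIV::'m set)}"
    then have "sign (?mp p) = sign p" using sign_map_permutation[OF inj, of p] by simp
    moreover have "(\<Prod>i\<in>UNIV. A $ i $ ?mp p i) = (\<Prod>i\<in>UNIV. A $ b i $ ?mp p (b i))"
      by (rule prod.reindex_bij_betw[symmetric]) (use b in simp)
    ultimately show "of_int (sign p) * (\<Prod>i\<in>UNIV. A $ b i $ b (p i)) = of_int (sign (?mp p)) * (\<Prod>i\<in>UNIV. A $ i $ ?mp p i)"
      by (simp add: mp)
  qed
  also have "\<dots> = (\<Sum>p | p permutes (UNIV::'n set). of_int (sign p) * (\<Prod>i\<in>UNIV. A $ i $ p i))"
    by (rule sum.reindex_bij_betw[OF bb])
  also have "\<dots> = det A" by (simp add: det_def)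
  finally show ?thesis .
qed

section \<open>Change of variables and diffeomorphisms\<close>

lemma absolutely_integrable_vec1:
  fixes h :: "'a::euclidean_space \<Rightarrow> real^1"
  shows "(\<lambda>x. h x $ 1) absolutely_integrable_on T \<longleftrightarrow> h absolutely_integrable_on T"
  by (subst absolutely_integrable_componentwise_iff[where f = h]) (auto simp: Basis_vec_def inner_axis UNIV_1)

lemma integral_vec1:
  fixes h :: "'a::euclidean_space \<Rightarrow> real^1"
  assumes "h integrable_on T"
  shows "integral T h $ 1 = integral T (\<lambda>x. h x $ 1)"
  using integral_component_eq_cart[OF assms, of 1] by simp

text \<open>The scalar integrand is wrapped as a \<open>real^1\<close>-valued one, the form in which
  \<open>has_absolute_integral_change_of_variables\<close> is applied.\<close>

lemma change_of_variables_ordered: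
  fixes f :: "real^'m::{finite,wellorder} \<Rightarrow> real" and g :: "real^'m::_ \<Rightarrow> real^'m::_"
  assumes S: "S \<in> sets lebesgue" and g: "\<And>x. x \<in> S \<Longrightarrow> (g has_derivative g' x) (at x within S)" and inj: "inj_on g S"
    and f: "set_integrable lebesgue (g ` S) f"
  shows "set_integrable lebesgue S (\<lambda>x. \<bar>det (matrix (g' x))\<bar> * f (g x))"
    "(LINT x:S|lebesgue. \<bar>det (matrix (g' x))\<bar> * f (g x)) = (LINT x:g ` S|lebesgue. f x)"
proof -
  let ?v = "\<lambda>x. vec (f x) :: real^1"
  note nth = absolutely_integrable_vec1 and comp = integral_vec1
  have va: "?v absolutely_integrable_on (g ` S)" using f nth[where h = ?v and T = "g ` S"] by simp
  have *: "(\<lambda>x. \<bar>det (matrix (g' x))\<bar> *\<^sub>R ?v (g x)) absolutely_integrable_on S \<and>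
      integral S (\<lambda>x. \<bar>det (matrix (g' x))\<bar> *\<^sub>R ?v (g x)) = integral (g ` S) ?v"
    using has_absolute_integral_change_of_variables[OF S g inj, of ?v "integral (g ` S) ?v"] va by blast
  then show si: "set_integrable lebesgue S (\<lambda>x. \<bar>det (matrix (g' x))\<bar> * f (g x))"
    using nth[where h = "\<lambda>x. \<bar>det (matrix (g' x))\<bar> *\<^sub>R ?v (g x)" and T = S] by simp
  have i1: "?v integrable_on (g ` S)" "(\<lambda>x. \<bar>det (matrix (g' x))\<bar> *\<^sub>R ?v (g x)) integrable_on S"
    using va * set_lebesgue_integral_eq_integral(1) by blast+
  have "integral S (\<lambda>x. \<bar>det (matrix (g' x))\<bar> * f (g x)) = integral (g ` S) f"
    using arg_cong[where f = "\<lambda>v. v $ 1", OF conjunct2[OF *]] comp[OF i1(1)] comp[OF i1(2)] by simp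
  then show "(LINT x:S|lebesgue. \<bar>det (matrix (g' x))\<bar> * f (g x)) = (LINT x:g ` S|lebesgue. f x)"
    using set_lebesgue_integral_eq_integral(2)[OF si] set_lebesgue_integral_eq_integral(2)[OF f] by simp
qed

text \<open>Conjugating \<open>g\<close> with a relabelling of the coordinates moves the problem to
  the ordered index type. The relabelling preserves Lebesgue integrals, and by
  \<open>det_reindex\<close> it does not alter the Jacobian determinant.\<close>

lemma change_of_variables:
  fixes f :: "real^'n \<Rightarrow> real" and g :: "real^'n \<Rightarrow> real^'n"
  assumes S: "S \<in> sets lebesgue" and g: "\<And>x. x \<in> S \<Longrightarrow> (g has_derivative g' x) (at x)" and inj: "inj_on g S"
    and f: "set_integrable lebesgue (g ` S) f"
  shows "set_integrable lebesgue S (\<lambda>x. \<bar>det (matrix (g' x))\<bar> * f (g x))"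
    "(LINT x:S|lebesgue. \<bar>det (matrix (g' x))\<bar> * f (g x)) = (LINT x:g ` S|lebesgue. f x)"
proof -
  obtain b :: "'n ordered_index \<Rightarrow> 'n" where b: "bij b"
    using finite_same_card_bij[of "UNIV :: 'n ordered_index set" "UNIV :: 'n set"] card_ordered_index by auto
  define c where "c = inv b"
  have bc: "b (c i) = i" "c (b j) = j" for i j
    unfolding c_def using b by (auto simp: bij_is_surj surj_f_inv_f bij_is_inj)
  have c: "bij c" using b by (simp add: c_def bij_imp_bij_inv)
  let ?R = "reindex b" and ?Q = "reindex c"
  have RQ: "?R (?Q x) = x" "?Q (?R y) = y" for x y by (simp_all add: reindex_inverse bc)
  let ?S = "?R ` S"
  have mem: "x \<in> ?R ` T \<longleftrightarrow> ?Q x \<in> T" for x T using RQ by (metis image_iff)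
  have ind: "indicat_real (?R ` T) x = indicat_real T (?Q x)" for x T using mem by (simp add: indicator_def)
  define G where "G x = ?R (g (?Q x))" for x
  define G' where "G' x v = ?R (g' (?Q x) (?Q v))" for x v
  have GS: "G ` ?S = ?R ` (g ` S)" by (auto simp: G_def RQ image_image)
  have S': "?S \<in> sets lebesgue"
  proof -
    have "?R ` S = ?Q -` S" using mem by auto
    moreover have "?Q \<in> measurable lebesgue lebesgue" by (rule measurable_lebesgue_reindex[OF c])
    ultimately show ?thesis using measurable_sets[of ?Q lebesgue lebesgue S] S by simp
  qed
  have f': "set_integrable lebesgue (G ` ?S) (\<lambda>x. f (?Q x))"
    using lebesgue_integral_reindex(1)[OF c f[unfolded set_integrable_def]]
    unfolding GS set_integrable_def ind by simp
  have dG: "(G has_derivative G' x) (at x within ?S)" if "x \<in> ?S" for x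
  proof -
    have "(g has_derivative g' (?Q x)) (at (?Q x))" using g mem that by blast
    from has_derivative_compose[OF bounded_linear_imp_has_derivative[OF bounded_linear_reindex] this]
    have "((\<lambda>x. g (?Q x)) has_derivative (\<lambda>v. g' (?Q x) (?Q v))) (at x)" .
    from bounded_linear.has_derivative[OF bounded_linear_reindex[of b] this]
    show ?thesis unfolding G_def[abs_def] G'_def[abs_def] by (rule has_derivative_at_withinI)
  qed
  have injG: "inj_on G ?S"
  proof (rule inj_onI)
    fix x y assume xy: "x \<in> ?S" "y \<in> ?S" "G x = G y"
    then have "g (?Q x) = g (?Q y)" unfolding G_def using RQ(2) by metis
    then have "?Q x = ?Q y" using inj xy mem by (simp add: inj_on_def)
    then show "x = y" using RQ(1) by metis
  qed
  have det: "det (matrix (G' (?R x))) = det (matrix (g' x))" for x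
  proof -
    have ax: "?Q (axis j 1) = axis (b j) 1" for j
      by (auto simp: reindex_def axis_def vec_eq_iff bc)
    have "matrix (G' (?R x)) = (\<chi> i j. matrix (g' x) $ b i $ b j)"
      by (simp add: matrix_def G'_def RQ ax) (simp add: reindex_def)
    then show ?thesis using det_reindex[OF b] by metis
  qed
  note cv = change_of_variables_ordered[OF S' dG injG f']
  have eq: "indicat_real ?S (?R x) *\<^sub>R (\<bar>det (matrix (G' (?R x)))\<bar> * f (?Q (G (?R x))))
     = indicat_real S x *\<^sub>R (\<bar>det (matrix (g' x))\<bar> * f (g x))" for x
    unfolding ind det G_def RQ ..
  show "set_integrable lebesgue S (\<lambda>x. \<bar>det (matrix (g' x))\<bar> * f (g x))"
    using lebesgue_integral_reindex(1)[OF b cv(1)[unfolded set_integrable_def]]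
    unfolding eq set_integrable_def .
  have "(LINT x:S|lebesgue. \<bar>det (matrix (g' x))\<bar> * f (g x)) = (LINT x:?S|lebesgue. \<bar>det (matrix (G' x))\<bar> * f (?Q (G x)))"
    using lebesgue_integral_reindex(2)[OF b cv(1)[unfolded set_integrable_def]]
    unfolding eq set_lebesgue_integral_def .
  also have "\<dots> = (LINT x:G ` ?S|lebesgue. f (?Q x))" by (rule cv(2))
  also have "\<dots> = (LINT x:g ` S|lebesgue. f x)"
    using lebesgue_integral_reindex(2)[OF c f[unfolded set_integrable_def]]
    unfolding GS set_lebesgue_integral_def ind .
  finally show "(LINT x:S|lebesgue. \<bar>det (matrix (g' x))\<bar> * f (g x)) = (LINT x:g ` S|lebesgue. f x)" .
qed

lemma set_integrable_imp_set_borel_measurable: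
  fixes f :: "'a \<Rightarrow> real"
  shows "set_integrable M A f \<Longrightarrow> set_borel_measurable M A f"
  unfolding set_integrable_def set_borel_measurable_def by (rule borel_measurable_integrable)

lemma weak_pairing_integrable:
  fixes X :: "real^'n \<Rightarrow> real^'n"
  assumes X: "L_loc 2 S X" and Y: "\<And>K. compact K \<Longrightarrow> K \<subseteq> S \<Longrightarrow> set_integrable lebesgue K Y"
    and \<xi>: "H1C S \<xi> w" and K: "compact K" "K \<subseteq> S"
  shows "set_integrable lebesgue K (\<lambda>y. X y \<bullet> w y + Y y * \<xi> y)"
proof (rule set_integral_add)
  show "set_integrable lebesgue K (\<lambda>y. X y \<bullet> w y)"
    unfolding inner_vec_def inner_real_def
    by (intro set_integrable_sum l2_on_mult_integrable L_loc_2_component[OF X K] L_loc_2_component[OF H1C_D(3)[OF \<xi>] K])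
  have c: "continuous_on K \<xi>" using H1C_D(1)[OF \<xi>] K(2) continuous_on_subset by blast
  obtain B where B: "\<And>x. x \<in> K \<Longrightarrow> \<bar>\<xi> x\<bar> \<le> B" using continuous_compact_bounded[OF K(1) c] by blast
  show "set_integrable lebesgue K (\<lambda>y. Y y * \<xi> y)"
  proof (rule set_integrable_bound_real)
    show "set_integrable lebesgue K (\<lambda>x. \<bar>Y x\<bar> * B)" using Y[OF K] by (intro set_integrable_mult_left set_integrable_abs)
    show "set_borel_measurable lebesgue K (\<lambda>y. Y y * \<xi> y)"
      by (rule set_borel_measurable_mult[OF set_integrable_imp_set_borel_measurable[OF Y[OF K]]
            set_borel_measurable_continuous_compact[OF K(1) c]])
    show "\<bar>Y x * \<xi> x\<bar> \<le> \<bar>Y x\<bar> * B" if "x \<in> K" for x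
      using B[OF that] by (simp add: abs_mult mult_left_mono)
  qed
qed

definition diffeo_on :: "(real^'n) set \<Rightarrow> (real^'n \<Rightarrow> real^'n) \<Rightarrow> (real^'n \<Rightarrow> real^'n^'n) \<Rightarrow> bool" where
  "diffeo_on S T J \<longleftrightarrow> open S \<and> open (T ` S) \<and> inj_on T S \<and>
     (\<forall>y\<in>S. (T has_derivative (\<lambda>v. J y *v v)) (at y)) \<and> continuous_on S J \<and> (\<forall>y\<in>S. det (J y) \<noteq> 0)"

lemma continuous_on_det:
  fixes J :: "'b::topological_space \<Rightarrow> real^'n^'n"
  assumes "continuous_on S J"
  shows "continuous_on S (\<lambda>y. det (J y))"
  unfolding det_def by (intro continuous_intros assms)

lemma diffeo_change_of_variables:
  fixes f :: "real^'n \<Rightarrow> real"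
  assumes T: "diffeo_on S T J" and A: "A \<in> sets lebesgue" "A \<subseteq> S" and f: "set_integrable lebesgue (T ` A) f"
  shows "set_integrable lebesgue A (\<lambda>x. \<bar>det (J x)\<bar> * f (T x))"
    "(LINT x:A|lebesgue. \<bar>det (J x)\<bar> * f (T x)) = (LINT x:T ` A|lebesgue. f x)"
proof -
  have d: "(T has_derivative (\<lambda>v. J y *v v)) (at y)" if "y \<in> A" for y using T A that by (auto simp: diffeo_on_def)
  have inj: "inj_on T A" using T A inj_on_subset by (auto simp: diffeo_on_def)
  from change_of_variables[OF A(1) d inj f]
  show "set_integrable lebesgue A (\<lambda>x. \<bar>det (J x)\<bar> * f (T x))"
    "(LINT x:A|lebesgue. \<bar>det (J x)\<bar> * f (T x)) = (LINT x:T ` A|lebesgue. f x)"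
    by (simp_all add: matrix_of_matrix_vector_mul)
qed

lemma diffeo_l2_on:
  assumes T: "diffeo_on S T J" and K: "compact K" "K \<subseteq> S"
  obtains C where "C > 0" "\<And>f. l2_on (T ` K) f \<Longrightarrow> l2_on K (\<lambda>y. f (T y)) \<and>
     (LINT y:K|lebesgue. (f (T y))\<^sup>2) \<le> C * (LINT y:T ` K|lebesgue. (f y)\<^sup>2)"
proof -
  have Jc: "continuous_on K (\<lambda>y. det (J y))"
    using T K by (intro continuous_on_det) (auto simp: diffeo_on_def intro: continuous_on_subset)
  have nz: "det (J y) \<noteq> 0" if "y \<in> K" for y using T K that by (auto simp: diffeo_on_def)
  have ic: "continuous_on K (\<lambda>y. 1 / \<bar>det (J y)\<bar>)" using nz by (intro continuous_intros Jc) auto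
  obtain C where C: "C > 0" "\<And>y. y \<in> K \<Longrightarrow> \<bar>1 / \<bar>det (J y)\<bar>\<bar> \<le> C" using continuous_compact_bounded[OF K(1) ic] by blast
  have Km: "K \<in> sets lebesgue" using K(1) by (simp add: compact_imp_closed)
  have Tc: "continuous_on S T"
    using T by (auto simp: diffeo_on_def intro!: continuous_at_imp_continuous_on has_derivative_continuous)
  have TK: "compact (T ` K)" using compact_continuous_image[OF continuous_on_subset[OF Tc K(2)] K(1)] .
  show ?thesis
  proof (rule that[OF C(1)])
    fix f :: "real^'a \<Rightarrow> real" assume f: "l2_on (T ` K) f"
    have fi: "set_integrable lebesgue (T ` K) f" by (rule l2_on_set_integrable[OF TK f])
    have f2: "set_integrable lebesgue (T ` K) (\<lambda>y. (f y)\<^sup>2)" using f by (simp add: l2_on_def)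
    note c1 = diffeo_change_of_variables[OF T Km K(2) fi] and c2 = diffeo_change_of_variables[OF T Km K(2) f2]
    \<comment> \<open>The change of variables yields measurability of \<open>f (T y)\<close>
      together with the Jacobian factor, which is then divided out.\<close>
    have "set_borel_measurable lebesgue K (\<lambda>y. (1 / \<bar>det (J y)\<bar>) * (\<bar>det (J y)\<bar> * f (T y)))"
      by (rule set_borel_measurable_mult[OF set_borel_measurable_continuous_compact[OF K(1) ic]
            set_integrable_imp_set_borel_measurable[OF c1(1)]])
    moreover have "indicat_real K y *\<^sub>R ((1 / \<bar>det (J y)\<bar>) * (\<bar>det (J y)\<bar> * f (T y))) = indicat_real K y *\<^sub>R f (T y)" for y
      using nz[of y] by (auto simp: indicator_def)
    ultimately have m: "set_borel_measurable lebesgue K (\<lambda>y. f (T y))" by (simp only: set_borel_measurable_def)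
    have m2: "set_borel_measurable lebesgue K (\<lambda>y. (f (T y))\<^sup>2)"
      unfolding power2_eq_square by (rule set_borel_measurable_mult[OF m m])
    have bd: "(f (T y))\<^sup>2 \<le> C * (\<bar>det (J y)\<bar> * (f (T y))\<^sup>2)" if "y \<in> K" for y
    proof -
      have "1 \<le> C * \<bar>det (J y)\<bar>" using C(2)[OF that] nz[OF that] by (simp add: divide_simps)
      then show ?thesis using mult_right_mono[of 1 "C * \<bar>det (J y)\<bar>" "(f (T y))\<^sup>2"] by (simp add: mult.assoc)
    qed
    have i2: "set_integrable lebesgue K (\<lambda>y. C * (\<bar>det (J y)\<bar> * (f (T y))\<^sup>2))" using c2(1) by simp
    have i1: "set_integrable lebesgue K (\<lambda>y. (f (T y))\<^sup>2)"
      by (rule set_integrable_bound_real[OF i2 m2]) (use bd in auto)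
    have "(LINT y:K|lebesgue. (f (T y))\<^sup>2) \<le> (LINT y:K|lebesgue. C * (\<bar>det (J y)\<bar> * (f (T y))\<^sup>2))"
      by (rule set_integral_mono[OF i1 i2 bd])
    also have "\<dots> = C * (LINT y:T ` K|lebesgue. (f y)\<^sup>2)" using c2(2) by simp
    finally show "l2_on K (\<lambda>y. f (T y)) \<and> (LINT y:K|lebesgue. (f (T y))\<^sup>2) \<le> C * (LINT y:T ` K|lebesgue. (f y)\<^sup>2)"
      using m i1 by (simp add: l2_on_def)
  qed
qed

text \<open>As for the chain rule: the mollifications \<open>F n\<close> composed with
  \<open>T\<close> are classically \<open>C^1\<close>, and \<open>diffeo_l2_on\<close> transports
  the convergence of their gradients. The covector \<open>w\<close> is pulled back by the transposed
  Jacobian.\<close>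

lemma H1C_compose:
  fixes h :: "real^'n \<Rightarrow> real"
  assumes T: "diffeo_on S T J" and H: "H1C (T ` S) h w"
  shows "H1C S (\<lambda>y. h (T y)) (\<lambda>y. transpose (J y) *v w (T y))"
  unfolding H1C_def
proof (intro conjI)
  note h = H1C_D[OF H]
  have S: "open S" and TS: "open (T ` S)" and dT: "\<And>y. y \<in> S \<Longrightarrow> (T has_derivative (\<lambda>v. J y *v v)) (at y)"
    and Jc: "continuous_on S J" using T by (auto simp: diffeo_on_def)
  have Tc: "continuous_on S T"
    using dT by (auto intro!: continuous_at_imp_continuous_on has_derivative_continuous)
  have Jc': "continuous_on S (\<lambda>y. J y $ j $ k)" for j k by (intro continuous_intros Jc)
  show "continuous_on S (\<lambda>y. h (T y))" by (rule continuous_on_compose2[OF h(1) Tc]) auto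
  have comp: "(transpose (J y) *v q) $ k = (\<Sum>j\<in>UNIV. J y $ j $ k * q $ j)" for y k q
    by (simp add: matrix_vector_mult_def transpose_def)
  have TK: "compact (T ` K)" "T ` K \<subseteq> T ` S" if "compact K" "K \<subseteq> S" for K
    using compact_continuous_image[OF continuous_on_subset[OF Tc that(2)] that(1)] that by auto
  have wl: "l2_on K (\<lambda>y. w (T y) $ j)" if K: "compact K" "K \<subseteq> S" for K j
  proof -
    obtain C where "\<And>f. l2_on (T ` K) f \<Longrightarrow> l2_on K (\<lambda>y. f (T y)) \<and>
     (LINT y:K|lebesgue. (f (T y))\<^sup>2) \<le> C * (LINT y:T ` K|lebesgue. (f y)\<^sup>2)"
      using diffeo_l2_on[OF T K] by blast
    from this[of "\<lambda>z. w z $ j"] show ?thesis using L_loc_2_component[OF h(3) TK[OF K]] by blast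
  qed
  show "L_loc 2 S (\<lambda>y. transpose (J y) *v w (T y))"
  proof (rule L_loc_2_I)
    fix K :: "(real^'n) set" and k assume K: "compact K" "K \<subseteq> S"
    show "l2_on K (\<lambda>y. (transpose (J y) *v w (T y)) $ k)"
      unfolding comp
      by (intro l2_on_sum K l2_on_continuous_mult wl continuous_on_subset[OF Jc']) auto
  qed
  show "weak_gradient_on S (\<lambda>y. h (T y)) (\<lambda>y. transpose (J y) *v w (T y))"
    unfolding weak_gradient_on_def
  proof (intro allI impI)
    fix \<psi> k assume t: "test_function S \<psi>"
    obtain K where K: "compact K" "K \<subseteq> S" "\<And>x. x \<notin> K \<Longrightarrow> \<psi> x = 0" "\<And>x k. x \<notin> K \<Longrightarrow> partials \<psi> x $ k = 0"
      "continuous_on UNIV \<psi>" "\<And>k. continuous_on UNIV (\<lambda>x. partials \<psi> x $ k)" "test_function K \<psi>"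
      using test_function_support[OF t] by metis
    have \<psi>K: "continuous_on K \<psi>" "continuous_on K (\<lambda>x. partials \<psi> x $ k)" using K(5,6) continuous_on_subset by blast+
    note TKK = TK[OF K(1,2)]
    obtain F where F: "\<And>n. smooth_on UNIV (F n)" "uniform_limit (T ` K) F h sequentially"
      "\<And>k. (\<lambda>n. LINT y:T ` K|lebesgue. (partials (F n) y $ k - w y $ k)\<^sup>2) \<longlonglongrightarrow> 0"
      by (rule weak_gradient_approx[OF TS h TKK]) (rule that)
    obtain C where C: "C > 0" "\<And>f. l2_on (T ` K) f \<Longrightarrow> l2_on K (\<lambda>y. f (T y)) \<and>
     (LINT y:K|lebesgue. (f (T y))\<^sup>2) \<le> C * (LINT y:T ` K|lebesgue. (f y)\<^sup>2)"
      using diffeo_l2_on[OF T K(1,2)] by blast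
    have Fc: "continuous_on A (F n)" for A n by (rule smooth_on_continuous[OF F(1)])
    have Fpc: "continuous_on A (\<lambda>y. partials (F n) y $ j)" for A n j
      using smooth_on_continuous[OF smooth_on_deriv[OF F(1)]] by (simp add: partials_def)
    have pl: "l2_on K (\<lambda>y. partials (F n) (T y) $ j)" for n j
      using C(2)[OF l2_on_continuous[OF TKK(1) Fpc]] by blast
    have dl: "l2_on (T ` K) (\<lambda>y. partials (F n) y $ j - w y $ j)" for n j
      by (intro l2_on_diff l2_on_continuous[OF TKK(1) Fpc] L_loc_2_component[OF h(3) TKK])
    have lim: "(\<lambda>n. LINT y:K|lebesgue. (partials (F n) (T y) $ j - w (T y) $ j)\<^sup>2) \<longlonglongrightarrow> 0" for j
    proof (rule tendsto_sandwich[OF _ _ tendsto_const])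
      show "eventually (\<lambda>n. 0 \<le> (LINT y:K|lebesgue. (partials (F n) (T y) $ j - w (T y) $ j)\<^sup>2)) sequentially"
        unfolding set_lebesgue_integral_def by (intro always_eventually allI Bochner_Integration.integral_nonneg) auto
      show "eventually (\<lambda>n. (LINT y:K|lebesgue. (partials (F n) (T y) $ j - w (T y) $ j)\<^sup>2)
         \<le> C * (LINT y:T ` K|lebesgue. (partials (F n) y $ j - w y $ j)\<^sup>2)) sequentially"
        using C(2)[OF dl] by (intro always_eventually allI) blast
      show "(\<lambda>n. C * (LINT y:T ` K|lebesgue. (partials (F n) y $ j - w y $ j)\<^sup>2)) \<longlonglongrightarrow> 0"
        using tendsto_mult[OF tendsto_const[of C] F(3)[of j]] by simp
    qed
    have FT: "continuous_on S (\<lambda>y. F n (T y))" for n by (rule continuous_on_compose2[OF Fc[of UNIV] Tc]) auto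
    have parts: "(LINT y:K|lebesgue. F n (T y) * partials \<psi> y $ k)
       = - (\<Sum>j\<in>UNIV. LINT y:K|lebesgue. (J y $ j $ k * \<psi> y) * partials (F n) (T y) $ j)" for n
    proof -
      have der: "((\<lambda>y. F n (T y)) has_derivative (\<lambda>v. partials (F n) (T y) \<bullet> (J y *v v))) (at y)" if "y \<in> S" for y
      proof -
        have "(F n has_derivative frechet_derivative (F n) (at (T y))) (at (T y))"
          using smooth_on_differentiable[OF F(1)] frechet_derivative_works by blast
        from has_derivative_compose[OF dT[OF that] this]
        show ?thesis using has_derivative_partials[OF smooth_on_differentiable[OF F(1)]] by simp
      qed
      have e: "partials (F n) (T y) \<bullet> (J y *v axis k 1) = (\<Sum>j\<in>UNIV. J y $ j $ k * partials (F n) (T y) $ j)" for y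
        by (simp add: inner_vec_def matrix_vector_mult_basis column_def mult.commute)
      have pTc: "continuous_on S (\<lambda>y. partials (F n) (T y) $ j)" for j
        by (rule continuous_on_compose2[OF Fpc[of UNIV] Tc]) auto
      have "continuous_on S (\<lambda>y. partials (F n) (T y) \<bullet> (J y *v axis k 1))"
        unfolding e by (intro continuous_intros Jc' pTc)
      from C1_integration_by_parts[OF S der this t]
      have "(\<integral>y. F n (T y) * partials \<psi> y $ k \<partial>lebesgue)
         = - (\<integral>y. (partials (F n) (T y) \<bullet> (J y *v axis k 1)) * \<psi> y \<partial>lebesgue)"
        by (simp only: partials_def vec_lambda_beta)
      also have "\<dots> = - (\<integral>y. (\<Sum>j\<in>UNIV. (J y $ j $ k * \<psi> y) * partials (F n) (T y) $ j) \<partial>lebesgue)"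
        by (simp only: e sum_distrib_right sum_distrib_left mult_ac)
      finally have fin: "(\<integral>y. F n (T y) * partials \<psi> y $ k \<partial>lebesgue) = - (\<integral>y. (\<Sum>j\<in>UNIV. (J y $ j $ k * \<psi> y) * partials (F n) (T y) $ j) \<partial>lebesgue)" .
      have "(\<integral>y. F n (T y) * partials \<psi> y $ k \<partial>lebesgue) = (LINT y:K|lebesgue. F n (T y) * partials \<psi> y $ k)"
        by (rule integral_eq_set_integral(1)) (simp add: K(4))
      moreover have "(\<integral>y. (\<Sum>j\<in>UNIV. (J y $ j $ k * \<psi> y) * partials (F n) (T y) $ j) \<partial>lebesgue)
        = (LINT y:K|lebesgue. (\<Sum>j\<in>UNIV. (J y $ j $ k * \<psi> y) * partials (F n) (T y) $ j))"
        by (rule integral_eq_set_integral(1)) (simp add: K(3))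
      moreover have "(LINT y:K|lebesgue. (\<Sum>j\<in>UNIV. (J y $ j $ k * \<psi> y) * partials (F n) (T y) $ j))
        = (\<Sum>j\<in>UNIV. LINT y:K|lebesgue. (J y $ j $ k * \<psi> y) * partials (F n) (T y) $ j)"
        by (intro set_integral_sum l2_on_mult_integrable pl l2_on_continuous K continuous_on_mult \<psi>K continuous_on_subset[OF Jc'])
      ultimately show ?thesis using fin by (simp only:)
    qed
    have hT: "\<bar>h (T y)\<bar> \<le> B" if "B \<ge> 0" "\<And>z. z \<in> T ` K \<Longrightarrow> \<bar>h z\<bar> \<le> B" "y \<in> K" for B y using that by blast
    obtain B where B: "B > 0" "\<And>z. z \<in> T ` K \<Longrightarrow> \<bar>h z\<bar> \<le> B"
      using continuous_compact_bounded[OF TKK(1) continuous_on_subset[OF h(1) TKK(2)]] by blast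
    have 1: "(\<lambda>n. LINT y:K|lebesgue. F n (T y) * partials \<psi> y $ k) \<longlonglongrightarrow> (LINT y:K|lebesgue. h (T y) * partials \<psi> y $ k)"
    proof (rule tendsto_set_integral_bounded_mult[OF K(1), where C = "B + 1"])
      have "\<forall>\<^sub>F n in sequentially. \<forall>z\<in>T ` K. dist (F n z) (h z) < 1" by (rule uniform_limitD[OF F(2)]) simp
      then show "\<forall>\<^sub>F n in sequentially. \<forall>x\<in>K. \<bar>F n (T x)\<bar> \<le> B + 1"
      proof eventually_elim
        case (elim n)
        show ?case
        proof
          fix x assume "x \<in> K"
          then show "\<bar>F n (T x)\<bar> \<le> B + 1" using elim B(2)[of "T x"] by (force simp: dist_norm)
        qed
      qed
      show "(\<lambda>n. F n (T x)) \<longlonglongrightarrow> h (T x)" if "x \<in> K" for x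
        using tendsto_uniform_limitI[OF F(2), of "T x"] that by simp
      show "set_borel_measurable lebesgue K (\<lambda>y. F n (T y))" for n
        by (intro set_borel_measurable_continuous_compact K continuous_on_subset[OF FT])
    qed (auto intro!: l2_on_continuous[OF K(1) \<psi>K(2)])
    have 2: "(\<lambda>n. \<Sum>j\<in>UNIV. LINT y:K|lebesgue. (J y $ j $ k * \<psi> y) * partials (F n) (T y) $ j)
       \<longlonglongrightarrow> (\<Sum>j\<in>UNIV. LINT y:K|lebesgue. (J y $ j $ k * \<psi> y) * w (T y) $ j)"
      by (intro tendsto_sum tendsto_set_integral_l2_mult pl wl[OF K(1,2)] lim l2_on_continuous K continuous_on_mult \<psi>K continuous_on_subset[OF Jc'])
    have "(LINT y:K|lebesgue. h (T y) * partials \<psi> y $ k) = - (\<Sum>j\<in>UNIV. LINT y:K|lebesgue. (J y $ j $ k * \<psi> y) * w (T y) $ j)"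
      using LIMSEQ_unique[OF 1[unfolded parts] tendsto_minus[OF 2]] .
    also have "(\<Sum>j\<in>UNIV. LINT y:K|lebesgue. (J y $ j $ k * \<psi> y) * w (T y) $ j)
       = (LINT y:K|lebesgue. (\<Sum>j\<in>UNIV. (J y $ j $ k * \<psi> y) * w (T y) $ j))"
      by (intro set_integral_sum[symmetric] l2_on_mult_integrable wl[OF K(1,2)] l2_on_continuous K continuous_on_mult \<psi>K continuous_on_subset[OF Jc'])
    also have "\<dots> = (\<integral>y. (\<Sum>j\<in>UNIV. (J y $ j $ k * \<psi> y) * w (T y) $ j) \<partial>lebesgue)"
      by (rule integral_eq_set_integral(1)[symmetric]) (simp add: K(3))
    also have "\<dots> = (\<integral>y. (transpose (J y) *v w (T y)) $ k * \<psi> y \<partial>lebesgue)"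
      unfolding comp by (simp add: sum_distrib_left sum_distrib_right mult_ac)
    also have "(LINT y:K|lebesgue. h (T y) * partials \<psi> y $ k) = (\<integral>y. h (T y) * partials \<psi> y $ k \<partial>lebesgue)"
      by (rule integral_eq_set_integral(1)[symmetric]) (simp add: K(4))
    finally show "(\<integral>y. h (T y) * partials \<psi> y $ k \<partial>lebesgue) = - (\<integral>y. (transpose (J y) *v w (T y)) $ k * \<psi> y \<partial>lebesgue)" .
  qed
qed

lemma H1C_subset:
  assumes "H1C S h w" "S' \<subseteq> S"
  shows "H1C S' h w"
proof -
  note h = H1C_D[OF assms(1)]
  have "weak_gradient_on S' h w" using h(2) test_function_mono[OF _ assms(2)] unfolding weak_gradient_on_def by blast
  moreover have "L_loc 2 S' w" using h(3) assms(2) unfolding L_loc_def by blast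
  ultimately show ?thesis using h(1) assms(2) continuous_on_subset unfolding H1C_def by blast
qed

text \<open>Lets the differential of a solution be modified on a null set, as is required to make it
  tensorial at every point.\<close>

lemma H1C_cong_AE:
  fixes w w' :: "real^'n \<Rightarrow> real^'n"
  assumes S: "open S" and h: "H1C S h w" and ae: "AE y in lebesgue. y \<in> S \<longrightarrow> w y = w' y"
  shows "H1C S h w'"
proof -
  note H = H1C_D[OF h]
  have lm: "l2_on K (\<lambda>y. w' y $ k)" if K: "compact K" "K \<subseteq> S" for K k
  proof -
    have l: "l2_on K (\<lambda>y. w y $ k)" by (rule L_loc_2_component[OF H(3) K])
    have ae1: "AE y in lebesgue. indicat_real K y *\<^sub>R w y $ k = indicat_real K y *\<^sub>R w' y $ k"
      using ae by eventually_elim (use K(2) in \<open>auto simp: indicator_def\<close>)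
    have ae2: "AE y in lebesgue. indicat_real K y *\<^sub>R (w y $ k)\<^sup>2 = indicat_real K y *\<^sub>R (w' y $ k)\<^sup>2"
      using ae by eventually_elim (use K(2) in \<open>auto simp: indicator_def\<close>)
    have m: "(\<lambda>y. indicat_real K y *\<^sub>R w' y $ k) \<in> borel_measurable lebesgue"
      by (rule borel_measurable_AE[OF _ ae1]) (use l in \<open>simp add: l2_on_def set_borel_measurable_def\<close>)
    have "(\<lambda>y. (indicat_real K y *\<^sub>R w' y $ k)\<^sup>2) \<in> borel_measurable lebesgue" using m by measurable
    moreover have "(\<lambda>y. (indicat_real K y *\<^sub>R w' y $ k)\<^sup>2) = (\<lambda>y. indicat_real K y *\<^sub>R (w' y $ k)\<^sup>2)"
      by (auto simp: indicator_def fun_eq_iff)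
    ultimately have m2: "(\<lambda>y. indicat_real K y *\<^sub>R (w' y $ k)\<^sup>2) \<in> borel_measurable lebesgue" by simp
    have i: "integrable lebesgue (\<lambda>y. indicat_real K y *\<^sub>R (w y $ k)\<^sup>2)" using l by (simp add: l2_on_def set_integrable_def)
    then have "integrable lebesgue (\<lambda>y. indicat_real K y *\<^sub>R (w' y $ k)\<^sup>2)"
      using ae2 m2 by (subst integrable_cong_AE[of _ _ "\<lambda>y. indicat_real K y *\<^sub>R (w y $ k)\<^sup>2"]) (auto elim: AE_mp)
    then show ?thesis using m by (simp add: l2_on_def set_integrable_def set_borel_measurable_def)
  qed
  then have L: "L_loc 2 S w'" by (rule L_loc_2_I)
  have "weak_gradient_on S h w'"
    unfolding weak_gradient_on_def
  proof (intro allI impI)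
    fix \<psi> k assume t: "test_function S \<psi>"
    obtain K where K: "K \<subseteq> S" "\<And>x. x \<notin> K \<Longrightarrow> \<psi> x = 0" using test_function_support[OF t] by metis
    have "(\<integral>y. w y $ k * \<psi> y \<partial>lebesgue) = (\<integral>y. w' y $ k * \<psi> y \<partial>lebesgue)"
    proof (rule integral_cong_AE)
      show "AE y in lebesgue. w y $ k * \<psi> y = w' y $ k * \<psi> y"
        using ae
      proof eventually_elim
        case (elim y)
        then show ?case using K(1) K(2)[of y] by (cases "y \<in> K") auto
      qed
    qed (use test_integrable(2)[OF t H(3)] test_integrable(2)[OF t L] in auto)
    then show "(\<integral>y. h y * partials \<psi> y $ k \<partial>lebesgue) = - (\<integral>y. w' y $ k * \<psi> y \<partial>lebesgue)"
      using H(2) t unfolding weak_gradient_on_def by simp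
  qed
  then show ?thesis using H(1) L by (simp add: H1C_def)
qed

section \<open>Sobolev functions and densities on the manifold\<close>

locale weighted_manifold_space =
  fixes M :: "('a::{t2_space, second_countable_topology}, 'n::finite) weighted_manifold"
  assumes weighted_manifold: "is_weighted_manifold M"
begin

abbreviation J :: "('a, 'n) chart \<Rightarrow> ('a, 'n) chart \<Rightarrow> 'a \<Rightarrow> real^'n^'n" where
  "J c d x \<equiv> transition_jacobian c d x"

section \<open>Charts, transition maps and their Jacobians\<close>

lemma chartD:
  assumes "c \<in> atlas M"
  shows "open (fst c)" "open (coords c UNIV)" "homeomorphism (fst c) (coords c UNIV) (snd c) (point c)"
  using assms weighted_manifold by (auto simp: is_weighted_manifold_def smooth_atlas_def is_chart_def)

lemma atlas_covers: obtains c where "c \<in> atlas M" "x \<in> fst c"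
proof -
  have "(\<Union>c\<in>atlas M. fst c) = UNIV"
    using weighted_manifold by (simp add: is_weighted_manifold_def smooth_atlas_def)
  then have "x \<in> (\<Union>c\<in>atlas M. fst c)" by simp
  then show ?thesis using that by blast
qed

lemma point_coord:
  assumes "c \<in> atlas M" "x \<in> fst c"
  shows "point c (snd c x) = x" "snd c x \<in> coords c UNIV"
  using homeomorphism_apply1[OF chartD(3)[OF assms(1)] assms(2)] assms(2) by (auto simp: coords_def)

lemma coord_point:
  assumes "c \<in> atlas M" "y \<in> coords c U"
  shows "snd c (point c y) = y" "point c y \<in> fst c" "point c y \<in> U"
proof -
  obtain x where x: "x \<in> fst c" "x \<in> U" "y = snd c x" using assms(2) by (auto simp: coords_def)
  then show "snd c (point c y) = y" "point c y \<in> fst c" "point c y \<in> U"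
    using point_coord[OF assms(1) x(1)] by auto
qed

lemma coords_mono: "U \<subseteq> V \<Longrightarrow> coords c U \<subseteq> coords c V"
  by (auto simp: coords_def)

lemma coords_iff:
  assumes c: "c \<in> atlas M"
  shows "y \<in> coords c U \<longleftrightarrow> y \<in> coords c UNIV \<and> point c y \<in> U"
proof
  assume y: "y \<in> coords c U"
  then have "y \<in> coords c UNIV" using coords_mono[of U UNIV c] by blast
  then show "y \<in> coords c UNIV \<and> point c y \<in> U" using coord_point(3)[OF c y] by simp
next
  assume y: "y \<in> coords c UNIV \<and> point c y \<in> U"
  then have "snd c (point c y) \<in> snd c ` (fst c \<inter> U)" using coord_point(2)[OF c, of y UNIV] by (intro imageI IntI) auto
  then show "y \<in> coords c U" using coord_point(1)[OF c, of y UNIV] y by (simp add: coords_def)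
qed

lemma coords_Int_fst: "coords c (fst c \<inter> U) = coords c U"
  by (auto simp: coords_def)

lemma continuous_on_point: "c \<in> atlas M \<Longrightarrow> continuous_on (coords c UNIV) (point c)"
  using chartD(3) by (auto simp: homeomorphism_def)

lemma continuous_on_coord: "c \<in> atlas M \<Longrightarrow> continuous_on (fst c) (snd c)"
  using chartD(3) by (auto simp: homeomorphism_def)

lemma open_coords:
  assumes "c \<in> atlas M" "open U"
  shows "open (coords c U)"
proof -
  have "coords c U = coords c UNIV \<inter> point c -` U" using coords_iff[OF assms(1)] by auto
  then show ?thesis using continuous_open_preimage[OF continuous_on_point[OF assms(1)] chartD(2)[OF assms(1)] assms(2)] by simp
qed

lemma compact_coords:
  assumes "c \<in> atlas M" "compact K" "K \<subseteq> fst c"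
  shows "compact (coords c K)" "coords c K \<subseteq> coords c UNIV"
proof -
  have "coords c K = snd c ` K" using assms(3) by (auto simp: coords_def)
  then show "compact (coords c K)"
    using compact_continuous_image[OF continuous_on_subset[OF continuous_on_coord[OF assms(1)] assms(3)] assms(2)] by simp
qed (auto simp: coords_def)

lemma compact_point_image:
  assumes "c \<in> atlas M" "compact K" "K \<subseteq> coords c UNIV"
  shows "compact (point c ` K)" "point c ` K \<subseteq> fst c"
  using compact_continuous_image[OF continuous_on_subset[OF continuous_on_point[OF assms(1)] assms(3)] assms(2)]
    coord_point(2)[OF assms(1)] assms(3) by auto

lemma sets_coords:
  assumes "c \<in> atlas M" "B \<in> sets borel"
  shows "coords c B \<in> sets lebesgue"
proof -
  have "(\<lambda>y. point c y) \<in> borel_measurable (restrict_space borel (coords c UNIV))"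
    by (rule borel_measurable_continuous_on_restrict[OF continuous_on_point[OF assms(1)]])
  from measurable_sets[OF this assms(2)]
  have "point c -` B \<inter> coords c UNIV \<in> sets (restrict_space borel (coords c UNIV))"
    by (simp add: space_restrict_space)
  moreover have "coords c UNIV \<in> sets borel" using chartD(2)[OF assms(1)] by simp
  ultimately have "point c -` B \<inter> coords c UNIV \<in> sets borel" by (simp add: sets_restrict_space_iff)
  moreover have "coords c B = point c -` B \<inter> coords c UNIV" using coords_iff[OF assms(1)] by auto
  ultimately show ?thesis by (metis sets_completionI_sets sets_lborel)
qed

lemma transition_simps:
  assumes "c \<in> atlas M" "d \<in> atlas M" "y \<in> coords c (fst d)"
  shows "transition c d y = snd d (point c y)" "point d (transition c d y) = point c y"
    "transition c d y \<in> coords d (fst c)"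
  using coord_point[OF assms(1,3)] point_coord[OF assms(2), of "point c y"]
  by (auto simp: transition_def coords_def)

lemma transition_image:
  assumes c: "c \<in> atlas M" and d: "d \<in> atlas M" and "B \<subseteq> fst c" "B \<subseteq> fst d"
  shows "transition c d ` coords c B = coords d B"
proof
  show "transition c d ` coords c B \<subseteq> coords d B"
  proof
    fix z assume "z \<in> transition c d ` coords c B"
    then obtain y where y: "y \<in> coords c B" "z = transition c d y" by auto
    have "y \<in> coords c (fst d)" using y assms(4) coords_mono by blast
    from transition_simps[OF c d this] coord_point[OF c y(1)] assms(4) y(2)
    show "z \<in> coords d B" by (auto simp: coords_def)
  qed
  show "coords d B \<subseteq> transition c d ` coords c B"
  proof
    fix z assume z: "z \<in> coords d B"
    then obtain x where x: "x \<in> B" "x \<in> fst d" "z = snd d x" by (auto simp: coords_def)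
    then have "snd c x \<in> coords c B" "point c (snd c x) = x" using assms(3) point_coord[OF c, of x] by (auto simp: coords_def)
    then show "z \<in> transition c d ` coords c B" using x by (auto simp: transition_def image_iff intro!: bexI[of _ "snd c x"])
  qed
qed

lemma transition_has_derivative:
  assumes c: "c \<in> atlas M" and d: "d \<in> atlas M" and y: "y \<in> coords c (fst d)"
  shows "(transition c d has_derivative (\<lambda>v. J c d (point c y) *v v)) (at y)"
proof -
  have "smooth_on (coords c (fst d)) (transition c d)"
    using weighted_manifold c d by (auto simp: is_weighted_manifold_def smooth_atlas_def smoothly_compatible_def)
  then have "transition c d differentiable (at y)" using y unfolding smooth_on_def by (metis Ck_on.simps(2))
  then have D: "(transition c d has_derivative frechet_derivative (transition c d) (at y)) (at y)"
    using frechet_derivative_works by blast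
  have "J c d (point c y) *v v = frechet_derivative (transition c d) (at y) v" for v
    unfolding transition_jacobian_def jacobian_def coord_point(1)[OF c y]
    by (rule matrix_works) (simp add: linear_matrix_vector_mul_eq has_derivative_linear[OF D])
  then show ?thesis using D by simp
qed

lemma transition_diffeo:
  assumes c: "c \<in> atlas M" and d: "d \<in> atlas M"
  shows "continuous_on (coords c (fst d)) (\<lambda>y. J c d (point c y))"
proof -
  have sm: "smooth_on (coords c (fst d)) (transition c d)"
    using weighted_manifold c d by (auto simp: is_weighted_manifold_def smooth_atlas_def smoothly_compatible_def)
  then have cont: "continuous_on (coords c (fst d)) (\<lambda>y. frechet_derivative (transition c d) (at y) v)" for v
    unfolding smooth_on_def by (metis Ck_on.simps)
  have "continuous_on (coords c (fst d)) (\<lambda>y. \<chi> i j. frechet_derivative (transition c d) (at y) (axis j 1) $ i)"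
    by (intro continuous_on_vec_lambda continuous_intros cont)
  then show ?thesis
    by (rule continuous_on_eq) (simp add: transition_jacobian_def jacobian_def matrix_def coord_point(1)[OF c])
qed

text \<open>The chain rule: near the coordinates of \<open>x\<close>, on the overlap of the three
  domains, \<open>transition c e\<close> is the composition of the two other transitions.\<close>

lemma jacobian_cocycle:
  assumes c: "c \<in> atlas M" and d: "d \<in> atlas M" and e: "e \<in> atlas M" and x: "x \<in> fst c" "x \<in> fst d" "x \<in> fst e"
  shows "J c e x = J d e x ** J c d x"
proof -
  let ?y = "snd c x"
  have px: "point c ?y = x" by (rule point_coord(1)[OF c x(1)])
  have y: "?y \<in> coords c (fst d)" "?y \<in> coords c (fst e)" "?y \<in> coords c (fst d \<inter> fst e)" using x by (auto simp: coords_def)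
  have ty: "transition c d ?y = snd d x" using transition_simps(1)[OF c d y(1)] px by simp
  have "snd d x \<in> coords d (fst e)" using x by (auto simp: coords_def)
  from transition_has_derivative[OF d e this] point_coord(1)[OF d x(2)]
  have "(transition d e has_derivative (\<lambda>v. J d e x *v v)) (at (transition c d ?y))" by (simp add: ty)
  from has_derivative_compose[OF transition_has_derivative[OF c d y(1), unfolded px] this]
  have "((\<lambda>y. transition d e (transition c d y)) has_derivative (\<lambda>v. J d e x *v (J c d x *v v))) (at ?y)" .
  then have "(transition c e has_derivative (\<lambda>v. J d e x *v (J c d x *v v))) (at ?y)"
  proof (rule has_derivative_transform_within_open[of _ _ _ UNIV "coords c (fst d \<inter> fst e)"])
    show "open (coords c (fst d \<inter> fst e))" using open_coords[OF c] chartD(1)[OF d] chartD(1)[OF e] by auto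
    show "transition d e (transition c d z) = transition c e z" if "z \<in> coords c (fst d \<inter> fst e)" for z
    proof -
      have z: "z \<in> coords c (fst d)" using that coords_mono[of "fst d \<inter> fst e" "fst d"] by blast
      show ?thesis using transition_simps(2)[OF c d z] by (simp add: transition_def)
    qed
  qed (use y in auto)
  from has_derivative_unique[OF this transition_has_derivative[OF c e y(2), unfolded px]]
  have "J d e x *v (J c d x *v v) = J c e x *v v" for v by metis
  then show ?thesis by (simp add: matrix_eq matrix_vector_mul_assoc)
qed

lemma jacobian_refl:
  assumes c: "c \<in> atlas M" and x: "x \<in> fst c"
  shows "J c c x = mat 1"
proof -
  let ?y = "snd c x"
  have px: "point c ?y = x" by (rule point_coord(1)[OF c x])
  have y: "?y \<in> coords c (fst c)" using x by (auto simp: coords_def)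
  have "((\<lambda>y. y) has_derivative (\<lambda>v. v)) (at ?y)" by simp
  then have "(transition c c has_derivative (\<lambda>v. v)) (at ?y)"
  proof (rule has_derivative_transform_within_open[of _ _ _ UNIV "coords c (fst c)"])
    show "open (coords c (fst c))" by (rule open_coords[OF c chartD(1)[OF c]])
    show "z = transition c c z" if "z \<in> coords c (fst c)" for z using coord_point(1)[OF c that] by (simp add: transition_def)
  qed (use y in auto)
  from has_derivative_unique[OF this transition_has_derivative[OF c c y, unfolded px]]
  have "J c c x *v v = v" for v by metis
  then show ?thesis by (simp add: matrix_eq)
qed

lemma jacobian_inverse:
  assumes c: "c \<in> atlas M" and d: "d \<in> atlas M" and x: "x \<in> fst c" "x \<in> fst d"
  shows "J d c x ** J c d x = mat 1" "det (J c d x) \<noteq> 0"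
proof -
  show *: "J d c x ** J c d x = mat 1" using jacobian_cocycle[OF c d c x x(1)] jacobian_refl[OF c x(1)] by simp
  then have "det (J d c x) * det (J c d x) = 1" by (metis det_I det_mul)
  then show "det (J c d x) \<noteq> 0" by auto
qed

lemma diffeo_transition:
  assumes c: "c \<in> atlas M" and d: "d \<in> atlas M"
  shows "diffeo_on (coords c (fst d)) (transition c d) (\<lambda>y. J c d (point c y))"
  unfolding diffeo_on_def
proof (intro conjI ballI)
  have img: "transition c d ` coords c (fst d) = coords d (fst c)"
    using transition_image[OF c d, of "fst c \<inter> fst d"] coords_Int_fst[of c "fst d"] coords_Int_fst[of d "fst c"] by (simp add: Int_commute)
  show "open (coords c (fst d))" by (rule open_coords[OF c chartD(1)[OF d]])
  show "open (transition c d ` coords c (fst d))" unfolding img by (rule open_coords[OF d chartD(1)[OF c]])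
  show "inj_on (transition c d) (coords c (fst d))"
  proof (rule inj_onI)
    fix y z assume yz: "y \<in> coords c (fst d)" "z \<in> coords c (fst d)" "transition c d y = transition c d z"
    then have "point c y = point c z" using transition_simps(2)[OF c d] by metis
    then show "y = z" using coord_point(1)[OF c yz(1)] coord_point(1)[OF c yz(2)] by metis
  qed
  show "continuous_on (coords c (fst d)) (\<lambda>y. J c d (point c y))" by (rule transition_diffeo[OF c d])
  fix y assume y: "y \<in> coords c (fst d)"
  show "(transition c d has_derivative (\<lambda>v. J c d (point c y) *v v)) (at y)" by (rule transition_has_derivative[OF c d y])
  show "det (J c d (point c y)) \<noteq> 0" using jacobian_inverse(2)[OF c d] coord_point[OF c y] by simp
qed

text \<open>Each point has a coordinate ball whose closure is a compact part of the chart; second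
  countability (Lindelof) leaves countably many of them. This cover underlies both the corrected
  differentials and the global integral.\<close>

lemma cover_exists:
  "\<exists>cs Os Cs. (\<forall>k::nat. cs k \<in> atlas M \<and> open (Os k) \<and> Os k \<subseteq> Cs k \<and> compact (Cs k) \<and> Cs k \<subseteq> fst (cs k)) \<and> (\<Union>k. Os k) = UNIV"
proof -
  let ?good = "\<lambda>V c C. c \<in> atlas M \<and> open V \<and> V \<subseteq> C \<and> compact C \<and> C \<subseteq> fst c"
  have ex: "\<exists>V c C. x \<in> V \<and> ?good V c C" for x :: 'a
  proof -
    obtain c where c: "c \<in> atlas M" "x \<in> fst c" by (rule atlas_covers)
    obtain r where r: "r > 0" "cball (snd c x) r \<subseteq> coords c UNIV"
      using chartD(2)[OF c(1)] point_coord(2)[OF c] unfolding open_contains_cball by blast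
    let ?O = "fst c \<inter> snd c -` ball (snd c x) r" and ?C = "point c ` cball (snd c x) r"
    have "open ?O" by (rule continuous_open_preimage[OF continuous_on_coord[OF c(1)] chartD(1)[OF c(1)] open_ball])
    moreover have "?O \<subseteq> ?C"
    proof
      fix z assume z: "z \<in> ?O"
      then have "z = point c (snd c z)" using point_coord(1)[OF c(1)] by simp
      moreover have "snd c z \<in> cball (snd c x) r" using z by auto
      ultimately show "z \<in> ?C" by blast
    qed
    moreover have "compact ?C" "?C \<subseteq> fst c" using compact_point_image[OF c(1) compact_cball r(2)] by auto
    moreover have "x \<in> ?O" using c r by auto
    ultimately show ?thesis using c(1) by (intro exI[of _ ?O] exI[of _ c] exI[of _ ?C] conjI)
  qed
  let ?F = "{V. \<exists>c C. ?good V c C}"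
  obtain F' where F': "F' \<subseteq> ?F" "countable F'" "\<Union>F' = \<Union>?F"
  proof (rule Lindelof[of ?F])
    show "open S" if "S \<in> ?F" for S using that by auto
  qed (rule that)
  have "x \<in> \<Union>?F" for x
  proof -
    from ex[of x] show ?thesis
    proof (elim exE)
      fix V c C assume a: "x \<in> V \<and> ?good V c C"
      then have "\<exists>c C. ?good V c C" by (intro exI) (erule conjunct2)
      then have "V \<in> ?F" by (rule CollectI)
      then show ?thesis by (rule UnionI[OF _ conjunct1[OF a]])
    qed
  qed
  then have un: "\<Union>F' = UNIV" unfolding F'(3) by blast
  then have ne: "F' \<noteq> {}" by auto
  define Os where "Os = from_nat_into F'"
  have OsF: "Os k \<in> F'" for k unfolding Os_def by (rule from_nat_into[OF ne])
  have ran: "range Os = F'" unfolding Os_def by (rule range_from_nat_into[OF ne F'(2)])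
  have "\<exists>c C. ?good (Os k) c C" for k using subsetD[OF F'(1) OsF[of k]] by simp
  then have "\<forall>k. \<exists>p. ?good (Os k) (fst p) (snd p)" by auto
  from choice[OF this] obtain p where p: "\<forall>k. ?good (Os k) (fst (p k)) (snd (p k))" by blast
  moreover have "(\<Union>k. Os k) = UNIV" using un ran by simp
  ultimately show ?thesis
    by (intro exI[of _ "\<lambda>k. fst (p k)"] exI[of _ Os] exI[of _ "\<lambda>k. snd (p k)"] conjI)
qed

definition cover where
  "cover = (SOME (cs, Os, Cs). (\<forall>k::nat. cs k \<in> atlas M \<and> open (Os k) \<and> Os k \<subseteq> Cs k \<and> compact (Cs k) \<and> Cs k \<subseteq> fst (cs k)) \<and> (\<Union>k. Os k) = UNIV)"

definition cov_chart where "cov_chart = fst cover"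
definition cov_open where "cov_open = fst (snd cover)"
definition cov_compact where "cov_compact = snd (snd cover)"

lemma cover:
  "cov_chart k \<in> atlas M" "open (cov_open k)" "cov_open k \<subseteq> cov_compact k" "compact (cov_compact k)"
  "cov_compact k \<subseteq> fst (cov_chart k)" "(\<Union>k. cov_open k) = UNIV"
proof -
  let ?P = "\<lambda>(cs, Os, Cs). (\<forall>k::nat. cs k \<in> atlas M \<and> open (Os k) \<and> Os k \<subseteq> Cs k \<and> compact (Cs k) \<and> Cs k \<subseteq> fst (cs k)) \<and> (\<Union>k. Os k) = UNIV"
  have "\<exists>p. ?P p" using cover_exists by auto
  then have "?P cover" unfolding cover_def by (rule someI_ex)
  then show "cov_chart k \<in> atlas M" "open (cov_open k)" "cov_open k \<subseteq> cov_compact k" "compact (cov_compact k)"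
    "cov_compact k \<subseteq> fst (cov_chart k)" "(\<Union>k. cov_open k) = UNIV"
    by (auto simp: cov_chart_def cov_open_def cov_compact_def split: prod.splits)
qed

text \<open>Taking the least index cuts the space into disjoint Borel pieces, each lying in a
  compact subset of one chart. In the global integral this replaces a partition of unity.\<close>

definition cov_index where "cov_index x = (LEAST k. x \<in> cov_compact k)"

lemma cov_index: "x \<in> cov_compact (cov_index x)" "x \<in> fst (cov_chart (cov_index x))"
proof -
  have "\<exists>k. x \<in> cov_compact k" using cover(3,6) by blast
  then show "x \<in> cov_compact (cov_index x)" unfolding cov_index_def by (rule LeastI_ex)
  then show "x \<in> fst (cov_chart (cov_index x))" using cover(5) by blast
qed

text \<open>The transformation law is demanded at every point, so that expressions formed from
  \<open>D\<close> transform exactly as densities do and are well defined before any null set is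
  discarded.\<close>

definition H1M :: "('a \<Rightarrow> real) \<Rightarrow> (('a, 'n) chart \<Rightarrow> 'a \<Rightarrow> real^'n) \<Rightarrow> bool" where
  "H1M f D \<longleftrightarrow> continuous_on UNIV f \<and> (\<forall>c\<in>atlas M. H1C (coords c UNIV) (f \<circ> point c) (D c \<circ> point c)) \<and>
     (\<forall>c\<in>atlas M. \<forall>d\<in>atlas M. \<forall>x\<in>fst c \<inter> fst d. D c x = transpose (J c d x) *v D d x)"

lemma H1M_D:
  assumes "H1M f D"
  shows "continuous_on UNIV f" "c \<in> atlas M \<Longrightarrow> H1C (coords c UNIV) (\<lambda>y. f (point c y)) (\<lambda>y. D c (point c y))"
    "c \<in> atlas M \<Longrightarrow> d \<in> atlas M \<Longrightarrow> x \<in> fst c \<Longrightarrow> x \<in> fst d \<Longrightarrow> D c x = transpose (J c d x) *v D d x"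
proof -
  note a = assms[unfolded H1M_def o_def]
  show "continuous_on UNIV f" using a by (rule conjunct1)
  show "H1C (coords c UNIV) (\<lambda>y. f (point c y)) (\<lambda>y. D c (point c y))" if "c \<in> atlas M"
    using bspec[OF conjunct1[OF conjunct2[OF a]] that] .
  show "D c x = transpose (J c d x) *v D d x" if "c \<in> atlas M" "d \<in> atlas M" "x \<in> fst c" "x \<in> fst d"
    using bspec[OF bspec[OF bspec[OF conjunct2[OF conjunct2[OF a]] that(1)] that(2)] IntI[OF that(3,4)]] .
qed

text \<open>A weak differential in the sense of the definition is tensorial only almost everywhere on
  each overlap of charts; it can be modified on null sets so as to be tensorial everywhere.\<close>

lemma consistent_differential:
  assumes u: "continuous_on UNIV u" and w: "weak_differential M UNIV u w"
  obtains D where "H1M u D" "\<And>c. c \<in> atlas M \<Longrightarrow> AE y in lebesgue. y \<in> coords c UNIV \<longrightarrow> w c (point c y) = D c (point c y)"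
proof -
  have Hw: "H1C (coords c UNIV) (\<lambda>y. u (point c y)) (\<lambda>y. w c (point c y))" if c: "c \<in> atlas M" for c
  proof -
    have "continuous_on (coords c UNIV) (\<lambda>y. u (point c y))"
      by (rule continuous_on_compose2[OF u continuous_on_point[OF c]]) auto
    then show ?thesis using w c unfolding weak_differential_def H1C_def o_def by auto
  qed
  \<comment> \<open>At each point one chart, selected by \<open>cov_index x\<close>, is declared to
    give the right components; all other charts receive their values by transformation from
    it.\<close>
  define D where "D c x = transpose (J c (cov_chart (cov_index x)) x) *v w (cov_chart (cov_index x)) x" for c x
  have overlap: "AE y in lebesgue. y \<in> coords c (fst d) \<longrightarrow> w c (point c y) = transpose (J c d (point c y)) *v w d (point c y)"
    if c: "c \<in> atlas M" and d: "d \<in> atlas M" for c d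
  proof -
    let ?S = "coords c (fst d)" and ?T = "transition c d"
    have T: "?T ` ?S \<subseteq> coords d UNIV" using transition_simps(3)[OF c d] coords_mono[of "fst c" UNIV d] by auto
    have "H1C ?S (\<lambda>y. u (point d (?T y))) (\<lambda>y. transpose (J c d (point c y)) *v w d (point d (?T y)))"
      by (rule H1C_compose[OF diffeo_transition[OF c d] H1C_subset[OF Hw[OF d] T]])
    then have 1: "H1C ?S (\<lambda>y. u (point c y)) (\<lambda>y. transpose (J c d (point c y)) *v w d (point c y))"
      by (rule H1C_cong) (use transition_simps(2)[OF c d] in auto)
    have 2: "H1C ?S (\<lambda>y. u (point c y)) (\<lambda>y. w c (point c y))"
      by (rule H1C_subset[OF Hw[OF c]]) (auto simp: coords_def)
    show ?thesis by (rule H1C_unique[OF open_coords[OF c chartD(1)[OF d]] 2 1])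
  qed
  have ae: "AE y in lebesgue. y \<in> coords c UNIV \<longrightarrow> w c (point c y) = D c (point c y)" if c: "c \<in> atlas M" for c
  proof -
    \<comment> \<open>Only countably many charts are ever selected, so the exceptional sets of the
      overlaps have a null union.\<close>
    have "AE y in lebesgue. \<forall>k. y \<in> coords c (fst (cov_chart k)) \<longrightarrow>
       w c (point c y) = transpose (J c (cov_chart k) (point c y)) *v w (cov_chart k) (point c y)"
      unfolding AE_all_countable using overlap[OF c cover(1)] by blast
    then show ?thesis
    proof eventually_elim
      case (elim y)
      show ?case
      proof
        assume y: "y \<in> coords c UNIV"
        let ?k = "cov_index (point c y)"
        have "y \<in> coords c (fst (cov_chart ?k))" using coords_iff[OF c] y cov_index(2) by blast
        then show "w c (point c y) = D c (point c y)" using elim by (simp add: D_def)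
      qed
    qed
  qed
  have "H1M u D"
    unfolding H1M_def o_def
  proof (intro conjI ballI u)
    fix c assume c: "c \<in> atlas M"
    show "H1C (coords c UNIV) (\<lambda>y. u (point c y)) (\<lambda>y. D c (point c y))"
      by (rule H1C_cong_AE[OF chartD(2)[OF c] Hw[OF c] ae[OF c]])
  next
    fix c d x assume c: "c \<in> atlas M" and d: "d \<in> atlas M" and x: "x \<in> fst c \<inter> fst d"
    let ?e = "cov_chart (cov_index x)"
    have "J c ?e x = J d ?e x ** J c d x" by (rule jacobian_cocycle[OF c d cover(1)]) (use x cov_index in auto)
    then show "D c x = transpose (J c d x) *v D d x"
      unfolding D_def by (simp only: matrix_transpose_mul matrix_vector_mul_assoc)
  qed
  then show ?thesis using ae by (rule that)
qed

lemma H1M_imp_weak_differential: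
  assumes "H1M f D"
  shows "weak_differential M UNIV f D"
  unfolding weak_differential_def
proof (intro ballI conjI)
  fix c assume c: "c \<in> atlas M"
  note h = H1C_D[OF H1M_D(2)[OF assms c]]
  show "L_loc 2 (coords c UNIV) (f \<circ> point c)"
    unfolding L_loc_2_real o_def using h(1) by (auto intro!: l2_on_continuous intro: continuous_on_subset)
  show "L_loc 2 (coords c UNIV) (D c \<circ> point c)" "weak_gradient_on (coords c UNIV) (f \<circ> point c) (D c \<circ> point c)"
    using h by (auto simp: o_def)
qed

section \<open>Calculus of Sobolev functions on the manifold\<close>

lemma H1M_add:
  assumes "H1M f D" "H1M g E"
  shows "H1M (\<lambda>x. f x + g x) (\<lambda>c x. D c x + E c x)"
  unfolding H1M_def o_def
proof (intro conjI ballI)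
  show "continuous_on UNIV (\<lambda>x. f x + g x)" by (intro continuous_on_add H1M_D(1)[OF assms(1)] H1M_D(1)[OF assms(2)])
  fix c assume c: "c \<in> atlas M"
  show "H1C (coords c UNIV) (\<lambda>y. f (point c y) + g (point c y)) (\<lambda>y. D c (point c y) + E c (point c y))"
    by (rule H1C_add[OF H1M_D(2)[OF assms(1) c] H1M_D(2)[OF assms(2) c]])
next
  fix c d x assume c: "c \<in> atlas M" "d \<in> atlas M" "x \<in> fst c \<inter> fst d"
  then show "D c x + E c x = transpose (J c d x) *v (D d x + E d x)"
    using H1M_D(3)[OF assms(1), of c d x] H1M_D(3)[OF assms(2), of c d x]
    by (simp add: matrix_vector_right_distrib)
qed

lemma H1M_cmult:
  assumes "H1M f D"
  shows "H1M (\<lambda>x. k * f x) (\<lambda>c x. k *\<^sub>R D c x)"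
  unfolding H1M_def o_def
proof (intro conjI ballI)
  show "continuous_on UNIV (\<lambda>x. k * f x)" by (intro continuous_intros H1M_D(1)[OF assms(1)])
  fix c assume c: "c \<in> atlas M"
  show "H1C (coords c UNIV) (\<lambda>y. k * f (point c y)) (\<lambda>y. k *\<^sub>R D c (point c y))"
    by (rule H1C_cmult[OF H1M_D(2)[OF assms(1) c]])
next
  fix c d x assume c: "c \<in> atlas M" "d \<in> atlas M" "x \<in> fst c \<inter> fst d"
  then show "k *\<^sub>R D c x = transpose (J c d x) *v (k *\<^sub>R D d x)"
    using H1M_D(3)[OF assms(1), of c d x] by (simp add: linear_cmul[OF matrix_vector_mul_linear])
qed

lemma H1M_mult:
  assumes "H1M f D" "H1M g E"
  shows "H1M (\<lambda>x. f x * g x) (\<lambda>c x. f x *\<^sub>R E c x + g x *\<^sub>R D c x)"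
  unfolding H1M_def o_def
proof (intro conjI ballI)
  show "continuous_on UNIV (\<lambda>x. f x * g x)" by (intro continuous_on_mult H1M_D(1)[OF assms(1)] H1M_D(1)[OF assms(2)])
  fix c assume c: "c \<in> atlas M"
  show "H1C (coords c UNIV) (\<lambda>y. f (point c y) * g (point c y))
     (\<lambda>y. f (point c y) *\<^sub>R E c (point c y) + g (point c y) *\<^sub>R D c (point c y))"
    by (rule H1C_mult[OF chartD(2)[OF c] H1M_D(2)[OF assms(1) c] H1M_D(2)[OF assms(2) c]])
next
  fix c d x assume c: "c \<in> atlas M" "d \<in> atlas M" "x \<in> fst c \<inter> fst d"
  then show "f x *\<^sub>R E c x + g x *\<^sub>R D c x = transpose (J c d x) *v (f x *\<^sub>R E d x + g x *\<^sub>R D d x)"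
    using H1M_D(3)[OF assms(1), of c d x] H1M_D(3)[OF assms(2), of c d x]
    by (simp add: matrix_vector_right_distrib linear_cmul[OF matrix_vector_mul_linear])
qed

lemma H1M_chain:
  assumes f: "H1M f D" and I: "open I" "\<And>x. f x \<in> I"
    and G: "\<And>t. t \<in> I \<Longrightarrow> (G has_real_derivative G' t) (at t)" "continuous_on I G'"
  shows "H1M (\<lambda>x. G (f x)) (\<lambda>c x. G' (f x) *\<^sub>R D c x)"
  unfolding H1M_def o_def
proof (intro conjI ballI)
  have "continuous_on I G" using G by (auto intro!: continuous_at_imp_continuous_on DERIV_isCont)
  then show "continuous_on UNIV (\<lambda>x. G (f x))"
    by (rule continuous_on_compose2[OF _ H1M_D(1)[OF f]]) (use I in auto)
  fix c assume c: "c \<in> atlas M"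
  show "H1C (coords c UNIV) (\<lambda>y. G (f (point c y))) (\<lambda>y. G' (f (point c y)) *\<^sub>R D c (point c y))"
    by (rule H1C_chain[OF chartD(2)[OF c] H1M_D(2)[OF f c] I(1) _ G]) (use I in auto)
next
  fix c d x assume c: "c \<in> atlas M" "d \<in> atlas M" "x \<in> fst c \<inter> fst d"
  then show "G' (f x) *\<^sub>R D c x = transpose (J c d x) *v (G' (f x) *\<^sub>R D d x)"
    using H1M_D(3)[OF f, of c d x] by (simp add: linear_cmul[OF matrix_vector_mul_linear])
qed

text \<open>The coordinate form of a signed, locally finite measure: the absolute value of the
  Jacobian determinant makes it independent of any orientation.\<close>

definition density :: "(('a, 'n) chart \<Rightarrow> 'a \<Rightarrow> real) \<Rightarrow> bool" where
  "density \<sigma> \<longleftrightarrow>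
     (\<forall>c\<in>atlas M. \<forall>K. compact K \<and> K \<subseteq> coords c UNIV \<longrightarrow> set_integrable lebesgue K (\<lambda>y. \<sigma> c (point c y))) \<and>
     (\<forall>c\<in>atlas M. \<forall>d\<in>atlas M. \<forall>x\<in>fst c \<inter> fst d. \<sigma> c x = \<bar>det (J c d x)\<bar> * \<sigma> d x)"

definition vanishes_off :: "(('a, 'n) chart \<Rightarrow> 'a \<Rightarrow> real) \<Rightarrow> 'a set \<Rightarrow> bool" where
  "vanishes_off \<sigma> K \<longleftrightarrow> (\<forall>c\<in>atlas M. \<forall>x\<in>fst c. x \<notin> K \<longrightarrow> \<sigma> c x = 0)"

definition piece :: "nat \<Rightarrow> 'a set" where "piece k = {x. cov_index x = k}"

definition piece_integral :: "(('a, 'n) chart \<Rightarrow> 'a \<Rightarrow> real) \<Rightarrow> nat \<Rightarrow> real" where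
  "piece_integral \<sigma> k = (LINT y:coords (cov_chart k) (piece k)|lebesgue. \<sigma> (cov_chart k) (point (cov_chart k) y))"

text \<open>Meant for densities that vanish off a compact set; then only finitely many pieces
  contribute and the series is a finite sum, see \<open>total_finite\<close>.\<close>

definition total :: "(('a, 'n) chart \<Rightarrow> 'a \<Rightarrow> real) \<Rightarrow> real" where
  "total \<sigma> = (\<Sum>k. piece_integral \<sigma> k)"

section \<open>The global integral: linearity, monotonicity and its value in a chart\<close>

lemma densityD:
  assumes "density \<sigma>"
  shows "c \<in> atlas M \<Longrightarrow> compact K \<Longrightarrow> K \<subseteq> coords c UNIV \<Longrightarrow> set_integrable lebesgue K (\<lambda>y. \<sigma> c (point c y))"
    "c \<in> atlas M \<Longrightarrow> d \<in> atlas M \<Longrightarrow> x \<in> fst c \<Longrightarrow> x \<in> fst d \<Longrightarrow> \<sigma> c x = \<bar>det (J c d x)\<bar> * \<sigma> d x"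
  using assms unfolding density_def by blast+

lemma piece_subset: "piece k \<subseteq> cov_compact k"
  using cov_index(1) by (auto simp: piece_def)

lemma piece_borel: "piece k \<in> sets borel"
proof -
  have "piece k = cov_compact k - (\<Union>j<k. cov_compact j)"
  proof (intro set_eqI iffI)
    fix x assume x: "x \<in> piece k"
    then have "x \<notin> cov_compact j" if "j < k" for j
      using not_less_Least[of j "\<lambda>k. x \<in> cov_compact k"] that by (simp add: piece_def cov_index_def)
    then show "x \<in> cov_compact k - (\<Union>j<k. cov_compact j)" using x piece_subset by auto
  next
    fix x assume x: "x \<in> cov_compact k - (\<Union>j<k. cov_compact j)"
    have "(LEAST k. x \<in> cov_compact k) = k"
    proof (rule Least_equality)
      show "x \<in> cov_compact k" using x by simp
      show "k \<le> j" if "x \<in> cov_compact j" for j using x that by (cases "j < k") auto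
    qed
    then show "x \<in> piece k" by (simp add: piece_def cov_index_def)
  qed
  moreover have "cov_compact j \<in> sets borel" for j using cover(4) by (simp add: compact_imp_closed)
  ultimately show ?thesis by auto
qed

lemma piece_fst: "piece k \<subseteq> fst (cov_chart k)"
  using piece_subset cover(5) by blast

lemma compact_in_cover:
  assumes "compact K"
  obtains m where "\<And>x. x \<in> K \<Longrightarrow> cov_index x < m"
proof -
  have "K \<subseteq> (\<Union>k\<in>UNIV. cov_open k)" using cover(6) by simp
  then obtain C where C: "C \<subseteq> UNIV" "finite C" "K \<subseteq> (\<Union>k\<in>C. cov_open k)"
    using compactE_image[OF assms, of UNIV cov_open] cover(2) by blast
  obtain m where m: "\<And>k. k \<in> C \<Longrightarrow> k < m"
    using finite_nat_set_iff_bounded[of C] C(2) by blast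
  have "cov_index x < m" if x: "x \<in> K" for x
  proof -
    obtain k where k: "k \<in> C" "x \<in> cov_open k" using C(3) x by blast
    have "cov_index x \<le> k" unfolding cov_index_def by (rule Least_le) (use k cover(3) in blast)
    then show ?thesis using m[OF k(1)] by simp
  qed
  then show ?thesis by (rule that)
qed

lemma piece_integral_eq_0:
  assumes "vanishes_off \<sigma> K" "\<And>x. x \<in> K \<Longrightarrow> cov_index x < m" "k \<ge> m"
  shows "piece_integral \<sigma> k = 0"
proof -
  let ?c = "cov_chart k"
  have "indicat_real (coords ?c (piece k)) y *\<^sub>R \<sigma> ?c (point ?c y) = 0" for y
  proof (cases "y \<in> coords ?c (piece k)")
    case True
    have "point ?c y \<in> piece k" "point ?c y \<in> fst ?c" using coord_point[OF cover(1) True] by auto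
    moreover have "point ?c y \<notin> K" using assms(2)[of "point ?c y"] assms(3) \<open>point ?c y \<in> piece k\<close> by (auto simp: piece_def)
    ultimately show ?thesis using assms(1) cover(1) unfolding vanishes_off_def by simp
  qed simp
  then have "(\<lambda>y. indicat_real (coords ?c (piece k)) y *\<^sub>R \<sigma> ?c (point ?c y)) = (\<lambda>y. 0)" by (rule ext)
  then show ?thesis unfolding piece_integral_def set_lebesgue_integral_def by (simp only: integral_zero)
qed

lemma total_finite:
  assumes "vanishes_off \<sigma> K" "\<And>x. x \<in> K \<Longrightarrow> cov_index x < m"
  shows "total \<sigma> = (\<Sum>k<m. piece_integral \<sigma> k)"
  unfolding total_def by (rule suminf_finite) (use piece_integral_eq_0[OF assms] in auto)

lemma piece_integrable:
  assumes "density \<sigma>"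
  shows "set_integrable lebesgue (coords (cov_chart k) (piece k)) (\<lambda>y. \<sigma> (cov_chart k) (point (cov_chart k) y))"
proof -
  note K = compact_coords[OF cover(1) cover(4) cover(5), of k]
  show ?thesis
    by (rule set_integrable_subset[OF densityD(1)[OF assms cover(1) K] sets_coords[OF cover(1) piece_borel] coords_mono[OF piece_subset]])
qed

lemma density_add:
  assumes "density \<sigma>" "density \<tau>"
  shows "density (\<lambda>c x. \<sigma> c x + \<tau> c x)"
  unfolding density_def
proof (intro conjI ballI allI impI)
  fix c K assume "c \<in> atlas M" "compact K \<and> K \<subseteq> coords c UNIV"
  then show "set_integrable lebesgue K (\<lambda>y. \<sigma> c (point c y) + \<tau> c (point c y))"
    using densityD(1)[OF assms(1)] densityD(1)[OF assms(2)] by (intro set_integral_add) blast+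
next
  fix c d x assume "c \<in> atlas M" "d \<in> atlas M" "x \<in> fst c \<inter> fst d"
  then show "\<sigma> c x + \<tau> c x = \<bar>det (J c d x)\<bar> * (\<sigma> d x + \<tau> d x)"
    using densityD(2)[OF assms(1), of c d x] densityD(2)[OF assms(2), of c d x] by (simp add: distrib_left)
qed

lemma density_cmult:
  assumes "density \<sigma>"
  shows "density (\<lambda>c x. r * \<sigma> c x)"
  unfolding density_def
proof (intro conjI ballI allI impI)
  fix c K assume "c \<in> atlas M" "compact K \<and> K \<subseteq> coords c UNIV"
  then show "set_integrable lebesgue K (\<lambda>y. r * \<sigma> c (point c y))"
    using densityD(1)[OF assms] by (intro set_integrable_mult_right) blast
next
  fix c d x assume "c \<in> atlas M" "d \<in> atlas M" "x \<in> fst c \<inter> fst d"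
  then show "r * \<sigma> c x = \<bar>det (J c d x)\<bar> * (r * \<sigma> d x)"
    using densityD(2)[OF assms, of c d x] by simp
qed

lemma density_mult_continuous:
  assumes s: "density \<sigma>" and f: "continuous_on UNIV (f :: 'a \<Rightarrow> real)"
  shows "density (\<lambda>c x. f x * \<sigma> c x)"
  unfolding density_def
proof (intro conjI ballI allI impI)
  fix c K assume c: "c \<in> atlas M" and K: "compact K \<and> K \<subseteq> coords c UNIV"
  have fc: "continuous_on K (\<lambda>y. f (point c y))"
    by (rule continuous_on_compose2[OF f continuous_on_subset[OF continuous_on_point[OF c]]]) (use K in auto)
  obtain B where B: "\<And>y. y \<in> K \<Longrightarrow> \<bar>f (point c y)\<bar> \<le> B" using continuous_compact_bounded[OF conjunct1[OF K] fc] by blast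
  have si: "set_integrable lebesgue K (\<lambda>y. \<sigma> c (point c y))" by (rule densityD(1)[OF s c conjunct1[OF K] conjunct2[OF K]])
  show "set_integrable lebesgue K (\<lambda>y. f (point c y) * \<sigma> c (point c y))"
  proof (rule set_integrable_bound_real)
    show "set_integrable lebesgue K (\<lambda>y. B * \<bar>\<sigma> c (point c y)\<bar>)" using si by (intro set_integrable_mult_right set_integrable_abs)
    show "set_borel_measurable lebesgue K (\<lambda>y. f (point c y) * \<sigma> c (point c y))"
      by (rule set_borel_measurable_mult[OF set_borel_measurable_continuous_compact[OF conjunct1[OF K] fc]
            set_integrable_imp_set_borel_measurable[OF si]])
    show "\<bar>f (point c y) * \<sigma> c (point c y)\<bar> \<le> B * \<bar>\<sigma> c (point c y)\<bar>" if "y \<in> K" for y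
      using B[OF that] by (simp add: abs_mult mult_right_mono)
  qed
next
  fix c d x assume "c \<in> atlas M" "d \<in> atlas M" "x \<in> fst c \<inter> fst d"
  then show "f x * \<sigma> c x = \<bar>det (J c d x)\<bar> * (f x * \<sigma> d x)" using densityD(2)[OF s, of c d x] by simp
qed

lemma piece_integral_add:
  "density \<sigma> \<Longrightarrow> density \<tau> \<Longrightarrow> piece_integral (\<lambda>c x. \<sigma> c x + \<tau> c x) k = piece_integral \<sigma> k + piece_integral \<tau> k"
  unfolding piece_integral_def by (rule set_integral_add(2)[OF piece_integrable piece_integrable])

lemma total_add:
  assumes "density \<sigma>" "density \<tau>" "compact K" "vanishes_off \<sigma> K" "vanishes_off \<tau> K"
  shows "total (\<lambda>c x. \<sigma> c x + \<tau> c x) = total \<sigma> + total \<tau>"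
proof -
  obtain m where m: "\<And>x. x \<in> K \<Longrightarrow> cov_index x < m" by (rule compact_in_cover[OF assms(3)]) (rule that)
  have "vanishes_off (\<lambda>c x. \<sigma> c x + \<tau> c x) K" using assms(4,5) by (simp add: vanishes_off_def)
  then show ?thesis
    using total_finite[OF _ m] assms by (simp add: piece_integral_add sum.distrib)
qed

lemma total_cmult:
  assumes "compact K" "vanishes_off \<sigma> K"
  shows "total (\<lambda>c x. r * \<sigma> c x) = r * total \<sigma>"
proof -
  obtain m where m: "\<And>x. x \<in> K \<Longrightarrow> cov_index x < m" by (rule compact_in_cover[OF assms(1)]) (rule that)
  have "vanishes_off (\<lambda>c x. r * \<sigma> c x) K" using assms(2) by (simp add: vanishes_off_def)
  then show ?thesis
    using total_finite[OF _ m] assms by (simp add: piece_integral_def sum_distrib_left)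
qed

lemma total_mono:
  assumes d: "density \<sigma>" "density \<tau>" and K: "compact K" "vanishes_off \<sigma> K" "vanishes_off \<tau> K"
    and le: "\<And>c. c \<in> atlas M \<Longrightarrow> AE y in lebesgue. y \<in> coords c UNIV \<longrightarrow> \<sigma> c (point c y) \<le> \<tau> c (point c y)"
  shows "total \<sigma> \<le> total \<tau>"
proof -
  obtain m where m: "\<And>x. x \<in> K \<Longrightarrow> cov_index x < m" by (rule compact_in_cover[OF K(1)]) (rule that)
  have "piece_integral \<sigma> k \<le> piece_integral \<tau> k" for k
    unfolding piece_integral_def set_lebesgue_integral_def
  proof (rule integral_mono_AE)
    show "AE y in lebesgue. indicat_real (coords (cov_chart k) (piece k)) y *\<^sub>R \<sigma> (cov_chart k) (point (cov_chart k) y)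
       \<le> indicat_real (coords (cov_chart k) (piece k)) y *\<^sub>R \<tau> (cov_chart k) (point (cov_chart k) y)"
      using le[OF cover(1)[of k]]
    proof eventually_elim
      case (elim y)
      then show ?case using coords_mono[of "piece k" UNIV "cov_chart k"] by (auto simp: indicator_def)
    qed
  qed (use piece_integrable[OF d(1), of k] piece_integrable[OF d(2), of k] in \<open>simp_all add: set_integrable_def\<close>)
  then show ?thesis
    unfolding total_finite[OF K(2) m, simplified] total_finite[OF K(3) m, simplified] by (rule sum_mono)
qed

lemma total_cong_AE:
  assumes d: "density \<sigma>" "density \<tau>" and K: "compact K" "vanishes_off \<sigma> K" "vanishes_off \<tau> K"
    and eq: "\<And>c. c \<in> atlas M \<Longrightarrow> AE y in lebesgue. y \<in> coords c UNIV \<longrightarrow> \<sigma> c (point c y) = \<tau> c (point c y)"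
  shows "total \<sigma> = total \<tau>"
proof (rule antisym)
  show "total \<sigma> \<le> total \<tau>"
    by (rule total_mono[OF d K]) (rule eventually_mono[OF eq], auto)
  show "total \<tau> \<le> total \<sigma>"
    by (rule total_mono[OF d(2,1) K(1,3,2)]) (rule eventually_mono[OF eq], auto)
qed

text \<open>Frees \<open>total\<close> from the arbitrary cover: on each piece the selected
  coordinates are exchanged for those of \<open>d\<close> by the change of variables, and the pieces
  are then put together again.\<close>

lemma total_chart:
  assumes s: "density \<sigma>" and d: "d \<in> atlas M" and L: "compact L" "L \<subseteq> fst d" "vanishes_off \<sigma> L"
  shows "total \<sigma> = (LINT y:coords d L|lebesgue. \<sigma> d (point d y))"
proof -
  obtain m where m: "\<And>x. x \<in> L \<Longrightarrow> cov_index x < m" by (rule compact_in_cover[OF L(1)]) (rule that)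
  note KL = compact_coords[OF d L(1,2)]
  have Lb: "L \<in> sets borel" using L(1) by (simp add: compact_imp_closed)
  have Bb: "piece k \<inter> L \<in> sets borel" for k using piece_borel Lb by auto
  have si: "set_integrable lebesgue (coords d (piece k \<inter> L)) (\<lambda>y. \<sigma> d (point d y))" for k
    by (rule set_integrable_subset[OF densityD(1)[OF s d KL] sets_coords[OF d Bb]]) (rule coords_mono, blast)
  have step: "piece_integral \<sigma> k = (LINT y:coords d (piece k \<inter> L)|lebesgue. \<sigma> d (point d y))" for k
  proof -
    let ?c = "cov_chart k" and ?B = "piece k \<inter> L"
    let ?A = "coords ?c ?B"
    have sub: "?B \<subseteq> fst ?c" "?B \<subseteq> fst d" using piece_fst L(2) by auto
    have img: "transition ?c d ` ?A = coords d ?B" by (rule transition_image[OF cover(1) d sub])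
    have A: "?A \<in> sets lebesgue" "?A \<subseteq> coords ?c (fst d)"
      by (rule sets_coords[OF cover(1) Bb], rule coords_mono[OF sub(2)])
    have "indicat_real (coords ?c (piece k)) y *\<^sub>R \<sigma> ?c (point ?c y)
       = indicat_real ?A y *\<^sub>R (\<bar>det (J ?c d (point ?c y))\<bar> * \<sigma> d (point d (transition ?c d y)))" for y
    proof (cases "y \<in> ?A")
      case True
      have y: "y \<in> coords ?c (fst d)" "y \<in> coords ?c (piece k)" using True A(2) coords_mono[of ?B "piece k" ?c] by auto
      show ?thesis
        using densityD(2)[OF s cover(1)[of k] d, of "point ?c y"] coord_point[OF cover(1) y(1)] transition_simps(2)[OF cover(1) d y(1)] True y
        by simp
    next
      case False
      have "\<sigma> ?c (point ?c y) = 0" if y: "y \<in> coords ?c (piece k)"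
      proof -
        have "point ?c y \<notin> L"
          using False y coords_iff[OF cover(1)[of k], of y ?B] coords_iff[OF cover(1)[of k], of y "piece k"] by blast
        then show ?thesis using L(3) coord_point[OF cover(1) y] cover(1) unfolding vanishes_off_def by simp
      qed
      then show ?thesis using False by (simp add: indicator_def)
    qed
    then have "piece_integral \<sigma> k = (LINT y:?A|lebesgue. \<bar>det (J ?c d (point ?c y))\<bar> * \<sigma> d (point d (transition ?c d y)))"
      unfolding piece_integral_def set_lebesgue_integral_def by simp
    also have "\<dots> = (LINT y:coords d ?B|lebesgue. \<sigma> d (point d y))"
      using diffeo_change_of_variables(2)[OF diffeo_transition[OF cover(1) d] A, of "\<lambda>z. \<sigma> d (point d z)"] si img by simp
    finally show ?thesis .
  qed
  have ind: "(\<Sum>k<m. indicat_real (coords d (piece k \<inter> L)) y *\<^sub>R \<sigma> d (point d y)) = indicat_real (coords d L) y *\<^sub>R \<sigma> d (point d y)" for y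
  proof -
    have "indicat_real (coords d (piece k \<inter> L)) y *\<^sub>R \<sigma> d (point d y)
       = (if k = cov_index (point d y) then indicat_real (coords d L) y *\<^sub>R \<sigma> d (point d y) else 0)" for k
      using coords_iff[OF d, of y "piece k \<inter> L"] coords_iff[OF d, of y L] by (auto simp: piece_def indicator_def)
    moreover have "cov_index (point d y) < m" if "y \<in> coords d L" using m coord_point(3)[OF d that] by simp
    ultimately show ?thesis by (cases "y \<in> coords d L") simp_all
  qed
  have "total \<sigma> = (\<Sum>k<m. LINT y:coords d (piece k \<inter> L)|lebesgue. \<sigma> d (point d y))"
    using total_finite[OF L(3) m] by (simp add: step)
  also have "\<dots> = (\<integral>y. (\<Sum>k<m. indicat_real (coords d (piece k \<inter> L)) y *\<^sub>R \<sigma> d (point d y)) \<partial>lebesgue)"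
    unfolding set_lebesgue_integral_def
    by (rule Bochner_Integration.integral_sum[symmetric]) (use si in \<open>simp add: set_integrable_def\<close>)
  also have "\<dots> = (LINT y:coords d L|lebesgue. \<sigma> d (point d y))"
    unfolding ind set_lebesgue_integral_def ..
  finally show ?thesis .
qed

end

section \<open>The operator in coordinates\<close>

lemma matrix_inv_works:
  fixes A :: "real^'n^'n"
  assumes "det A \<noteq> 0"
  shows "A *v (matrix_inv A *v x) = x" "matrix_inv A *v (A *v x) = x"
proof -
  have "\<exists>A'. A ** A' = mat 1 \<and> A' ** A = mat 1"
    using assms invertible_det_nz[of A] unfolding invertible_def by blast
  then have "A ** matrix_inv A = mat 1 \<and> matrix_inv A ** A = mat 1" unfolding matrix_inv_def by (rule someI_ex)
  then show "A *v (matrix_inv A *v x) = x" "matrix_inv A *v (A *v x) = x" by (simp_all add: matrix_vector_mul_assoc)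
qed

text \<open>By Cramer's rule the entries of the inverse are quotients of determinants.\<close>

lemma continuous_on_matrix_inv:
  fixes A :: "'b::topological_space \<Rightarrow> real^'n^'n"
  assumes A: "continuous_on S A" and nz: "\<And>y. y \<in> S \<Longrightarrow> det (A y) \<noteq> 0"
  shows "continuous_on S (\<lambda>y. matrix_inv (A y))"
proof -
  have entry: "matrix_inv (A y) $ k $ l = det (\<chi> i j. if j = k then axis l 1 $ i else A y $ i $ j) / det (A y)"
    if "y \<in> S" for y k l
  proof -
    have "matrix_inv (A y) *v axis l 1 = (\<chi> k. det (\<chi> i j. if j = k then axis l 1 $ i else A y $ i $ j) / det (A y))"
      using cramer[OF nz[OF that], of "matrix_inv (A y) *v axis l 1" "axis l 1"] matrix_inv_works(1)[OF nz[OF that]] by simp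
    moreover have "(matrix_inv (A y) *v axis l 1) $ k = matrix_inv (A y) $ k $ l"
      by (simp add: matrix_vector_mult_basis column_def)
    ultimately show ?thesis by (simp add: vec_eq_iff)
  qed
  have "continuous_on S (\<lambda>y. matrix_inv (A y) $ k $ l)" for k l
  proof (rule continuous_on_eq)
    show "continuous_on S (\<lambda>y. det (\<chi> i j. if j = k then axis l 1 $ i else A y $ i $ j) / det (A y))"
    proof (intro continuous_on_divide continuous_on_det A ballI nz)
      show "continuous_on S (\<lambda>y. \<chi> i j. if j = k then axis l 1 $ i else A y $ i $ j)"
      proof (intro continuous_on_vec_lambda)
        fix i j show "continuous_on S (\<lambda>y. if j = k then axis l 1 $ i else A y $ i $ j)"
          by (cases "j = k") (auto intro!: continuous_intros A)
      qed
    qed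
  qed (use entry in auto)
  then have "continuous_on S (\<lambda>y. \<chi> k l. matrix_inv (A y) $ k $ l)" by (intro continuous_on_vec_lambda)
  then show ?thesis by (simp add: vec_lambda_eta)
qed

text \<open>Every matrix on the segment from the identity to \<open>A\<close> is positive definite,
  hence has trivial kernel. The determinant never vanishes along the segment and starts with the
  value 1, so it stays positive.\<close>

lemma positive_definite_det_pos:
  fixes A :: "real^'n^'n"
  assumes pos: "\<And>\<xi>. \<xi> \<noteq> 0 \<Longrightarrow> \<xi> \<bullet> (A *v \<xi>) > 0"
  shows "det A > 0"
proof -
  define B where "B t = (1 - t) *\<^sub>R mat 1 + t *\<^sub>R A" for t :: real
  have nz: "det (B t) \<noteq> 0" if t: "0 \<le> t" "t \<le> 1" for t
  proof
    assume "det (B t) = 0"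
    then have "\<not> (\<exists>C. C ** B t = mat 1)"
      using invertible_det_nz[of "B t"] matrix_left_right_inverse unfolding invertible_def by blast
    then obtain \<xi> where \<xi>: "\<xi> \<noteq> 0" "B t *v \<xi> = 0" unfolding matrix_left_invertible_ker by blast
    have "B t *v \<xi> = (1 - t) *\<^sub>R \<xi> + t *\<^sub>R (A *v \<xi>)"
      by (simp add: B_def matrix_vector_mult_add_rdistrib scaleR_matrix_vector_assoc[symmetric])
    then have "0 = (1 - t) * (\<xi> \<bullet> \<xi>) + t * (\<xi> \<bullet> (A *v \<xi>))"
      using \<xi>(2) by (metis inner_add_right inner_scaleR_right inner_zero_right)
    moreover have "\<xi> \<bullet> \<xi> > 0" "\<xi> \<bullet> (A *v \<xi>) > 0" using \<xi>(1) pos by auto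
    moreover have "(1 - t) * (\<xi> \<bullet> \<xi>) + t * (\<xi> \<bullet> (A *v \<xi>)) > 0"
    proof (cases "t = 0")
      case False
      then have "t * (\<xi> \<bullet> (A *v \<xi>)) > 0" using t calculation(3) by simp
      moreover have "(1 - t) * (\<xi> \<bullet> \<xi>) \<ge> 0" using t by simp
      ultimately show ?thesis by linarith
    qed (use calculation(2) in simp)
    ultimately show False by simp
  qed
  have c: "continuous_on {0..1} (\<lambda>t. det (B t))" unfolding B_def by (intro continuous_on_det continuous_intros)
  show ?thesis
  proof (rule ccontr)
    assume "\<not> det A > 0"
    then have "det (B 1) \<le> 0" by (simp add: B_def)
    moreover have "det (B 0) = 1" by (simp add: B_def)
    ultimately obtain t where "0 \<le> t" "t \<le> 1" "det (B t) = 0"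
      using IVT2'[of "\<lambda>t. det (B t)" 1 0 0] c by auto
    then show False using nz by blast
  qed
qed

lemma locally_holder_on_continuous:
  fixes h :: "'b::euclidean_space \<Rightarrow> 'c::real_normed_vector"
  assumes S: "open S" and h: "locally_holder_on S h"
  shows "continuous_on S h"
proof (rule continuous_at_imp_continuous_on, rule ballI)
  fix x assume x: "x \<in> S"
  obtain r where r: "r > 0" "cball x r \<subseteq> S" using S x unfolding open_contains_cball by blast
  obtain C \<gamma> where C: "0 < \<gamma>" "\<And>y z. y \<in> cball x r \<Longrightarrow> z \<in> cball x r \<Longrightarrow> dist (h y) (h z) \<le> C * dist y z powr \<gamma>"
    using h r(2) unfolding locally_holder_on_def by (meson compact_cball)
  have "((\<lambda>y. dist y x) \<longlongrightarrow> 0) (at x)" by (rule tendsto_dist_iff[THEN iffD1]) (rule tendsto_ident_at)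
  then have "((\<lambda>y. dist y x powr \<gamma>) \<longlongrightarrow> 0) (at x)"
    by (rule tendsto_zero_powrI[OF _ tendsto_const]) (use C in auto)
  then have lim: "((\<lambda>y. C * dist y x powr \<gamma>) \<longlongrightarrow> 0) (at x)" using tendsto_mult_right_zero by blast
  have "eventually (\<lambda>y. y \<in> ball x r) (at x)"
    using r(1) unfolding eventually_at by (intro exI[of _ r]) (auto simp: dist_commute)
  then have "eventually (\<lambda>y. norm (dist (h y) (h x)) \<le> C * dist y x powr \<gamma>) (at x)"
    by eventually_elim (use C(2)[of _ x] r(1) in auto)
  then have "((\<lambda>y. dist (h y) (h x)) \<longlongrightarrow> 0) (at x)" by (rule Lim_null_comparison[OF _ lim])
  then show "isCont h x" unfolding isCont_def by (rule tendsto_dist_iff[THEN iffD2])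
qed

text \<open>On a set of finite measure, \<open>t powr q \<le> 1 + t powr p\<close> for
  \<open>t \<ge> 0\<close> gives the inclusion without Hoelder's inequality.\<close>

lemma L_loc_mono:
  fixes h :: "'b::euclidean_space \<Rightarrow> 'c::euclidean_space"
  assumes h: "L_loc p S h" and q: "0 < q" "q \<le> p"
  shows "L_loc q S h"
  unfolding L_loc_def
proof (intro allI impI conjI)
  fix K assume K: "compact K \<and> K \<subseteq> S"
  have m: "set_borel_measurable lebesgue K h" and i: "set_integrable lebesgue K (\<lambda>y. norm (h y) powr p)"
    using h K unfolding L_loc_def by auto
  show "set_borel_measurable lebesgue K h" by (rule m)
  show "set_integrable lebesgue K (\<lambda>y. norm (h y) powr q)"
  proof (rule set_integrable_bound_real)
    have "set_integrable lebesgue K (\<lambda>_. 1 :: real)" using K by (intro set_integrable_continuous_compact) auto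
    then show "set_integrable lebesgue K (\<lambda>y. 1 + norm (h y) powr p)" using i by (rule set_integral_add)
    have "(\<lambda>y. norm (indicat_real K y *\<^sub>R h y) powr q) \<in> borel_measurable lebesgue"
      using m unfolding set_borel_measurable_def by measurable
    moreover have "norm (indicat_real K y *\<^sub>R h y) powr q = indicat_real K y *\<^sub>R (norm (h y) powr q)" for y
      using q(1) by (auto simp: indicator_def)
    ultimately show "set_borel_measurable lebesgue K (\<lambda>y. norm (h y) powr q)" unfolding set_borel_measurable_def by simp
    show "\<bar>norm (h y) powr q\<bar> \<le> 1 + norm (h y) powr p" for y
    proof (cases "norm (h y) \<le> 1")
      case True
      then have "norm (h y) powr q \<le> 1" using q(1) powr_mono2[of q "norm (h y)" 1] by simp
      then show ?thesis by (simp add: add_increasing2)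
    next
      case False
      then have "norm (h y) powr q \<le> norm (h y) powr p" using q(2) by (intro powr_mono) auto
      then show ?thesis by simp
    qed
  qed
qed

locale elliptic_space = weighted_manifold_space M
  for M :: "('a::{t2_space, second_countable_topology}, 'n::finite) weighted_manifold" +
  fixes P :: "('a, 'n) operator"
  assumes elliptic: "elliptic_operator M P" and dimension: "CARD('n) \<ge> 2"
begin

abbreviation dens :: "('a, 'n) chart \<Rightarrow> 'a \<Rightarrow> real" where "dens c x \<equiv> nu_density M c x"

text \<open>The density of \<open>\<nu>\<close> is absorbed into the coefficients, so that the weak form is an integral
  against Lebesgue measure; \<open>acoef\<close> acts on covectors.\<close>

definition acoef :: "('a, 'n) chart \<Rightarrow> 'a \<Rightarrow> real^'n^'n" where
  "acoef c x = dens c x *\<^sub>R (leading P c x ** matrix_inv (metric M c x))"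

definition bcoef :: "('a, 'n) chart \<Rightarrow> 'a \<Rightarrow> real^'n" where
  "bcoef c x = dens c x *\<^sub>R drift P c x"

lemmas elliptic_transform = elliptic[unfolded elliptic_operator_def, THEN conjunct1]
  and elliptic_inner = elliptic[unfolded elliptic_operator_def, THEN conjunct2, THEN conjunct1]
  and elliptic_holder = elliptic[unfolded elliptic_operator_def, THEN conjunct2, THEN conjunct2, THEN conjunct2, THEN conjunct1]
  and elliptic_Lp = elliptic[unfolded elliptic_operator_def, THEN conjunct2, THEN conjunct2, THEN conjunct2, THEN conjunct2]

section \<open>Metric, measure and coefficients in charts\<close>

lemma metric_facts:
  assumes c: "c \<in> atlas M" and x: "x \<in> fst c"
  shows "transpose (metric M c x) = metric M c x" "det (metric M c x) > 0"
proof -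
  have r: "riemannian_metric (atlas M) (metric M)" using weighted_manifold by (simp add: is_weighted_manifold_def)
  then show "transpose (metric M c x) = metric M c x" using c x unfolding riemannian_metric_def by blast
  have "\<xi> \<noteq> 0 \<Longrightarrow> \<xi> \<bullet> (metric M c x *v \<xi>) > 0" for \<xi> using r c x unfolding riemannian_metric_def by blast
  then show "det (metric M c x) > 0" by (rule positive_definite_det_pos)
qed

lemma metric_transform:
  assumes "c \<in> atlas M" "d \<in> atlas M" "x \<in> fst c" "x \<in> fst d"
  shows "metric M c x = transpose (J c d x) ** metric M d x ** J c d x"
  using weighted_manifold assms unfolding is_weighted_manifold_def riemannian_metric_def Let_def by blast

lemma metric_symmetric_inner:
  assumes c: "c \<in> atlas M" and x: "x \<in> fst c"
  shows "\<xi> \<bullet> (metric M c x *v \<eta>) = (metric M c x *v \<xi>) \<bullet> \<eta>"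
  using dot_lmul_matrix[of \<xi> "metric M c x" \<eta>] metric_facts(1)[OF assms] transpose_matrix_vector[of "metric M c x" \<xi>] by simp

lemma continuous_on_metric:
  assumes c: "c \<in> atlas M"
  shows "continuous_on (coords c UNIV) (\<lambda>y. metric M c (point c y))"
proof -
  have "smooth_on (coords c UNIV) (metric M c \<circ> point c)"
    using weighted_manifold c unfolding is_weighted_manifold_def riemannian_metric_def by blast
  then show ?thesis unfolding smooth_on_def o_def by (metis Ck_on.simps(1))
qed

lemma dens_pos: "c \<in> atlas M \<Longrightarrow> x \<in> fst c \<Longrightarrow> dens c x > 0"
  using metric_facts(2)[of c x] weighted_manifold by (simp add: nu_density_def is_weighted_manifold_def)

lemma continuous_on_dens:
  assumes c: "c \<in> atlas M"
  shows "continuous_on (coords c UNIV) (\<lambda>y. dens c (point c y))"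
proof -
  have "locally_holder_on (coords c UNIV) (weight M \<circ> point c)" using weighted_manifold c unfolding is_weighted_manifold_def by blast
  from locally_holder_on_continuous[OF chartD(2)[OF c] this]
  show ?thesis unfolding nu_density_def o_def
    by (intro continuous_intros continuous_on_det continuous_on_metric[OF c])
qed

lemma dens_transform:
  assumes "c \<in> atlas M" "d \<in> atlas M" "x \<in> fst c" "x \<in> fst d"
  shows "dens c x = \<bar>det (J c d x)\<bar> * dens d x"
  unfolding nu_density_def metric_transform[OF assms]
  by (simp add: det_mul real_sqrt_mult mult_ac power2_eq_square[symmetric] flip: power2_eq_square)
     (simp add: real_sqrt_mult[symmetric] power2_eq_square)

lemma continuous_on_acoef:
  assumes c: "c \<in> atlas M"
  shows "continuous_on (coords c UNIV) (\<lambda>y. acoef c (point c y))"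
proof -
  have "locally_holder_on (coords c UNIV) (leading P c \<circ> point c)" using elliptic_holder c by (rule bspec)
  from locally_holder_on_continuous[OF chartD(2)[OF c] this]
  have L: "continuous_on (coords c UNIV) (\<lambda>y. leading P c (point c y))" by (simp add: o_def)
  have I: "continuous_on (coords c UNIV) (\<lambda>y. matrix_inv (metric M c (point c y)))"
    using continuous_on_matrix_inv[OF continuous_on_metric[OF c]] metric_facts(2)[OF c] coord_point(2)[OF c] by force
  have "continuous_on (coords c UNIV) (\<lambda>y. leading P c (point c y) ** matrix_inv (metric M c (point c y)))"
    unfolding matrix_matrix_mult_def by (intro continuous_on_vec_lambda continuous_intros L I)
  then show ?thesis unfolding acoef_def by (intro continuous_on_scaleR continuous_on_dens[OF c])
qed

text \<open>The dimension enters here: \<open>p > CARD('n)\<close> and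
  \<open>CARD('n) \<ge> 2\<close> put the drift into L^2_loc, and in
  \<open>potential_integrable\<close> they put the potential into L^1_loc. This is what the pairing
  with continuous functions having L^2_loc gradients requires.\<close>

lemma bcoef_L_loc:
  assumes c: "c \<in> atlas M"
  shows "L_loc 2 (coords c UNIV) (\<lambda>y. bcoef c (point c y))"
proof -
  obtain p where p: "p > real CARD('n)" "L_loc p (coords c UNIV) (drift P c \<circ> point c)"
    using elliptic_Lp c by blast
  then have "L_loc 2 (coords c UNIV) (\<lambda>y. drift P c (point c y))"
    using L_loc_mono[of p "coords c UNIV" "drift P c \<circ> point c" 2] dimension by (simp add: o_def)
  then show ?thesis unfolding bcoef_def by (rule L_loc_2_continuous_scaleR[OF continuous_on_dens[OF c]])
qed

lemma potential_integrable:
  assumes c: "c \<in> atlas M" and K: "compact K" "K \<subseteq> coords c UNIV"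
  shows "set_integrable lebesgue K (\<lambda>y. potential P (point c y))"
proof -
  obtain p where p: "p > real CARD('n)" "L_loc (p/2) (coords c UNIV) (potential P \<circ> point c)"
    using elliptic_Lp c by blast
  have "L_loc 1 (coords c UNIV) (potential P \<circ> point c)"
    using dimension p(1) by (intro L_loc_mono[OF p(2)]) auto
  then have m: "set_borel_measurable lebesgue K (\<lambda>y. potential P (point c y))"
    and i: "set_integrable lebesgue K (\<lambda>y. norm (potential P (point c y)) powr 1)"
    unfolding L_loc_def o_def using K by blast+
  show ?thesis by (rule set_integrable_bound_real[OF i m]) (simp add: powr_one)
qed

lemma acoef_inner:
  assumes c: "c \<in> atlas M" and x: "x \<in> fst c"
  shows "(acoef c x *v p) \<bullet> q = dens c x * metric_inner M c x (leading P c x *v (matrix_inv (metric M c x) *v p)) (matrix_inv (metric M c x) *v q)"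
  using metric_facts(2)[OF c x]
  by (simp add: acoef_def metric_inner_def matrix_inv_works scaleR_matrix_vector_assoc[symmetric] matrix_vector_mul_assoc[symmetric])

lemma acoef_symmetric:
  assumes c: "c \<in> atlas M" and x: "x \<in> fst c"
  shows "(acoef c x *v p) \<bullet> q = (acoef c x *v q) \<bullet> p"
proof -
  have s: "metric_inner M c x (leading P c x *v \<xi>) \<eta> = metric_inner M c x \<xi> (leading P c x *v \<eta>)" for \<xi> \<eta>
    using bspec[OF bspec[OF elliptic_inner c] x] by blast
  have "metric_inner M c x \<xi> \<eta> = metric_inner M c x \<eta> \<xi>" for \<xi> \<eta>
    unfolding metric_inner_def using metric_symmetric_inner[OF c x, of \<xi> \<eta>] by (simp add: inner_commute)
  then show ?thesis unfolding acoef_inner[OF c x] using s by metis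
qed

lemma acoef_nonneg:
  assumes c: "c \<in> atlas M" and x: "x \<in> fst c"
  shows "(acoef c x *v p) \<bullet> p \<ge> 0"
proof (cases "matrix_inv (metric M c x) *v p = 0")
  case False
  then have "metric_inner M c x (leading P c x *v (matrix_inv (metric M c x) *v p)) (matrix_inv (metric M c x) *v p) > 0"
    using bspec[OF bspec[OF elliptic_inner c] x] by blast
  then show ?thesis unfolding acoef_inner[OF c x] using dens_pos[OF c x] by simp
qed (simp add: acoef_inner[OF c x] metric_inner_def)

text \<open>The reason why energies can be integrated globally: the quadratic form of
  \<open>acoef\<close> on covectors is a density, its Jacobian factor coming from the density of
  \<open>\<nu>\<close>.\<close>

lemma acoef_transform:
  assumes c: "c \<in> atlas M" and d: "d \<in> atlas M" and x: "x \<in> fst c" "x \<in> fst d"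
  shows "(acoef c x *v (transpose (J c d x) *v p)) \<bullet> (transpose (J c d x) *v q) = \<bar>det (J c d x)\<bar> * ((acoef d x *v p) \<bullet> q)"
proof -
  let ?J = "J c d x" and ?gc = "metric M c x" and ?gd = "metric M d x"
  \<comment> \<open>\<open>z\<close> is the covector \<open>p\<close> with its index raised in the
    chart \<open>d\<close>, and \<open>z'\<close> is the same tangent vector in the chart
    \<open>c\<close>.\<close>
  define z where "z = matrix_inv ?gd *v p"
  define z' where "z' = J d c x *v z"
  have Jz: "?J *v z' = z" unfolding z'_def using jacobian_inverse(1)[OF d c x(2,1)] by (simp add: matrix_vector_mul_assoc)
  have "?gc *v z' = transpose ?J *v (?gd *v (?J *v z'))"
    unfolding metric_transform[OF c d x] by (simp only: matrix_vector_mul_assoc matrix_mul_assoc)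
  also have "\<dots> = transpose ?J *v p"
    unfolding Jz z_def using metric_facts(2)[OF d x(2)] by (simp add: matrix_inv_works del: transpose_matrix_vector)
  finally have "matrix_inv ?gc *v (transpose ?J *v p) = z'"
    using matrix_inv_works(2)[of ?gc z'] metric_facts(2)[OF c x(1)] by simp
  then have "acoef c x *v (transpose ?J *v p) = dens c x *\<^sub>R (leading P c x *v z')"
    by (simp add: acoef_def scaleR_matrix_vector_assoc[symmetric] matrix_vector_mul_assoc[symmetric] del: transpose_matrix_vector)
  then have "(acoef c x *v (transpose ?J *v p)) \<bullet> (transpose ?J *v q) = dens c x * ((leading P c x *v z') \<bullet> (transpose ?J *v q))"
    by (simp del: transpose_matrix_vector)
  also have "(leading P c x *v z') \<bullet> (transpose ?J *v q) = (?J *v (leading P c x *v z')) \<bullet> q"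
    using dot_lmul_matrix[of q ?J "leading P c x *v z'"] by (simp add: inner_commute)
  also have "?J *v (leading P c x *v z') = leading P d x *v z"
  proof -
    have "?J ** leading P c x = leading P d x ** ?J"
      using bspec[OF bspec[OF bspec[OF elliptic_transform c] d] IntI[OF x]] by (simp add: Let_def)
    then show ?thesis by (metis Jz matrix_vector_mul_assoc)
  qed
  also have "dens c x * ((leading P d x *v z) \<bullet> q) = \<bar>det ?J\<bar> * ((acoef d x *v p) \<bullet> q)"
    unfolding dens_transform[OF c d x]
    by (simp add: acoef_def z_def scaleR_matrix_vector_assoc[symmetric] matrix_vector_mul_assoc[symmetric])
  finally show ?thesis .
qed

lemma acoef_l2:
  assumes c: "c \<in> atlas M" and D: "L_loc 2 (coords c UNIV) (\<lambda>y. D c (point c y))"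
  shows "L_loc 2 (coords c UNIV) (\<lambda>y. acoef c (point c y) *v D c (point c y))"
proof (rule L_loc_2_I)
  fix K k assume K: "compact K" "K \<subseteq> coords c UNIV"
  show "l2_on K (\<lambda>y. (acoef c (point c y) *v D c (point c y)) $ k)"
    unfolding matrix_vector_mult_def vec_lambda_beta
  proof (intro l2_on_sum K l2_on_continuous_mult L_loc_2_component[OF D])
    show "continuous_on K (\<lambda>y. acoef c (point c y) $ k $ i)" for i
      by (intro continuous_intros continuous_on_subset[OF continuous_on_acoef[OF c] K(2)])
  qed auto
qed

lemma density_acoef:
  assumes f: "H1M f D" and g: "H1M g E"
  shows "density (\<lambda>c x. (acoef c x *v D c x) \<bullet> E c x)"
  unfolding density_def
proof (intro conjI ballI allI impI)
  fix c K assume c: "c \<in> atlas M" and K: "compact K \<and> K \<subseteq> coords c UNIV"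
  show "set_integrable lebesgue K (\<lambda>y. (acoef c (point c y) *v D c (point c y)) \<bullet> E c (point c y))"
    unfolding inner_vec_def inner_real_def
    using K by (intro set_integrable_sum l2_on_mult_integrable L_loc_2_component[OF acoef_l2[OF c]]
        L_loc_2_component[OF H1C_D(3)[OF H1M_D(2)[OF g c]]] H1C_D(3)[OF H1M_D(2)[OF f c]]) auto
next
  fix c d x assume c: "c \<in> atlas M" "d \<in> atlas M" and x: "x \<in> fst c \<inter> fst d"
  then show "(acoef c x *v D c x) \<bullet> E c x = \<bar>det (J c d x)\<bar> * ((acoef d x *v D d x) \<bullet> E d x)"
    using acoef_transform[OF c, of x "D d x" "E d x"] H1M_D(3)[OF f c, of x] H1M_D(3)[OF g c, of x] by simp
qed

lemma density_dens:
  assumes f: "continuous_on UNIV (f :: 'a \<Rightarrow> real)"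
  shows "density (\<lambda>c x. f x * dens c x)"
proof (rule density_mult_continuous[OF _ f])
  show "density dens"
    unfolding density_def
  proof (intro conjI ballI allI impI)
    fix c K assume c: "c \<in> atlas M" and K: "compact K \<and> K \<subseteq> coords c UNIV"
    then show "set_integrable lebesgue K (\<lambda>y. dens c (point c y))"
      by (intro set_integrable_continuous_compact continuous_on_subset[OF continuous_on_dens[OF c]]) auto
  next
    fix c d x assume "c \<in> atlas M" "d \<in> atlas M" "x \<in> fst c \<inter> fst d"
    then show "dens c x = \<bar>det (J c d x)\<bar> * dens d x" using dens_transform by blast
  qed
qed

text \<open>Pairing with a raised covector through the metric is the plain pairing, so the metric
  drops out of the formula. The potential \<open>q\<close> is arbitrary so that the same formula
  covers \<open>P\<close> and the operators obtained from it by subtracting potentials.\<close>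

lemma weak_integrand_eq:
  assumes c: "c \<in> atlas M" and x: "point c y \<in> fst c"
  shows "weak_integrand M (P\<lparr>potential := q\<rparr>) c u w \<psi> y =
    (acoef c (point c y) *v w c (point c y) + u (point c y) *\<^sub>R bcoef c (point c y)) \<bullet> partials \<psi> y
     + (bcoef c (point c y) \<bullet> w c (point c y) + q (point c y) * u (point c y) * dens c (point c y)) * \<psi> y"
proof -
  let ?x = "point c y"
  have d: "det (metric M c ?x) \<noteq> 0" using metric_facts(2)[OF c x] by simp
  have r: "metric_inner M c ?x v (raise M c ?x p) = v \<bullet> p" for v p
    unfolding metric_inner_def raise_def using matrix_inv_works(1)[OF d] by simp
  have a: "acoef c ?x *v p = dens c ?x *\<^sub>R (leading P c ?x *v raise M c ?x p)" for p
    unfolding acoef_def raise_def by (simp add: scaleR_matrix_vector_assoc[symmetric] matrix_vector_mul_assoc)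
  show ?thesis
    unfolding weak_integrand_def Let_def r a bcoef_def
    by (simp add: inner_add_left algebra_simps)
qed

end

section \<open>Global weak identities\<close>

lemma lebesgue_integral_cong_AE:
  fixes f g :: "'a::euclidean_space \<Rightarrow> real"
  assumes f: "integrable lebesgue f" and ae: "AE x in lebesgue. f x = g x"
  shows "integrable lebesgue g" "(\<integral>x. g x \<partial>lebesgue) = (\<integral>x. f x \<partial>lebesgue)"
proof -
  have g: "g \<in> borel_measurable lebesgue" by (rule borel_measurable_AE[OF _ ae]) (use f in auto)
  have ae': "AE x in lebesgue. g x = f x" using ae by eventually_elim simp
  show "integrable lebesgue g" using f g ae' by (subst integrable_cong_AE[of _ _ f]) auto
  show "(\<integral>x. g x \<partial>lebesgue) = (\<integral>x. f x \<partial>lebesgue)" using f g ae' by (intro integral_cong_AE) auto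
qed

text \<open>A shifted mollifier is bounded below on the ball of half its radius, and dividing by it
  gives integrability of \<open>k\<close> there; finitely many such balls cover \<open>K\<close>. It
  is needed because the definition of a solution provides integrability only after multiplication
  with test functions.\<close>

lemma set_integrable_of_tests:
  fixes k :: "'a::euclidean_space \<Rightarrow> real"
  assumes S: "open S" and k: "\<And>\<psi>. test_function S \<psi> \<Longrightarrow> integrable lebesgue (\<lambda>y. k y * \<psi> y)"
    and K: "compact K" "K \<subseteq> S"
  shows "set_integrable lebesgue K k"
proof -
  have local: "\<exists>r>0. set_integrable lebesgue (cball x r) k" if x: "x \<in> K" for x
  proof -
    obtain e where e: "e > 0" "cball x e \<subseteq> S" using S x K(2) unfolding open_contains_cball by blast
    let ?\<psi> = "\<lambda>z. moll e (x - z)"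
    have i: "integrable lebesgue (\<lambda>z. k z * ?\<psi> z)" by (rule k[OF test_function_moll_shift[OF e]])
    let ?B = "cball x (e/2)"
    have pos: "?\<psi> z > 0" if "z \<in> ?B" for z
    proof -
      have "norm (x - z) < e" using that e(1) by (simp add: dist_norm)
      then have "(x - z) \<bullet> (x - z) < e\<^sup>2" unfolding power2_norm_eq_inner[symmetric] by (intro power_strict_mono) auto
      then show ?thesis using integral_bump_pos[OF e(1), where 'a='a] bump_pos_iff[of e "x - z"] by (simp add: moll_def)
    qed
    have c: "continuous_on ?B (\<lambda>z. 1 / ?\<psi> z)"
    proof (intro continuous_on_divide continuous_on_const ballI)
      show "continuous_on ?B ?\<psi>" by (rule continuous_on_compose2[OF continuous_on_moll[of UNIV]]) (auto intro!: continuous_intros)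
      show "?\<psi> z \<noteq> 0" if "z \<in> ?B" for z using pos[OF that] by simp
    qed
    obtain B where B: "\<And>z. z \<in> ?B \<Longrightarrow> \<bar>1 / ?\<psi> z\<bar> \<le> B" using continuous_compact_bounded[OF compact_cball c] by blast
    have si: "set_integrable lebesgue ?B (\<lambda>z. k z * ?\<psi> z)"
      by (rule set_integrable_subset[of _ UNIV]) (use i in \<open>auto simp: set_integrable_def\<close>)
    have "set_integrable lebesgue ?B (\<lambda>z. (1 / ?\<psi> z) * (k z * ?\<psi> z))"
    proof (rule set_integrable_bound_real)
      show "set_integrable lebesgue ?B (\<lambda>z. B * \<bar>k z * ?\<psi> z\<bar>)" using si by (intro set_integrable_mult_right set_integrable_abs)
      show "set_borel_measurable lebesgue ?B (\<lambda>z. (1 / ?\<psi> z) * (k z * ?\<psi> z))"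
        by (rule set_borel_measurable_mult[OF set_borel_measurable_continuous_compact[OF compact_cball c] set_integrable_imp_set_borel_measurable[OF si]])
      show "\<bar>(1 / ?\<psi> z) * (k z * ?\<psi> z)\<bar> \<le> B * \<bar>k z * ?\<psi> z\<bar>" if "z \<in> ?B" for z
        unfolding abs_mult[of "1 / ?\<psi> z"] using B[OF that] by (rule mult_right_mono) simp
    qed
    moreover have "indicat_real ?B z *\<^sub>R ((1 / ?\<psi> z) * (k z * ?\<psi> z)) = indicat_real ?B z *\<^sub>R k z" for z
    proof (cases "z \<in> ?B")
      case True
      then show ?thesis using pos[OF True] by simp
    qed simp
    ultimately have "set_integrable lebesgue ?B k" unfolding set_integrable_def by (simp only:)
    then show ?thesis using e(1) by (intro exI[of _ "e/2"]) auto
  qed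
  then obtain r where r: "\<And>x. x \<in> K \<Longrightarrow> r x > 0" "\<And>x. x \<in> K \<Longrightarrow> set_integrable lebesgue (cball x (r x)) k" by metis
  obtain C where C: "C \<subseteq> K" "finite C" "K \<subseteq> (\<Union>x\<in>C. ball x (r x))"
    using compactE_image[OF K(1), of K "\<lambda>x. ball x (r x)"] r(1) by (metis (no_types, lifting) UN_I centre_in_ball open_ball subsetI)
  have "set_integrable lebesgue (\<Union>x\<in>C. cball x (r x)) k"
    by (rule set_integrable_UN[OF C(2)]) (use C(1) r(2) in auto)
  then show ?thesis
    by (rule set_integrable_subset[OF _ _ subset_trans[OF C(3) UN_mono[OF subset_refl ball_subset_cball]]])
      (use K(1) in \<open>simp add: compact_imp_closed\<close>)
qed

lemma test_function_H1C:
  fixes \<psi> :: "real^'n \<Rightarrow> real"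
  assumes t: "test_function S \<psi>" and S: "open S"
  shows "H1C S \<psi> (partials \<psi>)"
proof (rule H1C_C1[OF S])
  note sm = test_functionD(1)[OF t]
  show "(\<psi> has_derivative (\<lambda>v. partials \<psi> x \<bullet> v)) (at x)" for x
    using smooth_on_differentiable[OF sm, of x] has_derivative_partials[OF smooth_on_differentiable[OF sm, of x]]
    by (metis (no_types, lifting) ext frechet_derivative_works)
  show "continuous_on S (partials \<psi>)"
    unfolding partials_def[abs_def] by (intro continuous_on_vec_lambda smooth_on_continuous[OF smooth_on_deriv[OF sm]])
qed

context weighted_manifold_space
begin

definition supported where
  "supported \<xi> E K \<longleftrightarrow> (\<forall>x. x \<notin> K \<longrightarrow> \<xi> x = (0::real) \<and> (\<forall>c\<in>atlas M. E c x = (0 :: real^'n)))"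

text \<open>The weak form of \<open>div Z = \<kappa>\<close>, with \<open>Z\<close> a vector density
  and \<open>\<kappa>\<close> a density. The transformation law of \<open>Z\<close> is expressed by
  its pairing with covectors, the only way in which \<open>Z\<close> is used.\<close>

definition flux_identity where
  "flux_identity Z \<kappa> \<longleftrightarrow>
     (\<forall>c\<in>atlas M. L_loc 2 (coords c UNIV) (\<lambda>y. Z c (point c y))) \<and>
     (\<forall>c\<in>atlas M. \<forall>K. compact K \<and> K \<subseteq> coords c UNIV \<longrightarrow> set_integrable lebesgue K (\<lambda>y. \<kappa> c (point c y))) \<and>
     (\<forall>c\<in>atlas M. \<forall>d\<in>atlas M. \<forall>x\<in>fst c \<inter> fst d.
        (\<forall>p. Z c x \<bullet> (transpose (J c d x) *v p) = \<bar>det (J c d x)\<bar> * (Z d x \<bullet> p)) \<and> \<kappa> c x = \<bar>det (J c d x)\<bar> * \<kappa> d x) \<and>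
     (\<forall>c\<in>atlas M. \<forall>\<psi>. test_function (coords c UNIV) \<psi> \<longrightarrow>
        (\<integral>y. Z c (point c y) \<bullet> partials \<psi> y + \<kappa> c (point c y) * \<psi> y \<partial>lebesgue) = (0::real))"

lemma flux_identityD:
  assumes "flux_identity Z \<kappa>" "c \<in> atlas M"
  shows "L_loc 2 (coords c UNIV) (\<lambda>y. Z c (point c y))"
    "compact K \<Longrightarrow> K \<subseteq> coords c UNIV \<Longrightarrow> set_integrable lebesgue K (\<lambda>y. \<kappa> c (point c y))"
    "d \<in> atlas M \<Longrightarrow> x \<in> fst c \<Longrightarrow> x \<in> fst d \<Longrightarrow> Z c x \<bullet> (transpose (J c d x) *v p) = \<bar>det (J c d x)\<bar> * (Z d x \<bullet> p)"
    "d \<in> atlas M \<Longrightarrow> x \<in> fst c \<Longrightarrow> x \<in> fst d \<Longrightarrow> \<kappa> c x = \<bar>det (J c d x)\<bar> * \<kappa> d x"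
    "test_function (coords c UNIV) \<psi> \<Longrightarrow> (\<integral>y. Z c (point c y) \<bullet> partials \<psi> y + \<kappa> c (point c y) * \<psi> y \<partial>lebesgue) = 0"
proof -
  note a = assms(1)[unfolded flux_identity_def]
  note a1 = bspec[OF conjunct1[OF a] assms(2)] and a2 = bspec[OF conjunct1[OF conjunct2[OF a]] assms(2)]
    and a3 = bspec[OF conjunct1[OF conjunct2[OF conjunct2[OF a]]] assms(2)] and a4 = bspec[OF conjunct2[OF conjunct2[OF conjunct2[OF a]]] assms(2)]
  show "L_loc 2 (coords c UNIV) (\<lambda>y. Z c (point c y))" by (rule a1)
  show "set_integrable lebesgue K (\<lambda>y. \<kappa> c (point c y))" if "compact K" "K \<subseteq> coords c UNIV" using a2 that by blast
  show "Z c x \<bullet> (transpose (J c d x) *v p) = \<bar>det (J c d x)\<bar> * (Z d x \<bullet> p)" if "d \<in> atlas M" "x \<in> fst c" "x \<in> fst d"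
    using spec[OF conjunct1[OF bspec[OF bspec[OF a3 that(1)] IntI[OF that(2,3)]]]] .
  show "\<kappa> c x = \<bar>det (J c d x)\<bar> * \<kappa> d x" if "d \<in> atlas M" "x \<in> fst c" "x \<in> fst d"
    using conjunct2[OF bspec[OF bspec[OF a3 that(1)] IntI[OF that(2,3)]]] .
  show "(\<integral>y. Z c (point c y) \<bullet> partials \<psi> y + \<kappa> c (point c y) * \<psi> y \<partial>lebesgue) = 0" if "test_function (coords c UNIV) \<psi>"
    using a4 that by blast
qed

lemma density_flux:
  assumes F: "flux_identity Z \<kappa>" and \<xi>: "H1M \<xi> E"
  shows "density (\<lambda>c x. Z c x \<bullet> E c x + \<kappa> c x * \<xi> x)"
  unfolding density_def
proof (intro conjI ballI allI impI)
  fix c K assume c: "c \<in> atlas M" and K: "compact K \<and> K \<subseteq> coords c UNIV"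
  show "set_integrable lebesgue K (\<lambda>y. Z c (point c y) \<bullet> E c (point c y) + \<kappa> c (point c y) * \<xi> (point c y))"
    by (rule weak_pairing_integrable[OF flux_identityD(1)[OF F c] flux_identityD(2)[OF F c] H1M_D(2)[OF \<xi> c] conjunct1[OF K] conjunct2[OF K]])
next
  fix c d x assume c: "c \<in> atlas M" "d \<in> atlas M" and x: "x \<in> fst c \<inter> fst d"
  show "Z c x \<bullet> E c x + \<kappa> c x * \<xi> x = \<bar>det (J c d x)\<bar> * (Z d x \<bullet> E d x + \<kappa> d x * \<xi> x)"
    using flux_identityD(3,4)[OF F c, of x] H1M_D(3)[OF \<xi> c, of x] x by (simp add: distrib_left)
qed

text \<open>Within one chart the identity extends from smooth test functions to \<open>\<xi>\<close>
  by \<open>weak_identity_extend\<close>, and \<open>total_chart\<close> identifies the coordinate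
  integral with the global one.\<close>

lemma flux_total_chart:
  assumes F: "flux_identity Z \<kappa>" and \<xi>: "H1M \<xi> E" and c: "c \<in> atlas M"
    and L: "compact L" "L \<subseteq> fst c" "supported \<xi> E L"
  shows "total (\<lambda>c x. Z c x \<bullet> E c x + \<kappa> c x * \<xi> x) = 0"
proof -
  let ?L = "coords c L" and ?f = "\<lambda>y. Z c (point c y) \<bullet> E c (point c y) + \<kappa> c (point c y) * \<xi> (point c y)"
  note CL = compact_coords[OF c L(1,2)]
  \<comment> \<open>A slightly larger compact set is needed, because mollifying \<open>\<xi>\<close>
    enlarges its support.\<close>
  obtain r K where r: "r > 0" and K: "compact K" "K \<subseteq> coords c UNIV" "?L \<subseteq> K"
    and near: "\<And>x y. x \<in> ?L \<Longrightarrow> dist x y \<le> r \<Longrightarrow> y \<in> K"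
    by (rule compact_neighborhood[OF CL(1) chartD(2)[OF c] CL(2)]) (rule that)
  have int: "?L \<subseteq> interior K"
  proof
    fix x assume "x \<in> ?L"
    then have "ball x r \<subseteq> K" using near by auto
    then show "x \<in> interior K" using r by (meson centre_in_ball interior_maximal open_ball subsetD)
  qed
  have z0: "\<xi> (point c y) = 0" "?f y = 0" if "y \<in> coords c UNIV" "y \<notin> ?L" for y
  proof -
    have "point c y \<notin> L" using that coords_iff[OF c, of y L] by blast
    then show "\<xi> (point c y) = 0" "?f y = 0" using L(3) c unfolding supported_def by auto
  qed
  have "(LINT y:K|lebesgue. ?f y) = 0"
    by (rule weak_identity_extend[OF chartD(2)[OF c] flux_identityD(1)[OF F c] flux_identityD(2)[OF F c] flux_identityD(5)[OF F c]
          H1M_D(2)[OF \<xi> c] K(1,2) CL(1) int z0(1)])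
  moreover have "indicat_real K y *\<^sub>R ?f y = indicat_real ?L y *\<^sub>R ?f y" for y
    using z0(2)[of y] K(2,3) by (cases "y \<in> ?L"; cases "y \<in> K") auto
  ultimately have "(LINT y:?L|lebesgue. ?f y) = 0" unfolding set_lebesgue_integral_def by (simp only:)
  moreover have "vanishes_off (\<lambda>c x. Z c x \<bullet> E c x + \<kappa> c x * \<xi> x) L"
    using L(3) unfolding supported_def vanishes_off_def by simp
  ultimately show ?thesis using total_chart[OF density_flux[OF F \<xi>] c L(1,2)] by simp
qed

definition cutoff_in_chart where
  "cutoff_in_chart \<theta> \<Theta> \<longleftrightarrow> H1M \<theta> \<Theta> \<and> (\<exists>c\<in>atlas M. \<exists>L. compact L \<and> L \<subseteq> fst c \<and> supported \<theta> \<Theta> L)"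

lemma total_zero: "total (\<lambda>c x. 0) = 0"
  unfolding total_def piece_integral_def by simp

lemma density_zero: "density (\<lambda>c x. 0)"
  unfolding density_def by (simp add: set_integrable_def)

lemma H1M_const: "H1M (\<lambda>x. k) (\<lambda>c x. 0)"
  unfolding H1M_def o_def
proof (intro conjI ballI)
  fix c assume "c \<in> atlas M"
  then show "H1C (coords c UNIV) (\<lambda>y. k) (\<lambda>y. 0)" by (intro H1C_C1 chartD(2)) auto
qed auto

text \<open>Globalises a chart by chart identity without a partition of unity: peel off one chart after the other by
  replacing \<open>\<xi>\<close> with \<open>\<xi> (1 - \<theta>)\<close>.\<close>

lemma flux_total_list:
  assumes F: "flux_identity Z \<kappa>"
  shows "\<forall>(\<theta>, \<Theta>)\<in>set ts. cutoff_in_chart \<theta> \<Theta> \<Longrightarrow> H1M \<xi> E \<Longrightarrow> compact K \<Longrightarrow> supported \<xi> E K \<Longrightarrow>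
    (\<And>x. \<xi> x \<noteq> 0 \<Longrightarrow> \<exists>t\<in>set ts. fst t x = 1) \<Longrightarrow> total (\<lambda>c x. Z c x \<bullet> E c x + \<kappa> c x * \<xi> x) = 0"
proof (induction ts arbitrary: \<xi> E)
  case Nil
  have \<xi>0: "\<xi> x = 0" for x using Nil.prems(5)[of x] by auto
  then have \<xi>z: "\<xi> = (\<lambda>x. 0)" by blast
  have "total (\<lambda>c x. Z c x \<bullet> E c x + \<kappa> c x * \<xi> x) = total (\<lambda>c x. 0)"
  proof (rule total_cong_AE[OF density_flux[OF F Nil.prems(2)] density_zero Nil.prems(3)])
    show "vanishes_off (\<lambda>c x. Z c x \<bullet> E c x + \<kappa> c x * \<xi> x) K"
      using Nil.prems(4) unfolding supported_def vanishes_off_def by simp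
    show "vanishes_off (\<lambda>c x. 0) K" by (simp add: vanishes_off_def)
    fix c assume c: "c \<in> atlas M"
    \<comment> \<open>The zero function may come with a nonzero \<open>E\<close> on a null set;
      uniqueness of weak gradients settles the base case.\<close>
    have "AE y in lebesgue. y \<in> coords c UNIV \<longrightarrow> E c (point c y) = 0"
      using H1C_unique[OF chartD(2)[OF c] H1M_D(2)[OF Nil.prems(2)[unfolded \<xi>z] c] H1M_D(2)[OF H1M_const[of 0] c]] .
    then show "AE y in lebesgue. y \<in> coords c UNIV \<longrightarrow>
      Z c (point c y) \<bullet> E c (point c y) + \<kappa> c (point c y) * \<xi> (point c y) = 0"
      by eventually_elim (simp add: \<xi>0)
  qed
  then show ?case by (simp add: total_zero)
next
  case (Cons t ts)
  obtain \<theta> \<Theta> where t: "t = (\<theta>, \<Theta>)" by (cases t)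
  have H: "H1M \<theta> \<Theta>" using Cons.prems(1) by (simp add: t cutoff_in_chart_def)
  obtain c L where c: "c \<in> atlas M" and L: "compact L" "L \<subseteq> fst c" "supported \<theta> \<Theta> L"
    using Cons.prems(1) by (auto simp: t cutoff_in_chart_def)
  define \<xi>1 where "\<xi>1 x = \<xi> x * \<theta> x" for x
  define E1 where "E1 c x = \<xi> x *\<^sub>R \<Theta> c x + \<theta> x *\<^sub>R E c x" for c x
  define \<xi>2 where "\<xi>2 x = \<xi> x + - 1 * \<xi>1 x" for x
  define E2 where "E2 c x = E c x + - 1 *\<^sub>R E1 c x" for c x
  have H1: "H1M \<xi>1 E1" unfolding \<xi>1_def[abs_def] E1_def[abs_def] by (rule H1M_mult[OF Cons.prems(2) H])
  have H2: "H1M \<xi>2 E2" unfolding \<xi>2_def[abs_def] E2_def[abs_def] by (rule H1M_add[OF Cons.prems(2) H1M_cmult[OF H1]])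
  have s1L: "supported \<xi>1 E1 L" using L(3) unfolding supported_def \<xi>1_def E1_def by simp
  have s1: "supported \<xi>1 E1 K" using Cons.prems(4) unfolding supported_def \<xi>1_def E1_def by simp
  have s2: "supported \<xi>2 E2 K" using Cons.prems(4) s1 unfolding supported_def \<xi>2_def E2_def by simp
  have 1: "total (\<lambda>c x. Z c x \<bullet> E1 c x + \<kappa> c x * \<xi>1 x) = 0" by (rule flux_total_chart[OF F H1 c L(1,2) s1L])
  have 2: "total (\<lambda>c x. Z c x \<bullet> E2 c x + \<kappa> c x * \<xi>2 x) = 0"
  proof (rule Cons.IH[OF _ H2 Cons.prems(3) s2])
    show "\<forall>(\<theta>, \<Theta>)\<in>set ts. cutoff_in_chart \<theta> \<Theta>" using Cons.prems(1) by simp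
    fix x assume x: "\<xi>2 x \<noteq> 0"
    then have "\<xi> x \<noteq> 0" "\<theta> x \<noteq> 1" by (auto simp: \<xi>2_def \<xi>1_def)
    then show "\<exists>t\<in>set ts. fst t x = 1" using Cons.prems(5)[of x] by (auto simp: t)
  qed
  have v: "vanishes_off (\<lambda>c x. Z c x \<bullet> E1 c x + \<kappa> c x * \<xi>1 x) K" "vanishes_off (\<lambda>c x. Z c x \<bullet> E2 c x + \<kappa> c x * \<xi>2 x) K"
    using s1 s2 unfolding supported_def vanishes_off_def by simp_all
  have "Z c x \<bullet> E c x + \<kappa> c x * \<xi> x = (Z c x \<bullet> E1 c x + \<kappa> c x * \<xi>1 x) + (Z c x \<bullet> E2 c x + \<kappa> c x * \<xi>2 x)" for c x
    by (simp add: E2_def \<xi>2_def inner_diff_right algebra_simps)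
  then have "total (\<lambda>c x. Z c x \<bullet> E c x + \<kappa> c x * \<xi> x)
    = total (\<lambda>c x. (Z c x \<bullet> E1 c x + \<kappa> c x * \<xi>1 x) + (Z c x \<bullet> E2 c x + \<kappa> c x * \<xi>2 x))" by presburger
  also have "\<dots> = 0" using total_add[OF density_flux[OF F H1] density_flux[OF F H2] Cons.prems(3) v] 1 2 by simp
  finally show ?case .
qed

end

section \<open>Cutoff functions\<close>

definition clamp01 :: "real \<Rightarrow> real" where "clamp01 s = max 0 (min 1 s)"

text \<open>On the unit interval this is the cubic that runs from 0 to 1 with slope 0 at both ends.
  Being \<open>C^1\<close> is enough for the cutoffs, since the weak identities have been extended
  to the class \<open>H1C\<close>.\<close>

definition smooth_step :: "real \<Rightarrow> real" where "smooth_step s = 3 * (clamp01 s)\<^sup>2 - 2 * (clamp01 s) ^ 3"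

definition smooth_step' :: "real \<Rightarrow> real" where "smooth_step' s = 6 * clamp01 s * (1 - clamp01 s)"

text \<open>At the corners of the clamp the derivative from the constant side is 0, and
  \<open>q 0 = q 1 = 0\<close> makes the derivative from the other side agree with it.\<close>

lemma clamp_poly_DERIV:
  fixes p q :: "real \<Rightarrow> real"
  assumes p: "\<And>s. (p has_real_derivative q s) (at s)" and q: "q 0 = 0" "q 1 = 0"
  shows "((\<lambda>s. p (clamp01 s)) has_real_derivative q (clamp01 s)) (at s)"
proof -
  have within: "((\<lambda>s. p (clamp01 s)) has_real_derivative q (clamp01 s)) (at s within A)"
    if "s \<in> A" "\<And>t. t \<in> A \<Longrightarrow> p (clamp01 t) = f t" "(f has_real_derivative q (clamp01 s)) (at s)" for A f
  proof -
    have f: "(f has_real_derivative q (clamp01 s)) (at s within A)" using that(3) by (rule DERIV_subset) simp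
    show ?thesis
      unfolding has_field_derivative_def by (rule has_derivative_transform[OF that(1,2) f[unfolded has_field_derivative_def]])
  qed
  consider "s < 0" | "s = 0" | "0 < s" "s < 1" | "s = 1" | "s > 1" by linarith
  then show ?thesis
  proof cases
    case 1
    have "((\<lambda>s. p (clamp01 s)) has_real_derivative q (clamp01 s)) (at s within {..<0})"
      using 1 by (intro within[of _ "\<lambda>_. p 0"]) (auto simp: clamp01_def q)
    then show ?thesis using 1 at_within_open[of s "{..<0}"] by simp
  next
    case 2
    have l: "((\<lambda>s. p (clamp01 s)) has_real_derivative q (clamp01 s)) (at s within {..0})"
      using 2 by (intro within[of _ "\<lambda>_. p 0"]) (auto simp: clamp01_def q)
    have r: "((\<lambda>s. p (clamp01 s)) has_real_derivative q (clamp01 s)) (at s within {0..1})"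
      using 2 p[of 0] by (intro within[of _ p]) (auto simp: clamp01_def q)
    have "((\<lambda>s. p (clamp01 s)) has_real_derivative q (clamp01 s)) (at s within ({..0} \<union> {0..1}))"
      using l r unfolding has_field_derivative_iff by (rule Lim_Un)
    then have "((\<lambda>s. p (clamp01 s)) has_real_derivative q (clamp01 s)) (at s within {..<1})"
      by (rule DERIV_subset) auto
    then show ?thesis using 2 at_within_open[of s "{..<1}"] by simp
  next
    case 3
    have "((\<lambda>s. p (clamp01 s)) has_real_derivative q (clamp01 s)) (at s within {0<..<1})"
      using 3 p[of s] by (intro within[of _ p]) (auto simp: clamp01_def)
    then show ?thesis using 3 at_within_open[of s "{0<..<1}"] by simp
  next
    case 4
    have l: "((\<lambda>s. p (clamp01 s)) has_real_derivative q (clamp01 s)) (at s within {1..})"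
      using 4 by (intro within[of _ "\<lambda>_. p 1"]) (auto simp: clamp01_def q)
    have r: "((\<lambda>s. p (clamp01 s)) has_real_derivative q (clamp01 s)) (at s within {0..1})"
      using 4 p[of 1] by (intro within[of _ p]) (auto simp: clamp01_def q)
    have "((\<lambda>s. p (clamp01 s)) has_real_derivative q (clamp01 s)) (at s within ({1..} \<union> {0..1}))"
      using l r unfolding has_field_derivative_iff by (rule Lim_Un)
    then have "((\<lambda>s. p (clamp01 s)) has_real_derivative q (clamp01 s)) (at s within {0<..})"
      by (rule DERIV_subset) auto
    then show ?thesis using 4 at_within_open[of s "{0<..}"] by simp
  next
    case 5
    have "((\<lambda>s. p (clamp01 s)) has_real_derivative q (clamp01 s)) (at s within {1<..})"
      using 5 by (intro within[of _ "\<lambda>_. p 1"]) (auto simp: clamp01_def q)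
    then show ?thesis using 5 at_within_open[of s "{1<..}"] by simp
  qed
qed

lemma continuous_on_clamp: "continuous_on A clamp01"
  unfolding clamp01_def[abs_def] by (intro continuous_intros)

lemma smooth_step_DERIV: "(smooth_step has_real_derivative smooth_step' s) (at s)"
  unfolding smooth_step_def[abs_def] smooth_step'_def
  by (rule clamp_poly_DERIV[of "\<lambda>s. 3 * s\<^sup>2 - 2 * s ^ 3" "\<lambda>s. 6 * s * (1 - s)"])
     (auto intro!: derivative_eq_intros simp: power2_eq_square algebra_simps)

lemma continuous_on_smooth_step': "continuous_on A smooth_step'"
  unfolding smooth_step'_def[abs_def] by (intro continuous_intros continuous_on_clamp)

lemma smooth_step_simps: "s \<le> 0 \<Longrightarrow> smooth_step s = 0" "s \<ge> 1 \<Longrightarrow> smooth_step s = 1"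
   "s \<le> 0 \<Longrightarrow> smooth_step' s = 0" "s \<ge> 1 \<Longrightarrow> smooth_step' s = 0"
  by (auto simp: smooth_step_def smooth_step'_def clamp01_def)

lemma smooth_step_range: "0 \<le> smooth_step s" "smooth_step s \<le> 1"
proof -
  have c: "0 \<le> clamp01 s" "clamp01 s \<le> 1" by (auto simp: clamp01_def)
  have "smooth_step s = (clamp01 s)\<^sup>2 * (3 - 2 * clamp01 s)"
    by (simp add: smooth_step_def power2_eq_square power3_eq_cube algebra_simps)
  also have "\<dots> \<ge> 0" using c by (intro mult_nonneg_nonneg) auto
  finally show "0 \<le> smooth_step s" .
  have "1 - smooth_step s = (1 - clamp01 s)\<^sup>2 * (1 + 2 * clamp01 s)"
    by (simp add: smooth_step_def power2_eq_square power3_eq_cube algebra_simps)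
  also have "\<dots> \<ge> 0" using c by (intro mult_nonneg_nonneg) auto
  finally show "smooth_step s \<le> 1" by simp
qed

context weighted_manifold_space
begin

text \<open>For classical derivatives the transformation law of \<open>D\<close> is a consequence of
  the chain rule; it is derived in \<open>C1M_imp_H1M\<close>.\<close>

definition C1M :: "('a \<Rightarrow> real) \<Rightarrow> (('a, 'n) chart \<Rightarrow> 'a \<Rightarrow> real^'n) \<Rightarrow> bool" where
  "C1M f D \<longleftrightarrow> (\<forall>c\<in>atlas M. (\<forall>y\<in>coords c UNIV. ((\<lambda>y. f (point c y)) has_derivative (\<lambda>v. D c (point c y) \<bullet> v)) (at y)) \<and>
     continuous_on (coords c UNIV) (\<lambda>y. D c (point c y)))"

lemma C1M_D:
  assumes "C1M f D" "c \<in> atlas M"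
  shows "y \<in> coords c UNIV \<Longrightarrow> ((\<lambda>y. f (point c y)) has_derivative (\<lambda>v. D c (point c y) \<bullet> v)) (at y)"
    "continuous_on (coords c UNIV) (\<lambda>y. D c (point c y))"
  using assms unfolding C1M_def by blast+

lemma C1M_const: "C1M (\<lambda>x. k) (\<lambda>c x. 0)"
proof -
  have "((\<lambda>y. k) has_derivative (\<lambda>v. (0 :: real^'n) \<bullet> v)) (at y)" for y :: "real^'n"
    by (rule has_derivative_eq_rhs[OF has_derivative_const]) (simp add: fun_eq_iff)
  then show ?thesis unfolding C1M_def by (intro ballI conjI) (assumption | rule continuous_on_const)+
qed

lemma C1M_continuous:
  assumes "C1M f D" "c \<in> atlas M"
  shows "continuous_on (coords c UNIV) (\<lambda>y. f (point c y))"
  using C1M_D(1)[OF assms] by (auto intro!: continuous_at_imp_continuous_on has_derivative_continuous)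

lemma C1M_mult:
  assumes f: "C1M f D" and g: "C1M g E"
  shows "C1M (\<lambda>x. f x * g x) (\<lambda>c x. f x *\<^sub>R E c x + g x *\<^sub>R D c x)"
  unfolding C1M_def
proof (intro ballI conjI)
  fix c y assume c: "c \<in> atlas M" and y: "y \<in> coords c UNIV"
  show "((\<lambda>y. f (point c y) * g (point c y)) has_derivative
      (\<lambda>v. (f (point c y) *\<^sub>R E c (point c y) + g (point c y) *\<^sub>R D c (point c y)) \<bullet> v)) (at y)"
    using has_derivative_mult[OF C1M_D(1)[OF f c y] C1M_D(1)[OF g c y]] by (simp add: inner_add_left mult.commute)
next
  fix c assume c: "c \<in> atlas M"
  show "continuous_on (coords c UNIV) (\<lambda>y. f (point c y) *\<^sub>R E c (point c y) + g (point c y) *\<^sub>R D c (point c y))"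
    by (intro continuous_intros C1M_D(2)[OF f c] C1M_D(2)[OF g c] C1M_continuous[OF f c] C1M_continuous[OF g c])
qed

lemma C1M_one_minus:
  assumes f: "C1M f D"
  shows "C1M (\<lambda>x. 1 - f x) (\<lambda>c x. - D c x)"
  unfolding C1M_def
proof (intro ballI conjI)
  fix c y assume c: "c \<in> atlas M" and y: "y \<in> coords c UNIV"
  show "((\<lambda>y. 1 - f (point c y)) has_derivative (\<lambda>v. (- D c (point c y)) \<bullet> v)) (at y)"
    using has_derivative_diff[OF has_derivative_const C1M_D(1)[OF f c y]] by simp
next
  fix c assume c: "c \<in> atlas M"
  show "continuous_on (coords c UNIV) (\<lambda>y. - D c (point c y))" by (intro continuous_intros C1M_D(2)[OF f c])
qed

lemma C1M_glue:
  assumes A: "open A" "open B" "A \<union> B = UNIV" and g: "C1M g D1" and h: "C1M h D2"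
    and fA: "\<And>x. x \<in> A \<Longrightarrow> f x = g x" "\<And>c x. x \<in> A \<Longrightarrow> D c x = D1 c x"
    and fB: "\<And>x. x \<in> B \<Longrightarrow> f x = h x" "\<And>c x. x \<in> B \<Longrightarrow> D c x = D2 c x"
  shows "C1M f D"
proof -
  have step: "((\<lambda>y. f (point c y)) has_derivative (\<lambda>v. D c (point c y) \<bullet> v)) (at y)"
    if U: "open U" and k: "C1M k E" and eq: "\<And>x. x \<in> U \<Longrightarrow> f x = k x" "\<And>c x. x \<in> U \<Longrightarrow> D c x = E c x"
      and c: "c \<in> atlas M" and y: "y \<in> coords c UNIV" "point c y \<in> U" for U k E c y
  proof -
    have "y \<in> coords c U" using coords_iff[OF c] y by blast
    then have "((\<lambda>y. f (point c y)) has_derivative (\<lambda>v. E c (point c y) \<bullet> v)) (at y)"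
      by (rule has_derivative_transform_within_open[OF C1M_D(1)[OF k c y(1)] open_coords[OF c U]])
         (use eq(1) coord_point(3)[OF c] in auto)
    then show ?thesis using eq(2)[OF y(2)] by simp
  qed
  show ?thesis
    unfolding C1M_def
  proof (intro ballI conjI)
    fix c y assume c: "c \<in> atlas M" and y: "y \<in> coords c UNIV"
    have "point c y \<in> A \<or> point c y \<in> B" using A(3) by blast
    then show "((\<lambda>y. f (point c y)) has_derivative (\<lambda>v. D c (point c y) \<bullet> v)) (at y)"
      using step[OF A(1) g fA c y] step[OF A(2) h fB c y] by blast
  next
    fix c assume c: "c \<in> atlas M"
    have "continuous_on (coords c A) (\<lambda>y. D c (point c y))"
      by (rule continuous_on_eq[OF continuous_on_subset[OF C1M_D(2)[OF g c] coords_mono[OF subset_UNIV]]])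
         (use fA(2) coord_point(3)[OF c] in auto)
    moreover have "continuous_on (coords c B) (\<lambda>y. D c (point c y))"
      by (rule continuous_on_eq[OF continuous_on_subset[OF C1M_D(2)[OF h c] coords_mono[OF subset_UNIV]]])
         (use fB(2) coord_point(3)[OF c] in auto)
    ultimately have "continuous_on (coords c A \<union> coords c B) (\<lambda>y. D c (point c y))"
      using open_coords[OF c A(1)] open_coords[OF c A(2)] by (intro continuous_on_open_Un) auto
    moreover have "coords c A \<union> coords c B = coords c UNIV" using A(3) by (auto simp: coords_def)
    ultimately show "continuous_on (coords c UNIV) (\<lambda>y. D c (point c y))" by simp
  qed
qed

lemma C1M_imp_H1M:
  assumes f: "C1M f D"
  shows "H1M f D"
  unfolding H1M_def o_def
proof (intro conjI ballI)
  show "continuous_on UNIV f"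
  proof (rule continuous_at_imp_continuous_on, rule ballI)
    fix x
    obtain c where c: "c \<in> atlas M" "x \<in> fst c" by (rule atlas_covers)
    have "continuous_on (fst c) (\<lambda>x. f (point c (snd c x)))"
      by (rule continuous_on_compose2[OF C1M_continuous[OF f c(1)] continuous_on_coord[OF c(1)]]) (auto simp: coords_def)
    then have "continuous_on (fst c) f" by (rule continuous_on_eq) (simp add: point_coord(1)[OF c(1)])
    then show "isCont f x" using c chartD(1)[OF c(1)] continuous_on_eq_continuous_at by blast
  qed
  fix c assume c: "c \<in> atlas M"
  show "H1C (coords c UNIV) (\<lambda>y. f (point c y)) (\<lambda>y. D c (point c y))"
    by (rule H1C_C1[OF chartD(2)[OF c] C1M_D[OF f c]])
next
  fix c d x assume c: "c \<in> atlas M" and d: "d \<in> atlas M" and x: "x \<in> fst c \<inter> fst d"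
  let ?y = "snd c x"
  have y: "?y \<in> coords c (fst d)" and px: "point c ?y = x" and y': "?y \<in> coords c UNIV"
    using x point_coord[OF c] by (auto simp: coords_def)
  have ty: "transition c d ?y \<in> coords d UNIV" "point d (transition c d ?y) = x"
    using transition_simps(2,3)[OF c d y] coords_mono[of "fst c" UNIV d] px by auto
  have "((\<lambda>y. f (point d (transition c d y))) has_derivative (\<lambda>v. D d x \<bullet> (J c d x *v v))) (at ?y)"
    using has_derivative_compose[OF transition_has_derivative[OF c d y] C1M_D(1)[OF f d ty(1)]] by (simp add: ty(2) px)
  then have "((\<lambda>y. f (point c y)) has_derivative (\<lambda>v. D d x \<bullet> (J c d x *v v))) (at ?y)"
    by (rule has_derivative_transform_within_open[OF _ open_coords[OF c chartD(1)[OF d]] y])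
       (use transition_simps(2)[OF c d] in simp)
  from has_derivative_unique[OF this C1M_D(1)[OF f c y', unfolded px]]
  have "D d x \<bullet> (J c d x *v v) = D c x \<bullet> v" for v by metis
  then have "(transpose (J c d x) *v D d x) \<bullet> v = D c x \<bullet> v" for v
    using dot_lmul_matrix[of "D d x" "J c d x" v] by simp
  then show "D c x = transpose (J c d x) *v D d x" by (metis inner_commute vector_eq_rdot)
qed

lemma cutoff_exists:
  obtains \<theta> \<Theta> V where "C1M \<theta> \<Theta>" "cutoff_in_chart \<theta> \<Theta>" "open V" "x \<in> V" "\<And>z. z \<in> V \<Longrightarrow> \<theta> z = 1"
    "\<And>z. 0 \<le> \<theta> z \<and> \<theta> z \<le> 1"
proof -
  obtain c where c: "c \<in> atlas M" "x \<in> fst c" by (rule atlas_covers)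
  let ?p = "snd c x"
  obtain r0 where r0: "r0 > 0" "cball ?p r0 \<subseteq> coords c UNIV"
    using chartD(2)[OF c(1)] point_coord(2)[OF c] unfolding open_contains_cball by blast
  define r where "r = r0 / 2"
  have r: "r > 0" "cball ?p (2 * r) \<subseteq> coords c UNIV" using r0 by (auto simp: r_def)
  \<comment> \<open>At least 1 within distance \<open>r\<close> of \<open>?p\<close> and nonpositive
    from distance \<open>sqrt 2 * r\<close> on, so \<open>smooth_step (q y)\<close> is 1 on the
    small ball and vanishes off the ball of radius \<open>2 * r\<close>.\<close>
  define q where "q y = 2 - (y - ?p) \<bullet> (y - ?p) / r\<^sup>2" for y
  define F where "F y = smooth_step (q y)" for y
  define G where "G y = smooth_step' (q y) *\<^sub>R (- (2 / r\<^sup>2)) *\<^sub>R (y - ?p)" for y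
  have dq: "(q has_derivative (\<lambda>v. (- (2 / r\<^sup>2)) * ((y - ?p) \<bullet> v))) (at y)" for y
    unfolding q_def[abs_def] using r(1) by (auto intro!: derivative_eq_intros simp: inner_commute field_simps)
  have dF: "(F has_derivative (\<lambda>v. G y \<bullet> v)) (at y)" for y
    using DERIV_compose_FDERIV[OF smooth_step_DERIV dq, of y] unfolding F_def[abs_def] G_def by (simp add: mult_ac)
  have qc: "continuous_on A q" for A unfolding q_def[abs_def] using r(1) by (intro continuous_intros) auto
  have Gc: "continuous_on A G" for A unfolding G_def[abs_def]
    by (intro continuous_intros continuous_on_compose2[OF continuous_on_smooth_step'[of UNIV] qc]) auto
  have q1: "q y \<ge> 1" if "y \<in> ball ?p r" for y
  proof -
    have "(norm (y - ?p))\<^sup>2 \<le> r\<^sup>2" using that by (intro power_mono) (auto simp: dist_norm norm_minus_commute)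
    then have "(y - ?p) \<bullet> (y - ?p) / r\<^sup>2 \<le> 1" using r(1) by (simp add: power2_norm_eq_inner)
    then show ?thesis by (simp add: q_def)
  qed
  have q0: "q y \<le> 0" if "y \<notin> cball ?p (2 * r)" for y
  proof -
    have "(2 * r)\<^sup>2 \<le> (norm (y - ?p))\<^sup>2" using that r(1) by (intro power_mono) (auto simp: dist_norm norm_minus_commute)
    then have "4 \<le> (y - ?p) \<bullet> (y - ?p) / r\<^sup>2" using r(1) by (simp add: power2_norm_eq_inner divide_simps power_mult_distrib)
    then show ?thesis by (simp add: q_def)
  qed
  let ?L = "point c ` cball ?p (2 * r)"
  have L: "compact ?L" "?L \<subseteq> fst c" using compact_point_image[OF c(1) compact_cball r(2)] by auto
  define \<theta> where "\<theta> z = (if z \<in> fst c then F (snd c z) else 0)" for z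
  \<comment> \<open>The differential in any other chart \<open>d\<close> is the pullback of the
    differential in \<open>c\<close> by the transition map.\<close>
  define \<Theta> where "\<Theta> d z = (if z \<in> fst c then transpose (J d c z) *v G (snd c z) else 0)" for d z
  have off: "\<theta> z = 0" "\<Theta> d z = 0" if "z \<notin> ?L" for z d
  proof -
    have "snd c z \<notin> cball ?p (2 * r)" if "z \<in> fst c"
    proof
      assume "snd c z \<in> cball ?p (2 * r)"
      then have "point c (snd c z) \<in> ?L" by (rule imageI)
      then show False using \<open>z \<notin> ?L\<close> point_coord(1)[OF c(1) that] by simp
    qed
    then show "\<theta> z = 0" "\<Theta> d z = 0"
      using q0 by (auto simp: \<theta>_def \<Theta>_def F_def G_def smooth_step_simps)
  qed
  have C1: "C1M \<theta> \<Theta>"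
    unfolding C1M_def
  proof (intro ballI conjI)
    fix d y assume d: "d \<in> atlas M" and y: "y \<in> coords d UNIV"
    show "((\<lambda>y. \<theta> (point d y)) has_derivative (\<lambda>v. \<Theta> d (point d y) \<bullet> v)) (at y)"
    proof (cases "point d y \<in> fst c")
      case True
      have yc: "y \<in> coords d (fst c)" using True y coords_iff[OF d] by blast
      have "((\<lambda>y. F (transition d c y)) has_derivative (\<lambda>v. G (transition d c y) \<bullet> (J d c (point d y) *v v))) (at y)"
        by (rule has_derivative_compose[OF transition_has_derivative[OF d c(1) yc] dF])
      moreover have "G (transition d c y) \<bullet> (J d c (point d y) *v v) = \<Theta> d (point d y) \<bullet> v" for v
        using True transition_simps(1)[OF d c(1) yc] dot_lmul_matrix[of "G (transition d c y)" "J d c (point d y)" v] by (simp add: \<Theta>_def)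
      ultimately have "((\<lambda>y. F (transition d c y)) has_derivative (\<lambda>v. \<Theta> d (point d y) \<bullet> v)) (at y)" by simp
      then show ?thesis
        by (rule has_derivative_transform_within_open[OF _ open_coords[OF d chartD(1)[OF c(1)]] yc])
           (use transition_simps(1)[OF d c(1)] coord_point(3)[OF d] in \<open>simp add: \<theta>_def\<close>)
    next
      case False
      then have nL: "point d y \<in> - ?L" using L(2) by blast
      have oL: "open (- ?L)" using compact_imp_closed[OF L(1)] by auto
      have "y \<in> coords d (- ?L)" using nL y coords_iff[OF d] by blast
      then have "((\<lambda>y. \<theta> (point d y)) has_derivative (\<lambda>_. 0)) (at y)"
        by (rule frechet_derivative_eq_0_locally(1)[OF open_coords[OF d oL]]) (use off(1) coord_point(3)[OF d] in auto)
      then show ?thesis using off(2)[of "point d y" d] nL by simp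
    qed
  next
    fix d assume d: "d \<in> atlas M"
    have oL: "open (- ?L)" using compact_imp_closed[OF L(1)] by auto
    have Tc: "continuous_on (coords d (fst c)) (transition d c)"
      using transition_has_derivative[OF d c(1)] by (auto intro!: continuous_at_imp_continuous_on has_derivative_continuous)
    have "continuous_on (coords d (fst c)) (\<lambda>y. \<chi> i. \<Sum>j\<in>UNIV. J d c (point d y) $ j $ i * G (transition d c y) $ j)"
      by (intro continuous_on_vec_lambda continuous_intros transition_diffeo[OF d c(1)] continuous_on_compose2[OF Gc[of UNIV] Tc]) auto
    then have "continuous_on (coords d (fst c)) (\<lambda>y. \<Theta> d (point d y))"
    proof (rule continuous_on_eq)
      fix y assume y: "y \<in> coords d (fst c)"
      show "(\<chi> i. \<Sum>j\<in>UNIV. J d c (point d y) $ j $ i * G (transition d c y) $ j) = \<Theta> d (point d y)"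
        using coord_point(3)[OF d y] transition_simps(1)[OF d c(1) y]
        by (simp add: \<Theta>_def matrix_vector_mult_def transpose_def del: transpose_matrix_vector)
    qed
    moreover have "continuous_on (coords d (- ?L)) (\<lambda>y. \<Theta> d (point d y))"
    proof (rule continuous_on_eq[of _ "\<lambda>_. 0"])
      fix y assume y: "y \<in> coords d (- ?L)"
      then show "0 = \<Theta> d (point d y)" using coord_point(3)[OF d y] off(2)[of "point d y" d] by simp
    qed simp
    ultimately have "continuous_on (coords d (fst c) \<union> coords d (- ?L)) (\<lambda>y. \<Theta> d (point d y))"
      using open_coords[OF d chartD(1)[OF c(1)]] open_coords[OF d oL] by (intro continuous_on_open_Un) auto
    moreover have "coords d (fst c) \<union> coords d (- ?L) = coords d UNIV"
    proof -
      have "fst c \<union> - ?L = UNIV" using L(2) by blast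
      moreover have "coords d (fst c) \<union> coords d (- ?L) = coords d (fst c \<union> - ?L)" by (auto simp: coords_def)
      ultimately show ?thesis by simp
    qed
    ultimately show "continuous_on (coords d UNIV) (\<lambda>y. \<Theta> d (point d y))" by simp
  qed
  have "supported \<theta> \<Theta> ?L" unfolding supported_def using off by blast
  then have "cutoff_in_chart \<theta> \<Theta>" unfolding cutoff_in_chart_def using C1M_imp_H1M[OF C1] c(1) L by blast
  moreover have "open (fst c \<inter> snd c -` ball ?p r)"
    by (rule continuous_open_preimage[OF continuous_on_coord[OF c(1)] chartD(1)[OF c(1)] open_ball])
  moreover have "x \<in> fst c \<inter> snd c -` ball ?p r" using c(2) r(1) by simp
  moreover have "\<theta> z = 1" if "z \<in> fst c \<inter> snd c -` ball ?p r" for z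
    using that q1[of "snd c z"] by (simp add: \<theta>_def F_def smooth_step_simps)
  moreover have "0 \<le> \<theta> z \<and> \<theta> z \<le> 1" for z using smooth_step_range by (simp add: \<theta>_def F_def)
  ultimately show ?thesis by (rule that[OF C1])
qed

definition nice_cutoff where
  "nice_cutoff t \<longleftrightarrow> C1M (fst t) (snd t) \<and> cutoff_in_chart (fst t) (snd t) \<and> (\<forall>z. 0 \<le> fst t z \<and> fst t z \<le> 1)"

text \<open>A list rather than a set, because \<open>flux_total_list\<close> and
  \<open>cutoff_product\<close> recurse over it. The open set \<open>V\<close> leaves a
  neighbourhood of \<open>K\<close> on which some cutoff is 1.\<close>

lemma cutoff_list:
  assumes K: "compact K"
  obtains ts V where "\<forall>t\<in>set ts. nice_cutoff t" "open V" "K \<subseteq> V"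
    "\<And>x. x \<in> V \<Longrightarrow> \<exists>t\<in>set ts. fst t x = 1"
proof -
  let ?P = "\<lambda>x tV. nice_cutoff (fst tV) \<and> open (snd tV) \<and> x \<in> snd tV \<and> (\<forall>z\<in>snd tV. fst (fst tV) z = 1)"
  have "\<forall>x. \<exists>tV. ?P x tV"
  proof
    fix x
    obtain \<theta> \<Theta> V where "C1M \<theta> \<Theta>" "cutoff_in_chart \<theta> \<Theta>" "open V" "x \<in> V" "\<And>z. z \<in> V \<Longrightarrow> \<theta> z = 1"
      "\<And>z. 0 \<le> \<theta> z \<and> \<theta> z \<le> 1"
      by (rule cutoff_exists[of x]) (rule that)
    then show "\<exists>tV. ?P x tV" by (intro exI[of _ "((\<theta>, \<Theta>), V)"]) (simp add: nice_cutoff_def)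
  qed
  from choice[OF this] obtain tV where "\<forall>x. ?P x (tV x)" by (elim exE)
  then have tV: "\<And>x. nice_cutoff (fst (tV x))" "\<And>x. open (snd (tV x))" "\<And>x. x \<in> snd (tV x)"
    "\<And>x z. z \<in> snd (tV x) \<Longrightarrow> fst (fst (tV x)) z = 1" by simp_all
  have KV: "K \<subseteq> (\<Union>x\<in>K. snd (tV x))" using tV(3) by blast
  obtain C where C: "C \<subseteq> K" "finite C" "K \<subseteq> (\<Union>x\<in>C. snd (tV x))"
    by (rule compactE_image[OF K _ KV]) (use tV(2) in blast)+
  obtain xs where xs: "set xs = C" using C(2) finite_list by blast
  show ?thesis
  proof (rule that[of "map (\<lambda>x. fst (tV x)) xs" "\<Union>x\<in>C. snd (tV x)"])
    show "\<forall>t\<in>set (map (\<lambda>x. fst (tV x)) xs). nice_cutoff t" using tV(1) by simp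
    show "open (\<Union>x\<in>C. snd (tV x))" using tV(2) by blast
    show "K \<subseteq> (\<Union>x\<in>C. snd (tV x))" by (rule C(3))
    show "\<exists>t\<in>set (map (\<lambda>x. fst (tV x)) xs). fst t z = 1" if zC: "z \<in> (\<Union>x\<in>C. snd (tV x))" for z
    proof -
      obtain x where "x \<in> C" "z \<in> snd (tV x)" using zC by blast
      then show ?thesis using tV(4)[of z x] xs by (intro bexI[of _ "fst (tV x)"]) auto
    qed
  qed
qed

text \<open>The divergence theorem for compactly supported test functions on the manifold; the
  cutoffs of \<open>cutoff_list\<close> feed the recursion of
  \<open>flux_total_list\<close>.\<close>

lemma flux_total:
  assumes F: "flux_identity Z \<kappa>" and \<xi>: "H1M \<xi> E" and K: "compact K" "supported \<xi> E K"
  shows "total (\<lambda>c x. Z c x \<bullet> E c x + \<kappa> c x * \<xi> x) = 0"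
proof -
  obtain ts V where ts: "\<forall>t\<in>set ts. nice_cutoff t" and V: "open V" "K \<subseteq> V"
    "\<And>x. x \<in> V \<Longrightarrow> \<exists>t\<in>set ts. fst t x = 1" by (rule cutoff_list[OF K(1)]) (rule that)
  show ?thesis
  proof (rule flux_total_list[OF F _ \<xi> K])
    show "\<forall>(\<theta>, \<Theta>)\<in>set ts. cutoff_in_chart \<theta> \<Theta>" using ts by (auto simp: nice_cutoff_def)
    show "\<exists>t\<in>set ts. fst t x = 1" if "\<xi> x \<noteq> 0" for x using that K(2) V unfolding supported_def by blast
  qed
qed

text \<open>The product of the factors \<open>1 - \<theta>\<close> vanishes wherever one cutoff is 1
  and equals 1 off the union of their compact supports.\<close>

lemma cutoff_product:
  assumes "\<forall>t\<in>set ts. nice_cutoff t"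
  shows "\<exists>\<rho> R L. C1M \<rho> R \<and> (\<forall>x. 0 \<le> \<rho> x \<and> \<rho> x \<le> 1) \<and> (\<forall>x. (\<exists>t\<in>set ts. fst t x = 1) \<longrightarrow> \<rho> x = 0) \<and>
    compact L \<and> (\<forall>x. x \<notin> L \<longrightarrow> \<rho> x = 1 \<and> (\<forall>c\<in>atlas M. R c x = 0))"
  using assms
proof (induction ts)
  case Nil
  then show ?case
    by (intro exI[of _ "\<lambda>x. 1"] exI[of _ "\<lambda>c x. 0"] exI[of _ "{}"]) (simp add: C1M_const)
next
  case (Cons t ts)
  have "\<forall>t\<in>set ts. nice_cutoff t" using Cons.prems by simp
  from Cons.IH[OF this] obtain \<rho> R L where IH: "C1M \<rho> R" "\<forall>x. 0 \<le> \<rho> x \<and> \<rho> x \<le> 1" "\<forall>x. (\<exists>t\<in>set ts. fst t x = 1) \<longrightarrow> \<rho> x = 0"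
    "compact L" "\<forall>x. x \<notin> L \<longrightarrow> \<rho> x = 1 \<and> (\<forall>c\<in>atlas M. R c x = 0)" by (elim exE conjE)
  obtain \<theta> \<Theta> where t: "t = (\<theta>, \<Theta>)" by (cases t)
  have n: "C1M \<theta> \<Theta>" "cutoff_in_chart \<theta> \<Theta>" "\<forall>z. 0 \<le> \<theta> z \<and> \<theta> z \<le> 1" using Cons.prems by (auto simp: t nice_cutoff_def)
  obtain L' where L': "compact L'" "supported \<theta> \<Theta> L'" using n(2) unfolding cutoff_in_chart_def by blast
  show ?case
  proof (intro exI conjI allI impI)
    show "C1M (\<lambda>x. \<rho> x * (1 - \<theta> x)) (\<lambda>c x. \<rho> x *\<^sub>R (- \<Theta> c x) + (1 - \<theta> x) *\<^sub>R R c x)"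
      by (rule C1M_mult[OF IH(1) C1M_one_minus[OF n(1)]])
    show "compact (L \<union> L')" using IH(4) L'(1) by (rule compact_Un)
    fix x
    show "0 \<le> \<rho> x * (1 - \<theta> x)" "\<rho> x * (1 - \<theta> x) \<le> 1" using IH(2) n(3) by (simp_all add: mult_le_one)
    show "\<rho> x * (1 - \<theta> x) = 0" if "\<exists>t\<in>set (t # ts). fst t x = 1" using that IH(3) by (auto simp: t)
    show "\<rho> x * (1 - \<theta> x) = 1" if "x \<notin> L \<union> L'" using that IH(5) L'(2) unfolding supported_def by simp
    show "\<forall>c\<in>atlas M. \<rho> x *\<^sub>R (- \<Theta> c x) + (1 - \<theta> x) *\<^sub>R R c x = 0" if "x \<notin> L \<union> L'"
      using that IH(5) L'(2) unfolding supported_def by simp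
  qed
qed

lemma C1M_locally_zero:
  assumes f: "C1M f D" and V: "open V" "\<And>x. x \<in> V \<Longrightarrow> f x = 0" and c: "c \<in> atlas M" and x: "x \<in> V" "x \<in> fst c"
  shows "D c x = 0"
proof -
  have y: "snd c x \<in> coords c V" "snd c x \<in> coords c UNIV" using x by (auto simp: coords_def)
  have "((\<lambda>y. f (point c y)) has_derivative (\<lambda>_. 0)) (at (snd c x))"
    by (rule frechet_derivative_eq_0_locally(1)[OF open_coords[OF c V(1)] y(1)]) (use V(2) coord_point(3)[OF c] in auto)
  from has_derivative_unique[OF this C1M_D(1)[OF f c y(2)]]
  have "D c x \<bullet> v = 0" for v using point_coord(1)[OF c x(2)] by metis
  then show ?thesis by (metis inner_eq_zero_iff)
qed

text \<open>The cutoff is 0 near \<open>K\<close> and 1 at infinity: it will be restricted to the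
  single ends, where it must die out towards the compact core.\<close>

lemma cutoff_compact:
  assumes K: "compact K"
  obtains \<rho> R V L where "C1M \<rho> R" "open V" "K \<subseteq> V" "\<And>x. x \<in> V \<Longrightarrow> \<rho> x = 0"
    "compact L" "\<And>x. x \<notin> L \<Longrightarrow> \<rho> x = 1" "\<And>x c. x \<notin> L \<Longrightarrow> c \<in> atlas M \<Longrightarrow> R c x = 0"
    "\<And>x. 0 \<le> \<rho> x" "\<And>x. \<rho> x \<le> 1"
proof -
  obtain ts V where ts: "\<forall>t\<in>set ts. nice_cutoff t" and V: "open V" "K \<subseteq> V"
    "\<And>x. x \<in> V \<Longrightarrow> \<exists>t\<in>set ts. fst t x = 1" by (rule cutoff_list[OF K]) (rule that)
  from cutoff_product[OF ts] obtain \<rho> R L where "C1M \<rho> R" "\<forall>x. 0 \<le> \<rho> x \<and> \<rho> x \<le> 1"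
    "\<forall>x. (\<exists>t\<in>set ts. fst t x = 1) \<longrightarrow> \<rho> x = 0" "compact L" "\<forall>x. x \<notin> L \<longrightarrow> \<rho> x = 1 \<and> (\<forall>c\<in>atlas M. R c x = 0)"
    by (elim exE conjE)
  then show ?thesis using V by (intro that[of \<rho> R V L]) auto
qed

end

section \<open>Positive solutions and their products\<close>

lemma set_integrable_continuous_mult:
  fixes a k :: "'a::euclidean_space \<Rightarrow> real"
  assumes K: "compact K" and k: "set_integrable lebesgue K k" and a: "continuous_on K a"
  shows "set_integrable lebesgue K (\<lambda>y. a y * k y)"
proof -
  obtain B where B: "\<And>y. y \<in> K \<Longrightarrow> \<bar>a y\<bar> \<le> B" using continuous_compact_bounded[OF K a] by blast
  show ?thesis
  proof (rule set_integrable_bound_real)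
    show "set_integrable lebesgue K (\<lambda>y. B * \<bar>k y\<bar>)" using k by (intro set_integrable_mult_right set_integrable_abs)
    show "set_borel_measurable lebesgue K (\<lambda>y. a y * k y)"
      by (rule set_borel_measurable_mult[OF set_borel_measurable_continuous_compact[OF K a] set_integrable_imp_set_borel_measurable[OF k]])
    show "\<bar>a y * k y\<bar> \<le> B * \<bar>k y\<bar>" if "y \<in> K" for y using B[OF that] by (simp add: abs_mult mult_right_mono)
  qed
qed

lemma test_function_neighborhood:
  fixes \<psi> :: "real^'n \<Rightarrow> real"
  assumes t: "test_function S \<psi>" and S: "open S"
  obtains L K where "compact L" "compact K" "L \<subseteq> interior K" "K \<subseteq> S" "\<And>x. x \<notin> L \<Longrightarrow> \<psi> x = 0" "\<And>x k. x \<notin> L \<Longrightarrow> partials \<psi> x $ k = 0"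
proof -
  obtain L where L: "compact L" "L \<subseteq> S" "\<And>x. x \<notin> L \<Longrightarrow> \<psi> x = 0" "\<And>x k. x \<notin> L \<Longrightarrow> partials \<psi> x $ k = 0"
    by (rule test_function_support[OF t]) (rule that)
  obtain r K where r: "r > 0" and K: "compact K" "K \<subseteq> S" "L \<subseteq> K" and near: "\<And>x y. x \<in> L \<Longrightarrow> dist x y \<le> r \<Longrightarrow> y \<in> K"
    by (rule compact_neighborhood[OF L(1) S L(2)]) (rule that)
  have "L \<subseteq> interior K"
  proof
    fix x assume "x \<in> L"
    then have "ball x r \<subseteq> K" using near by auto
    then show "x \<in> interior K" using r by (meson centre_in_ball interior_maximal open_ball subsetD)
  qed
  then show ?thesis using that[of L K] L K by blast
qed

context weighted_manifold_space
begin

lemma H1M_sum: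
  assumes "finite A" "\<And>j. j \<in> A \<Longrightarrow> H1M (f j) (D j)"
  shows "H1M (\<lambda>x. \<Sum>j\<in>A. f j x) (\<lambda>c x. \<Sum>j\<in>A. D j c x)"
  using assms
proof (induction A rule: finite_induct)
  case empty
  then show ?case using H1M_const[of 0] by simp
next
  case (insert j A)
  then show ?case using H1M_add[of "f j" "D j"] by simp
qed

lemma H1M_ln:
  assumes "H1M f D" "\<And>x. f x > 0"
  shows "H1M (\<lambda>x. ln (f x)) (\<lambda>c x. (1 / f x) *\<^sub>R D c x)"
  by (rule H1M_chain[OF assms(1), of "{0<..}" ln "\<lambda>t. 1 / t"])
     (use assms(2) in \<open>auto intro!: derivative_eq_intros continuous_intros\<close>)

lemma H1M_exp:
  assumes "H1M f D"
  shows "H1M (\<lambda>x. exp (f x)) (\<lambda>c x. exp (f x) *\<^sub>R D c x)"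
  by (rule H1M_chain[OF assms, of UNIV exp exp]) (auto intro!: derivative_eq_intros continuous_intros)

lemma H1M_diff:
  assumes "H1M f D" "H1M g E"
  shows "H1M (\<lambda>x. f x - g x) (\<lambda>c x. D c x - E c x)"
  using H1M_add[OF assms(1) H1M_cmult[OF assms(2), of "-1"]] by simp

end

context elliptic_space
begin

text \<open>A positive solution with its differential made tensorial and the coefficients in
  absorbed form. The potential \<open>q\<close> is explicit so that solutions for different
  potentials can be compared, and its term is required to be locally integrable on its own so that
  it can be moved around separately.\<close>

definition weak_sol where
  "weak_sol q u D \<longleftrightarrow> H1M u D \<and> (\<forall>x. u x > 0) \<and>
    (\<forall>c\<in>atlas M. \<forall>K. compact K \<and> K \<subseteq> coords c UNIV \<longrightarrow>
       set_integrable lebesgue K (\<lambda>y. q (point c y) * u (point c y) * dens c (point c y))) \<and>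
    (\<forall>c\<in>atlas M. \<forall>\<psi>. test_function (coords c UNIV) \<psi> \<longrightarrow>
       (\<integral>y. (acoef c (point c y) *v D c (point c y) + u (point c y) *\<^sub>R bcoef c (point c y)) \<bullet> partials \<psi> y
        + (bcoef c (point c y) \<bullet> D c (point c y) + q (point c y) * u (point c y) * dens c (point c y)) * \<psi> y \<partial>lebesgue) = 0)"

lemma weak_solD:
  assumes "weak_sol q u D"
  shows "H1M u D" "u x > 0"
    "c \<in> atlas M \<Longrightarrow> compact K \<Longrightarrow> K \<subseteq> coords c UNIV \<Longrightarrow>
       set_integrable lebesgue K (\<lambda>y. q (point c y) * u (point c y) * dens c (point c y))"
    "c \<in> atlas M \<Longrightarrow> test_function (coords c UNIV) \<psi> \<Longrightarrow>
       (\<integral>y. (acoef c (point c y) *v D c (point c y) + u (point c y) *\<^sub>R bcoef c (point c y)) \<bullet> partials \<psi> y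
        + (bcoef c (point c y) \<bullet> D c (point c y) + q (point c y) * u (point c y) * dens c (point c y)) * \<psi> y \<partial>lebesgue) = 0"
  using assms unfolding weak_sol_def by blast+

lemma principal_part_L2:
  assumes u: "H1M u D" and c: "c \<in> atlas M"
  shows "L_loc 2 (coords c UNIV) (\<lambda>y. acoef c (point c y) *v D c (point c y) + u (point c y) *\<^sub>R bcoef c (point c y))"
  by (intro L_loc_2_add acoef_l2[OF c] L_loc_2_continuous_scaleR bcoef_L_loc[OF c] H1C_D(1,3)[OF H1M_D(2)[OF u c]])

lemma drift_integrable:
  assumes u: "H1M u D" and c: "c \<in> atlas M" and K: "compact K" "K \<subseteq> coords c UNIV"
  shows "set_integrable lebesgue K (\<lambda>y. bcoef c (point c y) \<bullet> D c (point c y))"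
  unfolding inner_vec_def inner_real_def
  by (intro set_integrable_sum l2_on_mult_integrable L_loc_2_component[OF bcoef_L_loc[OF c] K]
      L_loc_2_component[OF H1C_D(3)[OF H1M_D(2)[OF u c]] K])

text \<open>Two gains over the definition of a solution: a differential that is tensorial
  everywhere, and local integrability of the potential term alone, which the definition gives only
  for the whole integrand.\<close>

lemma positive_solution_weak_sol:
  assumes u: "positive_solution M (P\<lparr>potential := q\<rparr>) UNIV u"
  obtains D where "weak_sol q u D"
proof -
  have uc: "continuous_on UNIV u" and pos: "\<And>x. u x > 0" and eq: "weak_eq M (P\<lparr>potential := q\<rparr>) UNIV u (\<lambda>x. 0)"
    using u unfolding positive_solution_def by auto
  obtain w where w: "weak_differential M UNIV u w" and W: "\<And>c \<psi>. c \<in> atlas M \<Longrightarrow> test_function (coords c UNIV) \<psi> \<Longrightarrow>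
       integrable lebesgue (weak_integrand M (P\<lparr>potential := q\<rparr>) c u w \<psi>)
     \<and> integral\<^sup>L lebesgue (weak_integrand M (P\<lparr>potential := q\<rparr>) c u w \<psi>) = 0"
    using eq unfolding weak_eq_def by auto
  obtain D where D: "H1M u D" and ae: "\<And>c. c \<in> atlas M \<Longrightarrow> AE y in lebesgue. y \<in> coords c UNIV \<longrightarrow> w c (point c y) = D c (point c y)"
    by (rule consistent_differential[OF uc w]) (rule that)
  let ?X = "\<lambda>c y. acoef c (point c y) *v D c (point c y) + u (point c y) *\<^sub>R bcoef c (point c y)"
  let ?k = "\<lambda>c y. q (point c y) * u (point c y) * dens c (point c y)"
  let ?B = "\<lambda>c y. bcoef c (point c y) \<bullet> D c (point c y)"
  have formula: "integrable lebesgue (\<lambda>y. ?X c y \<bullet> partials \<psi> y + (?B c y + ?k c y) * \<psi> y)"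
    "(\<integral>y. ?X c y \<bullet> partials \<psi> y + (?B c y + ?k c y) * \<psi> y \<partial>lebesgue) = 0"
    if c: "c \<in> atlas M" and t: "test_function (coords c UNIV) \<psi>" for c \<psi>
  proof -
    obtain L where L: "L \<subseteq> coords c UNIV" "\<And>x. x \<notin> L \<Longrightarrow> \<psi> x = 0" "\<And>x k. x \<notin> L \<Longrightarrow> partials \<psi> x $ k = 0"
      by (rule test_function_support[OF t]) (rule that)
    have e: "AE y in lebesgue. weak_integrand M (P\<lparr>potential := q\<rparr>) c u w \<psi> y = ?X c y \<bullet> partials \<psi> y + (?B c y + ?k c y) * \<psi> y"
      using ae[OF c]
    proof eventually_elim
      case (elim y)
      show ?case
      proof (cases "y \<in> coords c UNIV")
        case True
        then show ?thesis using elim weak_integrand_eq[OF c coord_point(2)[OF c True]] by simp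
      next
        case False
        then have "\<psi> y = 0" "partials \<psi> y = 0" using L by (auto simp: vec_eq_iff)
        then show ?thesis by (simp add: weak_integrand_def Let_def raise_def metric_inner_def)
      qed
    qed
    show "integrable lebesgue (\<lambda>y. ?X c y \<bullet> partials \<psi> y + (?B c y + ?k c y) * \<psi> y)"
      "(\<integral>y. ?X c y \<bullet> partials \<psi> y + (?B c y + ?k c y) * \<psi> y \<partial>lebesgue) = 0"
      using lebesgue_integral_cong_AE[OF conjunct1[OF W[OF c t]] e] conjunct2[OF W[OF c t]] by auto
  qed
  have kint: "set_integrable lebesgue K (?k c)" if c: "c \<in> atlas M" and K: "compact K" "K \<subseteq> coords c UNIV" for c K
  proof (rule set_integrable_of_tests[OF chartD(2)[OF c] _ K])
    fix \<psi> assume t: "test_function (coords c UNIV) \<psi>"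
    obtain L K' where L: "compact L" and K': "compact K'" "L \<subseteq> interior K'" "K' \<subseteq> coords c UNIV"
      and z: "\<And>x. x \<notin> L \<Longrightarrow> \<psi> x = 0" "\<And>x k. x \<notin> L \<Longrightarrow> partials \<psi> x $ k = 0"
      by (rule test_function_neighborhood[OF t chartD(2)[OF c]]) (rule that)
    have LK: "L \<subseteq> K'" using K'(2) interior_subset by blast
    have z': "\<psi> x = 0" "partials \<psi> x = 0" if "x \<notin> K'" for x using z that LK by (auto simp: vec_eq_iff)
    have "set_integrable lebesgue K' (\<lambda>y. ?X c y \<bullet> partials \<psi> y + ?B c y * \<psi> y)"
      by (rule weak_pairing_integrable[OF principal_part_L2[OF D c] drift_integrable[OF D c] test_function_H1C[OF t chartD(2)[OF c]] K'(1,3)])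
    then have "integrable lebesgue (\<lambda>y. ?X c y \<bullet> partials \<psi> y + ?B c y * \<psi> y)"
      using integral_eq_set_integral(2)[of K' "\<lambda>y. ?X c y \<bullet> partials \<psi> y + ?B c y * \<psi> y"] z' by simp
    \<comment> \<open>The principal part and the drift pair L^2 functions and are integrable by
      themselves; subtracting them isolates the potential term.\<close>
    from Bochner_Integration.integrable_diff[OF formula(1)[OF c t] this]
    show "integrable lebesgue (\<lambda>y. ?k c y * \<psi> y)" by (simp add: distrib_right)
  qed
  have "weak_sol q u D" unfolding weak_sol_def using D pos kint formula(2) by blast
  then show ?thesis by (rule that)
qed

text \<open>The equation in a chart against test functions that are only of class
  \<open>H1C\<close>; these will be products of a smooth function with other solutions.\<close>

lemma weak_sol_test:
  assumes u: "weak_sol q u D" and c: "c \<in> atlas M" and \<xi>: "H1C (coords c UNIV) \<xi> w"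
    and K: "compact K" "K \<subseteq> coords c UNIV" and L: "compact L" "L \<subseteq> interior K"
    and z: "\<And>y. y \<in> coords c UNIV \<Longrightarrow> y \<notin> L \<Longrightarrow> \<xi> y = 0"
  shows "set_integrable lebesgue K (\<lambda>y. (acoef c (point c y) *v D c (point c y) + u (point c y) *\<^sub>R bcoef c (point c y)) \<bullet> w y
        + (bcoef c (point c y) \<bullet> D c (point c y) + q (point c y) * u (point c y) * dens c (point c y)) * \<xi> y)"
    "(LINT y:K|lebesgue. (acoef c (point c y) *v D c (point c y) + u (point c y) *\<^sub>R bcoef c (point c y)) \<bullet> w y
        + (bcoef c (point c y) \<bullet> D c (point c y) + q (point c y) * u (point c y) * dens c (point c y)) * \<xi> y) = 0"
proof -
  note H = weak_solD(1)[OF u]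
  have Y: "set_integrable lebesgue K (\<lambda>y. bcoef c (point c y) \<bullet> D c (point c y) + q (point c y) * u (point c y) * dens c (point c y))"
    if "compact K" "K \<subseteq> coords c UNIV" for K
    by (rule set_integral_add(1)[OF drift_integrable[OF H c that] weak_solD(3)[OF u c that]])
  show "set_integrable lebesgue K (\<lambda>y. (acoef c (point c y) *v D c (point c y) + u (point c y) *\<^sub>R bcoef c (point c y)) \<bullet> w y
        + (bcoef c (point c y) \<bullet> D c (point c y) + q (point c y) * u (point c y) * dens c (point c y)) * \<xi> y)"
    by (rule weak_pairing_integrable[OF principal_part_L2[OF H c] Y \<xi> K])
  show "(LINT y:K|lebesgue. (acoef c (point c y) *v D c (point c y) + u (point c y) *\<^sub>R bcoef c (point c y)) \<bullet> w y
        + (bcoef c (point c y) \<bullet> D c (point c y) + q (point c y) * u (point c y) * dens c (point c y)) * \<xi> y) = 0"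
    by (rule weak_identity_extend[OF chartD(2)[OF c] principal_part_L2[OF H c] Y weak_solD(4)[OF u c] \<xi> K L z])
qed

text \<open>The drift terms cancel because the operator is symmetric.\<close>

lemma ratio_flux:
  assumes f: "weak_sol q1 f D" and h: "weak_sol q2 h E"
  shows "flux_identity (\<lambda>c x. h x *\<^sub>R (acoef c x *v D c x) - f x *\<^sub>R (acoef c x *v E c x))
    (\<lambda>c x. h x * (q1 x * f x * dens c x) - f x * (q2 x * h x * dens c x))"
  unfolding flux_identity_def
proof (intro conjI ballI allI impI)
  note Hf = weak_solD(1)[OF f] and Hh = weak_solD(1)[OF h]
  {
    fix c assume c: "c \<in> atlas M"
    note hf = H1C_D[OF H1M_D(2)[OF Hf c]] and hh = H1C_D[OF H1M_D(2)[OF Hh c]]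
    have "L_loc 2 (coords c UNIV) (\<lambda>y. h (point c y) *\<^sub>R (acoef c (point c y) *v D c (point c y)) + (- f (point c y)) *\<^sub>R (acoef c (point c y) *v E c (point c y)))"
      by (intro L_loc_2_add L_loc_2_continuous_scaleR acoef_l2[OF c] hf hh continuous_on_minus)
    then show "L_loc 2 (coords c UNIV) (\<lambda>y. h (point c y) *\<^sub>R (acoef c (point c y) *v D c (point c y)) - f (point c y) *\<^sub>R (acoef c (point c y) *v E c (point c y)))"
      by simp
  next
    fix c K assume c: "c \<in> atlas M" and K: "compact K \<and> K \<subseteq> coords c UNIV"
    note hf = H1C_D[OF H1M_D(2)[OF Hf c]] and hh = H1C_D[OF H1M_D(2)[OF Hh c]]
    show "set_integrable lebesgue K (\<lambda>y. h (point c y) * (q1 (point c y) * f (point c y) * dens c (point c y)) - f (point c y) * (q2 (point c y) * h (point c y) * dens c (point c y)))"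
      using K by (intro set_integral_diff(1) set_integrable_continuous_mult weak_solD(3)[OF f c] weak_solD(3)[OF h c]
          continuous_on_subset[OF hf(1)] continuous_on_subset[OF hh(1)]) auto
  next
    fix c d x p assume c: "c \<in> atlas M" and d: "d \<in> atlas M" and x: "x \<in> fst c \<inter> fst d"
    have x': "x \<in> fst c" "x \<in> fst d" using x by auto
    show "(h x *\<^sub>R (acoef c x *v D c x) - f x *\<^sub>R (acoef c x *v E c x)) \<bullet> (transpose (J c d x) *v p)
        = \<bar>det (J c d x)\<bar> * ((h x *\<^sub>R (acoef d x *v D d x) - f x *\<^sub>R (acoef d x *v E d x)) \<bullet> p)"
      unfolding inner_diff_left inner_scaleR_left H1M_D(3)[OF Hf c d x'] H1M_D(3)[OF Hh c d x'] acoef_transform[OF c d x']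
      by (simp add: algebra_simps)
    show "h x * (q1 x * f x * dens c x) - f x * (q2 x * h x * dens c x)
        = \<bar>det (J c d x)\<bar> * (h x * (q1 x * f x * dens d x) - f x * (q2 x * h x * dens d x))"
      unfolding dens_transform[OF c d x'] by (simp add: algebra_simps)
  next
    fix c \<psi> assume c: "c \<in> atlas M" and t: "test_function (coords c UNIV) \<psi>"
    obtain L K where L: "compact L" and K: "compact K" "L \<subseteq> interior K" "K \<subseteq> coords c UNIV"
      and z: "\<And>x. x \<notin> L \<Longrightarrow> \<psi> x = 0" "\<And>x k. x \<notin> L \<Longrightarrow> partials \<psi> x $ k = 0"
      by (rule test_function_neighborhood[OF t chartD(2)[OF c]]) (rule that)
    have LK: "L \<subseteq> K" using K(2) interior_subset by blast
    have z': "\<psi> x = 0" "partials \<psi> x = 0" if "x \<notin> K" for x using z that LK by (auto simp: vec_eq_iff)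
    note \<psi>H = test_function_H1C[OF t chartD(2)[OF c]]
    \<comment> \<open>Test the equation of \<open>f\<close> with \<open>h \<psi>\<close> and that of
      \<open>h\<close> with \<open>f \<psi>\<close>. In the difference, the terms containing both
      differentials cancel because \<open>acoef\<close> is symmetric.\<close>
    note T1 = H1C_mult[OF chartD(2)[OF c] H1M_D(2)[OF Hh c] \<psi>H] and T2 = H1C_mult[OF chartD(2)[OF c] H1M_D(2)[OF Hf c] \<psi>H]
    have z1: "h (point c y) * \<psi> y = 0" "f (point c y) * \<psi> y = 0" if "y \<notin> L" for y using z(1)[OF that] by auto
    note I1 = weak_sol_test[OF f c T1 K(1,3) L K(2) z1(1)] and I2 = weak_sol_test[OF h c T2 K(1,3) L K(2) z1(2)]
    let ?I1 = "\<lambda>y. (acoef c (point c y) *v D c (point c y) + f (point c y) *\<^sub>R bcoef c (point c y)) \<bullet> (h (point c y) *\<^sub>R partials \<psi> y + \<psi> y *\<^sub>R E c (point c y))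
        + (bcoef c (point c y) \<bullet> D c (point c y) + q1 (point c y) * f (point c y) * dens c (point c y)) * (h (point c y) * \<psi> y)"
    let ?I2 = "\<lambda>y. (acoef c (point c y) *v E c (point c y) + h (point c y) *\<^sub>R bcoef c (point c y)) \<bullet> (f (point c y) *\<^sub>R partials \<psi> y + \<psi> y *\<^sub>R D c (point c y))
        + (bcoef c (point c y) \<bullet> E c (point c y) + q2 (point c y) * h (point c y) * dens c (point c y)) * (f (point c y) * \<psi> y)"
    let ?G = "\<lambda>y. (h (point c y) *\<^sub>R (acoef c (point c y) *v D c (point c y)) - f (point c y) *\<^sub>R (acoef c (point c y) *v E c (point c y))) \<bullet> partials \<psi> y
       + (h (point c y) * (q1 (point c y) * f (point c y) * dens c (point c y)) - f (point c y) * (q2 (point c y) * h (point c y) * dens c (point c y))) * \<psi> y"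
    have pw: "?I1 y - ?I2 y = ?G y" if "y \<in> K" for y
    proof -
      have "point c y \<in> fst c" using that K(3) coord_point(2)[OF c] by blast
      from acoef_symmetric[OF c this, of "D c (point c y)" "E c (point c y)"]
      show ?thesis by (simp add: inner_add_left inner_add_right inner_diff_left algebra_simps)
    qed
    have "(\<integral>y. ?G y \<partial>lebesgue) = (LINT y:K|lebesgue. ?G y)"
      by (rule integral_eq_set_integral(1)) (simp add: z')
    also have "\<dots> = (LINT y:K|lebesgue. ?I1 y - ?I2 y)"
    proof -
      have "indicat_real K y *\<^sub>R ?G y = indicat_real K y *\<^sub>R (?I1 y - ?I2 y)" for y
        using pw[of y] by (cases "y \<in> K") simp_all
      then show ?thesis unfolding set_lebesgue_integral_def by (simp only:)
    qed
    also have "\<dots> = (LINT y:K|lebesgue. ?I1 y) - (LINT y:K|lebesgue. ?I2 y)" by (rule set_integral_diff(2)[OF I1(1) I2(1)])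
    also have "\<dots> = 0" using I1(2) I2(2) by simp
    finally show "(\<integral>y. ?G y \<partial>lebesgue) = 0" .
  }
qed

text \<open>The flux \<open>h A \<nabla>f - f A \<nabla>h\<close> equals
  \<open>f h A \<nabla>(ln f - ln h)\<close>. With equal potentials this is the divergence free
  field behind the end cutoffs; with potentials differing by \<open>V\<close> it drives the ground
  state inequality.\<close>

lemma log_ratio_total:
  assumes f: "weak_sol q1 f D" and h: "weak_sol q2 h E"
    and \<xi>: "H1M \<xi> G" and K: "compact K" "supported \<xi> G K"
  shows "total (\<lambda>c x. f x * h x * ((acoef c x *v ((1 / f x) *\<^sub>R D c x - (1 / h x) *\<^sub>R E c x)) \<bullet> G c x)
      + (q1 x - q2 x) * f x * h x * \<xi> x * dens c x) = 0"
proof -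
  have "f x * h x * ((acoef c x *v ((1 / f x) *\<^sub>R D c x - (1 / h x) *\<^sub>R E c x)) \<bullet> G c x) + (q1 x - q2 x) * f x * h x * \<xi> x * dens c x
    = (h x *\<^sub>R (acoef c x *v D c x) - f x *\<^sub>R (acoef c x *v E c x)) \<bullet> G c x
      + (h x * (q1 x * f x * dens c x) - f x * (q2 x * h x * dens c x)) * \<xi> x" for c x
  proof -
    have "f x \<noteq> 0" "h x \<noteq> 0" using weak_solD(2)[OF f, of x] weak_solD(2)[OF h, of x] by auto
    then show ?thesis
      by (simp add: matrix_vector_mult_diff_distrib linear_cmul[OF matrix_vector_mul_linear] inner_diff_left field_simps)
  qed
  then show ?thesis using flux_total[OF ratio_flux[OF f h] \<xi> K] by (simp only:)
qed

text \<open>Test the equation of \<open>u j\<close> with \<open>\<alpha> j * (v / u j) * \<psi>\<close> and add up. The weight is the convexity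
  defect of the quadratic form of the operator at the logarithmic gradients of the \<open>u j\<close>.\<close>

lemma product_weak_eq:
  assumes fin: "finite A" and u: "\<And>j. j \<in> A \<Longrightarrow> weak_sol (potential P) (u j) (D j)"
    and a: "(\<Sum>j\<in>A. \<alpha> j) = 1" and v: "v = (\<lambda>x. \<Prod>j\<in>A. u j x powr \<alpha> j)"
  shows "\<exists>W. weak_eq M P UNIV v (\<lambda>x. W x * v x)"
proof -
  define \<Lambda> where "\<Lambda> x = (\<Sum>j\<in>A. \<alpha> j * ln (u j x))" for x
  define G where "G j c x = (1 / u j x) *\<^sub>R D j c x" for j c x
  define DL where "DL c x = (\<Sum>j\<in>A. \<alpha> j *\<^sub>R G j c x)" for c x
  have pos: "u j x > 0" if "j \<in> A" for j x by (rule weak_solD(2)[OF u[OF that]])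
  have Hl: "H1M (\<lambda>x. ln (u j x)) (G j)" if "j \<in> A" for j
    unfolding G_def[abs_def] by (rule H1M_ln[OF weak_solD(1)[OF u[OF that]] pos[OF that]])
  have H\<Lambda>: "H1M \<Lambda> DL"
    unfolding \<Lambda>_def[abs_def] DL_def[abs_def] by (rule H1M_sum[OF fin]) (rule H1M_cmult[OF Hl])
  have v_exp: "v = (\<lambda>x. exp (\<Lambda> x))"
  proof
    fix x
    have "u j x powr \<alpha> j = exp (\<alpha> j * ln (u j x))" if "j \<in> A" for j using pos[OF that, of x] by (simp add: powr_def)
    then show "v x = exp (\<Lambda> x)" by (simp add: v \<Lambda>_def exp_sum[OF fin])
  qed
  define w where "w c x = v x *\<^sub>R DL c x" for c x
  have Hv: "H1M v w" using H1M_exp[OF H\<Lambda>] by (simp add: v_exp w_def[abs_def])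
  \<comment> \<open>This is \<open>v / u j\<close>, written as an exponential so that its
    differential is visibly a multiple of \<open>DL - G j\<close>.\<close>
  define g where "g j x = exp (\<Lambda> x - ln (u j x))" for j x
  have Hg: "H1M (g j) (\<lambda>c x. g j x *\<^sub>R (DL c x - G j c x))" if "j \<in> A" for j
    unfolding g_def[abs_def] by (rule H1M_exp[OF H1M_diff[OF H\<Lambda> Hl[OF that]]])
  have ug: "u j x * g j x = v x" if "j \<in> A" for j x
    using pos[OF that, of x] by (simp add: g_def v_exp exp_diff)
  have uG: "D j c x = u j x *\<^sub>R G j c x" if "j \<in> A" for j c x using pos[OF that, of x] by (simp add: G_def)
  define Wd where "Wd c x = (\<Sum>j\<in>A. \<alpha> j * ((acoef c x *v G j c x) \<bullet> G j c x)) - (acoef c x *v DL c x) \<bullet> DL c x" for c x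
  \<comment> \<open>\<open>Wd\<close> and the density of \<open>\<nu>\<close> acquire the same
    factor under a change of chart, so their quotient may be computed in whichever chart the cover
    selects.\<close>
  define W where "W x = (let c = cov_chart (cov_index x) in Wd c x / dens c x)" for x
  have W: "W x * dens c x = Wd c x" if c: "c \<in> atlas M" and x: "x \<in> fst c" for c x
  proof -
    let ?d = "cov_chart (cov_index x)"
    note d = cover(1)[of "cov_index x"] cov_index(2)[of x]
    have "Wd c x = \<bar>det (J c ?d x)\<bar> * Wd ?d x"
      unfolding Wd_def using densityD(2)[OF density_acoef[OF H\<Lambda> H\<Lambda>] c d(1) x d(2)]
        densityD(2)[OF density_acoef[OF Hl Hl] c d(1) x d(2)]
      by (simp add: right_diff_distrib sum_distrib_left mult.left_commute)
    moreover have "dens c x = \<bar>det (J c ?d x)\<bar> * dens ?d x" by (rule dens_transform[OF c d(1) x d(2)])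
    moreover have "dens ?d x > 0" by (rule dens_pos[OF d])
    ultimately show ?thesis by (simp add: W_def Let_def)
  qed
  have "weak_eq M P UNIV v (\<lambda>x. W x * v x)"
    unfolding weak_eq_def
  proof (intro exI[of _ w] conjI ballI allI impI)
    show "weak_differential M UNIV v w" by (rule H1M_imp_weak_differential[OF Hv])
    fix c \<psi> assume c: "c \<in> atlas M" and t: "test_function (coords c UNIV) \<psi>"
    obtain L K where L: "compact L" and K: "compact K" "L \<subseteq> interior K" "K \<subseteq> coords c UNIV"
      and z: "\<And>x. x \<notin> L \<Longrightarrow> \<psi> x = 0" "\<And>x k. x \<notin> L \<Longrightarrow> partials \<psi> x $ k = 0"
      by (rule test_function_neighborhood[OF t chartD(2)[OF c]]) (rule that)
    have LK: "L \<subseteq> K" using K(2) interior_subset by blast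
    have z': "\<psi> x = 0" "partials \<psi> x = 0" if "x \<notin> K" for x using z that LK by (auto simp: vec_eq_iff)
    note \<psi>H = test_function_H1C[OF t chartD(2)[OF c]]
    have fst_c: "point c y \<in> fst c" if "y \<in> K" for y using that K(3) coord_point(2)[OF c] by blast
    have w0: "weak_integrand M P c v w \<psi> y = 0" if "y \<notin> K" for y
      using z'[OF that] by (simp add: weak_integrand_def Let_def raise_def metric_inner_def)
    have h0: "W (point c y) * v (point c y) * \<psi> y * dens c (point c y) = 0" if "y \<notin> K" for y
      using z'[OF that] by simp
    define I where "I j y = (acoef c (point c y) *v D j c (point c y) + u j (point c y) *\<^sub>R bcoef c (point c y)) \<bullet>
        (g j (point c y) *\<^sub>R partials \<psi> y + \<psi> y *\<^sub>R (g j (point c y) *\<^sub>R (DL c (point c y) - G j c (point c y))))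
        + (bcoef c (point c y) \<bullet> D j c (point c y) + potential P (point c y) * u j (point c y) * dens c (point c y)) * (g j (point c y) * \<psi> y)" for j y
    have I: "set_integrable lebesgue K (I j)" "(LINT y:K|lebesgue. I j y) = 0" if j: "j \<in> A" for j
      unfolding I_def[abs_def]
      by (rule weak_sol_test[OF u[OF j] c H1C_mult[OF chartD(2)[OF c] H1M_D(2)[OF Hg[OF j] c] \<psi>H] K(1,3) L K(2)], simp add: z)+
    have I\<alpha>: "set_integrable lebesgue K (\<lambda>y. \<Sum>j\<in>A. \<alpha> j * I j y)"
      using I(1) by (intro set_integrable_sum) simp
    have I\<alpha>0: "(LINT y:K|lebesgue. \<Sum>j\<in>A. \<alpha> j * I j y) = 0"
      by (subst set_integral_sum) (use I in auto)
    have wi_eq: "weak_integrand M P c v w \<psi> y = (acoef c (point c y) *v w c (point c y) + v (point c y) *\<^sub>R bcoef c (point c y)) \<bullet> partials \<psi> y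
     + (bcoef c (point c y) \<bullet> w c (point c y) + potential P (point c y) * v (point c y) * dens c (point c y)) * \<psi> y" if y: "y \<in> K" for y
      using weak_integrand_eq[OF c fst_c[OF y], of "potential P" v w \<psi>] by simp
    have pw: "(\<Sum>j\<in>A. \<alpha> j * I j y) = weak_integrand M P c v w \<psi> y - W (point c y) * v (point c y) * \<psi> y * dens c (point c y)"
      if y: "y \<in> K" for y
    proof -
      let ?x = "point c y"
      have lin: "(acoef c ?x *v DL c ?x) \<bullet> z = (\<Sum>j\<in>A. \<alpha> j * ((acoef c ?x *v G j c ?x) \<bullet> z))"
        "bcoef c ?x \<bullet> DL c ?x = (\<Sum>j\<in>A. \<alpha> j * (bcoef c ?x \<bullet> G j c ?x))" for z
        by (simp_all add: DL_def linear_sum[OF matrix_vector_mul_linear] linear_cmul[OF matrix_vector_mul_linear] inner_sum_left inner_sum_right)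
      have Ij: "\<alpha> j * I j y = v ?x * (\<alpha> j * ((acoef c ?x *v G j c ?x) \<bullet> partials \<psi> y) + \<psi> y * (\<alpha> j * ((acoef c ?x *v G j c ?x) \<bullet> DL c ?x))
          - \<psi> y * (\<alpha> j * ((acoef c ?x *v G j c ?x) \<bullet> G j c ?x))
          + \<alpha> j * (bcoef c ?x \<bullet> partials \<psi> y + \<psi> y * (bcoef c ?x \<bullet> DL c ?x) + potential P ?x * dens c ?x * \<psi> y))" if j: "j \<in> A" for j
        unfolding I_def uG[OF j] ug[OF j, of ?x, symmetric]
        by (simp add: linear_cmul[OF matrix_vector_mul_linear] inner_add_left inner_add_right inner_diff_right inner_scaleR_left inner_scaleR_right algebra_simps)
      have "(\<Sum>j\<in>A. \<alpha> j * I j y) = v ?x * ((acoef c ?x *v DL c ?x) \<bullet> partials \<psi> y + \<psi> y * ((acoef c ?x *v DL c ?x) \<bullet> DL c ?x)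
          - \<psi> y * (\<Sum>j\<in>A. \<alpha> j * ((acoef c ?x *v G j c ?x) \<bullet> G j c ?x))
          + (bcoef c ?x \<bullet> partials \<psi> y + \<psi> y * (bcoef c ?x \<bullet> DL c ?x) + potential P ?x * dens c ?x * \<psi> y))"
        unfolding lin(1) sum_distrib_left[symmetric] sum_distrib_right[symmetric]
        by (simp add: Ij sum.distrib sum_subtractf sum_distrib_left[symmetric] sum_distrib_right[symmetric] a)
      also have "\<dots> = weak_integrand M P c v w \<psi> y - Wd c ?x * v ?x * \<psi> y"
        unfolding wi_eq[OF y] Wd_def w_def
        by (simp add: linear_cmul[OF matrix_vector_mul_linear] inner_add_left inner_scaleR_left inner_scaleR_right algebra_simps)
      finally show ?thesis using W[OF c fst_c[OF y]] by (simp add: mult_ac)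
    qed
    have Y: "set_integrable lebesgue K' (\<lambda>y. bcoef c (point c y) \<bullet> w c (point c y) + potential P (point c y) * v (point c y) * dens c (point c y))"
      if K': "compact K'" "K' \<subseteq> coords c UNIV" for K'
    proof (rule set_integral_add(1)[OF drift_integrable[OF Hv c K']])
      have "set_integrable lebesgue K' (\<lambda>y. v (point c y) * dens c (point c y) * potential P (point c y))"
        by (rule set_integrable_continuous_mult[OF K'(1) potential_integrable[OF c K']])
          (intro continuous_intros continuous_on_subset[OF continuous_on_dens[OF c] K'(2)] continuous_on_subset[OF H1C_D(1)[OF H1M_D(2)[OF Hv c]] K'(2)])
      then show "set_integrable lebesgue K' (\<lambda>y. potential P (point c y) * v (point c y) * dens c (point c y))"
        by (simp add: mult_ac)
    qed
    have wiK: "set_integrable lebesgue K (weak_integrand M P c v w \<psi>)"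
      using weak_pairing_integrable[OF principal_part_L2[OF Hv c] Y \<psi>H K(1,3)] wi_eq
      by (subst set_integrable_cong[OF refl refl]) auto
    \<comment> \<open>Integrability of the weight term is not known in advance; it is inherited from
      the two other terms of the identity \<open>pw\<close>.\<close>
    have hK: "set_integrable lebesgue K (\<lambda>y. W (point c y) * v (point c y) * \<psi> y * dens c (point c y))"
    proof -
      have "set_integrable lebesgue K (\<lambda>y. weak_integrand M P c v w \<psi> y - (\<Sum>j\<in>A. \<alpha> j * I j y))"
        by (rule set_integral_diff(1)[OF wiK I\<alpha>])
      then show ?thesis
        by (subst (asm) set_integrable_cong[OF refl refl, of K _ "\<lambda>y. W (point c y) * v (point c y) * \<psi> y * dens c (point c y)"]) (auto simp: pw)
    qed
    show "integrable lebesgue (weak_integrand M P c v w \<psi>)"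
      using integral_eq_set_integral(2)[of K "weak_integrand M P c v w \<psi>"] w0 wiK by simp
    show "integrable lebesgue (\<lambda>y. W (point c y) * v (point c y) * \<psi> y * dens c (point c y))"
      using integral_eq_set_integral(2)[of K "\<lambda>y. W (point c y) * v (point c y) * \<psi> y * dens c (point c y)"] h0 hK by simp
    have "0 = (LINT y:K|lebesgue. weak_integrand M P c v w \<psi> y - W (point c y) * v (point c y) * \<psi> y * dens c (point c y))"
      unfolding I\<alpha>0[symmetric] set_lebesgue_integral_def
      by (rule Bochner_Integration.integral_cong[OF refl]) (use pw in \<open>auto simp: indicator_def\<close>)
    also have "\<dots> = (LINT y:K|lebesgue. weak_integrand M P c v w \<psi> y) - (LINT y:K|lebesgue. W (point c y) * v (point c y) * \<psi> y * dens c (point c y))"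
      by (rule set_integral_diff(2)[OF wiK hK])
    finally show "integral\<^sup>L lebesgue (weak_integrand M P c v w \<psi>) = (\<integral>y. W (point c y) * v (point c y) * \<psi> y * dens c (point c y) \<partial>lebesgue)"
      using integral_eq_set_integral(1)[of K "weak_integrand M P c v w \<psi>"] w0
        integral_eq_set_integral(1)[of K "\<lambda>y. W (point c y) * v (point c y) * \<psi> y * dens c (point c y)"] h0 by simp
  qed
  then show ?thesis by blast
qed

end

section \<open>Shifted potentials, supersolutions and cutoffs adapted to the ends\<close>

lemma minus_potential_minus_potential:
  "minus_potential (minus_potential P W) V = minus_potential P (\<lambda>x. W x + V x)"
  by (simp add: minus_potential_def diff_diff_eq)

lemma weak_eq_imp_solution:
  assumes v: "continuous_on UNIV v" "\<And>x. v x > 0" and eq: "weak_eq M P UNIV v (\<lambda>x. W x * v x)"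
  shows "positive_solution M (minus_potential P W) UNIV v"
proof -
  obtain w where w: "weak_differential M UNIV v w" and F: "\<And>c \<psi>. c \<in> atlas M \<Longrightarrow> test_function (coords c UNIV) \<psi> \<Longrightarrow>
           integrable lebesgue (weak_integrand M P c v w \<psi>)
         \<and> integrable lebesgue (\<lambda>y. W (point c y) * v (point c y) * \<psi> y * nu_density M c (point c y))
         \<and> integral\<^sup>L lebesgue (weak_integrand M P c v w \<psi>)
             = integral\<^sup>L lebesgue (\<lambda>y. W (point c y) * v (point c y) * \<psi> y * nu_density M c (point c y))"
    using eq unfolding weak_eq_def by blast
  have split: "weak_integrand M (minus_potential P W) c v w \<psi>
      = (\<lambda>y. weak_integrand M P c v w \<psi> y - W (point c y) * v (point c y) * \<psi> y * nu_density M c (point c y))" for c \<psi>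
    by (rule ext) (simp add: weak_integrand_def minus_potential_def Let_def algebra_simps)
  have "weak_eq M (minus_potential P W) UNIV v (\<lambda>x. 0)"
    unfolding weak_eq_def
  proof (intro exI[of _ w] conjI ballI allI impI)
    fix c \<psi> assume "c \<in> atlas M" "test_function (coords c UNIV) \<psi>"
    note f = F[OF this]
    show "integrable lebesgue (weak_integrand M (minus_potential P W) c v w \<psi>)"
      unfolding split using f by (intro Bochner_Integration.integrable_diff) auto
    show "integral\<^sup>L lebesgue (weak_integrand M (minus_potential P W) c v w \<psi>) = (\<integral>y. 0 * \<psi> y * nu_density M c (point c y) \<partial>lebesgue)"
      unfolding split using f by (subst Bochner_Integration.integral_diff) auto
  qed (use w in simp_all)
  then show ?thesis using v unfolding positive_solution_def by simp
qed

lemma test_function_subset: "test_function S \<psi> \<Longrightarrow> S \<subseteq> T \<Longrightarrow> test_function T \<psi>"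
  by (auto simp: test_function_def)

lemma positive_solution_imp_supersolution:
  assumes u: "positive_solution M P UNIV u"
  shows "positive_supersolution M P U u"
proof -
  obtain w where w: "weak_differential M UNIV u w" and F: "\<And>c \<psi>. c \<in> atlas M \<Longrightarrow> test_function (coords c UNIV) \<psi> \<Longrightarrow>
           integrable lebesgue (weak_integrand M P c u w \<psi>) \<and> integral\<^sup>L lebesgue (weak_integrand M P c u w \<psi>) = 0"
    using u unfolding positive_solution_def weak_eq_def by auto
  have sub: "coords c U \<subseteq> coords c UNIV" for c by (auto simp: coords_def)
  have tf: "test_function (coords c UNIV) \<psi>" if "test_function (coords c U) \<psi>" for c \<psi>
    using test_function_subset[OF that sub] .
  show ?thesis
    unfolding positive_supersolution_def
  proof (intro conjI exI[of _ w] ballI allI impI)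
    show "ae_on M U (\<lambda>x. u x > 0)" using u by (simp add: ae_on_def positive_solution_def)
    show "weak_differential M U u w"
      using w tf sub unfolding weak_differential_def weak_gradient_on_def L_loc_def by (meson subset_trans)
    fix c \<psi> assume c: "c \<in> atlas M" and t: "test_function (coords c U) \<psi> \<and> (\<forall>y. \<psi> y \<ge> 0)"
    show "integrable lebesgue (weak_integrand M P c u w \<psi>)" "integral\<^sup>L lebesgue (weak_integrand M P c u w \<psi>) \<ge> 0"
      using F[OF c tf[OF conjunct1[OF t]]] by auto
  qed
qed

context weighted_manifold_space
begin

lemma C1M_cong:
  assumes f: "C1M f D" and eq: "\<And>c x. c \<in> atlas M \<Longrightarrow> x \<in> fst c \<Longrightarrow> D c x = D' c x"
  shows "C1M f D'"
  unfolding C1M_def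
proof (intro ballI conjI)
  fix c y assume c: "c \<in> atlas M" and y: "y \<in> coords c UNIV"
  show "((\<lambda>y. f (point c y)) has_derivative (\<lambda>v. D' c (point c y) \<bullet> v)) (at y)"
    using C1M_D(1)[OF f c y] eq[OF c coord_point(2)[OF c y]] by simp
next
  fix c assume c: "c \<in> atlas M"
  show "continuous_on (coords c UNIV) (\<lambda>y. D' c (point c y))"
    using C1M_D(2)[OF f c] by (rule continuous_on_eq) (rule eq[OF c coord_point(2)[OF c]])
qed

lemma H1M_cong:
  assumes f: "H1M f D" and eq: "\<And>c x. c \<in> atlas M \<Longrightarrow> D c x = D' c x"
  shows "H1M f D'"
  unfolding H1M_def
proof (intro conjI ballI)
  show "continuous_on UNIV f" by (rule H1M_D(1)[OF f])
  fix c assume c: "c \<in> atlas M"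
  show "H1C (coords c UNIV) (f \<circ> point c) (D' c \<circ> point c)"
    using H1M_D(2)[OF f c] by (simp add: o_def eq[OF c])
next
  fix c d x assume "c \<in> atlas M" "d \<in> atlas M" "x \<in> fst c \<inter> fst d"
  then show "D' c x = transpose (J c d x) *v D' d x" using H1M_D(3)[OF f, of c d x] eq by auto
qed

lemma density_sum:
  assumes "finite I" "\<And>i. i \<in> I \<Longrightarrow> density (\<sigma> i)"
  shows "density (\<lambda>c x. \<Sum>i\<in>I. \<sigma> i c x)"
  using assms by (induction I) (simp_all add: density_zero density_add)

lemma total_sum:
  assumes "finite I" "\<And>i. i \<in> I \<Longrightarrow> density (\<sigma> i)" "compact K" "\<And>i. i \<in> I \<Longrightarrow> vanishes_off (\<sigma> i) K"
  shows "total (\<lambda>c x. \<Sum>i\<in>I. \<sigma> i c x) = (\<Sum>i\<in>I. total (\<sigma> i))"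
  using assms
proof (induction I)
  case empty
  then show ?case by (simp add: total_zero)
next
  case (insert i I)
  have "vanishes_off (\<lambda>c x. \<Sum>i\<in>I. \<sigma> i c x) K"
    using insert.prems(3) unfolding vanishes_off_def by (auto intro!: sum.neutral)
  then show ?case
    using insert total_add[of "\<sigma> i" "\<lambda>c x. \<Sum>i\<in>I. \<sigma> i c x" K] density_sum[of I \<sigma>] by simp
qed

text \<open>One function per end: the cutoff \<open>\<rho>\<close> that vanishes near
  \<open>K\<close>, kept on \<open>A i\<close> and set to 0 elsewhere. All differentials are
  supported in the common compact set \<open>L\<close>.\<close>

lemma end_cutoffs:
  fixes A :: "'i \<Rightarrow> 'a set"
  assumes A: "\<And>i. i \<in> I \<Longrightarrow> open (A i)" "\<And>i j. i \<in> I \<Longrightarrow> j \<in> I \<Longrightarrow> i \<noteq> j \<Longrightarrow> A i \<inter> A j = {}"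
    and K: "compact K" and cov: "\<And>x. x \<in> K \<or> (\<exists>i\<in>I. x \<in> A i)"
  obtains \<eta> X L where "\<And>i. i \<in> I \<Longrightarrow> C1M (\<eta> i) (X i)" "\<And>i x. 0 \<le> \<eta> i x \<and> \<eta> i x \<le> (1::real)"
    "compact L" "K \<subseteq> L" "\<And>i c x. c \<in> atlas M \<Longrightarrow> x \<notin> L \<Longrightarrow> X i c x = 0" "\<And>i x. x \<notin> A i \<Longrightarrow> \<eta> i x = 0"
    "\<And>i x. x \<in> K \<Longrightarrow> \<eta> i x = 0" "\<And>i x. x \<in> A i \<Longrightarrow> x \<notin> L \<Longrightarrow> \<eta> i x = 1"
proof -
  obtain \<rho> R V L where \<rho>: "C1M \<rho> R" and V: "open V" "K \<subseteq> V" "\<And>x. x \<in> V \<Longrightarrow> \<rho> x = 0"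
    and L: "compact L" "\<And>x. x \<notin> L \<Longrightarrow> \<rho> x = 1" "\<And>x c. x \<notin> L \<Longrightarrow> c \<in> atlas M \<Longrightarrow> R c x = 0"
    and r: "\<And>x. 0 \<le> \<rho> x" "\<And>x. \<rho> x \<le> 1" by (rule cutoff_compact[OF K]) (rule that)
  \<comment> \<open>Components of a differential outside the chart domain are arbitrary. They are
    set to 0 on \<open>V\<close> as well, so that gluing with the zero function holds for all
    arguments.\<close>
  define R' where "R' c x = (if x \<in> V then 0 else R c x)" for c x
  define \<eta> where "\<eta> i x = (if x \<in> A i then \<rho> x else 0)" for i x
  define X where "X i c x = (if x \<in> A i then R' c x else 0)" for i c x
  have \<rho>': "C1M \<rho> R'"
    using \<rho> by (rule C1M_cong) (use C1M_locally_zero[OF \<rho> V(1,3)] in \<open>auto simp: R'_def\<close>)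
  have "C1M (\<eta> i) (X i)" if i: "i \<in> I" for i
  proof (rule C1M_glue[OF A(1)[OF i] _ _ \<rho>' C1M_const[of 0]])
    \<comment> \<open>An open set that covers the complement of \<open>A i\<close> and meets
      \<open>A i\<close> only inside \<open>V\<close>, where \<open>\<rho>\<close> vanishes; hence
      extension by zero is consistent.\<close>
    let ?B = "V \<union> (\<Union>k\<in>I - {i}. A k)"
    show "open ?B" using V(1) A(1) by auto
    show "A i \<union> ?B = UNIV" using cov V(2) by auto
    have *: "x \<in> V" if "x \<in> ?B" "x \<in> A i" for x using that A(2)[OF i] by auto
    show "\<eta> i x = 0" if "x \<in> ?B" for x using *[OF that] V(3) by (auto simp: \<eta>_def)
    show "X i c x = 0" if "x \<in> ?B" for c x using *[OF that] by (auto simp: X_def R'_def)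
  qed (auto simp: \<eta>_def X_def)
  moreover have "K \<subseteq> L" using V L(2) by force
  ultimately show ?thesis
    by (intro that[of \<eta> X L]) (use V L r in \<open>auto simp: \<eta>_def X_def R'_def\<close>)
qed

end

text \<open>On the unit interval this is the antiderivative of the squared slope
  \<open>36 s^2 (1 - s)^2\<close> of the step, so that an energy density becomes an exact
  derivative. Its final value is \<open>36 * (1/3 - 1/2 + 1/5) = 6/5\<close>.\<close>

definition step_energy :: "real \<Rightarrow> real" where
  "step_energy s = 36 * ((clamp01 s) ^ 3 / 3 - (clamp01 s) ^ 4 / 2 + (clamp01 s) ^ 5 / 5)"

lemma step_energy_DERIV: "(step_energy has_real_derivative (smooth_step' s)\<^sup>2) (at s)"
proof -
  have "((\<lambda>s. 36 * (s ^ 3 / 3 - s ^ 4 / 2 + s ^ 5 / 5)) has_real_derivative 36 * (s\<^sup>2 * (1 - s)\<^sup>2)) (at s)" for s :: real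
    by (auto intro!: derivative_eq_intros simp: power2_eq_square algebra_simps eval_nat_numeral)
  from clamp_poly_DERIV[OF this] show ?thesis
    unfolding step_energy_def[abs_def] smooth_step'_def by (simp add: power_mult_distrib mult.assoc)
qed

lemma step_energy_simps: "s \<le> 0 \<Longrightarrow> step_energy s = 0" "s \<ge> 1 \<Longrightarrow> step_energy s = 6 / 5"
  by (simp_all add: step_energy_def clamp01_def)

context elliptic_space
begin

text \<open>The energy of the logarithmic cutoff at scale \<open>T\<close> is the flux of \<open>ln (s / f)\<close> through the
  transition layer of \<open>\<eta>\<close>, independently of \<open>T\<close>; \<open>6 / 5\<close> is the Dirichlet energy of the step.\<close>

lemma end_cutoff_energy:
  assumes s: "weak_sol q s D" and f: "weak_sol q f E" and \<eta>: "C1M \<eta> X"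
    and L: "\<And>c x. c \<in> atlas M \<Longrightarrow> x \<notin> L \<Longrightarrow> X c x = 0" "L \<subseteq> K" and K: "compact K" and T: "T > 0"
    and lnear: "\<And>x. x \<in> L \<Longrightarrow> ln (s x) - ln (f x) \<ge> - T"
    and far: "\<And>x. x \<notin> K \<Longrightarrow> \<eta> x = 0 \<or> ln (s x) - ln (f x) \<le> - 2 * T"
    and G: "\<And>c x. G c x = (1 / s x) *\<^sub>R D c x - (1 / f x) *\<^sub>R E c x"
  shows "total (\<lambda>c x. s x * f x * (\<eta> x * (smooth_step' ((ln (s x) - ln (f x) + 2 * T) / T))\<^sup>2 / T) * ((acoef c x *v G c x) \<bullet> G c x))
    = - (6 / 5) * total (\<lambda>c x. s x * f x * ((acoef c x *v G c x) \<bullet> X c x))"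
proof -
  define l where "l x = ln (s x) - ln (f x)" for x
  define r where "r x = (l x + 2 * T) / T" for x
  note pos = weak_solD(2)[OF s] weak_solD(2)[OF f]
  have Hl: "H1M l G"
    using H1M_diff[OF H1M_ln[OF weak_solD(1)[OF s] pos(1)] H1M_ln[OF weak_solD(1)[OF f] pos(2)]]
    unfolding l_def[abs_def] G[abs_def] .
  have Q: "((\<lambda>t. step_energy ((t + 2 * T) / T)) has_real_derivative (smooth_step' ((t + 2 * T) / T))\<^sup>2 / T) (at t)" for t
    by (rule DERIV_chain2[OF step_energy_DERIV, THEN DERIV_cong]) (use T in \<open>auto intro!: derivative_eq_intros\<close>)
  have Qc: "continuous_on UNIV (\<lambda>t. (smooth_step' ((t + 2 * T) / T))\<^sup>2 / T)"
    using T by (intro continuous_intros continuous_on_compose2[OF continuous_on_smooth_step'[of UNIV]]) auto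
  have HQ: "H1M (\<lambda>x. step_energy (r x)) (\<lambda>c x. ((smooth_step' (r x))\<^sup>2 / T) *\<^sub>R G c x)"
    unfolding r_def by (rule H1M_chain[OF Hl open_UNIV _ Q Qc]) simp
  note H\<eta> = C1M_imp_H1M[OF \<eta>]
  \<comment> \<open>Chosen for its differential: the factor \<open>step_energy (r x)\<close>
    contributes the energy density times \<open>\<eta>\<close>, and where \<open>\<eta>\<close>
    varies it is the constant \<open>6 / 5\<close>, which leaves only the flux through that
    region.\<close>
  define \<xi> where "\<xi> x = \<eta> x * step_energy (r x)" for x
  define B where "B c x = (\<eta> x * (smooth_step' (r x))\<^sup>2 / T) *\<^sub>R G c x + (6 / 5) *\<^sub>R X c x" for c x
  have H\<xi>: "H1M \<xi> B"
    using H1M_mult[OF H\<eta> HQ] unfolding \<xi>_def[symmetric]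
  proof (rule H1M_cong)
    fix c x assume c: "c \<in> atlas M"
    have "step_energy (r x) = 6 / 5" if "x \<in> L"
      using lnear[OF that] T by (intro step_energy_simps(2)) (simp add: r_def l_def)
    then have "step_energy (r x) *\<^sub>R X c x = (6 / 5) *\<^sub>R X c x" using L(1)[OF c, of x] by (cases "x \<in> L") auto
    then show "\<eta> x *\<^sub>R ((smooth_step' (r x))\<^sup>2 / T) *\<^sub>R G c x + step_energy (r x) *\<^sub>R X c x = B c x"
      by (simp add: B_def)
  qed
  have r0: "\<eta> x = 0 \<or> r x \<le> 0" if "x \<notin> K" for x
    using far[OF that] T by (auto simp: r_def l_def divide_simps)
  have z: "\<eta> x * step_energy (r x) = 0" "\<eta> x * (smooth_step' (r x))\<^sup>2 = 0" if "x \<notin> K" for x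
    using r0[OF that] smooth_step_simps(3) step_energy_simps(1) by auto
  have X0: "X c x = 0" if "c \<in> atlas M" "x \<notin> K" for c x using L(1)[OF that(1)] L(2) that(2) by blast
  have supp: "supported \<xi> B K"
    unfolding supported_def \<xi>_def B_def using z X0 by auto
  have sc: "continuous_on UNIV s" "continuous_on UNIV f" by (rule H1M_D(1)[OF weak_solD(1)[OF s]], rule H1M_D(1)[OF weak_solD(1)[OF f]])
  have lc: "continuous_on UNIV r" unfolding r_def[abs_def] using T by (intro continuous_intros H1M_D(1)[OF Hl]) auto
  let ?e = "\<lambda>c x. s x * f x * (\<eta> x * (smooth_step' (r x))\<^sup>2 / T) * ((acoef c x *v G c x) \<bullet> G c x)"
  let ?x = "\<lambda>c x. s x * f x * ((acoef c x *v G c x) \<bullet> X c x)"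
  have de: "density ?e"
    using T by (intro density_mult_continuous[OF density_acoef[OF Hl Hl]] continuous_intros sc H1M_D(1)[OF H\<eta>]
      continuous_on_compose2[OF continuous_on_smooth_step'[of UNIV] lc]) auto
  have dx: "density ?x" by (intro density_mult_continuous[OF density_acoef[OF Hl H\<eta>]] continuous_intros sc)
  have ve: "vanishes_off ?e K" unfolding vanishes_off_def using z(2) by auto
  have vx: "vanishes_off ?x K" unfolding vanishes_off_def using X0 by auto
  have vx': "vanishes_off (\<lambda>c x. (6 / 5) * ?x c x) K" using vx unfolding vanishes_off_def by auto
  have "0 = total (\<lambda>c x. s x * f x * ((acoef c x *v ((1 / s x) *\<^sub>R D c x - (1 / f x) *\<^sub>R E c x)) \<bullet> B c x)
      + (q x - q x) * s x * f x * \<xi> x * dens c x)"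
    by (rule log_ratio_total[OF s f H\<xi> K supp, symmetric])
  also have "\<dots> = total (\<lambda>c x. ?e c x + (6 / 5) * ?x c x)"
    by (simp add: G[symmetric] B_def inner_add_right algebra_simps)
  also have "\<dots> = total ?e + total (\<lambda>c x. (6 / 5) * ?x c x)"
    by (rule total_add[OF de density_cmult[OF dx] K ve vx'])
  also have "\<dots> = total ?e + (6 / 5) * total ?x" by (simp only: total_cmult[OF K vx])
  finally show ?thesis unfolding r_def l_def by simp
qed

lemma energy_scaleR: "(acoef c x *v (r *\<^sub>R p)) \<bullet> (r *\<^sub>R p) = r\<^sup>2 * ((acoef c x *v p) \<bullet> p)"
  by (simp add: linear_cmul[OF matrix_vector_mul_linear] power2_eq_square)

text \<open>In the application \<open>f i\<close> is \<open>u_i\<close> and \<open>s i\<close> is a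
  solution small against it at the end. The cutoff runs from 1 to 0 while \<open>l i\<close> falls
  from \<open>-T\<close> to \<open>-2 * T\<close>. Its energy is at most the sum of the
  \<open>C i * b i / T\<close>, where \<open>b i\<close> does not depend on \<open>T\<close>.
  Outside the ends nothing happens, since \<open>w\<close> is 1 there.\<close>

lemma null_sequence:
  fixes A :: "'i \<Rightarrow> 'a set"
  assumes I: "finite I"
    and A: "\<And>i. i \<in> I \<Longrightarrow> open (A i)" "\<And>i j. i \<in> I \<Longrightarrow> j \<in> I \<Longrightarrow> i \<noteq> j \<Longrightarrow> A i \<inter> A j = {}"
    and K1: "compact K1" and cov: "\<And>x. x \<in> K1 \<or> (\<exists>i\<in>I. x \<in> A i)"
    and s: "\<And>i. i \<in> I \<Longrightarrow> weak_sol q (s i) (D i)" and f: "\<And>i. i \<in> I \<Longrightarrow> weak_sol q (f i) (E i)"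
    and far: "\<And>i T. i \<in> I \<Longrightarrow> \<exists>K. compact K \<and> (\<forall>x\<in>A i - K. ln (s i x) - ln (f i x) \<le> - T)"
    and v: "continuous_on UNIV v" "\<And>i x. i \<in> I \<Longrightarrow> x \<in> A i \<Longrightarrow> (v x)\<^sup>2 \<le> C i * (s i x * f i x)"
    and \<epsilon>: "\<epsilon> > 0"
  obtains w Dw K where "H1M w Dw" "compact K" "supported w Dw K" "\<And>x. x \<in> K1 \<Longrightarrow> w x = 1"
    "total (\<lambda>c x. (v x)\<^sup>2 * ((acoef c x *v Dw c x) \<bullet> Dw c x)) \<le> \<epsilon>"
proof -
  obtain \<eta> X L where \<eta>: "\<And>i. i \<in> I \<Longrightarrow> C1M (\<eta> i) (X i)" and \<eta>r: "\<And>i x. 0 \<le> \<eta> i x \<and> \<eta> i x \<le> (1::real)"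
    and L: "compact L" "K1 \<subseteq> L" "\<And>i c x. c \<in> atlas M \<Longrightarrow> x \<notin> L \<Longrightarrow> X i c x = 0"
    and \<eta>0: "\<And>i x. x \<notin> A i \<Longrightarrow> \<eta> i x = 0" and \<eta>K: "\<And>i x. x \<in> K1 \<Longrightarrow> \<eta> i x = 0"
    and \<eta>1: "\<And>i x. x \<in> A i \<Longrightarrow> x \<notin> L \<Longrightarrow> \<eta> i x = 1"
    by (rule end_cutoffs[of I A K1]; (rule A(1) | rule A(2) | rule K1 | rule cov | rule that); assumption)
  define l where "l i x = ln (s i x) - ln (f i x)" for i x
  define G where "G i c x = (1 / s i x) *\<^sub>R D i c x - (1 / f i x) *\<^sub>R E i c x" for i c x
  \<comment> \<open>The value of the energy found in \<open>end_cutoff_energy\<close>. It involves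
    the fixed cutoffs at the ends but not \<open>T\<close>, so \<open>T\<close> can be chosen
    afterwards.\<close>
  define b where "b i = - (6 / 5) * total (\<lambda>c x. s i x * f i x * ((acoef c x *v G i c x) \<bullet> X i c x))" for i
  note pos = weak_solD(2)[OF s] weak_solD(2)[OF f]
  have Hl: "H1M (l i) (G i)" if "i \<in> I" for i
    unfolding l_def[abs_def] G_def[abs_def]
    by (intro H1M_diff H1M_ln weak_solD(1)[OF s] weak_solD(1)[OF f] pos that)
  have H\<eta>: "H1M (\<eta> i) (X i)" if "i \<in> I" for i by (rule C1M_imp_H1M[OF \<eta>[OF that]])
  have "\<exists>T0. \<forall>i\<in>I. \<forall>x\<in>L. \<bar>l i x\<bar> \<le> T0"
    using I Hl
  proof (induction I)
    case (insert i I)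
    then obtain T0 where T0: "\<forall>i\<in>I. \<forall>x\<in>L. \<bar>l i x\<bar> \<le> T0" by auto
    obtain B where B: "\<And>x. x \<in> L \<Longrightarrow> \<bar>l i x\<bar> \<le> B"
      by (rule continuous_compact_bounded[OF L(1) continuous_on_subset[OF H1M_D(1)[OF insert.prems[of i]] subset_UNIV]]) auto
    show ?case by (intro exI[of _ "max T0 B"] ballI) (use T0 B in \<open>force simp: le_max_iff_disj\<close>)
  qed simp
  then obtain T0 where T0: "\<And>i x. i \<in> I \<Longrightarrow> x \<in> L \<Longrightarrow> \<bar>l i x\<bar> \<le> T0" by blast
  \<comment> \<open>Being at least \<open>T0\<close>, it puts all of \<open>L\<close> before the
    transition layer; the last entry makes the final bound at most
    \<open>\<epsilon>\<close>.\<close>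
  define T where "T = max 1 (max T0 ((\<Sum>i\<in>I. C i * b i) / \<epsilon>))"
  have T: "T > 0" "T0 \<le> T" "(\<Sum>i\<in>I. C i * b i) \<le> T * \<epsilon>"
  proof -
    have "(\<Sum>i\<in>I. C i * b i) / \<epsilon> \<le> T" by (simp add: T_def)
    then show "(\<Sum>i\<in>I. C i * b i) \<le> T * \<epsilon>" using \<epsilon> by (simp add: divide_simps)
  qed (auto simp: T_def)
  have "\<exists>K. compact K \<and> (\<forall>x\<in>A i - K. l i x \<le> - (2 * T))" if "i \<in> I" for i
    using far[OF that, of "2 * T"] unfolding l_def .
  then obtain Kf where Kf: "\<And>i. i \<in> I \<Longrightarrow> compact (Kf i)" "\<And>i x. i \<in> I \<Longrightarrow> x \<in> A i \<Longrightarrow> x \<notin> Kf i \<Longrightarrow> l i x \<le> - (2 * T)"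
    by (metis DiffI)
  define K where "K = L \<union> (\<Union>i\<in>I. Kf i)"
  have K: "compact K" "L \<subseteq> K" using L(1) Kf(1) I by (auto simp: K_def)
  \<comment> \<open>The affine parameter of the layer: 1 for \<open>l = -T\<close> and 0 for
    \<open>l = -2 * T\<close>.\<close>
  define r where "r i x = (l i x + 2 * T) / T" for i x
  have rc: "continuous_on UNIV (r i)" if "i \<in> I" for i
    unfolding r_def[abs_def] using T(1) by (intro continuous_intros H1M_D(1)[OF Hl[OF that]]) auto
  have r1: "r i x \<ge> 1" if "i \<in> I" "x \<in> L" for i x
    using T0[OF that] T(1,2) by (simp add: r_def divide_simps)
  have r0: "r i x \<le> 0" if "i \<in> I" "x \<in> A i" "x \<notin> K" for i x
    using Kf(2)[OF that(1,2)] that T(1) by (auto simp: r_def divide_simps K_def)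
  \<comment> \<open>On the end \<open>i\<close> this is \<open>1 + \<eta> i * (step - 1)\<close>:
    equal to 1 where \<open>\<eta> i\<close> vanishes, and equal to the step where
    \<open>\<eta> i\<close> is 1.\<close>
  define w where "w x = 1 + (\<Sum>i\<in>I. \<eta> i x * (smooth_step (r i x) - 1))" for x
  define Dw where "Dw c x = (\<Sum>i\<in>I. (\<eta> i x * smooth_step' (r i x) / T) *\<^sub>R G i c x)" for c x
  have HS: "H1M (\<lambda>x. smooth_step (r i x) - 1) (\<lambda>c x. (smooth_step' (r i x) / T) *\<^sub>R G i c x)" if i: "i \<in> I" for i
    unfolding r_def
  proof (rule H1M_chain[OF Hl[OF i] open_UNIV, of "\<lambda>t. smooth_step ((t + 2 * T) / T) - 1" "\<lambda>t. smooth_step' ((t + 2 * T) / T) / T"])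
    show "((\<lambda>t. smooth_step ((t + 2 * T) / T) - 1) has_real_derivative smooth_step' ((t + 2 * T) / T) / T) (at t)" for t
      by (rule DERIV_cong[OF DERIV_diff[OF DERIV_chain2[OF smooth_step_DERIV] DERIV_const]])
         (use T in \<open>auto intro!: derivative_eq_intros\<close>)
    show "continuous_on UNIV (\<lambda>t. smooth_step' ((t + 2 * T) / T) / T)"
      using T by (intro continuous_intros continuous_on_compose2[OF continuous_on_smooth_step'[of UNIV]]) auto
  qed simp
  have Hw: "H1M w Dw"
    unfolding w_def[abs_def]
  proof (rule H1M_cong[OF H1M_add[OF H1M_const H1M_sum[OF I H1M_mult[OF H\<eta> HS]]]])
    fix c x assume c: "c \<in> atlas M"
    \<comment> \<open>The differential of \<open>\<eta> i\<close> lives in \<open>L\<close>, where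
      the step is still 1, so it does not contribute to \<open>Dw\<close>.\<close>
    have "(smooth_step (r i x) - 1) *\<^sub>R X i c x = 0" if "i \<in> I" for i
      using L(3)[OF c, of x] smooth_step_simps(2)[OF r1[OF that]] by (cases "x \<in> L") auto
    then show "0 + (\<Sum>i\<in>I. \<eta> i x *\<^sub>R (smooth_step' (r i x) / T) *\<^sub>R G i c x + (smooth_step (r i x) - 1) *\<^sub>R X i c x) = Dw c x"
      unfolding Dw_def add_0 by (intro sum.cong refl) simp
  qed
  \<comment> \<open>Off \<open>K1\<close> a point belongs to exactly one of the disjoint sets
    \<open>A i\<close>, so every sum over the ends reduces to one term.\<close>
  have single: "\<exists>i\<in>I. x \<in> A i \<and> (\<forall>F::'i \<Rightarrow> real. (\<Sum>k\<in>I. \<eta> k x * F k) = \<eta> i x * F i) \<and> Dw c x = (\<eta> i x * smooth_step' (r i x) / T) *\<^sub>R G i c x"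
    if x: "x \<notin> K1" for c x
  proof -
    obtain i where i: "i \<in> I" "x \<in> A i" using cov[of x] x by blast
    have z: "\<eta> k x = 0" if "k \<in> I - {i}" for k using A(2)[of i k] i that by (intro \<eta>0) auto
    have "(\<Sum>k\<in>I. \<eta> k x * F k) = \<eta> i x * F i" for F
      using sum.remove[OF I i(1), of "\<lambda>k. \<eta> k x * F k"] z by simp
    moreover have "Dw c x = (\<eta> i x * smooth_step' (r i x) / T) *\<^sub>R G i c x"
      using sum.remove[OF I i(1), of "\<lambda>i. (\<eta> i x * smooth_step' (r i x) / T) *\<^sub>R G i c x"] z by (simp add: Dw_def)
    ultimately show ?thesis using i by blast
  qed
  have supp: "supported w Dw K"
    unfolding supported_def
  proof (intro allI impI conjI ballI)
    fix x assume x: "x \<notin> K"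
    then have xL: "x \<notin> L" "x \<notin> K1" using K(2) L(2) by auto
    have *: "w x = 0 \<and> Dw c x = 0" for c
    proof -
      obtain i where i: "i \<in> I" "x \<in> A i" and S: "\<And>F::'i \<Rightarrow> real. (\<Sum>k\<in>I. \<eta> k x * F k) = \<eta> i x * F i"
        and Di: "Dw c x = (\<eta> i x * smooth_step' (r i x) / T) *\<^sub>R G i c x" using single[OF xL(2)] by blast
      have "w x = 1 + \<eta> i x * (smooth_step (r i x) - 1)" unfolding w_def S ..
      then show ?thesis using Di \<eta>1[OF i(2) xL(1)] smooth_step_simps(1,3)[OF r0[OF i x]] by simp
    qed
    show "w x = 0" using * by blast
    show "Dw c x = 0" for c using * by blast
  qed
  have w1: "w x = 1" if "x \<in> K1" for x using \<eta>K[OF that] by (simp add: w_def)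
  let ?e = "\<lambda>i c x. s i x * f i x * (\<eta> i x * (smooth_step' (r i x))\<^sup>2 / T) * ((acoef c x *v G i c x) \<bullet> G i c x)"
  let ?E = "\<lambda>c x. (v x)\<^sup>2 * ((acoef c x *v Dw c x) \<bullet> Dw c x)"
  have sc: "continuous_on UNIV (s i)" "continuous_on UNIV (f i)" if "i \<in> I" for i
    by (rule H1M_D(1)[OF weak_solD(1)[OF s[OF that]]], rule H1M_D(1)[OF weak_solD(1)[OF f[OF that]]])
  have de: "density (?e i)" if i: "i \<in> I" for i
    using T by (intro density_mult_continuous[OF density_acoef[OF Hl[OF i] Hl[OF i]]] continuous_intros sc[OF i] H1M_D(1)[OF H\<eta>[OF i]]
      continuous_on_compose2[OF continuous_on_smooth_step'[of UNIV] rc[OF i]]) auto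
  have ve: "vanishes_off (?e i) K" if i: "i \<in> I" for i
    unfolding vanishes_off_def
  proof (intro ballI impI)
    fix c x assume "x \<notin> K"
    then have "\<eta> i x = 0 \<or> smooth_step' (r i x) = 0" using \<eta>0[of x i] smooth_step_simps(3)[OF r0[OF i]] by blast
    then show "?e i c x = 0" by auto
  qed
  have et: "total (?e i) = b i" if i: "i \<in> I" for i
    unfolding b_def r_def l_def
  proof (rule end_cutoff_energy[OF s[OF i] f[OF i] \<eta>[OF i] L(3) K(2,1) T(1) _ _ G_def])
    show "ln (s i x) - ln (f i x) \<ge> - T" if "x \<in> L" for x using T0[OF i that] T(2) unfolding l_def by linarith
    show "\<eta> i x = 0 \<or> ln (s i x) - ln (f i x) \<le> - 2 * T" if "x \<notin> K" for x
      using \<eta>0[of x i] Kf(2)[OF i, of x] that i unfolding l_def K_def by auto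
  qed
  have dE: "density ?E" by (intro density_mult_continuous[OF density_acoef[OF Hw Hw]] continuous_intros v(1))
  have vE: "vanishes_off ?E K" using supp unfolding vanishes_off_def supported_def by auto
  have le: "?E c x \<le> (\<Sum>i\<in>I. (C i / T) * ?e i c x)" if c: "c \<in> atlas M" and x: "x \<in> fst c" for c x
  proof (cases "x \<in> K1")
    case True
    then show ?thesis using \<eta>K[OF True] by (simp add: Dw_def)
  next
    case False
    obtain i where i: "i \<in> I" "x \<in> A i" and S: "\<And>F::'i \<Rightarrow> real. (\<Sum>k\<in>I. \<eta> k x * F k) = \<eta> i x * F i"
      and Di: "Dw c x = (\<eta> i x * smooth_step' (r i x) / T) *\<^sub>R G i c x" using single[OF False] by blast
    let ?q = "(acoef c x *v G i c x) \<bullet> G i c x" and ?S = "(smooth_step' (r i x) / T)\<^sup>2"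
    have "(\<Sum>i\<in>I. (C i / T) * ?e i c x) = (\<Sum>k\<in>I. \<eta> k x * ((C k / T) * s k x * f k x * ((smooth_step' (r k x))\<^sup>2 / T) * ((acoef c x *v G k c x) \<bullet> G k c x)))"
      by (simp add: mult_ac)
    also have "\<dots> = \<eta> i x * (?S * ?q * (C i * (s i x * f i x)))"
      unfolding S by (simp add: power2_eq_square mult_ac)
    finally have R: "(\<Sum>i\<in>I. (C i / T) * ?e i c x) = \<eta> i x * (?S * ?q * (C i * (s i x * f i x)))" .
    have q: "?q \<ge> 0" by (rule acoef_nonneg[OF c x])
    have "?E c x = (\<eta> i x)\<^sup>2 * (?S * ?q * (v x)\<^sup>2)"
      unfolding Di energy_scaleR by (simp add: power_mult_distrib power_divide)
    \<comment> \<open>\<open>\<eta>^2 \<le> \<eta>\<close> because \<open>\<eta>\<close> takes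
      values between 0 and 1; the energy identity is linear in \<open>\<eta>\<close>.\<close>
    also have "\<dots> \<le> \<eta> i x * (?S * ?q * (v x)\<^sup>2)"
      using \<eta>r[of i x] q mult_left_le[of "\<eta> i x" "\<eta> i x"] by (intro mult_right_mono) (auto simp: power2_eq_square)
    also have "\<dots> \<le> \<eta> i x * (?S * ?q * (C i * (s i x * f i x)))"
      using \<eta>r[of i x] q v(2)[OF i] by (intro mult_left_mono) auto
    finally show ?thesis unfolding R .
  qed
  have dc: "density (\<lambda>c x. (C i / T) * ?e i c x)" if "i \<in> I" for i by (rule density_cmult[OF de[OF that]])
  have vc: "vanishes_off (\<lambda>c x. (C i / T) * ?e i c x) K" if "i \<in> I" for i
    using ve[OF that] unfolding vanishes_off_def by auto
  have vs: "vanishes_off (\<lambda>c x. \<Sum>i\<in>I. (C i / T) * ?e i c x) K"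
    using vc unfolding vanishes_off_def by (auto intro!: sum.neutral)
  have "total ?E \<le> total (\<lambda>c x. \<Sum>i\<in>I. (C i / T) * ?e i c x)"
    by (rule total_mono[OF dE density_sum[OF I dc] K(1) vE vs]) (use le coord_point(2) in blast)+
  also have "\<dots> = (\<Sum>i\<in>I. total (\<lambda>c x. (C i / T) * ?e i c x))" by (rule total_sum[OF I dc K(1) vc])
  also have "\<dots> = (\<Sum>i\<in>I. (C i / T) * b i)"
    using et by (intro sum.cong refl) (simp only: total_cmult[OF K(1) ve])
  also have "\<dots> = (\<Sum>i\<in>I. C i * b i) / T" by (simp add: sum_divide_distrib)
  also have "\<dots> \<le> \<epsilon>" using T by (simp add: divide_simps mult.commute)
  finally have "total ?E \<le> \<epsilon>" .
  from that[OF Hw K(1) supp _ this] w1 show ?thesis by blast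
qed

end

section \<open>Ground state comparison\<close>

lemma AE_open_empty:
  fixes U :: "'a::euclidean_space set"
  assumes U: "open U" and ae: "AE y in lebesgue. y \<notin> U"
  shows "U = {}"
proof -
  obtain N where "N \<in> null_sets lebesgue" "U \<subseteq> N" using ae by (auto simp: eventually_ae_filter)
  then have "negligible U" using negligible_iff_null_sets negligible_subset by blast
  then show ?thesis using open_not_negligible[OF U] by blast
qed

context elliptic_space
begin

text \<open>Supersolutions are defined only almost everywhere, so minimal growth yields an almost
  everywhere bound. For continuous functions the set where it fails is open and null, hence
  empty.\<close>

lemma ae_on_le_imp_le:
  assumes ae: "ae_on M U (\<lambda>x. f x \<le> g x)" and U: "open U" and fg: "continuous_on UNIV f" "continuous_on UNIV (g :: 'a \<Rightarrow> real)"
    and x: "x \<in> U"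
  shows "f x \<le> g x"
proof (rule ccontr)
  assume n: "\<not> f x \<le> g x"
  obtain c where c: "c \<in> atlas M" "x \<in> fst c" by (rule atlas_covers)
  let ?B = "U \<inter> {x. g x < f x}"
  have "open {x. g x < f x}" by (rule open_Collect_less[OF fg(2,1)])
  then have "open (coords c ?B)" using U by (intro open_coords[OF c(1)]) auto
  moreover have "AE y in lebesgue. y \<notin> coords c ?B"
    using bspec[OF ae[unfolded ae_on_def] c(1)]
  proof eventually_elim
    case (elim y)
    then show ?case using coord_point(3)[OF c(1), of y ?B] coords_mono[of ?B U c] by fastforce
  qed
  ultimately have "coords c ?B = {}" by (rule AE_open_empty)
  moreover have "snd c x \<in> coords c ?B" using c x n by (auto simp: coords_def)
  ultimately show False by blast
qed

text \<open>The ground state transform: test the equations of \<open>v\<close> and \<open>f\<close> with \<open>w\<^sup>2 v / f\<close> and complete the square.\<close>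

lemma ground_state_inequality:
  assumes v: "weak_sol q v D" and f: "weak_sol (\<lambda>x. q x - V x) f E" and V: "continuous_on UNIV V"
    and w: "H1M w Dw" and K: "compact K" "supported w Dw K"
  shows "total (\<lambda>c x. V x * (v x)\<^sup>2 * (w x)\<^sup>2 * dens c x) \<le> total (\<lambda>c x. (v x)\<^sup>2 * ((acoef c x *v Dw c x) \<bullet> Dw c x))"
proof -
  define G where "G c x = (1 / v x) *\<^sub>R D c x - (1 / f x) *\<^sub>R E c x" for c x
  define l where "l x = ln (v x) - ln (f x)" for x
  note pos = weak_solD(2)[OF v] weak_solD(2)[OF f]
  have Hl: "H1M l G"
    using H1M_diff[OF H1M_ln[OF weak_solD(1)[OF v] pos(1)] H1M_ln[OF weak_solD(1)[OF f] pos(2)]]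
    unfolding l_def[abs_def] G_def[abs_def] .
  \<comment> \<open>As \<open>exp l = v / f\<close>, this is the test function
    \<open>w^2 v / f\<close>, and the weight \<open>v f\<close> of the flux turns into
    \<open>v^2\<close>.\<close>
  note H = H1M_mult[OF H1M_mult[OF w w] H1M_exp[OF Hl]]
  have w0: "w x = 0" "c \<in> atlas M \<Longrightarrow> Dw c x = 0" if "x \<notin> K" for c x using K(2) that by (auto simp: supported_def)
  have supp: "supported (\<lambda>x. w x * w x * exp (l x)) (\<lambda>c x. (w x * w x) *\<^sub>R exp (l x) *\<^sub>R G c x + exp (l x) *\<^sub>R (w x *\<^sub>R Dw c x + w x *\<^sub>R Dw c x)) K"
    by (simp add: supported_def w0)
  have vc: "continuous_on UNIV v" by (rule H1M_D(1)[OF weak_solD(1)[OF v]])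
  have wc: "continuous_on UNIV w" by (rule H1M_D(1)[OF w])
  let ?F = "\<lambda>c x. V x * (v x)\<^sup>2 * (w x)\<^sup>2 * dens c x" and ?E = "\<lambda>c x. (v x)\<^sup>2 * ((acoef c x *v Dw c x) \<bullet> Dw c x)"
  let ?Z = "\<lambda>c x. ((v x)\<^sup>2 * (w x)\<^sup>2 * ((acoef c x *v G c x) \<bullet> G c x) + 2 * (v x)\<^sup>2 * w x * ((acoef c x *v G c x) \<bullet> Dw c x)) + ?F c x"
  have dF: "density ?F" by (intro density_dens continuous_intros V vc wc)
  have dE: "density ?E" by (intro density_mult_continuous[OF density_acoef[OF w w]] continuous_intros vc)
  have dZ: "density ?Z"
    by (intro density_add[OF _ dF] density_add density_mult_continuous[OF density_acoef[OF Hl Hl]]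
      density_mult_continuous[OF density_acoef[OF Hl w]] continuous_intros vc wc)
  have vF: "vanishes_off ?F K" and vE: "vanishes_off ?E K" and vZ: "vanishes_off ?Z K"
    by (simp_all add: vanishes_off_def w0)
  have vl: "v x * f x * exp (l x) = (v x)\<^sup>2" for x
    using pos(1)[of x] pos(2)[of x] by (simp add: l_def exp_diff power2_eq_square)
  have "0 = total (\<lambda>c x. v x * f x * ((acoef c x *v G c x) \<bullet> ((w x * w x) *\<^sub>R exp (l x) *\<^sub>R G c x + exp (l x) *\<^sub>R (w x *\<^sub>R Dw c x + w x *\<^sub>R Dw c x)))
      + (q x - (q x - V x)) * v x * f x * (w x * w x * exp (l x)) * dens c x)"
    unfolding G_def by (rule log_ratio_total[OF v f H[unfolded G_def] K(1) supp[unfolded G_def], symmetric])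
  also have "\<dots> = total ?Z"
  proof -
    have "v x * f x * ((acoef c x *v G c x) \<bullet> ((w x * w x) *\<^sub>R exp (l x) *\<^sub>R G c x + exp (l x) *\<^sub>R (w x *\<^sub>R Dw c x + w x *\<^sub>R Dw c x)))
      + (q x - (q x - V x)) * v x * f x * (w x * w x * exp (l x)) * dens c x = ?Z c x" for c x
      unfolding vl[symmetric] inner_add_right inner_scaleR_right by (simp add: power2_eq_square algebra_simps)
    then show ?thesis by (simp only:)
  qed
  finally have Z: "total ?Z = 0" by simp
  have pw: "?F c x \<le> ?Z c x + ?E c x" if c: "c \<in> atlas M" and x: "x \<in> fst c" for c x
  proof -
    \<comment> \<open>\<open>w G + Dw\<close> is \<open>f / v\<close> times the differential of
      \<open>w v / f\<close>; the dropped term is thus the energy of \<open>w v / f\<close> with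
      weight \<open>f^2\<close>.\<close>
    have "0 \<le> (v x)\<^sup>2 * ((acoef c x *v (w x *\<^sub>R G c x + Dw c x)) \<bullet> (w x *\<^sub>R G c x + Dw c x))"
      using acoef_nonneg[OF c x] by simp
    also have "\<dots> = (v x)\<^sup>2 * (w x)\<^sup>2 * ((acoef c x *v G c x) \<bullet> G c x) + 2 * (v x)\<^sup>2 * w x * ((acoef c x *v G c x) \<bullet> Dw c x) + ?E c x"
      using acoef_symmetric[OF c x, of "G c x" "Dw c x"]
      by (simp add: matrix_vector_right_distrib linear_cmul[OF matrix_vector_mul_linear] inner_add_left inner_add_right power2_eq_square algebra_simps)
    finally show ?thesis by simp
  qed
  have "total ?F \<le> total (\<lambda>c x. ?Z c x + ?E c x)"
  proof (rule total_mono[OF dF density_add[OF dZ dE] K(1) vF])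
    show "vanishes_off (\<lambda>c x. ?Z c x + ?E c x) K" using vZ vE by (simp add: vanishes_off_def)
    show "AE y in lebesgue. y \<in> coords c UNIV \<longrightarrow> ?F c (point c y) \<le> ?Z c (point c y) + ?E c (point c y)" if c: "c \<in> atlas M" for c
      using pw[OF c coord_point(2)[OF c]] by (intro AE_I2 impI)
  qed
  also have "\<dots> = total ?Z + total ?E" by (rule total_add[OF dZ dE K(1) vZ vE])
  finally show ?thesis using Z by simp
qed

text \<open>If the integral vanished, \<open>h\<close> would be zero almost everywhere in
  coordinates, but it is positive on a nonempty open set.\<close>

lemma total_bump_pos:
  assumes h: "continuous_on UNIV h" "\<And>x. h x \<ge> 0" "h x > 0" and d: "d \<in> atlas M"
    and L: "compact L" "L \<subseteq> fst d" "\<And>x. x \<notin> L \<Longrightarrow> h x = 0"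
  shows "total (\<lambda>c x. h x * dens c x) > 0"
proof -
  let ?k = "\<lambda>y. h (point d y) * dens d (point d y)"
  note KL = compact_coords[OF d L(1,2)]
  have dn: "density (\<lambda>c x. h x * dens c x)" by (rule density_dens[OF h(1)])
  have t: "total (\<lambda>c x. h x * dens c x) = (LINT y:coords d L|lebesgue. ?k y)"
    by (rule total_chart[OF dn d L(1,2)]) (simp add: vanishes_off_def L(3))
  have i: "integrable lebesgue (\<lambda>y. indicat_real (coords d L) y *\<^sub>R ?k y)"
    using densityD(1)[OF dn d KL] unfolding set_integrable_def .
  have nn: "indicat_real (coords d L) y *\<^sub>R ?k y \<ge> 0" for y
  proof (cases "y \<in> coords d L")
    case True
    then show ?thesis using h(2) less_imp_le[OF dens_pos[OF d coord_point(2)[OF d True]]] by simp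
  qed simp
  have ge: "(LINT y:coords d L|lebesgue. ?k y) \<ge> 0"
    unfolding set_lebesgue_integral_def by (rule Bochner_Integration.integral_nonneg) (rule nn)
  have "(LINT y:coords d L|lebesgue. ?k y) \<noteq> 0"
  proof
    assume "(LINT y:coords d L|lebesgue. ?k y) = 0"
    then have "AE y in lebesgue. indicat_real (coords d L) y *\<^sub>R ?k y = 0"
      unfolding set_lebesgue_integral_def using integral_nonneg_eq_0_iff_AE[OF i] nn by simp
    then have "AE y in lebesgue. y \<notin> coords d {x. h x > 0}"
    proof eventually_elim
      case (elim y)
      show ?case
      proof
        assume y: "y \<in> coords d {x. h x > 0}"
        have p: "h (point d y) > 0" using coord_point(3)[OF d y] by simp
        then have "y \<in> coords d L" using coords_iff[OF d] y L(3) by (metis less_irrefl)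
        then show False using elim p dens_pos[OF d coord_point(2)[OF d y]] by simp
      qed
    qed
    moreover have "open (coords d {x. h x > 0})"
      by (rule open_coords[OF d open_Collect_less[OF continuous_on_const h(1)]])
    ultimately have "coords d {x. h x > 0} = {}" by (intro AE_open_empty)
    moreover have "x \<in> L" using L(3) h(3) by force
    ultimately show False using h(3) L(2) by (auto simp: coords_def)
  qed
  then show ?thesis using t ge by simp
qed

text \<open>Localise \<open>V v^2\<close> by a bump \<open>\<theta>\<close> around a point with
  \<open>V > 0\<close>; this leaves a fixed positive mass. If \<open>w\<close> is 1 on the support
  of \<open>\<theta>\<close>, the ground state inequality bounds this mass by the energy of
  \<open>w\<close>, which can be made at most half of it.\<close>

lemma null_sequence_no_solution:
  assumes v: "weak_sol q v D" and f: "weak_sol (\<lambda>x. q x - V x) f E"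
    and V: "continuous_on UNIV V" "\<And>x. V x \<ge> 0" "V x0 \<noteq> 0"
    and null: "\<And>K1 \<epsilon>. compact K1 \<Longrightarrow> \<epsilon> > 0 \<Longrightarrow> \<exists>w Dw K. H1M w Dw \<and> compact K \<and> supported w Dw K \<and> (\<forall>x\<in>K1. w x = 1) \<and>
      total (\<lambda>c x. (v x)\<^sup>2 * ((acoef c x *v Dw c x) \<bullet> Dw c x)) \<le> \<epsilon>"
  shows False
proof -
  obtain \<theta> \<Theta> U where \<theta>: "C1M \<theta> \<Theta>" "cutoff_in_chart \<theta> \<Theta>" and U: "x0 \<in> U" "\<And>z. z \<in> U \<Longrightarrow> \<theta> z = 1"
    and \<theta>r: "\<And>z. 0 \<le> \<theta> z \<and> \<theta> z \<le> 1" by (rule cutoff_exists[of x0]) (rule that)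
  obtain d L where d: "d \<in> atlas M" and L: "compact L" "L \<subseteq> fst d" "supported \<theta> \<Theta> L"
    using \<theta>(2) unfolding cutoff_in_chart_def by blast
  have \<theta>0: "\<theta> x = 0" if "x \<notin> L" for x using L(3) that by (simp add: supported_def)
  have vc: "continuous_on UNIV v" by (rule H1M_D(1)[OF weak_solD(1)[OF v]])
  have \<theta>c: "continuous_on UNIV \<theta>" by (rule H1M_D(1)[OF C1M_imp_H1M[OF \<theta>(1)]])
  define h where "h x = \<theta> x * V x * (v x)\<^sup>2" for x
  have hc: "continuous_on UNIV h" unfolding h_def[abs_def] by (intro continuous_intros \<theta>c V(1) vc)
  have h0: "h x \<ge> 0" for x using \<theta>r V(2) by (simp add: h_def)
  have hx: "h x0 > 0" using U V(2)[of x0] V(3) weak_solD(2)[OF v, of x0] by (simp add: h_def)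
  have m: "total (\<lambda>c x. h x * dens c x) > 0"
    by (rule total_bump_pos[OF hc h0 hx d L(1,2)]) (simp add: h_def \<theta>0)
  obtain w Dw K where w: "H1M w Dw" and K: "compact K" "supported w Dw K" and w1: "\<And>x. x \<in> L \<Longrightarrow> w x = 1"
    and e: "total (\<lambda>c x. (v x)\<^sup>2 * ((acoef c x *v Dw c x) \<bullet> Dw c x)) \<le> total (\<lambda>c x. h x * dens c x) / 2"
    using null[OF L(1), of "total (\<lambda>c x. h x * dens c x) / 2"] m by auto
  have wc: "continuous_on UNIV w" by (rule H1M_D(1)[OF w])
  have "total (\<lambda>c x. h x * dens c x) \<le> total (\<lambda>c x. V x * (v x)\<^sup>2 * (w x)\<^sup>2 * dens c x)"
  proof (rule total_mono)
    show "density (\<lambda>c x. h x * dens c x)" by (rule density_dens[OF hc])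
    show "density (\<lambda>c x. V x * (v x)\<^sup>2 * (w x)\<^sup>2 * dens c x)" by (intro density_dens continuous_intros V(1) vc wc)
    show "compact (K \<union> L)" using K(1) L(1) by auto
    show "vanishes_off (\<lambda>c x. h x * dens c x) (K \<union> L)" by (simp add: vanishes_off_def h_def \<theta>0)
    show "vanishes_off (\<lambda>c x. V x * (v x)\<^sup>2 * (w x)\<^sup>2 * dens c x) (K \<union> L)"
      using K(2) by (simp add: vanishes_off_def supported_def)
    fix c assume c: "c \<in> atlas M"
    have "h x * dens c x \<le> V x * (v x)\<^sup>2 * (w x)\<^sup>2 * dens c x" if x: "x \<in> fst c" for x
    proof (rule mult_right_mono)
      show "dens c x \<ge> 0" using dens_pos[OF c x] by simp
      show "h x \<le> V x * (v x)\<^sup>2 * (w x)\<^sup>2"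
      proof (cases "x \<in> L")
        case True
        have "\<theta> x * (V x * (v x)\<^sup>2) \<le> 1 * (V x * (v x)\<^sup>2)" using \<theta>r V(2) by (intro mult_right_mono) auto
        then show ?thesis by (simp add: h_def w1[OF True] mult.assoc)
      next
        case False
        then show ?thesis using V(2) by (simp add: h_def \<theta>0)
      qed
    qed
    then show "AE y in lebesgue. y \<in> coords c UNIV \<longrightarrow> h (point c y) * dens c (point c y)
        \<le> V (point c y) * (v (point c y))\<^sup>2 * (w (point c y))\<^sup>2 * dens c (point c y)"
      using coord_point(2)[OF c] by (intro AE_I2 impI) blast
  qed
  also have "\<dots> \<le> total (\<lambda>c x. (v x)\<^sup>2 * ((acoef c x *v Dw c x) \<bullet> Dw c x))"
    by (rule ground_state_inequality[OF v f V(1) w K])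
  finally show False using e m by linarith
qed

end

section \<open>Behaviour at the ends\<close>

lemma eventually_at_end:
  "eventually Q (at_end F) \<longleftrightarrow> (\<exists>K. compact K \<and> (\<forall>x\<in>F - K. Q x))"
proof -
  have "eventually Q (at_end F) \<longleftrightarrow> (\<exists>K\<in>{K. compact K}. eventually Q (principal (F - K)))"
    unfolding at_end_def
  proof (rule eventually_INF_base)
    fix K L :: "'a set" assume "K \<in> {K. compact K}" "L \<in> {K. compact K}"
    then have "K \<union> L \<in> {K. compact K}" by (simp add: compact_Un)
    moreover have "principal (F - (K \<union> L)) \<le> inf (principal (F - K)) (principal (F - L))" by auto
    ultimately show "\<exists>x\<in>{K. compact K}. principal (F - x) \<le> inf (principal (F - K)) (principal (F - L))" by blast
  qed (use compact_empty in blast)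
  then show ?thesis by (simp add: eventually_principal)
qed

text \<open>Where \<open>U i\<close> is the largest of the functions and all the others are controlled by \<open>s\<close>,
  the exponent \<open>\<alpha> i \<le> 1 / 2\<close> leaves enough powers of \<open>s\<close>.\<close>

lemma product_square_bound:
  fixes U \<alpha> :: "'i \<Rightarrow> real"
  assumes I: "finite I" "i \<in> I" and pos: "\<And>m. m \<in> I \<Longrightarrow> U m > 0" and \<alpha>: "\<And>m. m \<in> I \<Longrightarrow> 0 < \<alpha> m" "\<alpha> i \<le> 1 / 2"
    and one: "(\<Sum>m\<in>I. \<alpha> m) = 1" and s: "0 < s" "s \<le> U i" and C: "C \<ge> 1" "\<And>m. m \<in> I \<Longrightarrow> m \<noteq> i \<Longrightarrow> U m \<le> C * s"
  shows "(\<Prod>m\<in>I. U m powr \<alpha> m)\<^sup>2 \<le> C\<^sup>2 * (s * U i)"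
proof -
  let ?a = "\<alpha> i" and ?P = "\<Prod>m\<in>I - {i}. U m powr \<alpha> m"
  have Cs: "C * s > 0" using s C by simp
  have Ui: "U i > 0" by (rule pos[OF I(2)])
  have "?P \<le> (\<Prod>m\<in>I - {i}. (C * s) powr \<alpha> m)"
    using pos \<alpha>(1) C(2) by (intro prod_mono conjI powr_mono2) (auto intro: less_imp_le)
  also have "\<dots> = (C * s) powr (1 - ?a)"
  proof -
    have "(\<Sum>m\<in>I - {i}. \<alpha> m) = 1 - ?a" using sum.remove[OF I, of \<alpha>] one by simp
    then show ?thesis using powr_sum[of "C * s" \<alpha> "I - {i}"] Cs by (metis less_irrefl)
  qed
  finally have P: "?P \<le> (C * s) powr (1 - ?a)" .
  have "(\<Prod>m\<in>I. U m powr \<alpha> m) \<le> U i powr ?a * (C * s) powr (1 - ?a)"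
    unfolding prod.remove[OF I] using P by (rule mult_left_mono) simp
  then have "(\<Prod>m\<in>I. U m powr \<alpha> m)\<^sup>2 \<le> (U i powr ?a * (C * s) powr (1 - ?a))\<^sup>2"
    by (rule power_mono) (simp add: prod_nonneg)
  also have "\<dots> = U i powr (2 * ?a) * ((C * s) * (C * s) powr (1 - 2 * ?a))"
  proof -
    have "(U i powr ?a)\<^sup>2 = U i powr (2 * ?a)" by (simp add: power2_eq_square powr_add[symmetric])
    moreover have "((C * s) powr (1 - ?a))\<^sup>2 = (C * s) powr (1 + (1 - 2 * ?a))"
      by (simp add: power2_eq_square powr_add[symmetric])
    moreover have "\<dots> = (C * s) * (C * s) powr (1 - 2 * ?a)" using Cs by (simp only: powr_add powr_one less_imp_le)
    ultimately show ?thesis by (simp add: power_mult_distrib)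
  qed
  \<comment> \<open>Here \<open>\<alpha> i \<le> 1 / 2\<close> enters: the exponent
    \<open>1 - 2 * \<alpha> i\<close> is nonnegative, so the surplus power of \<open>s\<close> may
    be raised to a power of \<open>U i\<close>, leaving exactly one factor \<open>s\<close>.\<close>
  also have "\<dots> \<le> U i powr (2 * ?a) * ((C * s) * (C * U i) powr (1 - 2 * ?a))"
    using s C \<alpha>(2) Cs by (intro mult_left_mono powr_mono2) auto
  also have "\<dots> = C * s * (U i powr (2 * ?a) * U i powr (1 - 2 * ?a)) * C powr (1 - 2 * ?a)"
    using C(1) Ui by (simp add: powr_mult)
  also have "U i powr (2 * ?a) * U i powr (1 - 2 * ?a) = U i"
    using Ui by (simp add: powr_add[symmetric])
  also have "C * s * U i * C powr (1 - 2 * ?a) \<le> C * s * U i * C"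
    using C(1) s Ui \<alpha>(1)[OF I(2)] powr_mono[of "1 - 2 * ?a" 1 C] by (intro mult_left_mono) auto
  finally show ?thesis by (simp add: power2_eq_square mult_ac)
qed

context elliptic_space
begin

text \<open>\<open>u k\<close> itself serves as the competing supersolution in the minimal growth of
  every other \<open>u m\<close> at this end. An end has a boundary and is open only off a compact
  set; that openness is read off from the neighbourhood of infinity which minimal growth
  provides.\<close>

lemma end_control:
  fixes Ends :: "nat \<Rightarrow> 'a set"
  assumes i: "i \<in> {1..N}" and k: "k \<in> {1..N}" "k \<noteq> i"
    and u: "\<And>i. i \<in> {1..N} \<Longrightarrow> positive_solution M P UNIV (u i)"
    and mg: "\<And>m. m \<in> {1..N} \<Longrightarrow> m \<noteq> i \<Longrightarrow> minimal_growth_at M P (Ends i) (u m)"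
    and lim: "((\<lambda>x. u k x / u i x) \<longlongrightarrow> 0) (at_end (Ends i))"
    and \<alpha>: "\<And>j. j \<in> {1..N} \<Longrightarrow> 0 < \<alpha> j \<and> \<alpha> j \<le> 1 / 2" "(\<Sum>j=1..N. \<alpha> j) = 1"
  shows "\<exists>K C. compact K \<and> (\<forall>K'. compact K' \<and> K \<subseteq> K' \<longrightarrow> open (Ends i - K')) \<and>
    (\<forall>x\<in>Ends i - K. (\<Prod>j=1..N. u j x powr \<alpha> j)\<^sup>2 \<le> C * (u k x * u i x))"
proof -
  have uc: "continuous_on UNIV (u j)" and up: "u j x > 0" if "j \<in> {1..N}" for j x
    using u[OF that] by (auto simp: positive_solution_def)
  obtain U K0 where U: "end_neighborhood (Ends i) U" "open U" "U \<subseteq> Ends i" and K0: "compact K0" "Ends i - K0 \<subseteq> U"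
  proof -
    from mg[OF k] obtain U where U: "end_neighborhood (Ends i) U" unfolding minimal_growth_at_def by (elim conjE exE)
    from U obtain K0 where "open U" "U \<subseteq> Ends i" "compact K0" "Ends i - K0 \<subseteq> U" unfolding end_neighborhood_def by (elim conjE exE)
    with U show ?thesis by (rule that)
  qed
  have op: "open (Ends i - K')" if "compact K'" "K0 \<subseteq> K'" for K'
  proof -
    have "Ends i - K' = U - K'" using U(3) K0(2) that(2) by blast
    then show ?thesis using open_Diff[OF U(2) compact_imp_closed[OF that(1)]] by simp
  qed
  have "\<exists>C K. compact K \<and> (\<forall>x\<in>Ends i - K. u m x \<le> C * u k x)" if m: "m \<in> {1..N}" "m \<noteq> i" for m
  proof -
    obtain C U' where U': "end_neighborhood (Ends i) U'" and ae: "ae_on M U' (\<lambda>x. u m x \<le> C * u k x)"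
      using mg[OF m] U(1) positive_solution_imp_supersolution[OF u[OF k(1)], of U] unfolding minimal_growth_at_def by blast
    obtain K where K: "compact K" "Ends i - K \<subseteq> U'" and oU: "open U'" using U' unfolding end_neighborhood_def by blast
    have "u m x \<le> C * u k x" if "x \<in> U'" for x
      by (rule ae_on_le_imp_le[OF ae oU uc[OF m(1)] _ that]) (intro continuous_intros uc[OF k(1)])
    then show ?thesis using K by blast
  qed
  then obtain C K where CK: "\<And>m. m \<in> {1..N} - {i} \<Longrightarrow> compact (K m)"
    "\<And>m x. m \<in> {1..N} - {i} \<Longrightarrow> x \<in> Ends i - K m \<Longrightarrow> u m x \<le> C m * u k x"
    by (metis DiffD1 DiffD2 singletonI)
  have "eventually (\<lambda>x. u k x / u i x < 1) (at_end (Ends i))" using lim by (rule order_tendstoD) simp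
  then obtain K1 where K1: "compact K1" "\<And>x. x \<in> Ends i - K1 \<Longrightarrow> u k x / u i x < 1" unfolding eventually_at_end by blast
  \<comment> \<open>Inserting 1 secures \<open>C0 \<ge> 1\<close>, as
    \<open>product_square_bound\<close> demands.\<close>
  define C0 where "C0 = Max (insert 1 (C ` ({1..N} - {i})))"
  define Kc where "Kc = K0 \<union> K1 \<union> (\<Union>m\<in>{1..N} - {i}. K m)"
  have C0: "C0 \<ge> 1" "\<And>m. m \<in> {1..N} - {i} \<Longrightarrow> C m \<le> C0" unfolding C0_def by (auto intro!: Max_ge)
  have "compact Kc" using K0(1) K1(1) CK(1) unfolding Kc_def by (intro compact_Un compact_UN) auto
  moreover have "open (Ends i - K')" if "compact K'" "Kc \<subseteq> K'" for K' using op that by (auto simp: Kc_def)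
  moreover have "(\<Prod>j=1..N. u j x powr \<alpha> j)\<^sup>2 \<le> C0\<^sup>2 * (u k x * u i x)" if x: "x \<in> Ends i - Kc" for x
  proof (rule product_square_bound[OF _ i])
    show "u k x \<le> u i x" using K1(2)[of x] x up[OF i, of x] by (simp add: Kc_def)
    show "u m x \<le> C0 * u k x" if m: "m \<in> {1..N}" "m \<noteq> i" for m
    proof -
      have "u m x \<le> C m * u k x" using CK(2)[of m x] m x by (auto simp: Kc_def)
      also have "\<dots> \<le> C0 * u k x" using C0(2)[of m] m up[OF k(1), of x] by (intro mult_right_mono) auto
      finally show ?thesis .
    qed
  qed (use up \<alpha> i k C0 in auto)
  ultimately show ?thesis by blast
qed

lemma product_null_sequence:
  fixes Ends :: "nat \<Rightarrow> 'a set"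
  assumes ends: "has_ends M N Ends" and N: "N \<ge> 2"
    and u: "\<And>i. i \<in> {1..N} \<Longrightarrow> positive_solution M P UNIV (u i)"
    and mg: "\<And>i j. i \<in> {1..N} \<Longrightarrow> j \<in> {1..N} \<Longrightarrow> j \<noteq> i \<Longrightarrow> minimal_growth_at M P (Ends j) (u i)"
    and lim: "\<And>i j. i \<in> {1..N} \<Longrightarrow> j \<in> {1..N} \<Longrightarrow> j \<noteq> i \<Longrightarrow> ((\<lambda>x. u j x / u i x) \<longlongrightarrow> 0) (at_end (Ends i))"
    and \<alpha>: "\<And>j. j \<in> {1..N} \<Longrightarrow> 0 < \<alpha> j \<and> \<alpha> j \<le> 1 / 2" "(\<Sum>j=1..N. \<alpha> j) = 1"
    and v: "v = (\<lambda>x. \<Prod>j=1..N. u j x powr \<alpha> j)" "continuous_on UNIV v" and K1: "compact K1" and \<epsilon>: "\<epsilon> > 0"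
  shows "\<exists>w Dw K. H1M w Dw \<and> compact K \<and> supported w Dw K \<and> (\<forall>x\<in>K1. w x = 1) \<and>
      total (\<lambda>c x. (v x)\<^sup>2 * ((acoef c x *v Dw c x) \<bullet> Dw c x)) \<le> \<epsilon>"
proof -
  have up: "u j x > 0" if "j \<in> {1..N}" for j x
    using u[OF that] by (auto simp: positive_solution_def)
  \<comment> \<open>Any index other than \<open>i\<close> would do; \<open>N \<ge> 2\<close>
    guarantees that this one lies in range.\<close>
  define k where "k i = (if i = 1 then 2 else 1 :: nat)" for i :: nat
  have k: "k i \<in> {1..N}" "k i \<noteq> i" for i using N by (auto simp: k_def)
  have "\<exists>D. weak_sol (potential P) (u i) D" if i: "i \<in> {1..N}" for i
  proof -
    obtain D where "weak_sol (potential P) (u i) D"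
      by (rule positive_solution_weak_sol[of "potential P" "u i"]) (use u[OF i] in auto)
    then show ?thesis by blast
  qed
  then obtain D where D: "\<And>i. i \<in> {1..N} \<Longrightarrow> weak_sol (potential P) (u i) (D i)" by metis
  have "\<exists>K C. compact K \<and> (\<forall>K'. compact K' \<and> K \<subseteq> K' \<longrightarrow> open (Ends i - K')) \<and>
    (\<forall>x\<in>Ends i - K. (v x)\<^sup>2 \<le> C * (u (k i) x * u i x))" if i: "i \<in> {1..N}" for i
    unfolding v(1) by (rule end_control[where Ends = Ends and u = u, OF i k u mg[OF _ i] lim[OF i k(1) k(2)] \<alpha>]) auto
  then obtain Kf C where Kf: "\<And>i. i \<in> {1..N} \<Longrightarrow> compact (Kf i)"
    "\<And>i K'. i \<in> {1..N} \<Longrightarrow> compact K' \<Longrightarrow> Kf i \<subseteq> K' \<Longrightarrow> open (Ends i - K')"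
    "\<And>i x. i \<in> {1..N} \<Longrightarrow> x \<in> Ends i - Kf i \<Longrightarrow> (v x)\<^sup>2 \<le> C i * (u (k i) x * u i x)"
    by metis
  \<comment> \<open>The compact core absorbs the prescribed set, the closure of \<open>E_0\<close>
    and all exceptional sets of the ends. What remains of each end is open, disjoint from the others
    and subject to the bound on \<open>v^2\<close>.\<close>
  define Kc where "Kc = K1 \<union> closure (Ends 0) \<union> (\<Union>i\<in>{1..N}. Kf i)"
  have e: "UNIV = (\<Union>i\<in>{0..N}. Ends i)" "disjoint_family_on Ends {1..N}" "compact (closure (Ends 0))"
    using ends by (auto simp: has_ends_def)
  have Kc: "compact Kc" "K1 \<subseteq> Kc" "\<And>i. i \<in> {1..N} \<Longrightarrow> Kf i \<subseteq> Kc" using K1 e(3) Kf(1) by (auto simp: Kc_def intro!: compact_Un compact_UN)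
  have cov: "x \<in> Kc \<or> (\<exists>i\<in>{1..N}. x \<in> Ends i - Kc)" for x
  proof -
    obtain i where i: "i \<in> {0..N}" "x \<in> Ends i" using e(1) by blast
    show ?thesis
    proof (cases "i = 0")
      case True
      then show ?thesis using i(2) closure_subset[of "Ends 0"] by (auto simp: Kc_def)
    next
      case False
      then show ?thesis using i by (intro disjCI bexI[of _ i]) auto
    qed
  qed
  have far: "\<exists>K. compact K \<and> (\<forall>x\<in>(Ends i - Kc) - K. ln (u (k i) x) - ln (u i x) \<le> - T)" if i: "i \<in> {1..N}" for i T
  proof -
    have "eventually (\<lambda>x. u (k i) x / u i x < exp (- T)) (at_end (Ends i))"
      using lim[OF i k] by (rule order_tendstoD) simp
    then obtain K where K: "compact K" "\<And>x. x \<in> Ends i - K \<Longrightarrow> u (k i) x / u i x < exp (- T)" unfolding eventually_at_end by blast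
    have "ln (u (k i) x) - ln (u i x) \<le> - T" if "x \<in> Ends i - K" for x
    proof -
      have "ln (u (k i) x) - ln (u i x) = ln (u (k i) x / u i x)" using up[OF k(1), of i x] up[OF i, of x] by (simp add: ln_div)
      also have "\<dots> \<le> ln (exp (- T))" using K(2)[OF that] up[OF k(1), of i x] up[OF i, of x] by (intro ln_mono) auto
      finally show ?thesis by simp
    qed
    then show ?thesis using K(1) by blast
  qed
  show ?thesis
  proof (rule null_sequence[where I = "{1..N}" and A = "\<lambda>i. Ends i - Kc" and ?K1.0 = Kc and q = "potential P"
        and s = "\<lambda>i. u (k i)" and D = "\<lambda>i. D (k i)" and f = u and E = D and v = v and C = C and \<epsilon> = \<epsilon>])
    show "(Ends i - Kc) \<inter> (Ends j - Kc) = {}" if "i \<in> {1..N}" "j \<in> {1..N}" "i \<noteq> j" for i j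
      using disjoint_family_onD[OF e(2) that] by blast
    show "(v x)\<^sup>2 \<le> C i * (u (k i) x * u i x)" if "i \<in> {1..N}" "x \<in> Ends i - Kc" for i x
      using Kf(3)[OF that(1), of x] that Kc(3) by blast
    show "open (Ends i - Kc)" if "i \<in> {1..N}" for i using Kf(2)[OF that Kc(1) Kc(3)[OF that]] .
    show "compact Kc" by (rule Kc(1))
    show "x \<in> Kc \<or> (\<exists>i\<in>{1..N}. x \<in> Ends i - Kc)" for x by (rule cov)
    show "weak_sol (potential P) (u (k i)) (D (k i))" "weak_sol (potential P) (u i) (D i)" if "i \<in> {1..N}" for i
      by (rule D[OF k(1)], rule D[OF that])
    show "\<exists>K. compact K \<and> (\<forall>x\<in>Ends i - Kc - K. ln (u (k i) x) - ln (u i x) \<le> - T)" if "i \<in> {1..N}" for i T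
      by (rule far[OF that])
    fix w Dw K assume "H1M w Dw" "compact K" "supported w Dw K" "\<And>x. x \<in> Kc \<Longrightarrow> w x = 1"
      "total (\<lambda>c x. (v x)\<^sup>2 * ((acoef c x *v Dw c x) \<bullet> Dw c x)) \<le> \<epsilon>"
    then show ?thesis using Kc(2) by blast
  qed (rule finite_atLeastAtMost v(2) \<epsilon>)+
qed

end

theorem theorem12p3:
  fixes M :: "('a::{t2_space, second_countable_topology}, 'n::finite) weighted_manifold"
    and P :: "('a, 'n) operator"
    and N :: nat
    and E :: "nat \<Rightarrow> 'a set"
    and u :: "nat \<Rightarrow> 'a \<Rightarrow> real"
    and \<alpha> :: "nat \<Rightarrow> real"
    and v :: "'a \<Rightarrow> real"
  assumes "CARD('n) \<ge> 2"
    and "is_weighted_manifold M" and "\<not> compact (UNIV :: 'a set)"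
    and "has_ends M N E" and "N \<ge> 2"
    and "elliptic_operator M P" and "subcritical M P"
    and "\<And>i. i \<in> {1..N} \<Longrightarrow> positive_solution M P UNIV (u i)"
    and "\<And>i j. i \<in> {1..N} \<Longrightarrow> j \<in> {1..N} \<Longrightarrow> j \<noteq> i \<Longrightarrow> minimal_growth_at M P (E j) (u i)"
    and "\<And>i j. i \<in> {1..N} \<Longrightarrow> j \<in> {1..N} \<Longrightarrow> j \<noteq> i \<Longrightarrow>
           ((\<lambda>x. u j x / u i x) \<longlongrightarrow> 0) (at_end (E i))"
    and "\<And>j. j \<in> {1..N} \<Longrightarrow> 0 < \<alpha> j \<and> \<alpha> j \<le> 1/2"
    and "(\<Sum>j=1..N. \<alpha> j) = 1"
    and "v = (\<lambda>x. \<Prod>j=1..N. u j x powr \<alpha> j)"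
  shows "(\<exists>W. weak_eq M P UNIV v (\<lambda>x. W x * v x)) \<and>
    (\<forall>W. weak_eq M P UNIV v (\<lambda>x. W x * v x) \<longrightarrow> critical M (minus_potential P W))"
proof -
  interpret elliptic_space M P using assms(1,2,6) by unfold_locales
  have uc: "continuous_on UNIV (u j)" and up: "u j x > 0" if "j \<in> {1..N}" for j x
    using assms(8)[OF that] by (auto simp: positive_solution_def)
  have "\<exists>D. weak_sol (potential P) (u i) D" if i: "i \<in> {1..N}" for i
  proof -
    obtain D where "weak_sol (potential P) (u i) D"
      by (rule positive_solution_weak_sol[of "potential P" "u i"]) (use assms(8)[OF i] in auto)
    then show ?thesis by blast
  qed
  then obtain D where D: "\<And>i. i \<in> {1..N} \<Longrightarrow> weak_sol (potential P) (u i) (D i)" by metis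
  have exW: "\<exists>W. weak_eq M P UNIV v (\<lambda>x. W x * v x)"
    by (rule product_weak_eq[OF finite_atLeastAtMost D assms(12,13)])
  have vp: "v x > 0" for x unfolding assms(13) using up by (intro prod_pos) (simp add: less_imp_neq[symmetric])
  have vc: "continuous_on UNIV v"
    unfolding assms(13) by (intro continuous_on_prod continuous_on_powr uc continuous_on_const) (use up in \<open>auto simp: less_imp_neq[symmetric]\<close>)
  have "critical M (minus_potential P W)" if W: "weak_eq M P UNIV v (\<lambda>x. W x * v x)" for W
  proof -
    have sol: "positive_solution M (minus_potential P W) UNIV v" by (rule weak_eq_imp_solution[OF vc vp W])
    \<comment> \<open>For \<open>P - W\<close> no separate locale is needed: its potential is just
      another value of the parameter \<open>q\<close>, so \<open>W\<close> itself need not satisfy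
      the coefficient conditions.\<close>
    obtain Dv where Dv: "weak_sol (\<lambda>x. potential P x - W x) v Dv"
      by (rule positive_solution_weak_sol[OF sol[unfolded minus_potential_def]]) (rule that)
    have "\<not> subcritical M (minus_potential P W)"
    proof
      assume "subcritical M (minus_potential P W)"
      then obtain V x0 where V: "continuous_on UNIV V" "\<And>x. V x \<ge> 0" "V x0 \<noteq> 0"
        and l: "lambda0 M (minus_potential P W) V > 0" unfolding subcritical_def by blast
      \<comment> \<open>A positive supremum is approached by positive admissible values, so some
        \<open>t > 0\<close> gives a positive solution with potential diminished by
        \<open>t V\<close>.\<close>
      obtain t where t: "t > 0" "nonneg_operator M (minus_potential (minus_potential P W) (\<lambda>x. t * V x))"
        using l unfolding lambda0_def less_Sup_iff by auto
      obtain f where f: "positive_solution M (P\<lparr>potential := \<lambda>x. potential P x - (W x + t * V x)\<rparr>) UNIV f"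
        using t(2) unfolding nonneg_operator_def minus_potential_minus_potential unfolding minus_potential_def by blast
      obtain Df where Df: "weak_sol (\<lambda>x. potential P x - (W x + t * V x)) f Df"
        by (rule positive_solution_weak_sol[OF f]) (rule that)
      have Df': "weak_sol (\<lambda>x. (potential P x - W x) - t * V x) f Df" using Df by (simp only: diff_diff_eq)
      show False
      \<comment> \<open>The null sequence depends on \<open>v\<close> and on the leading part alone;
        hence it contradicts subcriticality for every admissible \<open>W\<close>.\<close>
      proof (rule null_sequence_no_solution[OF Dv Df', of x0])
        show "continuous_on UNIV (\<lambda>x. t * V x)" by (intro continuous_intros V(1))
        show "t * V x \<ge> 0" for x using t(1) V(2) by simp
        show "t * V x0 \<noteq> 0" using t(1) V(3) by simp
      qed (rule product_null_sequence[OF assms(4,5,8,9,10,11,12,13) vc])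
    qed
    then show ?thesis using sol unfolding critical_def nonneg_operator_def by blast
  qed
  then show ?thesis using exW by blast
qed

end
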